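(* Let $L$ be a (Hausdorff) locally compact group, let $G$ be a discrete group in the class $\mathcal G$, and let $\varphi:L\to G$ be an abstract (not necessarily continuous) homomorphism. Then either $\varphi$ is continuous, or there is a finite nontrivial subgroup $F\subseteq G$ such that $\varphi(L)$ is contained in the normalizer of $F$ in $G$.
   Context: $\mathcal G$ is the class of all groups $G$ such that (1) every torsion subgroup of $G$ is finite, and (2) every abelian subgroup of $G$ is a (possibly infinite) direct sum of cyclic groups. *)

theory Defs
  imports "HOL-Analysis.Analysis" "HOL-Algebra.Algebra"
begin

definition topological_group :: "('a, 'b) monoid_scheme \<Rightarrow> 'a topology \<Rightarrow> bool" where
  "topological_group L T \<longleftrightarrow>
     group L \<and> topspace T = carrier L \<and>
     continuous_map (prod_topology T T) T (\<lambda>p. fst p \<otimes>\<^bsub>L\<^esub> snd p) \<and>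
     continuous_map T T (\<lambda>x. inv\<^bsub>L\<^esub> x)"

definition locally_compact_group :: "('a, 'b) monoid_scheme \<Rightarrow> 'a topology \<Rightarrow> bool" where
  "locally_compact_group L T \<longleftrightarrow>
     topological_group L T \<and> Hausdorff_space T \<and> locally_compact_space T"

text \<open>Torsion subgroup: every element has finite order (ord = 0 means infinite order).\<close>
definition torsion_subgroup :: "('a, 'b) monoid_scheme \<Rightarrow> 'a set \<Rightarrow> bool" where
  "torsion_subgroup G H \<longleftrightarrow> subgroup H G \<and> (\<forall>x\<in>H. group.ord G x \<noteq> 0)"

definition abelian_subgroup :: "('a, 'b) monoid_scheme \<Rightarrow> 'a set \<Rightarrow> bool" where
  "abelian_subgroup G H \<longleftrightarrow> subgroup H G \<and> (\<forall>x\<in>H. \<forall>y\<in>H. x \<otimes>\<^bsub>G\<^esub> y = y \<otimes>\<^bsub>G\<^esub> x)"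

text \<open>H (a subgroup of G) is isomorphic to a (possibly infinite) direct sum of cyclic groups.
  Index set and summands are taken in the element type of G, which is large enough.\<close>
definition direct_sum_of_cyclic :: "('a, 'b) monoid_scheme \<Rightarrow> 'a set \<Rightarrow> bool" where
  "direct_sum_of_cyclic G H \<longleftrightarrow>
     (\<exists>(I :: 'a set) (C :: 'a \<Rightarrow> 'a monoid).
        (\<forall>i\<in>I. group (C i) \<and> cyclic_group (C i)) \<and>
        subgroup_generated G H \<cong> sum_group I C)"

definition class_G :: "('a, 'b) monoid_scheme \<Rightarrow> bool" where
  "class_G G \<longleftrightarrow> group G \<and>
     (\<forall>H. torsion_subgroup G H \<longrightarrow> finite H) \<and>
     (\<forall>H. abelian_subgroup G H \<longrightarrow> direct_sum_of_cyclic G H)"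

end

theory Submission
  imports Defs
begin

text \<open>
  A compact subgroup of \<open>L\<close> has finite image. If \<open>\<phi> x\<close> had infinite order for some \<open>x\<close> in it, the
  closed subgroup generated by \<open>x\<close> would have a homomorphism to the integers that sends \<open>x\<close> to some
  \<open>m \<noteq> 0\<close>. But limits \<open>y\<^sub>n\<close> of powers of \<open>x\<close> with \<open>y\<^sub>n = x y\<^sub>n\<^sub>+\<^sub>1\<^sup>k\<close> force the image of \<open>y\<^sub>0\<close> to be
  \<open>-m / (k - 1)\<close>, which is not an integer for large \<open>k\<close>.

  By a trapping argument in the style of Gleason, the elements all of whose powers stay in a small
  neighbourhood \<open>V\<close> of the identity generate a relatively compact subgroup. Its closure has finite
  image, and for \<open>V\<close> small this image \<open>F\<close> no longer depends on \<open>V\<close>, so it is invariant under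
  conjugation by \<open>\<phi>(L)\<close>.

  If \<open>F\<close> is trivial, the kernel contains a compact subgroup \<open>K\<close> that contains every sufficiently
  small subgroup. The normalizer of \<open>K\<close> is open, and its quotient by \<open>K\<close> has no small subgroups, so a
  neighbourhood of its identity is generated by one-parameter subgroups. The image of the reals in
  \<open>G\<close> under a homomorphism is divisible and therefore trivial; hence the kernel of \<open>\<phi>\<close> is open.
\<close>

section \<open>Ultrafilters\<close>

definition ultrafilter :: "'i filter \<Rightarrow> bool" where
  "ultrafilter F \<longleftrightarrow> F \<noteq> bot \<and> (\<forall>P. eventually P F \<or> eventually (\<lambda>x. \<not> P x) F)"

lemma ultrafilter_not_bot: "ultrafilter F \<Longrightarrow> F \<noteq> bot"
  by (simp add: ultrafilter_def)

lemma ultrafilter_not_eventually: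
  "ultrafilter F \<Longrightarrow> \<not> eventually P F \<longleftrightarrow> eventually (\<lambda>x. \<not> P x) F"
  unfolding ultrafilter_def using eventually_conj[of P F "\<lambda>x. \<not> P x"]
  by (auto simp: eventually_False)

lemma chain_Inf_filter_not_bot:
  fixes C :: "'i filter set"
  assumes "C \<noteq> {}" and not_bot: "\<And>F. F \<in> C \<Longrightarrow> F \<noteq> bot"
    and chain: "\<And>F G. F \<in> C \<Longrightarrow> G \<in> C \<Longrightarrow> F \<le> G \<or> G \<le> F"
  shows "Inf C \<noteq> bot"
proof (rule Inf_filter_not_bot)
  fix Z assume Z: "Z \<subseteq> C" "finite Z"
  show "Inf Z \<noteq> bot"
  proof (cases "Z = {}")
    case True
    obtain F where "F \<in> C" using \<open>C \<noteq> {}\<close> by blast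
    then have "Sup UNIV \<noteq> (bot :: 'i filter)"
      using not_bot Sup_upper[of F UNIV] by (metis UNIV_I bot.extremum_unique)
    then show ?thesis using True by (simp add: Inf_filter_def)
  next
    case False
    have "Inf Z \<in> C"
      using Z(2) False Z(1)
    proof (induction Z rule: finite_ne_induct)
      case (insert F Z)
      then have "Inf Z \<in> C" "F \<in> C" by auto
      then show ?case using chain[of F "Inf Z"] by (auto simp: inf_absorb1 inf_absorb2)
    qed auto
    then show ?thesis by (rule not_bot)
  qed
qed

lemma minimal_filter_exists:
  fixes F :: "'i filter"
  assumes "F \<noteq> bot"
  obtains M where "M \<noteq> bot" "M \<le> F" "\<And>G. G \<noteq> bot \<Longrightarrow> G \<le> M \<Longrightarrow> G = M"
proof -
  let ?A = "{G. G \<noteq> bot \<and> G \<le> F}"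
  have "\<exists>M\<in>?A. \<forall>G\<in>?A. G \<le> M \<longrightarrow> G = M"
  proof (rule predicate_Zorn[where P = "\<lambda>G H. H \<le> G"])
    show "partial_order_on ?A (relation_of (\<lambda>G H. H \<le> G) ?A)"
      by (auto simp: partial_order_on_def preorder_on_def refl_on_def trans_def antisym_def
          relation_of_def)
    fix C assume "C \<in> Chains (relation_of (\<lambda>G H. H \<le> G) ?A)"
    then have sub: "C \<subseteq> ?A" and chain: "\<And>G H. G \<in> C \<Longrightarrow> H \<in> C \<Longrightarrow> G \<le> H \<or> H \<le> G"
      by (auto simp: Chains_def relation_of_def)
    show "\<exists>L\<in>?A. \<forall>G\<in>C. L \<le> G"
    proof (cases "C = {}")
      case True
      then show ?thesis using assms by auto
    next
      case False
      have "Inf C \<noteq> bot" using sub chain False by (intro chain_Inf_filter_not_bot) auto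
      moreover have "Inf C \<le> F" using sub False by (auto intro: Inf_lower2)
      ultimately show ?thesis by (auto intro: Inf_lower)
    qed
  qed
  then obtain M where "M \<in> ?A" "\<And>G. G \<in> ?A \<Longrightarrow> G \<le> M \<Longrightarrow> G = M" by blast
  then show ?thesis using that[of M] by (auto intro: order_trans)
qed

lemma minimal_filter_imp_ultrafilter:
  assumes "M \<noteq> bot" and minimal: "\<And>G. G \<noteq> bot \<Longrightarrow> G \<le> M \<Longrightarrow> G = M"
  shows "ultrafilter M"
  unfolding ultrafilter_def
proof (intro conjI allI disjCI)
  fix P assume "\<not> eventually (\<lambda>x. \<not> P x) M"
  then have "inf M (principal {x. P x}) \<noteq> bot"
    by (simp add: trivial_limit_def eventually_inf_principal)
  then have "inf M (principal {x. P x}) = M" by (rule minimal) simp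
  moreover have "eventually P (inf M (principal {x. P x}))"
    by (simp add: eventually_inf_principal)
  ultimately show "eventually P M" by simp
qed fact

lemma ultrafilter_exists:
  assumes "F \<noteq> bot"
  obtains U where "ultrafilter U" "U \<le> F"
  using minimal_filter_exists[OF assms] minimal_filter_imp_ultrafilter by metis

lemma ultrafilter_exists_base:
  assumes "B \<noteq> {}" "\<And>A. A \<in> B \<Longrightarrow> A \<noteq> {}" "\<And>A C. A \<in> B \<Longrightarrow> C \<in> B \<Longrightarrow> \<exists>D\<in>B. D \<subseteq> A \<inter> C"
  obtains U where "ultrafilter U" "\<And>A. A \<in> B \<Longrightarrow> eventually (\<lambda>x. x \<in> A) U"
proof -
  let ?F = "INF A\<in>B. principal A"
  have eventually_iff: "eventually P ?F \<longleftrightarrow> (\<exists>A\<in>B. \<forall>x\<in>A. P x)" for P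
    using assms(1,3) by (subst eventually_INF_base) (auto simp: eventually_principal)
  have "?F \<noteq> bot"
    using eventually_iff[of "\<lambda>x. False"] assms(2) by (auto simp: trivial_limit_def)
  then obtain U where "ultrafilter U" "U \<le> ?F" by (rule ultrafilter_exists)
  then show ?thesis using that eventually_iff by (metis filter_leD)
qed

lemma compactin_finite_subcover:
  assumes C: "compactin Z C" and S: "\<And>x. x \<in> C \<Longrightarrow> openin Z (S x) \<and> x \<in> S x"
  obtains D where "finite D" "D \<subseteq> C" "C \<subseteq> \<Union>(S ` D)"
proof -
  have "\<exists>F. finite F \<and> F \<subseteq> S ` C \<and> C \<subseteq> \<Union>F"
    using compactinD[OF C, of "S ` C"] S by blast
  then show ?thesis using that by (metis finite_subset_image)
qed

lemma ultrafilter_compactin_limit: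
  assumes U: "ultrafilter U" and C: "compactin Z C" and in_C: "eventually (\<lambda>i. f i \<in> C) U"
  obtains l where "l \<in> C" "limitin Z f l U"
proof -
  have "\<exists>l\<in>C. limitin Z f l U"
  proof (rule ccontr)
    assume "\<not> ?thesis"
    then have "\<forall>l\<in>C. \<exists>S. openin Z S \<and> l \<in> S \<and> \<not> eventually (\<lambda>i. f i \<in> S) U"
      using compactin_subset_topspace[OF C] by (auto simp: limitin_def)
    then obtain S where S: "\<And>l. l \<in> C \<Longrightarrow> openin Z (S l) \<and> l \<in> S l"
        and avoids: "\<And>l. l \<in> C \<Longrightarrow> \<not> eventually (\<lambda>i. f i \<in> S l) U"
      by metis
    obtain D where D: "finite D" "D \<subseteq> C" "C \<subseteq> \<Union>(S ` D)"
      using compactin_finite_subcover[where S = S, OF C S] by blast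
    have "eventually (\<lambda>i. \<forall>l\<in>D. f i \<notin> S l) U"
      using D avoids U by (intro eventually_ball_finite) (auto simp: ultrafilter_not_eventually)
    with in_C have "eventually (\<lambda>i. False) U"
      by eventually_elim (use D in auto)
    then show False using U by (auto simp: ultrafilter_def)
  qed
  then show ?thesis using that by blast
qed

section \<open>Topological groups\<close>

lemma (in group) inv_mult_cancel_left [simp]:
  "x \<in> carrier G \<Longrightarrow> y \<in> carrier G \<Longrightarrow> inv x \<otimes> (x \<otimes> y) = y"
  by (simp flip: m_assoc)

lemma (in group) mult_inv_cancel_left [simp]:
  "x \<in> carrier G \<Longrightarrow> y \<in> carrier G \<Longrightarrow> x \<otimes> (inv x \<otimes> y) = y"
  by (simp flip: m_assoc)

locale top_group = group L for L (structure) +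
  fixes T
  assumes topspace_T [simp]: "topspace T = carrier L"
    and cont_mult: "continuous_map (prod_topology T T) T (\<lambda>p. fst p \<otimes> snd p)"
    and cont_inv: "continuous_map T T (\<lambda>x. inv x)"
begin

lemma continuous_map_mult [continuous_intros]:
  assumes "continuous_map Z T f" "continuous_map Z T g"
  shows "continuous_map Z T (\<lambda>x. f x \<otimes> g x)"
  using continuous_map_compose[OF _ cont_mult, of Z "\<lambda>x. (f x, g x)"] assms
  by (simp add: o_def continuous_map_pairwise)

lemma continuous_map_inverse [continuous_intros]:
  assumes "continuous_map Z T f"
  shows "continuous_map Z T (\<lambda>x. inv (f x))"
  using continuous_map_compose[OF assms cont_inv] by (simp add: o_def)

lemma continuous_map_const_carrier [continuous_intros]:
  "a \<in> carrier L \<Longrightarrow> continuous_map Z T (\<lambda>x. a)"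
  by simp

lemma continuous_map_left_translate: "a \<in> carrier L \<Longrightarrow> continuous_map T T (\<lambda>x. a \<otimes> x)"
  by (intro continuous_intros)

lemma continuous_map_right_translate: "a \<in> carrier L \<Longrightarrow> continuous_map T T (\<lambda>x. x \<otimes> a)"
  by (intro continuous_intros)

lemma continuous_map_real_compose:
  assumes "continuous_map T euclideanreal f" "continuous_map Z T g"
  shows "continuous_map Z euclideanreal (\<lambda>x. f (g x))"
  using continuous_map_compose[OF assms(2,1)] by (simp add: o_def)

lemma limitin_mult:
  assumes "limitin T f a F" "limitin T g b F"
  shows "limitin T (\<lambda>i. f i \<otimes> g i) (a \<otimes> b) F"
proof -
  have "limitin (prod_topology T T) (\<lambda>i. (f i, g i)) (a, b) F"
    using assms by (simp add: limitin_pairwise o_def)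
  from continuous_map_limit[OF cont_mult this] show ?thesis by (simp add: o_def)
qed

lemma limitin_nat_pow:
  assumes "limitin T f a F"
  shows "limitin T (\<lambda>i. f i [^] (n::nat)) (a [^] n) F"
proof (induction n)
  case 0
  then show ?case by simp
next
  case (Suc n)
  then show ?case using limitin_mult[OF Suc assms] by simp
qed

lemma openin_preimage:
  assumes "continuous_map T Z f" "openin Z W"
  shows "openin T {x \<in> carrier L. f x \<in> W}"
  using openin_continuous_map_preimage[OF assms] by simp

lemma openin_left_translate:
  assumes a: "a \<in> carrier L" and W: "openin T W"
  shows "openin T ((\<lambda>x. a \<otimes> x) ` W)"
proof -
  have "W \<subseteq> carrier L" using openin_subset[OF W] by simp
  then have "(\<lambda>x. a \<otimes> x) ` W \<subseteq> {x \<in> carrier L. inv a \<otimes> x \<in> W}" using a by (auto simp: subset_iff)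
  moreover have "x \<in> (\<lambda>x. a \<otimes> x) ` W" if "x \<in> carrier L" "inv a \<otimes> x \<in> W" for x
    using that a by (intro image_eqI[of _ _ "inv a \<otimes> x"]) auto
  ultimately have "(\<lambda>x. a \<otimes> x) ` W = {x \<in> carrier L. inv a \<otimes> x \<in> W}" by blast
  then show ?thesis
    using a W openin_preimage[OF continuous_map_left_translate, of "inv a" W] by simp
qed

lemma openin_right_translate:
  assumes a: "a \<in> carrier L" and W: "openin T W"
  shows "openin T ((\<lambda>x. x \<otimes> a) ` W)"
proof -
  have "W \<subseteq> carrier L" using openin_subset[OF W] by simp
  then have "(\<lambda>x. x \<otimes> a) ` W \<subseteq> {x \<in> carrier L. x \<otimes> inv a \<in> W}"
    using a by (auto simp: subset_iff m_assoc)
  moreover have "x \<in> (\<lambda>x. x \<otimes> a) ` W" if "x \<in> carrier L" "x \<otimes> inv a \<in> W" for x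
    using that a by (intro image_eqI[of _ _ "x \<otimes> inv a"]) (auto simp: m_assoc)
  ultimately have "(\<lambda>x. x \<otimes> a) ` W = {x \<in> carrier L. x \<otimes> inv a \<in> W}" by blast
  then show ?thesis
    using a W openin_preimage[OF continuous_map_right_translate, of "inv a" W] by simp
qed

lemma openin_set_mult_right:
  assumes "A \<subseteq> carrier L" "openin T W"
  shows "openin T (A <#> W)"
proof -
  have "A <#> W = (\<Union>a\<in>A. (\<lambda>x. a \<otimes> x) ` W)" by (auto simp: set_mult_def)
  then show ?thesis using assms openin_left_translate by (auto intro!: openin_Union)
qed

lemma openin_set_mult_left:
  assumes "A \<subseteq> carrier L" "openin T W"
  shows "openin T (W <#> A)"
proof -
  have "W <#> A = (\<Union>a\<in>A. (\<lambda>x. x \<otimes> a) ` W)" by (auto simp: set_mult_def)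
  then show ?thesis using assms openin_right_translate by (auto intro!: openin_Union)
qed

lemma compactin_set_mult:
  assumes "compactin T A" "compactin T B"
  shows "compactin T (A <#> B)"
proof -
  have "compactin T ((\<lambda>p. fst p \<otimes> snd p) ` (A \<times> B))"
    using assms by (intro image_compactin[OF _ cont_mult]) (simp add: compactin_Times)
  moreover have "(\<lambda>p. fst p \<otimes> snd p) ` (A \<times> B) = A <#> B"
    by (force simp: set_mult_def image_iff)
  ultimately show ?thesis by simp
qed

lemma compactin_carrier: "compactin T C \<Longrightarrow> C \<subseteq> carrier L"
  using compactin_subset_topspace[of T C] by simp

lemma compactin_image_inv: "compactin T A \<Longrightarrow> compactin T ((\<lambda>x. inv x) ` A)"
  using image_compactin[OF _ cont_inv] .

definition nhd_one :: "'a set \<Rightarrow> bool" where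
  "nhd_one V \<longleftrightarrow> openin T V \<and> \<one> \<in> V"

lemma nhd_one_carrier: "nhd_one V \<Longrightarrow> V \<subseteq> carrier L"
  using openin_subset[of T V] by (simp add: nhd_one_def)

lemma nhd_one_mem_carrier: "nhd_one V \<Longrightarrow> x \<in> V \<Longrightarrow> x \<in> carrier L"
  using nhd_one_carrier by blast

lemma nhd_one_openin: "nhd_one V \<Longrightarrow> openin T V"
  by (simp add: nhd_one_def)

lemma nhd_one_mem: "nhd_one V \<Longrightarrow> \<one> \<in> V"
  by (simp add: nhd_one_def)

lemma nhd_one_Int: "nhd_one V \<Longrightarrow> nhd_one W \<Longrightarrow> nhd_one (V \<inter> W)"
  by (auto simp: nhd_one_def)

lemma nhd_one_univ: "nhd_one (carrier L)"
  using openin_topspace[of T] by (auto simp: nhd_one_def)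

lemma nhd_one_preimage:
  assumes "continuous_map T Z f" "openin Z W" "f \<one> \<in> W"
  shows "nhd_one {x \<in> carrier L. f x \<in> W}"
  using openin_preimage[OF assms(1,2)] assms(3) by (simp add: nhd_one_def)

lemma nhd_one_inv: "nhd_one V \<Longrightarrow> nhd_one {x \<in> carrier L. inv x \<in> V}"
  by (rule nhd_one_preimage[OF cont_inv]) (auto simp: nhd_one_def)

definition symmetric_set :: "'a set \<Rightarrow> bool" where
  "symmetric_set V \<longleftrightarrow> (\<forall>x\<in>V. inv x \<in> V)"

lemma symmetric_setD: "symmetric_set V \<Longrightarrow> x \<in> V \<Longrightarrow> inv x \<in> V"
  by (simp add: symmetric_set_def)

lemma symmetric_nhd_one:
  assumes "nhd_one V"
  obtains W where "nhd_one W" "symmetric_set W" "W \<subseteq> V"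
proof
  let ?W = "V \<inter> {x \<in> carrier L. inv x \<in> V}"
  show "nhd_one ?W" using nhd_one_Int nhd_one_inv assms by blast
  show "symmetric_set ?W" by (auto simp: symmetric_set_def)
qed auto

lemma mult_open_nhds:
  assumes S: "openin T S" and ab: "a \<in> carrier L" "b \<in> carrier L" "a \<otimes> b \<in> S"
  obtains A B where "openin T A" "openin T B" "a \<in> A" "b \<in> B"
    "\<And>x y. x \<in> A \<Longrightarrow> y \<in> B \<Longrightarrow> x \<otimes> y \<in> S"
proof -
  let ?P = "{p \<in> topspace (prod_topology T T). fst p \<otimes> snd p \<in> S}"
  have "openin (prod_topology T T) ?P" by (rule openin_continuous_map_preimage[OF cont_mult S])
  moreover have "(a, b) \<in> ?P" using ab by simp
  ultimately obtain A B where AB: "openin T A" "openin T B" "a \<in> A" "b \<in> B" "A \<times> B \<subseteq> ?P"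
    unfolding openin_prod_topology_alt by meson
  have "x \<otimes> y \<in> S" if "x \<in> A" "y \<in> B" for x y using subsetD[OF AB(5), of "(x, y)"] that by simp
  then show ?thesis using that AB(1-4) by blast
qed

lemma mult_nhd_one:
  assumes "nhd_one V"
  obtains W where "nhd_one W" "symmetric_set W" "W \<subseteq> V" "\<And>x y. x \<in> W \<Longrightarrow> y \<in> W \<Longrightarrow> x \<otimes> y \<in> V"
proof -
  obtain A B where AB: "openin T A" "openin T B" "\<one> \<in> A" "\<one> \<in> B"
    "\<And>x y. x \<in> A \<Longrightarrow> y \<in> B \<Longrightarrow> x \<otimes> y \<in> V"
    using mult_open_nhds[of V \<one> \<one>] assms by (auto simp: nhd_one_def)
  then have "nhd_one (A \<inter> B \<inter> V)" using assms by (auto simp: nhd_one_def)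
  then obtain W where "nhd_one W" "symmetric_set W" "W \<subseteq> A \<inter> B \<inter> V"
    using symmetric_nhd_one by blast
  then show ?thesis using AB(5) that[of W] by (simp add: subset_iff)
qed

lemma nhd_one_tube:
  assumes g: "continuous_map (prod_topology T T) Z (\<lambda>p. g (fst p) (snd p))"
    and C: "compactin T C" and W: "openin Z W" and sub: "\<And>y. y \<in> C \<Longrightarrow> g y \<one> \<in> W"
  obtains V where "nhd_one V" "\<And>y h. y \<in> C \<Longrightarrow> h \<in> V \<Longrightarrow> g y h \<in> W"
proof -
  let ?P = "{p \<in> topspace (prod_topology T T). g (fst p) (snd p) \<in> W}"
  have op: "openin (prod_topology T T) ?P" by (rule openin_continuous_map_preimage[OF g W])
  have CP: "C \<times> {\<one>} \<subseteq> ?P" using sub compactin_carrier[OF C] by auto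
  obtain U V where "openin T U" "openin T V" "C \<subseteq> U" "{\<one>} \<subseteq> V" and UV: "U \<times> V \<subseteq> ?P"
    using Wallace_theorem_prod_topology[OF C _ op, of "{\<one>}"] CP by auto
  moreover have "g y h \<in> W" if "y \<in> C" "h \<in> V" for y h
    using subsetD[OF UV, of "(y, h)"] that \<open>C \<subseteq> U\<close> by auto
  ultimately show ?thesis using that[of V] by (auto simp: nhd_one_def)
qed

lemma nhd_one_conjugate:
  assumes C: "compactin T C" and V: "nhd_one V"
  obtains W where "nhd_one W" "\<And>y h. y \<in> C \<Longrightarrow> h \<in> W \<Longrightarrow> inv y \<otimes> h \<otimes> y \<in> V"
proof (rule nhd_one_tube[of T "\<lambda>y h. inv y \<otimes> h \<otimes> y" C V])
  show "continuous_map (prod_topology T T) T (\<lambda>p. inv (fst p) \<otimes> snd p \<otimes> fst p)"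
    by (intro continuous_intros continuous_map_fst continuous_map_snd)
qed (use C V compactin_carrier[OF C] that in \<open>auto simp: nhd_one_def subset_iff\<close>)

lemma compactin_set_mult_nhd_one:
  assumes C: "compactin T C" and W: "openin T W" "C \<subseteq> W"
  obtains V where "nhd_one V" "C <#> V \<subseteq> W"
proof (rule nhd_one_tube[OF cont_mult C W(1)])
  show "y \<otimes> \<one> \<in> W" if "y \<in> C" for y
    using that W(2) compactin_carrier[OF C] by (auto simp: subset_iff)
qed (auto simp: set_mult_def intro: that)

lemma subset_set_mult_right_nhd_one: "A \<subseteq> carrier L \<Longrightarrow> nhd_one V \<Longrightarrow> A \<subseteq> A <#> V"
  unfolding set_mult_def nhd_one_def by force

lemma subset_set_mult_left_nhd_one: "A \<subseteq> carrier L \<Longrightarrow> nhd_one V \<Longrightarrow> A \<subseteq> V <#> A"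
  unfolding set_mult_def nhd_one_def by force

lemma closure_of_subset_set_mult:
  assumes "A \<subseteq> carrier L" "nhd_one V"
  shows "T closure_of A \<subseteq> A <#> V"
proof
  fix x assume x: "x \<in> T closure_of A"
  then have xL: "x \<in> carrier L" by (simp add: in_closure_of)
  let ?W = "{y \<in> carrier L. inv y \<otimes> x \<in> V}"
  have "openin T ?W"
    using assms(2) xL by (intro openin_preimage[of T] continuous_intros) (auto simp: nhd_one_def)
  moreover have "x \<in> ?W" using xL assms(2) by (simp add: nhd_one_def)
  ultimately obtain a where a: "a \<in> A" "inv a \<otimes> x \<in> V"
    using x unfolding in_closure_of by (metis (no_types, lifting) mem_Collect_eq)
  moreover have "x = a \<otimes> (inv a \<otimes> x)" using a assms(1) xL by auto
  ultimately show "x \<in> A <#> V" unfolding set_mult_def by blast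
qed

lemma openin_subgroup:
  assumes H: "subgroup H L" and V: "nhd_one V" "V \<subseteq> H"
  shows "openin T H"
proof -
  have "H <#> V \<subseteq> H" using H V(2) by (auto simp: set_mult_def intro: subgroup.m_closed)
  then have "H = H <#> V"
    using subset_set_mult_right_nhd_one[OF subgroup.subset[OF H] V(1)] by blast
  then show ?thesis
    using openin_set_mult_right[OF subgroup.subset[OF H] nhd_one_openin[OF V(1)]] by simp
qed

lemma subgroup_closure_of:
  assumes H: "subgroup H L"
  shows "subgroup (T closure_of H) L"
proof (rule subgroupI)
  have HL: "H \<subseteq> carrier L" using H by (rule subgroup.subset)
  show "T closure_of H \<subseteq> carrier L" using closure_of_subset_topspace[of T H] by simp
  show "T closure_of H \<noteq> {}" using closure_of_subset[of H T] HL subgroup.one_closed[OF H] by auto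
  show "inv a \<in> T closure_of H" if "a \<in> T closure_of H" for a
  proof -
    have "(\<lambda>x. inv x) ` H \<subseteq> H" using H by (auto intro: subgroup.m_inv_closed)
    then have "T closure_of ((\<lambda>x. inv x) ` H) \<subseteq> T closure_of H" by (rule closure_of_mono)
    then show ?thesis using continuous_map_image_closure_subset[OF cont_inv, of H] that by blast
  qed
  show "a \<otimes> b \<in> T closure_of H" if "a \<in> T closure_of H" "b \<in> T closure_of H" for a b
  proof -
    have "(a, b) \<in> prod_topology T T closure_of (H \<times> H)"
      using that by (simp add: closure_of_Times)
    then have "a \<otimes> b \<in> T closure_of ((\<lambda>p. fst p \<otimes> snd p) ` (H \<times> H))"
      using continuous_map_image_closure_subset[OF cont_mult, of "H \<times> H"] by force
    moreover have "(\<lambda>p. fst p \<otimes> snd p) ` (H \<times> H) \<subseteq> H" using H by (auto intro: subgroup.m_closed)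
    ultimately show ?thesis using closure_of_mono subsetD by metis
  qed
qed

lemma closure_of_commute:
  assumes "Hausdorff_space T" and "A \<subseteq> carrier L"
    and commute: "\<And>a b. a \<in> A \<Longrightarrow> b \<in> A \<Longrightarrow> a \<otimes> b = b \<otimes> a"
    and "a \<in> T closure_of A" "b \<in> T closure_of A"
  shows "a \<otimes> b = b \<otimes> a"
proof -
  have flip: "continuous_map (prod_topology T T) T (\<lambda>p. snd p \<otimes> fst p)"
    by (intro continuous_intros continuous_map_fst continuous_map_snd)
  have "(a, b) \<in> prod_topology T T closure_of (A \<times> A)"
    using assms(4,5) by (simp add: closure_of_Times)
  then have "fst (a, b) \<otimes> snd (a, b) = snd (a, b) \<otimes> fst (a, b)"
    by (rule forall_in_closure_of_eq[OF _ assms(1) cont_mult flip]) (use commute in force)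
  then show ?thesis by simp
qed

lemma top_group_subgroup:
  assumes H: "subgroup H L"
  shows "top_group (L\<lparr>carrier := H\<rparr>) (subtopology T H)"
proof -
  interpret H: group "L\<lparr>carrier := H\<rparr>"
    using H by (rule subgroup.subgroup_is_group) (rule is_group)
  have HL: "H \<subseteq> carrier L" using H by (rule subgroup.subset)
  show ?thesis
  proof
    show "topspace (subtopology T H) = carrier (L\<lparr>carrier := H\<rparr>)" using HL by auto
    have "continuous_map (subtopology (prod_topology T T) (H \<times> H)) T (\<lambda>p. fst p \<otimes> snd p)"
      using cont_mult continuous_map_from_subtopology by blast
    then show "continuous_map (prod_topology (subtopology T H) (subtopology T H)) (subtopology T H)
        (\<lambda>p. fst p \<otimes>\<^bsub>L\<lparr>carrier := H\<rparr>\<^esub> snd p)"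
      using subgroup.m_closed[OF H]
      by (auto simp: continuous_map_in_subtopology subtopology_Times[symmetric])
    have "continuous_map (subtopology T H) (subtopology T H) (\<lambda>x. inv x)"
      using cont_inv H by (auto simp: continuous_map_in_subtopology
          continuous_map_from_subtopology intro: subgroup.m_inv_closed)
    then show "continuous_map (subtopology T H) (subtopology T H) (\<lambda>x. inv\<^bsub>L\<lparr>carrier := H\<rparr>\<^esub> x)"
      by (rule continuous_map_eq) (use H HL in \<open>auto simp: m_inv_consistent\<close>)
  qed
qed

lemma continuous_map_of_right_modulus:
  fixes f :: "'a \<Rightarrow> real"
  assumes modulus: "\<And>e. e > 0 \<Longrightarrow> \<exists>V. nhd_one V \<and> (\<forall>x\<in>carrier L. \<forall>z\<in>V. \<bar>f (x \<otimes> z) - f x\<bar> < e)"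
  shows "continuous_map T euclideanreal f"
proof -
  have "openin T {x \<in> topspace T. f x \<in> S}" if S: "open S" for S
  proof (subst openin_subopen, intro ballI)
    fix x assume "x \<in> {x \<in> topspace T. f x \<in> S}"
    then have x: "x \<in> carrier L" "f x \<in> S" by auto
    then obtain e where e: "e > 0" "\<And>y. \<bar>y - f x\<bar> < e \<Longrightarrow> y \<in> S"
      using S unfolding open_dist dist_real_def by blast
    obtain V where V: "nhd_one V" "\<forall>x\<in>carrier L. \<forall>z\<in>V. \<bar>f (x \<otimes> z) - f x\<bar> < e"
      using modulus[OF e(1)] by auto
    let ?W = "(\<lambda>z. x \<otimes> z) ` V"
    have "openin T ?W" using openin_left_translate[OF x(1)] V(1) by (simp add: nhd_one_def)
    moreover have "x \<in> ?W" using V(1) x by (auto simp: nhd_one_def image_iff intro!: bexI[of _ \<one>])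
    moreover have "?W \<subseteq> {x \<in> topspace T. f x \<in> S}"
      using V x e nhd_one_carrier[OF V(1)] by auto
    ultimately show "\<exists>W. openin T W \<and> x \<in> W \<and> W \<subseteq> {x \<in> topspace T. f x \<in> S}"
      by (intro exI conjI)
  qed
  then show ?thesis by (auto simp: continuous_map_def)
qed

definition traps_subgroups :: "'a set \<Rightarrow> 'a set \<Rightarrow> bool" where
  "traps_subgroups \<Omega> K \<longleftrightarrow> (\<forall>P. subgroup P L \<longrightarrow> P \<subseteq> \<Omega> \<longrightarrow> P \<subseteq> K)"

lemma traps_subgroupsD: "traps_subgroups \<Omega> K \<Longrightarrow> subgroup P L \<Longrightarrow> P \<subseteq> \<Omega> \<Longrightarrow> P \<subseteq> K"
  by (simp add: traps_subgroups_def)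

lemma traps_subgroups_mono: "traps_subgroups \<Omega> K \<Longrightarrow> \<Omega>' \<subseteq> \<Omega> \<Longrightarrow> traps_subgroups \<Omega>' K"
  by (auto simp: traps_subgroups_def)

end

locale lc_group = top_group +
  assumes Hausdorff_T: "Hausdorff_space T" and locally_compact_T: "locally_compact_space T"
begin

lemma compact_nhd_one:
  assumes "nhd_one V"
  obtains W C where "nhd_one W" "compactin T C" "W \<subseteq> C" "C \<subseteq> V"
proof -
  have "neighbourhood_base_of (compactin T) T"
    using locally_compact_space_neighbourhood_base Hausdorff_T locally_compact_T by blast
  then show ?thesis using assms that
    unfolding neighbourhood_base_of nhd_one_def by (metis openin_subset)
qed

lemma compactin_closedin: "compactin T C \<Longrightarrow> closedin T C"
  using compactin_imp_closedin Hausdorff_T by blast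

lemma limitin_unique: "limitin T f a F \<Longrightarrow> limitin T f b F \<Longrightarrow> F \<noteq> bot \<Longrightarrow> a = b"
  using limitin_Hausdorff_unique[OF _ _ _ Hausdorff_T] by blast

lemma lc_group_closed_subgroup:
  assumes "subgroup H L" "closedin T H"
  shows "lc_group (L\<lparr>carrier := H\<rparr>) (subtopology T H)"
  unfolding lc_group_def lc_group_axioms_def
  using top_group_subgroup[OF assms(1)] Hausdorff_space_subtopology[OF Hausdorff_T]
    locally_compact_space_closed_subset[OF locally_compact_T assms(2)] by auto

lemma lc_group_open_subgroup:
  assumes "subgroup H L" "openin T H"
  shows "lc_group (L\<lparr>carrier := H\<rparr>) (subtopology T H)"
  unfolding lc_group_def lc_group_axioms_def
  using top_group_subgroup[OF assms(1)] Hausdorff_space_subtopology[OF Hausdorff_T]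
    locally_compact_space_open_subset[OF _ locally_compact_T assms(2)] Hausdorff_T by auto

lemma bump_function_exists:
  assumes "nhd_one V"
  obtains h :: "'a \<Rightarrow> real" and C where "continuous_map T euclideanreal h" "compactin T C" "C \<subseteq> V"
    "h \<in> carrier L \<rightarrow> {0..1}" "h \<one> = 1" "\<And>x. x \<in> carrier L \<Longrightarrow> x \<notin> C \<Longrightarrow> h x = 0"
proof -
  obtain W C where W: "nhd_one W" "compactin T C" "W \<subseteq> C" "C \<subseteq> V" using compact_nhd_one[OF assms] .
  have "completely_regular_space T"
    using locally_compact_regular_imp_completely_regular_space locally_compact_T Hausdorff_T
    by blast
  moreover have "closedin T (carrier L - W)"
    using closedin_diff[OF closedin_topspace nhd_one_openin[OF W(1)]] by simp
  moreover have "\<one> \<in> topspace T - (carrier L - W)" using W by (auto simp: nhd_one_def)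
  ultimately obtain f :: "'a \<Rightarrow> real" where f: "continuous_map T (top_of_set {0..1}) f" "f \<one> = 0"
      "f ` (carrier L - W) \<subseteq> {1}"
    unfolding completely_regular_space_def by blast
  have f01: "f x \<in> {0..1}" if "x \<in> carrier L" for x
    using f(1) that by (auto simp: continuous_map_in_subtopology)
  show ?thesis
  proof (rule that[of "\<lambda>x. 1 - f x" C])
    show "continuous_map T euclideanreal (\<lambda>x. 1 - f x)"
      using f(1) by (intro continuous_map_diff) (auto simp: continuous_map_in_subtopology)
    show "1 - f x = 0" if "x \<in> carrier L" "x \<notin> C" for x
      using f(3) that W by auto
  qed (use f f01 W in auto)
qed

end

lemma locally_compact_group_imp_lc_group: "locally_compact_group L T \<Longrightarrow> lc_group L T"
  unfolding locally_compact_group_def topological_group_def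
    lc_group_def lc_group_axioms_def top_group_def top_group_axioms_def by blast

section \<open>Continuous functions with compact support\<close>

context lc_group
begin

definition Cc :: "('a \<Rightarrow> real) set" where
  "Cc = {f. continuous_map T euclideanreal f \<and> (\<exists>C. compactin T C \<and> (\<forall>x\<in>carrier L - C. f x = 0))}"

lemma CcI:
  "continuous_map T euclideanreal f \<Longrightarrow> compactin T C \<Longrightarrow>
    (\<And>x. x \<in> carrier L \<Longrightarrow> x \<notin> C \<Longrightarrow> f x = 0) \<Longrightarrow> f \<in> Cc"
  by (auto simp: Cc_def)

lemma Cc_continuous: "f \<in> Cc \<Longrightarrow> continuous_map T euclideanreal f"
  by (simp add: Cc_def)

lemma Cc_support:
  assumes "f \<in> Cc"
  obtains C where "compactin T C" "\<And>x. x \<in> carrier L \<Longrightarrow> x \<notin> C \<Longrightarrow> f x = 0"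
  using assms by (auto simp: Cc_def)

lemma Cc_of_support:
  assumes "continuous_map T euclideanreal g" "f \<in> Cc"
    and "\<And>x. x \<in> carrier L \<Longrightarrow> f x = 0 \<Longrightarrow> g x = 0"
  shows "g \<in> Cc"
  using Cc_support[OF assms(2)] CcI[OF assms(1)] assms(3) by metis

lemma Cc_mult_left:
  "f \<in> Cc \<Longrightarrow> continuous_map T euclideanreal g \<Longrightarrow> (\<lambda>x. f x * g x) \<in> Cc"
  by (rule Cc_of_support[of _ f]) (simp_all add: continuous_map_real_mult Cc_continuous)

lemma Cc_mult: "f \<in> Cc \<Longrightarrow> g \<in> Cc \<Longrightarrow> (\<lambda>x. f x * g x) \<in> Cc"
  by (intro Cc_mult_left Cc_continuous)

lemma Cc_scale: "f \<in> Cc \<Longrightarrow> (\<lambda>x. c * f x) \<in> Cc"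
  by (rule Cc_of_support[of _ f]) (simp_all add: continuous_map_real_mult Cc_continuous)

lemma Cc_minus: "f \<in> Cc \<Longrightarrow> (\<lambda>x. - f x) \<in> Cc"
  using Cc_scale[of f "-1"] by simp

lemma Cc_add:
  assumes "f \<in> Cc" "g \<in> Cc"
  shows "(\<lambda>x. f x + g x) \<in> Cc"
proof -
  obtain C where C: "compactin T C" "\<And>x. x \<in> carrier L \<Longrightarrow> x \<notin> C \<Longrightarrow> f x = 0"
    using Cc_support[OF assms(1)] by blast
  obtain D where D: "compactin T D" "\<And>x. x \<in> carrier L \<Longrightarrow> x \<notin> D \<Longrightarrow> g x = 0"
    using Cc_support[OF assms(2)] by blast
  show ?thesis
    by (rule CcI[of _ "C \<union> D"])
      (auto intro!: compactin_Un continuous_map_add simp: C D Cc_continuous assms)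
qed

lemma Cc_diff: "f \<in> Cc \<Longrightarrow> g \<in> Cc \<Longrightarrow> (\<lambda>x. f x - g x) \<in> Cc"
  using Cc_add[of f "\<lambda>x. - g x"] Cc_minus[of g] by simp

lemma Cc_zero: "(\<lambda>x. 0) \<in> Cc"
  by (rule CcI[of _ "{}"]) auto

lemma Cc_sum: "finite S \<Longrightarrow> (\<And>s. s \<in> S \<Longrightarrow> f s \<in> Cc) \<Longrightarrow> (\<lambda>x. \<Sum>s\<in>S. f s x) \<in> Cc"
  by (induction S rule: finite_induct) (auto intro!: Cc_zero Cc_add)

lemma Cc_max_zero: "f \<in> Cc \<Longrightarrow> (\<lambda>x. max 0 (f x)) \<in> Cc"
  by (rule Cc_of_support[of _ f]) (simp_all add: continuous_map_real_max Cc_continuous)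

lemma Cc_abs: "f \<in> Cc \<Longrightarrow> (\<lambda>x. \<bar>f x\<bar>) \<in> Cc"
  by (rule Cc_of_support[of _ f]) (simp_all add: continuous_map_real_abs Cc_continuous)

lemma Cc_left_translate:
  assumes "f \<in> Cc" "g \<in> carrier L"
  shows "(\<lambda>x. f (g \<otimes> x)) \<in> Cc"
proof -
  obtain C where C: "compactin T C" "\<And>x. x \<in> carrier L \<Longrightarrow> x \<notin> C \<Longrightarrow> f x = 0"
    using Cc_support[OF assms(1)] by blast
  have translate: "compactin T ((\<lambda>x. inv g \<otimes> x) ` C)"
    by (rule image_compactin[OF C(1) continuous_map_left_translate]) (simp add: assms)
  show ?thesis
  proof (rule CcI[OF _ translate])
    show "continuous_map T euclideanreal (\<lambda>x. f (g \<otimes> x))"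
      using assms
      by (intro continuous_map_real_compose[OF Cc_continuous continuous_map_left_translate])
    fix x assume x: "x \<in> carrier L" "x \<notin> (\<lambda>x. inv g \<otimes> x) ` C"
    then have "g \<otimes> x \<notin> C" using assms(2) by (metis image_eqI inv_mult_cancel_left)
    then show "f (g \<otimes> x) = 0" using x assms C(2) by simp
  qed
qed

lemma Cc_compose_inv:
  assumes "f \<in> Cc"
  shows "(\<lambda>x. f (inv x)) \<in> Cc"
proof -
  obtain C where C: "compactin T C" "\<And>x. x \<in> carrier L \<Longrightarrow> x \<notin> C \<Longrightarrow> f x = 0"
    using Cc_support[OF assms] by blast
  show ?thesis
  proof (rule CcI[OF _ compactin_image_inv[OF C(1)]])
    show "continuous_map T euclideanreal (\<lambda>x. f (inv x))"
      by (rule continuous_map_real_compose[OF Cc_continuous[OF assms] cont_inv])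
    fix x assume x: "x \<in> carrier L" "x \<notin> (\<lambda>x. inv x) ` C"
    then have "inv x \<notin> C" by (metis imageI inv_inv)
    then show "f (inv x) = 0" using x C(2) by simp
  qed
qed

lemma Cc_bounded:
  assumes "f \<in> Cc"
  obtains M where "M > 0" "\<And>x. x \<in> carrier L \<Longrightarrow> \<bar>f x\<bar> \<le> M"
proof -
  obtain C where C: "compactin T C" "\<And>x. x \<in> carrier L \<Longrightarrow> x \<notin> C \<Longrightarrow> f x = 0"
    using Cc_support[OF assms] by blast
  have "compactin euclideanreal (f ` C)"
    using image_compactin[OF C(1) Cc_continuous[OF assms]] .
  then have "bounded (f ` C)" by (simp add: compact_imp_bounded)
  then obtain M where M: "M > 0" "\<And>x. x \<in> C \<Longrightarrow> \<bar>f x\<bar> \<le> M"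
    unfolding bounded_pos by auto
  have "\<bar>f x\<bar> \<le> M" if "x \<in> carrier L" for x
    using M C(2)[OF that] by (cases "x \<in> C") auto
  then show ?thesis using that M by blast
qed

text \<open>The tube lemma gives the modulus on a compact neighbourhood of the support; outside of it both
  values vanish.\<close>

lemma Cc_right_modulus:
  assumes f: "f \<in> Cc" and e: "e > 0"
  obtains V where "nhd_one V" "\<And>x z. x \<in> carrier L \<Longrightarrow> z \<in> V \<Longrightarrow> \<bar>f (x \<otimes> z) - f x\<bar> < e"
proof -
  obtain C where C: "compactin T C" "\<And>x. x \<in> carrier L \<Longrightarrow> x \<notin> C \<Longrightarrow> f x = 0"
    using Cc_support[OF f] by blast
  obtain W D where W: "nhd_one W" "compactin T D" "W \<subseteq> D"
    using compact_nhd_one[OF nhd_one_univ] .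
  have cont: "continuous_map (prod_topology T T) euclideanreal (\<lambda>p. f (fst p \<otimes> snd p) - f (fst p))"
    using Cc_continuous[OF f]
    by (intro continuous_map_diff continuous_map_real_compose[OF _ cont_mult]
        continuous_map_real_compose[OF _ continuous_map_fst]) auto
  obtain V0 where V0: "nhd_one V0"
    and tube: "\<And>x z. x \<in> C <#> D \<Longrightarrow> z \<in> V0 \<Longrightarrow> f (x \<otimes> z) - f x \<in> {-e<..<e}"
  proof (rule nhd_one_tube[OF cont compactin_set_mult[OF C(1) W(2)]])
    show "f (x \<otimes> \<one>) - f x \<in> {-e<..<e}" if "x \<in> C <#> D" for x
      using that e compactin_carrier[OF compactin_set_mult[OF C(1) W(2)]] by auto
  qed auto
  obtain V where V: "nhd_one V" "symmetric_set V" "V \<subseteq> V0 \<inter> W"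
    using symmetric_nhd_one[OF nhd_one_Int[OF V0 W(1)]] .
  have "\<bar>f (x \<otimes> z) - f x\<bar> < e" if x: "x \<in> carrier L" and z: "z \<in> V" for x z
  proof (cases "x \<in> C <#> D")
    case True
    have "f (x \<otimes> z) - f x \<in> {-e<..<e}" using tube[OF True] z V(3) by blast
    then show ?thesis by auto
  next
    case False
    have zL: "z \<in> carrier L" using z nhd_one_carrier[OF V(1)] by auto
    have CD: "x \<otimes> v \<notin> C" if "inv v \<in> D" "v \<in> carrier L" for v
    proof
      assume "x \<otimes> v \<in> C"
      then have "x \<otimes> v \<otimes> inv v \<in> C <#> D" using that unfolding set_mult_def by blast
      then show False using False x that by (simp add: m_assoc)
    qed
    have "inv z \<in> D" "inv \<one> \<in> D"
      using z V W symmetric_setD[OF V(2) z] nhd_one_mem[OF W(1)] by auto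
    then have "f (x \<otimes> z) = 0" "f (x \<otimes> \<one>) = 0" using CD[of z] CD[of \<one>] C(2) x zL by auto
    then show ?thesis using x e by simp
  qed
  then show ?thesis using that V(1) by blast
qed

lemma Cc_left_modulus:
  assumes f: "f \<in> Cc" and e: "e > 0"
  obtains V where "nhd_one V" "symmetric_set V"
    "\<And>x z. x \<in> carrier L \<Longrightarrow> z \<in> V \<Longrightarrow> \<bar>f (z \<otimes> x) - f x\<bar> < e"
proof -
  obtain V where V: "nhd_one V"
      "\<And>x z. x \<in> carrier L \<Longrightarrow> z \<in> V \<Longrightarrow> \<bar>f (inv (x \<otimes> z)) - f (inv x)\<bar> < e"
    using Cc_right_modulus[OF Cc_compose_inv[OF f] e] by blast
  obtain W where W: "nhd_one W" "symmetric_set W" "W \<subseteq> V" using symmetric_nhd_one[OF V(1)] .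
  have "\<bar>f (z \<otimes> x) - f x\<bar> < e" if "x \<in> carrier L" "z \<in> W" for x z
  proof -
    have "z \<in> carrier L" "inv z \<in> V"
      using that nhd_one_carrier[OF W(1)] symmetric_setD[OF W(2)] W(3) by auto
    then show ?thesis using V(2)[of "inv x" "inv z"] that by (simp add: inv_mult_group)
  qed
  then show ?thesis using that W(1,2) by blast
qed

definition Cc_plus :: "('a \<Rightarrow> real) set" where
  "Cc_plus = {f \<in> Cc. \<forall>x\<in>carrier L. 0 \<le> f x}"

lemma Cc_plusI: "f \<in> Cc \<Longrightarrow> (\<And>x. x \<in> carrier L \<Longrightarrow> 0 \<le> f x) \<Longrightarrow> f \<in> Cc_plus"
  by (simp add: Cc_plus_def)

lemma Cc_plus_imp_Cc: "f \<in> Cc_plus \<Longrightarrow> f \<in> Cc"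
  by (simp add: Cc_plus_def)

lemma Cc_plus_nonneg: "f \<in> Cc_plus \<Longrightarrow> x \<in> carrier L \<Longrightarrow> 0 \<le> f x"
  by (simp add: Cc_plus_def)

lemma Cc_plus_continuous: "f \<in> Cc_plus \<Longrightarrow> continuous_map T euclideanreal f"
  by (simp add: Cc_plus_def Cc_continuous)

lemma Cc_plus_add: "f \<in> Cc_plus \<Longrightarrow> g \<in> Cc_plus \<Longrightarrow> (\<lambda>x. f x + g x) \<in> Cc_plus"
  by (auto simp: Cc_plus_def intro!: Cc_add)

lemma Cc_plus_scale: "f \<in> Cc_plus \<Longrightarrow> 0 \<le> c \<Longrightarrow> (\<lambda>x. c * f x) \<in> Cc_plus"
  by (auto simp: Cc_plus_def intro!: Cc_scale)

lemma Cc_plus_left_translate: "f \<in> Cc_plus \<Longrightarrow> g \<in> carrier L \<Longrightarrow> (\<lambda>x. f (g \<otimes> x)) \<in> Cc_plus"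
  by (auto simp: Cc_plus_def intro!: Cc_left_translate)

lemma Cc_plus_zero: "(\<lambda>x. 0) \<in> Cc_plus"
  by (simp add: Cc_plus_def Cc_zero)

lemma Cc_plus_sum:
  "finite S \<Longrightarrow> (\<And>s. s \<in> S \<Longrightarrow> f s \<in> Cc_plus) \<Longrightarrow> (\<lambda>x. \<Sum>s\<in>S. f s x) \<in> Cc_plus"
  by (auto simp: Cc_plus_def intro!: Cc_sum sum_nonneg)

lemma Cc_plus_positive_part: "f \<in> Cc \<Longrightarrow> (\<lambda>x. max 0 (f x)) \<in> Cc_plus"
  by (intro Cc_plusI Cc_max_zero) auto

lemma Cc_plus_negative_part: "f \<in> Cc \<Longrightarrow> (\<lambda>x. max 0 (- f x)) \<in> Cc_plus"
  by (intro Cc_plusI Cc_max_zero Cc_minus) auto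

definition bumps_in :: "'a set \<Rightarrow> ('a \<Rightarrow> real) set" where
  "bumps_in V = {\<phi> \<in> Cc_plus. \<phi> \<one> > 0 \<and> (\<forall>x\<in>carrier L. \<phi> x \<noteq> 0 \<longrightarrow> x \<in> V)}"

lemma bumps_inD:
  assumes "\<phi> \<in> bumps_in V"
  shows "\<phi> \<in> Cc_plus" "\<phi> \<one> > 0" "x \<in> carrier L \<Longrightarrow> \<phi> x \<noteq> 0 \<Longrightarrow> x \<in> V"
  using assms by (auto simp: bumps_in_def)

lemma bumps_in_univI: "\<phi> \<in> Cc_plus \<Longrightarrow> \<phi> \<one> > 0 \<Longrightarrow> \<phi> \<in> bumps_in (carrier L)"
  by (simp add: bumps_in_def)

lemma bumps_in_mono: "V \<subseteq> W \<Longrightarrow> bumps_in V \<subseteq> bumps_in W"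
  by (auto simp: bumps_in_def)

lemma normalized_bump_exists:
  assumes "nhd_one V"
  obtains \<phi> where "\<phi> \<in> bumps_in V" "\<phi> \<one> = 1" "\<And>x. x \<in> carrier L \<Longrightarrow> \<phi> x \<le> 1"
proof -
  obtain \<phi> C where \<phi>: "continuous_map T euclideanreal \<phi>" "compactin T C" "C \<subseteq> V"
    "\<phi> \<in> carrier L \<rightarrow> {0..1}" "\<phi> \<one> = (1::real)" "\<And>x. x \<in> carrier L \<Longrightarrow> x \<notin> C \<Longrightarrow> \<phi> x = 0"
    using bump_function_exists[OF assms] by blast
  have "\<phi> \<in> Cc_plus" using \<phi>(4) by (intro Cc_plusI CcI[OF \<phi>(1,2,6)]) auto
  then have "\<phi> \<in> bumps_in V" using \<phi>(3,5,6) by (auto simp: bumps_in_def)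
  then show ?thesis using \<phi>(4,5) by (intro that[of \<phi>]) auto
qed

text \<open>The finitely many translates on which a bump exceeds half of its value at the identity are
  what makes a compact set small relative to it.\<close>

lemma compactin_covered_by_bump_translates:
  assumes C: "compactin T C" and \<phi>: "\<phi> \<in> bumps_in V"
  obtains S where "finite S" "S \<subseteq> carrier L" "\<And>x. x \<in> C \<Longrightarrow> \<exists>s\<in>S. \<phi> \<one> / 2 < \<phi> (inv s \<otimes> x)"
proof -
  have CL: "C \<subseteq> carrier L" by (rule compactin_carrier[OF C])
  let ?W = "\<lambda>s. {x \<in> carrier L. \<phi> (inv s \<otimes> x) \<in> {\<phi> \<one> / 2<..}}"
  have W: "openin T (?W s) \<and> s \<in> ?W s" if "s \<in> C" for s
  proof
    have "s \<in> carrier L" using that CL by auto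
    then have "continuous_map T euclideanreal (\<lambda>x. \<phi> (inv s \<otimes> x))"
      by (intro Cc_plus_continuous Cc_plus_left_translate bumps_inD(1)[OF \<phi>]) auto
    then show "openin T (?W s)" by (rule openin_preimage) auto
    show "s \<in> ?W s" using \<open>s \<in> carrier L\<close> bumps_inD(2)[OF \<phi>] by simp
  qed
  obtain S where "finite S" "S \<subseteq> C" "C \<subseteq> \<Union>(?W ` S)"
    using compactin_finite_subcover[OF C W] by blast
  then show ?thesis using that[of S] CL by fastforce
qed

lemma Cc_plus_ge_one_on_compact:
  assumes C: "compactin T C"
  obtains h where "h \<in> Cc_plus" "\<And>x. x \<in> C \<Longrightarrow> 1 \<le> h x"
proof -
  obtain \<phi> where \<phi>: "\<phi> \<in> bumps_in (carrier L)" "\<phi> \<one> = 1"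
    using normalized_bump_exists[OF nhd_one_univ] by blast
  obtain S where S: "finite S" "S \<subseteq> carrier L" "\<And>x. x \<in> C \<Longrightarrow> \<exists>s\<in>S. \<phi> \<one> / 2 < \<phi> (inv s \<otimes> x)"
    using compactin_covered_by_bump_translates[OF C \<phi>(1)] by blast
  have translate: "(\<lambda>x. 2 * \<phi> (inv s \<otimes> x)) \<in> Cc_plus" if "s \<in> S" for s
    using that S(2) by (intro Cc_plus_scale Cc_plus_left_translate bumps_inD(1)[OF \<phi>(1)]) auto
  show ?thesis
  proof (rule that[of "\<lambda>x. \<Sum>s\<in>S. 2 * \<phi> (inv s \<otimes> x)"])
    show "(\<lambda>x. \<Sum>s\<in>S. 2 * \<phi> (inv s \<otimes> x)) \<in> Cc_plus" using S(1) translate by (rule Cc_plus_sum)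
    fix x assume x: "x \<in> C"
    then obtain s where s: "s \<in> S" "1 / 2 < \<phi> (inv s \<otimes> x)" using S(3) \<phi>(2) by auto
    have "1 \<le> 2 * \<phi> (inv s \<otimes> x)" using s(2) by simp
    also have "\<dots> \<le> (\<Sum>s\<in>S. 2 * \<phi> (inv s \<otimes> x))"
      using s(1) S(1) compactin_carrier[OF C] x Cc_plus_nonneg[OF translate]
      by (intro member_le_sum) auto
    finally show "1 \<le> (\<Sum>s\<in>S. 2 * \<phi> (inv s \<otimes> x))" .
  qed
qed

end

section \<open>Haar integral\<close>

lemma sum_list_pair_mono:
  fixes p q :: "'b \<Rightarrow> 'c \<Rightarrow> real"
  assumes "\<And>c s. (c, s) \<in> set cs \<Longrightarrow> p c s \<le> q c s"
  shows "(\<Sum>(c,s)\<leftarrow>cs. p c s) \<le> (\<Sum>(c,s)\<leftarrow>cs. q c s)"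
  using assms by (intro sum_list_mono) auto

lemma sum_list_pair_cong:
  fixes p q :: "'b \<Rightarrow> 'c \<Rightarrow> real"
  assumes "\<And>c s. (c, s) \<in> set cs \<Longrightarrow> p c s = q c s"
  shows "(\<Sum>(c,s)\<leftarrow>cs. p c s) = (\<Sum>(c,s)\<leftarrow>cs. q c s)"
  using assms by (intro arg_cong[of _ _ sum_list] map_cong) auto

lemma sum_list_pair_const_mult:
  fixes p :: "'b \<Rightarrow> 'c \<Rightarrow> real"
  shows "(\<Sum>(c,s)\<leftarrow>cs. k * p c s) = k * (\<Sum>(c,s)\<leftarrow>cs. p c s)"
  by (simp add: case_prod_unfold sum_list_const_mult)

context lc_group
begin

definition cover_weight :: "(real \<times> 'a) list \<Rightarrow> real" where
  "cover_weight cs = (\<Sum>(c,s)\<leftarrow>cs. c)"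

definition cover_sum :: "('a \<Rightarrow> real) \<Rightarrow> (real \<times> 'a) list \<Rightarrow> 'a \<Rightarrow> real" where
  "cover_sum \<phi> cs x = (\<Sum>(c,s)\<leftarrow>cs. c * \<phi> (inv s \<otimes> x))"

definition translate_covers :: "('a \<Rightarrow> real) \<Rightarrow> ('a \<Rightarrow> real) \<Rightarrow> (real \<times> 'a) list set" where
  "translate_covers f \<phi> =
     {cs. set cs \<subseteq> {0..} \<times> carrier L \<and> (\<forall>x\<in>carrier L. f x \<le> cover_sum \<phi> cs x)}"

text \<open>\<open>covering_number f \<phi>\<close> is the covering number \<open>(f : \<phi>)\<close> of Weil's construction.\<close>

definition covering_number :: "('a \<Rightarrow> real) \<Rightarrow> ('a \<Rightarrow> real) \<Rightarrow> real" where
  "covering_number f \<phi> = Inf (cover_weight ` translate_covers f \<phi>)"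

lemma translate_coversI:
  "set cs \<subseteq> {0..} \<times> carrier L \<Longrightarrow> (\<And>x. x \<in> carrier L \<Longrightarrow> f x \<le> cover_sum \<phi> cs x) \<Longrightarrow>
    cs \<in> translate_covers f \<phi>"
  by (simp add: translate_covers_def)

lemma translate_coversD:
  assumes "cs \<in> translate_covers f \<phi>"
  shows "(c, s) \<in> set cs \<Longrightarrow> 0 \<le> c" "(c, s) \<in> set cs \<Longrightarrow> s \<in> carrier L"
    "x \<in> carrier L \<Longrightarrow> f x \<le> cover_sum \<phi> cs x"
  using assms by (auto simp: translate_covers_def)

lemma cover_weight_nonneg: "cs \<in> translate_covers f \<phi> \<Longrightarrow> 0 \<le> cover_weight cs"
  by (auto simp: cover_weight_def dest: translate_coversD(1) intro!: sum_list_nonneg)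

lemma covering_number_le: "cs \<in> translate_covers f \<phi> \<Longrightarrow> covering_number f \<phi> \<le> cover_weight cs"
  unfolding covering_number_def
  by (rule cInf_lower) (auto intro!: bdd_belowI[of _ 0] cover_weight_nonneg)

lemma translate_covers_nonempty:
  assumes f: "f \<in> Cc" and \<phi>: "\<phi> \<in> bumps_in V"
  shows "translate_covers f \<phi> \<noteq> {}"
proof -
  obtain C where C: "compactin T C" "\<And>x. x \<in> carrier L \<Longrightarrow> x \<notin> C \<Longrightarrow> f x = 0"
    using Cc_support[OF f] by blast
  obtain M where M: "M > 0" "\<And>x. x \<in> carrier L \<Longrightarrow> \<bar>f x\<bar> \<le> M" using Cc_bounded[OF f] by blast
  obtain S where S: "finite S" "S \<subseteq> carrier L" "\<And>x. x \<in> C \<Longrightarrow> \<exists>s\<in>S. \<phi> \<one> / 2 < \<phi> (inv s \<otimes> x)"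
    using compactin_covered_by_bump_translates[OF C(1) \<phi>] by blast
  obtain ss where ss: "set ss = S" using finite_list[OF S(1)] by blast
  define c where "c = 2 * M / \<phi> \<one>"
  have c: "0 \<le> c" "c * (\<phi> \<one> / 2) = M" using M(1) bumps_inD(2)[OF \<phi>] by (auto simp: c_def)
  have "map (Pair c) ss \<in> translate_covers f \<phi>"
  proof (rule translate_coversI)
    show "set (map (Pair c) ss) \<subseteq> {0..} \<times> carrier L" using ss S(2) c(1) by auto
    fix x assume x: "x \<in> carrier L"
    have sum: "cover_sum \<phi> (map (Pair c) ss) x = (\<Sum>s\<leftarrow>ss. c * \<phi> (inv s \<otimes> x))"
      by (simp add: cover_sum_def o_def)
    have nonneg: "0 \<le> c * \<phi> (inv s \<otimes> x)" if "s \<in> S" for s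
      using that S(2) x c(1)
      by (intro mult_nonneg_nonneg Cc_plus_nonneg[OF bumps_inD(1)[OF \<phi>]]) auto
    show "f x \<le> cover_sum \<phi> (map (Pair c) ss) x"
    proof (cases "x \<in> C")
      case True
      then obtain s where s: "s \<in> S" "\<phi> \<one> / 2 < \<phi> (inv s \<otimes> x)" using S(3) by blast
      have "f x \<le> c * (\<phi> \<one> / 2)" using M(2)[OF x] c(2) by auto
      also have "\<dots> \<le> c * \<phi> (inv s \<otimes> x)" using s(2) c(1) by (intro mult_left_mono) auto
      also have "\<dots> \<le> (\<Sum>s\<leftarrow>ss. c * \<phi> (inv s \<otimes> x))"
        using nonneg ss s(1) by (intro member_le_sum_list) auto
      finally show ?thesis by (simp add: sum)
    next
      case False
      then show ?thesis using C(2)[OF x] nonneg ss by (auto simp: sum intro!: sum_list_nonneg)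
    qed
  qed
  then show ?thesis by blast
qed

lemma le_mult_covering_number:
  assumes "f \<in> Cc" "\<phi> \<in> bumps_in V" and w: "0 \<le> w"
    and bound: "\<And>cs. cs \<in> translate_covers f \<phi> \<Longrightarrow> b \<le> w * cover_weight cs"
  shows "b \<le> w * covering_number f \<phi>"
proof (cases "w = 0")
  case True
  then show ?thesis using bound translate_covers_nonempty[OF assms(1,2)] by auto
next
  case False
  then have "b / w \<le> cover_weight cs" if "cs \<in> translate_covers f \<phi>" for cs
    using bound[OF that] w by (simp add: field_simps)
  then have "b / w \<le> covering_number f \<phi>"
    unfolding covering_number_def
    using translate_covers_nonempty[OF assms(1,2)] by (intro cInf_greatest) auto
  then show ?thesis using False w by (simp add: field_simps)
qed

lemma le_covering_number:
  assumes "f \<in> Cc" "\<phi> \<in> bumps_in V"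
    and "\<And>cs. cs \<in> translate_covers f \<phi> \<Longrightarrow> b \<le> cover_weight cs"
  shows "b \<le> covering_number f \<phi>"
  using le_mult_covering_number[OF assms(1,2), of 1 b] assms(3) by simp

lemma covering_number_nonneg: "f \<in> Cc \<Longrightarrow> \<phi> \<in> bumps_in V \<Longrightarrow> 0 \<le> covering_number f \<phi>"
  by (rule le_covering_number) (auto intro: cover_weight_nonneg)

lemma covering_number_mono:
  assumes "g \<in> Cc" "\<phi> \<in> bumps_in V" and f_le_g: "\<And>x. x \<in> carrier L \<Longrightarrow> f x \<le> g x"
  shows "covering_number f \<phi> \<le> covering_number g \<phi>"
proof (rule le_covering_number[OF assms(1,2)])
  fix cs assume "cs \<in> translate_covers g \<phi>"
  then have "cs \<in> translate_covers f \<phi>"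
    using f_le_g by (fastforce simp: translate_covers_def)
  then show "covering_number f \<phi> \<le> cover_weight cs" by (rule covering_number_le)
qed

lemma covering_number_add_le:
  assumes "f \<in> Cc" "g \<in> Cc" "\<phi> \<in> bumps_in V"
  shows "covering_number (\<lambda>x. f x + g x) \<phi> \<le> covering_number f \<phi> + covering_number g \<phi>"
proof -
  let ?N = "covering_number (\<lambda>x. f x + g x) \<phi>"
  have "?N - cover_weight ds \<le> covering_number f \<phi>" if ds: "ds \<in> translate_covers g \<phi>" for ds
  proof (rule le_covering_number[OF assms(1,3)])
    fix cs assume "cs \<in> translate_covers f \<phi>"
    then have "cs @ ds \<in> translate_covers (\<lambda>x. f x + g x) \<phi>"
      using ds by (auto simp: translate_covers_def cover_sum_def intro!: add_mono)
    from covering_number_le[OF this] show "?N - cover_weight ds \<le> cover_weight cs"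
      by (simp add: cover_weight_def)
  qed
  then have "?N - covering_number f \<phi> \<le> covering_number g \<phi>"
    by (intro le_covering_number[OF assms(2,3)]) (simp add: algebra_simps)
  then show ?thesis by simp
qed

lemma covering_number_left_translate_le:
  assumes "f \<in> Cc" "\<phi> \<in> bumps_in V" "g \<in> carrier L"
  shows "covering_number (\<lambda>x. f (inv g \<otimes> x)) \<phi> \<le> covering_number f \<phi>"
proof (rule le_covering_number[OF assms(1,2)])
  fix cs assume cs: "cs \<in> translate_covers f \<phi>"
  let ?ds = "map (\<lambda>(c,s). (c, g \<otimes> s)) cs"
  have "?ds \<in> translate_covers (\<lambda>x. f (inv g \<otimes> x)) \<phi>"
  proof (rule translate_coversI)
    show "set ?ds \<subseteq> {0..} \<times> carrier L" using translate_coversD(1,2)[OF cs] assms(3) by auto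
    fix x assume x: "x \<in> carrier L"
    have "f (inv g \<otimes> x) \<le> (\<Sum>(c,s)\<leftarrow>cs. c * \<phi> (inv s \<otimes> (inv g \<otimes> x)))"
      using translate_coversD(3)[OF cs] x assms(3) by (simp add: cover_sum_def)
    also have "\<dots> = (\<Sum>(c,s)\<leftarrow>cs. c * \<phi> (inv (g \<otimes> s) \<otimes> x))"
      using translate_coversD(2)[OF cs] x assms(3)
      by (intro sum_list_pair_cong) (simp add: inv_mult_group m_assoc)
    finally show "f (inv g \<otimes> x) \<le> cover_sum \<phi> ?ds x"
      by (simp add: cover_sum_def o_def case_prod_unfold)
  qed
  from covering_number_le[OF this] show "covering_number (\<lambda>x. f (inv g \<otimes> x)) \<phi> \<le> cover_weight cs"
    by (simp add: cover_weight_def o_def case_prod_unfold)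
qed

lemma covering_number_left_translate:
  assumes "f \<in> Cc" "\<phi> \<in> bumps_in V" "g \<in> carrier L"
  shows "covering_number (\<lambda>x. f (inv g \<otimes> x)) \<phi> = covering_number f \<phi>"
proof (rule antisym[OF covering_number_left_translate_le[OF assms]])
  have f': "(\<lambda>x. f (inv g \<otimes> x)) \<in> Cc" using assms by (intro Cc_left_translate) auto
  have "(\<lambda>x. f (inv g \<otimes> (inv (inv g) \<otimes> x))) \<in> Cc"
    using Cc_left_translate[OF f', of "inv (inv g)"] assms(3) by simp
  then have "covering_number f \<phi> \<le> covering_number (\<lambda>x. f (inv g \<otimes> (inv (inv g) \<otimes> x))) \<phi>"
    using assms by (intro covering_number_mono) auto
  also have "\<dots> \<le> covering_number (\<lambda>x. f (inv g \<otimes> x)) \<phi>"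
    using covering_number_left_translate_le[OF f' assms(2), of "inv g"] assms(3) by auto
  finally show "covering_number f \<phi> \<le> covering_number (\<lambda>x. f (inv g \<otimes> x)) \<phi>" .
qed

lemma covering_number_scale_le:
  assumes "f \<in> Cc" "\<phi> \<in> bumps_in V" "c \<ge> 0"
  shows "covering_number (\<lambda>x. c * f x) \<phi> \<le> c * covering_number f \<phi>"
proof (rule le_mult_covering_number[OF assms])
  fix cs assume cs: "cs \<in> translate_covers f \<phi>"
  let ?ds = "map (\<lambda>(a,s). (c * a, s)) cs"
  have "?ds \<in> translate_covers (\<lambda>x. c * f x) \<phi>"
  proof (rule translate_coversI)
    show "set ?ds \<subseteq> {0..} \<times> carrier L" using translate_coversD(1,2)[OF cs] assms(3) by auto
    fix x assume "x \<in> carrier L"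
    then have "c * f x \<le> c * cover_sum \<phi> cs x"
      using translate_coversD(3)[OF cs] assms(3) by (intro mult_left_mono)
    then show "c * f x \<le> cover_sum \<phi> ?ds x"
      by (simp add: cover_sum_def o_def case_prod_unfold mult.assoc sum_list_const_mult)
  qed
  from covering_number_le[OF this] show "covering_number (\<lambda>x. c * f x) \<phi> \<le> c * cover_weight cs"
    by (simp add: cover_weight_def o_def case_prod_unfold sum_list_const_mult)
qed

lemma covering_number_scale:
  assumes "f \<in> Cc" "\<phi> \<in> bumps_in V" "c > 0"
  shows "covering_number (\<lambda>x. c * f x) \<phi> = c * covering_number f \<phi>"
proof (rule antisym)
  show "covering_number (\<lambda>x. c * f x) \<phi> \<le> c * covering_number f \<phi>"
    using assms by (intro covering_number_scale_le) auto
  have "covering_number (\<lambda>x. (1 / c) * (c * f x)) \<phi> \<le> (1 / c) * covering_number (\<lambda>x. c * f x) \<phi>"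
    using assms by (intro covering_number_scale_le Cc_scale) auto
  then show "c * covering_number f \<phi> \<le> covering_number (\<lambda>x. c * f x) \<phi>"
    using assms(3) by (simp add: field_simps)
qed

definition compose_covers :: "(real \<times> 'a) list \<Rightarrow> (real \<times> 'a) list \<Rightarrow> (real \<times> 'a) list" where
  "compose_covers cs ds = concat (map (\<lambda>(c,s). map (\<lambda>(d,t). (c * d, s \<otimes> t)) ds) cs)"

lemma cover_weight_compose:
  "cover_weight (compose_covers cs ds) = cover_weight cs * cover_weight ds"
  unfolding cover_weight_def compose_covers_def
  by (induction cs) (auto simp: o_def case_prod_unfold sum_list_const_mult distrib_right)

lemma cover_sum_compose:
  "cover_sum \<phi> (compose_covers cs ds) x = (\<Sum>(c,s)\<leftarrow>cs. \<Sum>(d,t)\<leftarrow>ds. c * d * \<phi> (inv (s \<otimes> t) \<otimes> x))"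
  unfolding cover_sum_def compose_covers_def
  by (induction cs) (auto simp: o_def case_prod_unfold)

lemma compose_covers_mem:
  assumes cs: "cs \<in> translate_covers f \<psi>" and ds: "ds \<in> translate_covers \<psi> \<phi>"
  shows "compose_covers cs ds \<in> translate_covers f \<phi>"
proof (rule translate_coversI)
  have "0 \<le> c * d \<and> s \<otimes> t \<in> carrier L" if "(c, s) \<in> set cs" "(d, t) \<in> set ds" for c s d t
    using translate_coversD(1,2)[OF cs that(1)] translate_coversD(1,2)[OF ds that(2)] by simp
  then show "set (compose_covers cs ds) \<subseteq> {0..} \<times> carrier L"
    by (auto simp: compose_covers_def)
  fix x assume x: "x \<in> carrier L"
  have "f x \<le> (\<Sum>(c,s)\<leftarrow>cs. c * \<psi> (inv s \<otimes> x))"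
    using translate_coversD(3)[OF cs x] by (simp add: cover_sum_def)
  also have "\<dots> \<le> (\<Sum>(c,s)\<leftarrow>cs. \<Sum>(d,t)\<leftarrow>ds. c * d * \<phi> (inv (s \<otimes> t) \<otimes> x))"
  proof (rule sum_list_pair_mono)
    fix c s assume "(c, s) \<in> set cs"
    then have c: "0 \<le> c" and s: "s \<in> carrier L" using translate_coversD(1,2)[OF cs] by auto
    have "c * \<psi> (inv s \<otimes> x) \<le> c * (\<Sum>(d,t)\<leftarrow>ds. d * \<phi> (inv t \<otimes> (inv s \<otimes> x)))"
      using translate_coversD(3)[OF ds, of "inv s \<otimes> x"] c s x
      by (intro mult_left_mono) (auto simp: cover_sum_def)
    also have "\<dots> = (\<Sum>(d,t)\<leftarrow>ds. c * d * \<phi> (inv (s \<otimes> t) \<otimes> x))"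
      unfolding sum_list_pair_const_mult[symmetric] using translate_coversD(2)[OF ds] s x
      by (intro sum_list_pair_cong) (simp add: inv_mult_group m_assoc mult.assoc)
    finally show "c * \<psi> (inv s \<otimes> x) \<le> (\<Sum>(d,t)\<leftarrow>ds. c * d * \<phi> (inv (s \<otimes> t) \<otimes> x))" .
  qed
  finally show "f x \<le> cover_sum \<phi> (compose_covers cs ds) x" by (simp add: cover_sum_compose)
qed

lemma covering_number_triangle:
  assumes f: "f \<in> Cc" and \<psi>: "\<psi> \<in> bumps_in W" and \<phi>: "\<phi> \<in> bumps_in V"
  shows "covering_number f \<phi> \<le> covering_number f \<psi> * covering_number \<psi> \<phi>"
proof -
  have \<psi>c: "\<psi> \<in> Cc" by (rule Cc_plus_imp_Cc[OF bumps_inD(1)[OF \<psi>]])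
  have "covering_number f \<phi> \<le> covering_number \<psi> \<phi> * cover_weight cs"
    if cs: "cs \<in> translate_covers f \<psi>" for cs
  proof -
    have "covering_number f \<phi> \<le> cover_weight cs * cover_weight ds"
      if "ds \<in> translate_covers \<psi> \<phi>" for ds
      using covering_number_le[OF compose_covers_mem[OF cs that]]
      by (simp add: cover_weight_compose)
    then have "covering_number f \<phi> \<le> cover_weight cs * covering_number \<psi> \<phi>"
      by (rule le_mult_covering_number[OF \<psi>c \<phi> cover_weight_nonneg[OF cs]])
    then show ?thesis by (simp add: mult.commute)
  qed
  then have "covering_number f \<phi> \<le> covering_number \<psi> \<phi> * covering_number f \<psi>"
    by (rule le_mult_covering_number[OF f \<psi> covering_number_nonneg[OF \<psi>c \<phi>]])
  then show ?thesis by (simp add: mult.commute)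
qed

lemma covering_number_pos:
  assumes f: "f \<in> Cc" and \<phi>: "\<phi> \<in> bumps_in V" and x: "x \<in> carrier L" "f x > 0"
  shows "covering_number f \<phi> > 0"
proof -
  obtain M where M: "M > 0" "\<And>x. x \<in> carrier L \<Longrightarrow> \<bar>\<phi> x\<bar> \<le> M"
    using Cc_bounded[OF Cc_plus_imp_Cc[OF bumps_inD(1)[OF \<phi>]]] by blast
  have "f x \<le> M * covering_number f \<phi>"
  proof (rule le_mult_covering_number[OF f \<phi> less_imp_le[OF M(1)]])
    fix cs assume cs: "cs \<in> translate_covers f \<phi>"
    have "f x \<le> (\<Sum>(c,s)\<leftarrow>cs. c * \<phi> (inv s \<otimes> x))"
      using translate_coversD(3)[OF cs x(1)] by (simp add: cover_sum_def)
    also have "\<dots> \<le> (\<Sum>(c,s)\<leftarrow>cs. M * c)"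
    proof (rule sum_list_pair_mono)
      fix c s assume "(c, s) \<in> set cs"
      then have "0 \<le> c" "\<phi> (inv s \<otimes> x) \<le> M"
        using translate_coversD(1,2)[OF cs] M(2)[of "inv s \<otimes> x"] x(1) by (auto simp: abs_le_iff)
      then show "c * \<phi> (inv s \<otimes> x) \<le> M * c" using mult_left_mono by (fastforce simp: mult.commute)
    qed
    also have "\<dots> = M * cover_weight cs"
      unfolding cover_weight_def by (rule sum_list_pair_const_mult)
    finally show "f x \<le> M * cover_weight cs" .
  qed
  then have "0 < M * covering_number f \<phi>" using x(2) by linarith
  then show ?thesis using M(1) by (simp add: zero_less_mult_iff)
qed

lemma covering_number_weighted_le:
  assumes \<phi>: "\<phi> \<in> bumps_in V" and cs: "cs \<in> translate_covers F \<phi>" and e: "0 \<le> e"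
    and h: "\<And>x. x \<in> carrier L \<Longrightarrow> 0 \<le> h x" "\<And>x. x \<in> carrier L \<Longrightarrow> f x \<le> h x * F x"
    and modulus: "\<And>x z. x \<in> carrier L \<Longrightarrow> z \<in> V \<Longrightarrow> \<bar>h (x \<otimes> z) - h x\<bar> < e"
  shows "covering_number f \<phi> \<le> (\<Sum>(c,s)\<leftarrow>cs. c * (h s + e))"
proof -
  let ?ds = "map (\<lambda>(c,s). (c * (h s + e), s)) cs"
  have "?ds \<in> translate_covers f \<phi>"
  proof (rule translate_coversI)
    show "set ?ds \<subseteq> {0..} \<times> carrier L"
      using translate_coversD(1,2)[OF cs] h(1) e
      by (force intro!: mult_nonneg_nonneg add_nonneg_nonneg)
    fix x assume x: "x \<in> carrier L"
    have "f x \<le> h x * F x" by (rule h(2)[OF x])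
    also have "\<dots> \<le> h x * (\<Sum>(c,s)\<leftarrow>cs. c * \<phi> (inv s \<otimes> x))"
      using translate_coversD(3)[OF cs x] h(1)[OF x]
      by (intro mult_left_mono) (auto simp: cover_sum_def)
    also have "\<dots> = (\<Sum>(c,s)\<leftarrow>cs. h x * (c * \<phi> (inv s \<otimes> x)))"
      by (rule sum_list_pair_const_mult[symmetric])
    also have "\<dots> \<le> (\<Sum>(c,s)\<leftarrow>cs. c * (h s + e) * \<phi> (inv s \<otimes> x))"
    proof (rule sum_list_pair_mono)
      fix c s assume "(c, s) \<in> set cs"
      then have c: "0 \<le> c" and s: "s \<in> carrier L" using translate_coversD(1,2)[OF cs] by auto
      have \<phi>0: "0 \<le> \<phi> (inv s \<otimes> x)" using s x by (intro Cc_plus_nonneg[OF bumps_inD(1)[OF \<phi>]]) auto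
      have "h x * (c * \<phi> (inv s \<otimes> x)) \<le> (h s + e) * (c * \<phi> (inv s \<otimes> x))"
      proof (cases "\<phi> (inv s \<otimes> x) = 0")
        case False
        then have "inv s \<otimes> x \<in> V" using bumps_inD(3)[OF \<phi>] s x by auto
        then have "h x \<le> h s + e" using modulus[of s "inv s \<otimes> x"] s x by auto
        then show ?thesis using c \<phi>0 by (intro mult_right_mono) auto
      qed simp
      then show "h x * (c * \<phi> (inv s \<otimes> x)) \<le> c * (h s + e) * \<phi> (inv s \<otimes> x)" by (simp add: mult_ac)
    qed
    finally show "f x \<le> cover_sum \<phi> ?ds x" by (simp add: cover_sum_def o_def case_prod_unfold)
  qed
  from covering_number_le[OF this] show ?thesis
    by (simp add: cover_weight_def o_def case_prod_unfold)
qed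

lemma covering_number_split_le:
  assumes \<phi>: "\<phi> \<in> bumps_in V" and F: "F \<in> Cc" and e: "0 \<le> e"
    and h: "\<And>x. x \<in> carrier L \<Longrightarrow> 0 \<le> h x" "\<And>x. x \<in> carrier L \<Longrightarrow> f x \<le> h x * F x"
      "\<And>x z. x \<in> carrier L \<Longrightarrow> z \<in> V \<Longrightarrow> \<bar>h (x \<otimes> z) - h x\<bar> < e"
    and k: "\<And>x. x \<in> carrier L \<Longrightarrow> 0 \<le> k x" "\<And>x. x \<in> carrier L \<Longrightarrow> g x \<le> k x * F x"
      "\<And>x z. x \<in> carrier L \<Longrightarrow> z \<in> V \<Longrightarrow> \<bar>k (x \<otimes> z) - k x\<bar> < e"
    and le_1: "\<And>x. x \<in> carrier L \<Longrightarrow> h x + k x \<le> 1"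
  shows "covering_number f \<phi> + covering_number g \<phi> \<le> (1 + 2 * e) * covering_number F \<phi>"
proof (rule le_mult_covering_number[OF F \<phi>])
  fix cs assume cs: "cs \<in> translate_covers F \<phi>"
  have "covering_number f \<phi> + covering_number g \<phi>
      \<le> (\<Sum>(c,s)\<leftarrow>cs. c * (h s + e)) + (\<Sum>(c,s)\<leftarrow>cs. c * (k s + e))"
    using covering_number_weighted_le[OF \<phi> cs e h] covering_number_weighted_le[OF \<phi> cs e k]
    by (rule add_mono)
  also have "\<dots> = (\<Sum>(c,s)\<leftarrow>cs. c * (h s + k s + 2 * e))"
    by (simp add: case_prod_unfold sum_list_addf[symmetric] algebra_simps)
  also have "\<dots> \<le> (\<Sum>(c,s)\<leftarrow>cs. (1 + 2 * e) * c)"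
  proof (rule sum_list_pair_mono)
    fix c s assume "(c, s) \<in> set cs"
    then have "0 \<le> c" "h s + k s \<le> 1" using translate_coversD(1,2)[OF cs] le_1 by auto
    then have "c * (h s + k s + 2 * e) \<le> c * (1 + 2 * e)" by (intro mult_left_mono) auto
    then show "c * (h s + k s + 2 * e) \<le> (1 + 2 * e) * c" by (simp add: mult.commute)
  qed
  also have "\<dots> = (1 + 2 * e) * cover_weight cs"
    unfolding cover_weight_def by (rule sum_list_pair_const_mult)
  finally show "covering_number f \<phi> + covering_number g \<phi> \<le> (1 + 2 * e) * cover_weight cs" .
qed (use e in simp)

lemma regularized_fraction:
  assumes f: "f \<in> Cc_plus" and g: "g \<in> Cc_plus" and e: "e > 0"
    and h: "\<And>x. x \<in> carrier L \<Longrightarrow> f x \<noteq> 0 \<Longrightarrow> 1 \<le> h x"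
  shows "(\<lambda>x. f x / (g x + e)) \<in> Cc_plus"
    and "x \<in> carrier L \<Longrightarrow> f x \<le> f x / (g x + e) * (g x + e * h x)"
proof -
  have pos: "g x + e > 0" if "x \<in> carrier L" for x
    using Cc_plus_nonneg[OF g that] e by simp
  have "continuous_map T euclideanreal (\<lambda>x. 1 / (g x + e))"
    using pos Cc_plus_continuous[OF g]
    by (intro continuous_map_real_divide continuous_map_add) (auto simp: less_imp_neq[symmetric])
  from Cc_mult_left[OF Cc_plus_imp_Cc[OF f] this] show "(\<lambda>x. f x / (g x + e)) \<in> Cc_plus"
    using Cc_plus_nonneg[OF f] pos by (intro Cc_plusI) (auto intro!: divide_nonneg_pos)
  assume x: "x \<in> carrier L"
  show "f x \<le> f x / (g x + e) * (g x + e * h x)"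
  proof (cases "f x = 0")
    case False
    have "f x = f x / (g x + e) * (g x + e)" using pos[OF x] by simp
    also have "\<dots> \<le> f x / (g x + e) * (g x + e * h x)"
      using h[OF x False] e Cc_plus_nonneg[OF f x] pos[OF x] by (intro mult_left_mono) auto
    finally show ?thesis .
  qed simp
qed

lemma covering_number_add_ge:
  assumes f: "f \<in> Cc_plus" and g: "g \<in> Cc_plus" and h: "h \<in> Cc_plus"
    and h_ge_1: "\<And>x. x \<in> carrier L \<Longrightarrow> f x \<noteq> 0 \<or> g x \<noteq> 0 \<Longrightarrow> 1 \<le> h x" and e: "e > 0"
  shows "\<exists>V. nhd_one V \<and> (\<forall>\<phi>\<in>bumps_in V. covering_number f \<phi> + covering_number g \<phi>
    \<le> (1 + 2 * e) * (covering_number (\<lambda>x. f x + g x) \<phi> + e * covering_number h \<phi>))"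
proof -
  let ?s = "\<lambda>x. f x + g x"
  define F where "F = (\<lambda>x. ?s x + e * h x)"
  define p where "p = (\<lambda>x. f x / (?s x + e))"
  define q where "q = (\<lambda>x. g x / (?s x + e))"
  note s_plus = Cc_plus_add[OF f g]
  have F: "F \<in> Cc" unfolding F_def
    by (intro Cc_plus_imp_Cc Cc_plus_add s_plus Cc_plus_scale h less_imp_le[OF e])
  have p: "p \<in> Cc_plus" "\<And>x. x \<in> carrier L \<Longrightarrow> f x \<le> p x * F x"
    unfolding p_def F_def using regularized_fraction[OF f s_plus e, of h] h_ge_1 by auto
  have q: "q \<in> Cc_plus" "\<And>x. x \<in> carrier L \<Longrightarrow> g x \<le> q x * F x"
    unfolding q_def F_def using regularized_fraction[OF g s_plus e, of h] h_ge_1 by auto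
  have pq: "p x + q x \<le> 1" if "x \<in> carrier L" for x
    using Cc_plus_nonneg[OF s_plus that] e
    by (simp add: p_def q_def add_divide_distrib[symmetric])
  obtain V where V: "nhd_one V" "\<And>x z. x \<in> carrier L \<Longrightarrow> z \<in> V \<Longrightarrow> \<bar>p (x \<otimes> z) - p x\<bar> < e"
    using Cc_right_modulus[OF Cc_plus_imp_Cc[OF p(1)] e] by blast
  obtain W where W: "nhd_one W" "\<And>x z. x \<in> carrier L \<Longrightarrow> z \<in> W \<Longrightarrow> \<bar>q (x \<otimes> z) - q x\<bar> < e"
    using Cc_right_modulus[OF Cc_plus_imp_Cc[OF q(1)] e] by blast
  have "covering_number f \<phi> + covering_number g \<phi>
      \<le> (1 + 2 * e) * (covering_number ?s \<phi> + e * covering_number h \<phi>)"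
    if \<phi>: "\<phi> \<in> bumps_in (V \<inter> W)" for \<phi>
  proof -
    have "covering_number f \<phi> + covering_number g \<phi> \<le> (1 + 2 * e) * covering_number F \<phi>"
      using V(2) W(2) e Cc_plus_nonneg[OF p(1)] Cc_plus_nonneg[OF q(1)]
      by (intro covering_number_split_le[OF \<phi> F _ _ p(2) _ _ q(2) _ pq]) auto
    also have "\<dots> \<le> (1 + 2 * e) * (covering_number ?s \<phi> + covering_number (\<lambda>x. e * h x) \<phi>)"
      unfolding F_def using e
      by (intro mult_left_mono covering_number_add_le[OF _ _ \<phi>] Cc_plus_imp_Cc s_plus
          Cc_plus_scale h) auto
    also have "covering_number (\<lambda>x. e * h x) \<phi> = e * covering_number h \<phi>"
      by (rule covering_number_scale[OF Cc_plus_imp_Cc[OF h] \<phi> e])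
    finally show ?thesis .
  qed
  then show ?thesis using nhd_one_Int[OF V(1) W(1)] by blast
qed

lemma covering_number_almost_superadditive:
  assumes f: "f \<in> Cc_plus" and g: "g \<in> Cc_plus"
  obtains h where "h \<in> Cc_plus"
    "\<And>e. e > 0 \<Longrightarrow> \<exists>V. nhd_one V \<and> (\<forall>\<phi>\<in>bumps_in V. covering_number f \<phi> + covering_number g \<phi>
        \<le> (1 + 2 * e) * (covering_number (\<lambda>x. f x + g x) \<phi> + e * covering_number h \<phi>))"
proof -
  obtain C where C: "compactin T C" "\<And>x. x \<in> carrier L \<Longrightarrow> x \<notin> C \<Longrightarrow> f x + g x = 0"
    using Cc_support[OF Cc_plus_imp_Cc[OF Cc_plus_add[OF f g]]] by blast
  obtain h where h: "h \<in> Cc_plus" "\<And>x. x \<in> C \<Longrightarrow> 1 \<le> h x"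
    using Cc_plus_ge_one_on_compact[OF C(1)] by blast
  have "1 \<le> h x" if "x \<in> carrier L" "f x \<noteq> 0 \<or> g x \<noteq> 0" for x
  proof -
    have "f x + g x \<noteq> 0"
      using that Cc_plus_nonneg[OF f that(1)] Cc_plus_nonneg[OF g that(1)] by linarith
    then show ?thesis using C(2)[OF that(1)] h(2) by blast
  qed
  then show ?thesis by (rule that[OF h(1) covering_number_add_ge[OF f g h(1)]])
qed

end

locale haar_integral = lc_group +
  fixes I :: "('a \<Rightarrow> real) \<Rightarrow> real"
  assumes I_add: "\<And>f g. f \<in> Cc \<Longrightarrow> g \<in> Cc \<Longrightarrow> I (\<lambda>x. f x + g x) = I f + I g"
    and I_scale: "\<And>f c. f \<in> Cc \<Longrightarrow> I (\<lambda>x. c * f x) = c * I f"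
    and I_nonneg: "\<And>f. f \<in> Cc_plus \<Longrightarrow> 0 \<le> I f"
    and I_left_translate: "\<And>f g. f \<in> Cc \<Longrightarrow> g \<in> carrier L \<Longrightarrow> I (\<lambda>x. f (inv g \<otimes> x)) = I f"
    and I_pos: "\<And>f x. f \<in> Cc_plus \<Longrightarrow> x \<in> carrier L \<Longrightarrow> f x > 0 \<Longrightarrow> I f > 0"

locale haar_limit = lc_group +
  fixes U :: "('a \<Rightarrow> real) filter" and f\<^sub>0 :: "'a \<Rightarrow> real"
  assumes ultra: "ultrafilter U"
    and shrinking: "\<And>V. nhd_one V \<Longrightarrow> eventually (\<lambda>\<phi>. \<phi> \<in> bumps_in V) U"
    and f\<^sub>0: "f\<^sub>0 \<in> bumps_in (carrier L)"
begin

definition haar_ratio :: "('a \<Rightarrow> real) \<Rightarrow> ('a \<Rightarrow> real) \<Rightarrow> real" where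
  "haar_ratio f \<phi> = covering_number f \<phi> / covering_number f\<^sub>0 \<phi>"

definition plus_integral :: "('a \<Rightarrow> real) \<Rightarrow> real" where
  "plus_integral f = Lim U (haar_ratio f)"

lemma U_not_bot: "U \<noteq> bot"
  by (rule ultrafilter_not_bot[OF ultra])

lemma eventually_bump: "eventually (\<lambda>\<phi>. \<phi> \<in> bumps_in (carrier L)) U"
  by (rule shrinking[OF nhd_one_univ])

lemma f\<^sub>0_Cc: "f\<^sub>0 \<in> Cc"
  by (rule Cc_plus_imp_Cc[OF bumps_inD(1)[OF f\<^sub>0]])

lemma covering_number_f\<^sub>0_pos: "\<phi> \<in> bumps_in V \<Longrightarrow> covering_number f\<^sub>0 \<phi> > 0"
  using covering_number_pos[OF f\<^sub>0_Cc _ one_closed] bumps_inD(2)[OF f\<^sub>0] by blast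

lemma haar_ratio_nonneg: "f \<in> Cc \<Longrightarrow> \<phi> \<in> bumps_in V \<Longrightarrow> 0 \<le> haar_ratio f \<phi>"
  using covering_number_nonneg[of f \<phi> V] covering_number_f\<^sub>0_pos[of \<phi> V]
  by (simp add: haar_ratio_def)

lemma haar_ratio_tendsto:
  assumes f: "f \<in> Cc_plus"
  shows "(haar_ratio f \<longlongrightarrow> plus_integral f) U"
proof -
  have fc: "f \<in> Cc" by (rule Cc_plus_imp_Cc[OF f])
  have "eventually (\<lambda>\<phi>. haar_ratio f \<phi> \<in> {0..covering_number f f\<^sub>0}) U"
    using eventually_bump
  proof eventually_elim
    case (elim \<phi>)
    then show ?case
      using covering_number_triangle[OF fc f\<^sub>0 elim] covering_number_f\<^sub>0_pos[OF elim]
        haar_ratio_nonneg[OF fc elim] by (simp add: haar_ratio_def field_simps)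
  qed
  then obtain l where "limitin euclideanreal (haar_ratio f) l U"
    using ultrafilter_compactin_limit[OF ultra, of euclideanreal "{0..covering_number f f\<^sub>0}"]
    by auto
  then show ?thesis
    using tendsto_Lim[OF U_not_bot, of "haar_ratio f" l] by (simp add: plus_integral_def)
qed

lemma plus_integral_eqI: "f \<in> Cc_plus \<Longrightarrow> (haar_ratio f \<longlongrightarrow> l) U \<Longrightarrow> plus_integral f = l"
  using tendsto_unique[OF U_not_bot haar_ratio_tendsto] by blast

lemma plus_integral_mono:
  assumes "f \<in> Cc_plus" "g \<in> Cc_plus" "\<And>x. x \<in> carrier L \<Longrightarrow> f x \<le> g x"
  shows "plus_integral f \<le> plus_integral g"
proof (rule tendsto_le[OF U_not_bot haar_ratio_tendsto[OF assms(2)] haar_ratio_tendsto[OF assms(1)]])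
  show "eventually (\<lambda>\<phi>. haar_ratio f \<phi> \<le> haar_ratio g \<phi>) U"
    using eventually_bump
  proof eventually_elim
    case (elim \<phi>)
    then show ?case
      using covering_number_mono[OF Cc_plus_imp_Cc[OF assms(2)] elim assms(3)]
        covering_number_f\<^sub>0_pos[OF elim] by (simp add: haar_ratio_def divide_right_mono)
  qed
qed

lemma plus_integral_nonneg:
  assumes "f \<in> Cc_plus"
  shows "0 \<le> plus_integral f"
proof (rule tendsto_lowerbound[OF haar_ratio_tendsto[OF assms] _ U_not_bot])
  show "eventually (\<lambda>\<phi>. 0 \<le> haar_ratio f \<phi>) U"
    using eventually_bump
    by eventually_elim (rule haar_ratio_nonneg[OF Cc_plus_imp_Cc[OF assms]])
qed

lemma plus_integral_add_le:
  assumes f: "f \<in> Cc_plus" and g: "g \<in> Cc_plus"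
  shows "plus_integral (\<lambda>x. f x + g x) \<le> plus_integral f + plus_integral g"
proof (rule tendsto_le[OF U_not_bot])
  show "((\<lambda>\<phi>. haar_ratio f \<phi> + haar_ratio g \<phi>) \<longlongrightarrow> plus_integral f + plus_integral g) U"
    by (intro tendsto_add haar_ratio_tendsto f g)
  show "(haar_ratio (\<lambda>x. f x + g x) \<longlongrightarrow> plus_integral (\<lambda>x. f x + g x)) U"
    by (intro haar_ratio_tendsto Cc_plus_add f g)
  show "eventually (\<lambda>\<phi>. haar_ratio (\<lambda>x. f x + g x) \<phi> \<le> haar_ratio f \<phi> + haar_ratio g \<phi>) U"
    using eventually_bump
  proof eventually_elim
    case (elim \<phi>)
    then show ?case
      using covering_number_add_le[OF Cc_plus_imp_Cc[OF f] Cc_plus_imp_Cc[OF g] elim]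
        covering_number_f\<^sub>0_pos[OF elim]
      by (simp add: haar_ratio_def add_divide_distrib[symmetric] divide_right_mono)
  qed
qed

lemma plus_integral_add_ge:
  assumes f: "f \<in> Cc_plus" and g: "g \<in> Cc_plus"
  shows "plus_integral f + plus_integral g \<le> plus_integral (\<lambda>x. f x + g x)"
proof -
  let ?s = "\<lambda>x. f x + g x"
  obtain h where h: "h \<in> Cc_plus"
    and super: "\<And>e. e > 0 \<Longrightarrow> \<exists>V. nhd_one V \<and> (\<forall>\<phi>\<in>bumps_in V. covering_number f \<phi> + covering_number g \<phi>
        \<le> (1 + 2 * e) * (covering_number ?s \<phi> + e * covering_number h \<phi>))"
    using covering_number_almost_superadditive[OF f g] by blast
  have almost_le: "plus_integral f + plus_integral g
      \<le> (1 + 2 * e) * (plus_integral ?s + e * plus_integral h)"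
    if e: "e > 0" for e
  proof (rule tendsto_le[OF U_not_bot])
    show "((\<lambda>\<phi>. (1 + 2 * e) * (haar_ratio ?s \<phi> + e * haar_ratio h \<phi>))
        \<longlongrightarrow> (1 + 2 * e) * (plus_integral ?s + e * plus_integral h)) U"
      by (intro tendsto_intros haar_ratio_tendsto Cc_plus_add f g h)
    show "((\<lambda>\<phi>. haar_ratio f \<phi> + haar_ratio g \<phi>) \<longlongrightarrow> plus_integral f + plus_integral g) U"
      by (intro tendsto_add haar_ratio_tendsto f g)
    obtain V where V: "nhd_one V"
      and super_V: "\<And>\<phi>. \<phi> \<in> bumps_in V \<Longrightarrow> covering_number f \<phi> + covering_number g \<phi>
        \<le> (1 + 2 * e) * (covering_number ?s \<phi> + e * covering_number h \<phi>)"
      using super[OF e] by blast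
    show "eventually (\<lambda>\<phi>. haar_ratio f \<phi> + haar_ratio g \<phi>
        \<le> (1 + 2 * e) * (haar_ratio ?s \<phi> + e * haar_ratio h \<phi>)) U"
      using shrinking[OF V]
    proof eventually_elim
      case (elim \<phi>)
      from divide_right_mono[OF super_V[OF elim] less_imp_le[OF covering_number_f\<^sub>0_pos[OF elim]]]
      show ?case by (simp add: haar_ratio_def flip: add_divide_distrib)
    qed
  qed
  have "((\<lambda>e::real. (1 + 2 * e) * (plus_integral ?s + e * plus_integral h))
      \<longlongrightarrow> (1 + 2 * 0) * (plus_integral ?s + 0 * plus_integral h)) (at_right 0)"
    by (intro tendsto_intros)
  moreover have "eventually (\<lambda>e. plus_integral f + plus_integral g
      \<le> (1 + 2 * e) * (plus_integral ?s + e * plus_integral h)) (at_right 0)"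
    using almost_le by (auto simp: eventually_at_filter)
  ultimately show ?thesis
    using tendsto_lowerbound[of _ _ "at_right (0::real)"] by fastforce
qed

lemma plus_integral_add:
  "f \<in> Cc_plus \<Longrightarrow> g \<in> Cc_plus \<Longrightarrow> plus_integral (\<lambda>x. f x + g x) = plus_integral f + plus_integral g"
  by (intro antisym plus_integral_add_le plus_integral_add_ge)

lemma plus_integral_zero: "plus_integral (\<lambda>x. 0) = 0"
  using plus_integral_add[OF Cc_plus_zero Cc_plus_zero] by simp

lemma plus_integral_scale:
  assumes f: "f \<in> Cc_plus" and c: "c \<ge> 0"
  shows "plus_integral (\<lambda>x. c * f x) = c * plus_integral f"
proof (cases "c = 0")
  case True
  then show ?thesis by (simp add: plus_integral_zero)
next
  case False
  show ?thesis
  proof (rule plus_integral_eqI[OF Cc_plus_scale[OF f c]])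
    have "((\<lambda>\<phi>. c * haar_ratio f \<phi>) \<longlongrightarrow> c * plus_integral f) U"
      by (intro tendsto_intros haar_ratio_tendsto f)
    moreover have "eventually (\<lambda>\<phi>. c * haar_ratio f \<phi> = haar_ratio (\<lambda>x. c * f x) \<phi>) U"
      using eventually_bump
    proof eventually_elim
      case (elim \<phi>)
      then show ?case
        using covering_number_scale[OF Cc_plus_imp_Cc[OF f] elim, of c] c False
        by (simp add: haar_ratio_def)
    qed
    ultimately show "(haar_ratio (\<lambda>x. c * f x) \<longlongrightarrow> c * plus_integral f) U"
      by (rule Lim_transform_eventually)
  qed
qed

lemma plus_integral_left_translate:
  assumes f: "f \<in> Cc_plus" and g: "g \<in> carrier L"
  shows "plus_integral (\<lambda>x. f (inv g \<otimes> x)) = plus_integral f"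
proof (rule plus_integral_eqI)
  show "(\<lambda>x. f (inv g \<otimes> x)) \<in> Cc_plus" using f g by (intro Cc_plus_left_translate) auto
  have "eventually (\<lambda>\<phi>. haar_ratio f \<phi> = haar_ratio (\<lambda>x. f (inv g \<otimes> x)) \<phi>) U"
    using eventually_bump
  proof eventually_elim
    case (elim \<phi>)
    then show ?case
      using covering_number_left_translate[OF Cc_plus_imp_Cc[OF f] elim g]
      by (simp add: haar_ratio_def)
  qed
  with haar_ratio_tendsto[OF f] show "(haar_ratio (\<lambda>x. f (inv g \<otimes> x)) \<longlongrightarrow> plus_integral f) U"
    by (rule Lim_transform_eventually)
qed

lemma plus_integral_pos:
  assumes f: "f \<in> Cc_plus" and x: "x \<in> carrier L" "f x > 0"
  shows "plus_integral f > 0"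
proof -
  let ?g = "\<lambda>y. f (inv (inv x) \<otimes> y)"
  have g: "?g \<in> bumps_in (carrier L)"
    using f x by (intro bumps_in_univI Cc_plus_left_translate) auto
  have pos: "covering_number f\<^sub>0 ?g > 0" by (rule covering_number_f\<^sub>0_pos[OF g])
  have "eventually (\<lambda>\<phi>. 1 / covering_number f\<^sub>0 ?g \<le> haar_ratio ?g \<phi>) U"
    using eventually_bump
  proof eventually_elim
    case (elim \<phi>)
    show ?case
      using covering_number_triangle[OF f\<^sub>0_Cc g elim] covering_number_f\<^sub>0_pos[OF elim] pos
      by (simp add: haar_ratio_def field_simps)
  qed
  then have "1 / covering_number f\<^sub>0 ?g \<le> plus_integral ?g"
    by (rule tendsto_lowerbound[OF haar_ratio_tendsto[OF bumps_inD(1)[OF g]] _ U_not_bot])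
  moreover have "0 < 1 / covering_number f\<^sub>0 ?g" using pos by simp
  moreover have "plus_integral ?g = plus_integral f"
    using plus_integral_left_translate[OF f, of "inv x"] x by simp
  ultimately show ?thesis by linarith
qed

definition signed_integral :: "('a \<Rightarrow> real) \<Rightarrow> real" where
  "signed_integral f = plus_integral (\<lambda>x. max 0 (f x)) - plus_integral (\<lambda>x. max 0 (- f x))"

lemma signed_integral_eq_diff:
  assumes f: "f \<in> Cc" and "a \<in> Cc_plus" "b \<in> Cc_plus"
    and eq: "\<And>x. x \<in> carrier L \<Longrightarrow> f x = a x - b x"
  shows "signed_integral f = plus_integral a - plus_integral b"
proof -
  note parts = Cc_plus_positive_part[OF f] Cc_plus_negative_part[OF f]
  have "plus_integral (\<lambda>x. max 0 (f x) + b x) = plus_integral (\<lambda>x. max 0 (- f x) + a x)"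
    using assms(2,3) parts by (intro antisym plus_integral_mono Cc_plus_add) (auto simp: eq)
  then show ?thesis
    using plus_integral_add parts assms(2,3) by (simp add: signed_integral_def)
qed

lemma signed_integral_eq_plus_integral: "f \<in> Cc_plus \<Longrightarrow> signed_integral f = plus_integral f"
  using signed_integral_eq_diff[OF Cc_plus_imp_Cc _ Cc_plus_zero] by (simp add: plus_integral_zero)

lemma signed_integral_add:
  assumes f: "f \<in> Cc" and g: "g \<in> Cc"
  shows "signed_integral (\<lambda>x. f x + g x) = signed_integral f + signed_integral g"
proof -
  note pos = Cc_plus_positive_part[OF f] Cc_plus_positive_part[OF g]
  note neg = Cc_plus_negative_part[OF f] Cc_plus_negative_part[OF g]
  have "signed_integral (\<lambda>x. f x + g x) = plus_integral (\<lambda>x. max 0 (f x) + max 0 (g x))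
      - plus_integral (\<lambda>x. max 0 (- f x) + max 0 (- g x))"
    using f g pos neg by (intro signed_integral_eq_diff Cc_add Cc_plus_add) auto
  then show ?thesis
    using plus_integral_add[OF pos] plus_integral_add[OF neg] by (simp add: signed_integral_def)
qed

lemma signed_integral_scale:
  assumes f: "f \<in> Cc"
  shows "signed_integral (\<lambda>x. c * f x) = c * signed_integral f"
proof (cases "c \<ge> 0")
  case True
  note parts = Cc_plus_positive_part[OF f] Cc_plus_negative_part[OF f]
  have "signed_integral (\<lambda>x. c * f x)
      = plus_integral (\<lambda>x. c * max 0 (f x)) - plus_integral (\<lambda>x. c * max 0 (- f x))"
    using True
    by (intro signed_integral_eq_diff Cc_scale f Cc_plus_scale parts) (auto simp: max_def)
  then show ?thesis
    using plus_integral_scale[OF parts(1) True] plus_integral_scale[OF parts(2) True]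
    by (simp add: signed_integral_def right_diff_distrib)
next
  case False
  then have c: "- c \<ge> 0" by simp
  note parts = Cc_plus_positive_part[OF f] Cc_plus_negative_part[OF f]
  have "signed_integral (\<lambda>x. c * f x)
      = plus_integral (\<lambda>x. - c * max 0 (- f x)) - plus_integral (\<lambda>x. - c * max 0 (f x))"
    using c by (intro signed_integral_eq_diff Cc_scale f Cc_plus_scale parts) (auto simp: max_def)
  then show ?thesis
    using plus_integral_scale[OF parts(1) c] plus_integral_scale[OF parts(2) c]
    by (simp add: signed_integral_def right_diff_distrib)
qed

lemma signed_integral_left_translate:
  assumes f: "f \<in> Cc" and g: "g \<in> carrier L"
  shows "signed_integral (\<lambda>x. f (inv g \<otimes> x)) = signed_integral f"
  using plus_integral_left_translate[OF Cc_plus_positive_part[OF f] g]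
    plus_integral_left_translate[OF Cc_plus_negative_part[OF f] g]
  by (simp add: signed_integral_def)

lemma haar_integral_signed_integral: "haar_integral L T signed_integral"
  by unfold_locales (auto simp: signed_integral_add signed_integral_scale
      signed_integral_left_translate signed_integral_eq_plus_integral
      plus_integral_nonneg intro: plus_integral_pos)

end

context lc_group
begin

lemma ultrafilter_of_nhd_one_family:
  assumes ne: "\<And>V. nhd_one V \<Longrightarrow> A V \<noteq> {}" and mono: "\<And>V W. V \<subseteq> W \<Longrightarrow> A V \<subseteq> A W"
  obtains U where "ultrafilter U" "\<And>V. nhd_one V \<Longrightarrow> eventually (\<lambda>i. i \<in> A V) U"
proof (rule ultrafilter_exists_base[of "A ` {V. nhd_one V}"])
  show "A ` {V. nhd_one V} \<noteq> {}" using nhd_one_univ by auto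
  show "\<exists>D\<in>A ` {V. nhd_one V}. D \<subseteq> B \<inter> C"
    if "B \<in> A ` {V. nhd_one V}" "C \<in> A ` {V. nhd_one V}" for B C
  proof -
    obtain V W where "nhd_one V" "B = A V" "nhd_one W" "C = A W" using \<open>B \<in> _\<close> \<open>C \<in> _\<close> by auto
    moreover have "A (V \<inter> W) \<subseteq> A V \<inter> A W" using mono by auto
    ultimately show ?thesis using nhd_one_Int by blast
  qed
qed (use ne that in auto)

lemma haar_integral_exists:
  obtains I where "haar_integral L T I"
proof -
  have ne: "bumps_in V \<noteq> {}" if "nhd_one V" for V
    using normalized_bump_exists[OF that] by blast
  obtain U where U: "ultrafilter U" "\<And>V. nhd_one V \<Longrightarrow> eventually (\<lambda>\<phi>. \<phi> \<in> bumps_in V) U"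
    using ultrafilter_of_nhd_one_family[of bumps_in, OF ne bumps_in_mono] by blast
  obtain f\<^sub>0 where "f\<^sub>0 \<in> bumps_in (carrier L)" using ne[OF nhd_one_univ] by blast
  then interpret haar_limit L T U f\<^sub>0 using U by unfold_locales
  show ?thesis by (rule that[OF haar_integral_signed_integral])
qed

end

context haar_integral
begin

lemma I_zero: "I (\<lambda>x. 0) = 0"
  using I_scale[OF Cc_zero, of 0] by simp

lemma I_diff: "f \<in> Cc \<Longrightarrow> g \<in> Cc \<Longrightarrow> I (\<lambda>x. f x - g x) = I f - I g"
  using I_add[of f "\<lambda>x. (-1) * g x"] I_scale[of g "-1"] Cc_scale[of g "-1"] by simp

lemma I_sum: "finite S \<Longrightarrow> (\<And>s. s \<in> S \<Longrightarrow> f s \<in> Cc) \<Longrightarrow> I (\<lambda>x. \<Sum>s\<in>S. f s x) = (\<Sum>s\<in>S. I (f s))"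
proof (induction S rule: finite_induct)
  case empty
  then show ?case by (simp add: I_zero)
next
  case (insert s S)
  then show ?case using I_add[of "f s" "\<lambda>x. \<Sum>s\<in>S. f s x"] Cc_sum[of S f] by auto
qed

lemma I_mono:
  assumes "f \<in> Cc" "g \<in> Cc" "\<And>x. x \<in> carrier L \<Longrightarrow> f x \<le> g x"
  shows "I f \<le> I g"
proof -
  have "0 \<le> I (\<lambda>x. g x - f x)" using assms by (intro I_nonneg Cc_plusI Cc_diff) auto
  then show ?thesis using I_diff[OF assms(2,1)] by simp
qed

lemma I_cong:
  assumes "f \<in> Cc" "g \<in> Cc" "\<And>x. x \<in> carrier L \<Longrightarrow> f x = g x"
  shows "I f = I g"
  using assms by (intro antisym I_mono) auto

lemma I_abs_nonneg: "f \<in> Cc \<Longrightarrow> 0 \<le> I (\<lambda>x. \<bar>f x\<bar>)"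
  by (intro I_nonneg Cc_plusI Cc_abs) auto

lemma I_abs_le:
  assumes "f \<in> Cc" "g \<in> Cc" "\<And>x. x \<in> carrier L \<Longrightarrow> \<bar>f x\<bar> \<le> g x"
  shows "\<bar>I f\<bar> \<le> I g"
proof -
  have "I f \<le> I g" using assms by (intro I_mono) (auto simp: abs_le_iff)
  moreover have "I (\<lambda>x. (-1) * f x) \<le> I g"
    using assms by (intro I_mono Cc_scale) (auto simp: abs_le_iff)
  ultimately show ?thesis using I_scale[OF assms(1), of "-1"] by simp
qed

lemma I_mult_abs_le:
  assumes a: "a \<in> Cc" and b: "continuous_map T euclideanreal b" and \<Theta>: "\<Theta> \<in> Cc" and \<beta>: "0 \<le> \<beta>"
    and a_le: "\<And>y. y \<in> carrier L \<Longrightarrow> \<bar>a y\<bar> \<le> \<Theta> y"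
    and b_le: "\<And>y. y \<in> carrier L \<Longrightarrow> a y \<noteq> 0 \<Longrightarrow> \<bar>b y\<bar> \<le> \<beta>"
  shows "\<bar>I (\<lambda>y. a y * b y)\<bar> \<le> \<beta> * I \<Theta>"
proof -
  have "\<bar>I (\<lambda>y. a y * b y)\<bar> \<le> I (\<lambda>y. \<beta> * \<Theta> y)"
  proof (rule I_abs_le[OF Cc_mult_left[OF a b] Cc_scale[OF \<Theta>]])
    fix y assume y: "y \<in> carrier L"
    have \<Theta>y: "0 \<le> \<Theta> y" using a_le[OF y] by linarith
    show "\<bar>a y * b y\<bar> \<le> \<beta> * \<Theta> y"
    proof (cases "a y = 0")
      case True
      then show ?thesis using \<Theta>y \<beta> by simp
    next
      case False
      then have "\<bar>a y\<bar> * \<bar>b y\<bar> \<le> \<Theta> y * \<beta>"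
        using a_le[OF y] b_le[OF y] \<Theta>y by (intro mult_mono) auto
      then show ?thesis by (simp add: abs_mult mult.commute)
    qed
  qed
  then show ?thesis by (simp add: I_scale[OF \<Theta>])
qed

lemma I_mult_diff_abs_le:
  assumes a: "a \<in> Cc" and b: "continuous_map T euclideanreal b" "continuous_map T euclideanreal b'"
    and "\<Theta> \<in> Cc" "0 \<le> \<beta>" "\<And>y. y \<in> carrier L \<Longrightarrow> \<bar>a y\<bar> \<le> \<Theta> y"
    and "\<And>y. y \<in> carrier L \<Longrightarrow> a y \<noteq> 0 \<Longrightarrow> \<bar>b y - b' y\<bar> \<le> \<beta>"
  shows "\<bar>I (\<lambda>y. a y * b y) - I (\<lambda>y. a y * b' y)\<bar> \<le> \<beta> * I \<Theta>"
proof -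
  have "I (\<lambda>y. a y * b y) - I (\<lambda>y. a y * b' y) = I (\<lambda>y. a y * (b y - b' y))"
    using I_diff[OF Cc_mult_left[OF a b(1)] Cc_mult_left[OF a b(2)]]
    by (simp add: right_diff_distrib)
  also have "\<bar>\<dots>\<bar> \<le> \<beta> * I \<Theta>" using assms by (intro I_mult_abs_le continuous_map_diff)
  finally show ?thesis .
qed

text \<open>Only the Haar functional is available, not a product measure, so Fubini's theorem is replaced
  by the exchange of integrals for kernels that are uniform limits of sums of products.\<close>

lemma I_mult_sum:
  assumes "finite S" and u: "u \<in> Cc" and "\<And>s. s \<in> S \<Longrightarrow> continuous_map T euclideanreal (a s)"
  shows "I (\<lambda>y. u y * (\<Sum>s\<in>S. a s y * c s)) = (\<Sum>s\<in>S. I (\<lambda>y. u y * a s y) * c s)"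
proof -
  have Cc: "(\<lambda>y. u y * a s y) \<in> Cc" if "s \<in> S" for s using assms that by (intro Cc_mult_left)
  have "I (\<lambda>y. u y * (\<Sum>s\<in>S. a s y * c s)) = I (\<lambda>y. \<Sum>s\<in>S. c s * (u y * a s y))"
    by (simp add: sum_distrib_left mult_ac)
  also have "\<dots> = (\<Sum>s\<in>S. I (\<lambda>y. c s * (u y * a s y)))"
    using assms(1) Cc by (intro I_sum Cc_scale)
  also have "\<dots> = (\<Sum>s\<in>S. I (\<lambda>y. u y * a s y) * c s)"
    using I_scale[OF Cc] by (simp add: mult.commute)
  finally show ?thesis .
qed

lemma I_swap_separable:
  assumes S: "finite S" and u: "u \<in> Cc" and v: "v \<in> Cc"
    and a: "\<And>s. s \<in> S \<Longrightarrow> continuous_map T euclideanreal (a s)"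
    and b: "\<And>s. s \<in> S \<Longrightarrow> continuous_map T euclideanreal (b s)"
  shows "I (\<lambda>x. v x * I (\<lambda>y. u y * (\<Sum>s\<in>S. a s y * b s x))) =
    I (\<lambda>y. u y * I (\<lambda>x. v x * (\<Sum>s\<in>S. a s y * b s x)))"
proof -
  have "I (\<lambda>x. v x * I (\<lambda>y. u y * (\<Sum>s\<in>S. a s y * b s x))) =
      I (\<lambda>x. v x * (\<Sum>s\<in>S. b s x * I (\<lambda>y. u y * a s y)))"
    by (simp add: I_mult_sum[OF S u a] mult.commute)
  also have "\<dots> = (\<Sum>s\<in>S. I (\<lambda>x. v x * b s x) * I (\<lambda>y. u y * a s y))"
    by (rule I_mult_sum[OF S v b])
  also have "\<dots> = (\<Sum>s\<in>S. I (\<lambda>y. u y * a s y) * I (\<lambda>x. v x * b s x))"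
    by (simp add: mult.commute)
  also have "\<dots> = I (\<lambda>y. u y * (\<Sum>s\<in>S. a s y * I (\<lambda>x. v x * b s x)))"
    by (rule I_mult_sum[OF S u a, symmetric])
  also have "(\<lambda>y. \<Sum>s\<in>S. a s y * I (\<lambda>x. v x * b s x)) = (\<lambda>y. I (\<lambda>x. v x * (\<Sum>s\<in>S. a s y * b s x)))"
    using I_mult_sum[OF S v b] by (simp add: mult.commute)
  finally show ?thesis .
qed

lemma iterated_integral_approx:
  assumes u: "u \<in> Cc" and v: "v \<in> Cc" and e: "0 \<le> e"
    and k: "\<And>x. x \<in> carrier L \<Longrightarrow> continuous_map T euclideanreal (k x)"
      "continuous_map T euclideanreal (\<lambda>x. I (\<lambda>y. u y * k x y))"
    and k': "\<And>x. x \<in> carrier L \<Longrightarrow> continuous_map T euclideanreal (k' x)"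
      "continuous_map T euclideanreal (\<lambda>x. I (\<lambda>y. u y * k' x y))"
    and close: "\<And>x y. x \<in> carrier L \<Longrightarrow> y \<in> carrier L \<Longrightarrow> \<bar>k x y - k' x y\<bar> \<le> e"
  shows "\<bar>I (\<lambda>x. v x * I (\<lambda>y. u y * k x y)) - I (\<lambda>x. v x * I (\<lambda>y. u y * k' x y))\<bar>
    \<le> e * I (\<lambda>x. \<bar>u x\<bar>) * I (\<lambda>x. \<bar>v x\<bar>)"
proof (rule I_mult_diff_abs_le[OF v k(2) k'(2) Cc_abs[OF v]])
  show "\<bar>I (\<lambda>y. u y * k x y) - I (\<lambda>y. u y * k' x y)\<bar> \<le> e * I (\<lambda>x. \<bar>u x\<bar>)"
    if x: "x \<in> carrier L" for x
    using close[OF x] e by (intro I_mult_diff_abs_le[OF u k(1)[OF x] k'(1)[OF x] Cc_abs[OF u]]) auto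
qed (use e I_abs_nonneg[OF u] in auto)

definition convolution :: "('a \<Rightarrow> real) \<Rightarrow> ('a \<Rightarrow> real) \<Rightarrow> 'a \<Rightarrow> real" where
  "convolution a b x = I (\<lambda>y. a y * b (inv y \<otimes> x))"

lemma continuous_map_inv_translate:
  "continuous_map T euclideanreal b \<Longrightarrow> x \<in> carrier L \<Longrightarrow>
    continuous_map T euclideanreal (\<lambda>y. b (inv y \<otimes> x))"
  using continuous_map_real_compose[OF _ continuous_map_mult[OF cont_inv continuous_map_const_carrier]]
  by blast

lemma convolution_integrand_Cc:
  "a \<in> Cc \<Longrightarrow> b \<in> Cc \<Longrightarrow> x \<in> carrier L \<Longrightarrow> (\<lambda>y. a y * b (inv y \<otimes> x)) \<in> Cc"
  by (intro Cc_mult_left continuous_map_inv_translate Cc_continuous)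

lemma convolution_cong:
  assumes "a \<in> Cc" "a' \<in> Cc" "b \<in> Cc" "x \<in> carrier L" "\<And>y. y \<in> carrier L \<Longrightarrow> a y = a' y"
  shows "convolution a b x = convolution a' b x"
  unfolding convolution_def using assms by (intro I_cong convolution_integrand_Cc) auto

lemma convolution_left_translate:
  assumes "a \<in> Cc" "b \<in> Cc" "x \<in> carrier L" "g \<in> carrier L"
  shows "convolution a b (inv g \<otimes> x) = convolution (\<lambda>y. a (inv g \<otimes> y)) b x"
proof -
  let ?f = "\<lambda>y. a y * b (inv y \<otimes> (inv g \<otimes> x))"
  have f: "?f \<in> Cc" using assms by (intro convolution_integrand_Cc) auto
  have "convolution a b (inv g \<otimes> x) = I (\<lambda>y. ?f (inv g \<otimes> y))"
    using I_left_translate[OF f assms(4)] by (simp add: convolution_def)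
  also have "\<dots> = I (\<lambda>y. a (inv g \<otimes> y) * b (inv y \<otimes> x))"
  proof (rule I_cong)
    show "(\<lambda>y. ?f (inv g \<otimes> y)) \<in> Cc" using Cc_left_translate[OF f, of "inv g"] assms by simp
    show "(\<lambda>y. a (inv g \<otimes> y) * b (inv y \<otimes> x)) \<in> Cc"
      using assms by (intro convolution_integrand_Cc Cc_left_translate) auto
    show "?f (inv g \<otimes> y) = a (inv g \<otimes> y) * b (inv y \<otimes> x)" if "y \<in> carrier L" for y
      using that assms by (simp add: inv_mult_group m_assoc)
  qed
  finally show ?thesis by (simp add: convolution_def)
qed

lemma convolution_diff_left:
  assumes "a \<in> Cc" "a' \<in> Cc" "b \<in> Cc" "x \<in> carrier L"
  shows "convolution (\<lambda>y. a y - a' y) b x = convolution a b x - convolution a' b x"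
  using I_diff[OF convolution_integrand_Cc[OF assms(1,3,4)] convolution_integrand_Cc[OF assms(2,3,4)]]
  by (simp add: convolution_def left_diff_distrib)

lemma convolution_diff_abs_le:
  assumes a: "a \<in> Cc" and b: "b \<in> Cc" and x: "x \<in> carrier L" "x' \<in> carrier L"
    and "\<Theta> \<in> Cc" "0 \<le> \<beta>" "\<And>y. y \<in> carrier L \<Longrightarrow> \<bar>a y\<bar> \<le> \<Theta> y"
    and "\<And>y. y \<in> carrier L \<Longrightarrow> a y \<noteq> 0 \<Longrightarrow> \<bar>b (inv y \<otimes> x') - b (inv y \<otimes> x)\<bar> \<le> \<beta>"
  shows "\<bar>convolution a b x' - convolution a b x\<bar> \<le> \<beta> * I \<Theta>"
  unfolding convolution_def
  using assms by (intro I_mult_diff_abs_le continuous_map_inv_translate Cc_continuous[OF b])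

lemma convolution_left_translate_diff_abs_le:
  assumes a: "a \<in> Cc" and b: "b \<in> Cc" and h: "h \<in> carrier L" and x: "x \<in> carrier L"
    and \<Theta>: "\<Theta> \<in> Cc" "0 \<le> \<beta>" "\<And>y. y \<in> carrier L \<Longrightarrow> \<bar>a y\<bar> \<le> \<Theta> y"
    and osc: "\<And>y z. y \<in> carrier L \<Longrightarrow> a y \<noteq> 0 \<Longrightarrow> z \<in> carrier L \<Longrightarrow>
      \<bar>b (inv y \<otimes> inv h \<otimes> y \<otimes> z) - b z\<bar> \<le> \<beta>"
  shows "\<bar>convolution a b (inv h \<otimes> x) - convolution a b x\<bar> \<le> \<beta> * I \<Theta>"
proof (rule convolution_diff_abs_le[OF a b x _ \<Theta>])
  show "\<bar>b (inv y \<otimes> (inv h \<otimes> x)) - b (inv y \<otimes> x)\<bar> \<le> \<beta>" if "y \<in> carrier L" "a y \<noteq> 0" for y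
    using osc[OF that, of "inv y \<otimes> x"] that h x by (simp add: m_assoc)
qed (use h x in auto)

lemma continuous_map_convolution:
  assumes a: "a \<in> Cc" and b: "b \<in> Cc"
  shows "continuous_map T euclideanreal (convolution a b)"
proof (rule continuous_map_of_right_modulus)
  fix e :: real assume e: "e > 0"
  let ?d = "e / (I (\<lambda>y. \<bar>a y\<bar>) + 1)"
  have Ia: "0 \<le> I (\<lambda>y. \<bar>a y\<bar>)" by (rule I_abs_nonneg[OF a])
  have d: "?d > 0" using e Ia by auto
  obtain V where V: "nhd_one V" "\<And>x z. x \<in> carrier L \<Longrightarrow> z \<in> V \<Longrightarrow> \<bar>b (x \<otimes> z) - b x\<bar> < ?d"
    using Cc_right_modulus[OF b d] by blast
  have "\<bar>convolution a b (x \<otimes> z) - convolution a b x\<bar> < e"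
    if x: "x \<in> carrier L" and z: "z \<in> V" for x z
  proof -
    have zL: "z \<in> carrier L" by (rule nhd_one_mem_carrier[OF V(1) z])
    have "\<bar>b (inv y \<otimes> (x \<otimes> z)) - b (inv y \<otimes> x)\<bar> \<le> ?d" if "y \<in> carrier L" for y
      using V(2)[of "inv y \<otimes> x" z] that x z zL by (simp add: m_assoc less_imp_le)
    then have "\<bar>convolution a b (x \<otimes> z) - convolution a b x\<bar> \<le> ?d * I (\<lambda>y. \<bar>a y\<bar>)"
      using x zL d by (intro convolution_diff_abs_le[OF a b _ _ Cc_abs[OF a]]) auto
    also have "\<dots> < e" using e Ia by (simp add: field_simps)
    finally show ?thesis .
  qed
  then show "\<exists>V. nhd_one V \<and>
      (\<forall>x\<in>carrier L. \<forall>z\<in>V. \<bar>convolution a b (x \<otimes> z) - convolution a b x\<bar> < e)"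
    using V(1) by blast
qed

lemma convolution_eq_0:
  assumes "\<And>y. y \<in> carrier L \<Longrightarrow> a y * b (inv y \<otimes> x) = 0" "a \<in> Cc" "b \<in> Cc" "x \<in> carrier L"
  shows "convolution a b x = 0"
  using I_cong[OF convolution_integrand_Cc[OF assms(2-4)] Cc_zero assms(1)]
  by (simp add: convolution_def I_zero)

lemma convolution_Cc:
  assumes a: "a \<in> Cc" and b: "b \<in> Cc"
  shows "convolution a b \<in> Cc"
proof -
  obtain C where C: "compactin T C" "\<And>x. x \<in> carrier L \<Longrightarrow> x \<notin> C \<Longrightarrow> a x = 0"
    using Cc_support[OF a] by blast
  obtain D where D: "compactin T D" "\<And>x. x \<in> carrier L \<Longrightarrow> x \<notin> D \<Longrightarrow> b x = 0"
    using Cc_support[OF b] by blast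
  show ?thesis
  proof (rule CcI[OF continuous_map_convolution[OF a b] compactin_set_mult[OF C(1) D(1)]])
    fix x assume x: "x \<in> carrier L" "x \<notin> C <#> D"
    show "convolution a b x = 0"
    proof (rule convolution_eq_0[OF _ a b x(1)])
      fix y assume y: "y \<in> carrier L"
      have "y \<notin> C \<or> inv y \<otimes> x \<notin> D"
        using x y mult_inv_cancel_left[OF y x(1)] unfolding set_mult_def by fastforce
      then show "a y * b (inv y \<otimes> x) = 0" using C(2) D(2) x y by auto
    qed
  qed
qed

definition inner_L2 :: "('a \<Rightarrow> real) \<Rightarrow> ('a \<Rightarrow> real) \<Rightarrow> real" where
  "inner_L2 u v = I (\<lambda>x. u x * v x)"

definition norm_L2 :: "('a \<Rightarrow> real) \<Rightarrow> real" where
  "norm_L2 u = sqrt (inner_L2 u u)"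

lemma inner_L2_commute: "inner_L2 u v = inner_L2 v u"
  by (simp add: inner_L2_def mult.commute)

lemma inner_L2_diff_left:
  "u \<in> Cc \<Longrightarrow> v \<in> Cc \<Longrightarrow> w \<in> Cc \<Longrightarrow> inner_L2 (\<lambda>x. u x - v x) w = inner_L2 u w - inner_L2 v w"
  using I_diff[OF Cc_mult[of u w] Cc_mult[of v w]] by (simp add: inner_L2_def left_diff_distrib)

lemma inner_L2_diff_right:
  "u \<in> Cc \<Longrightarrow> v \<in> Cc \<Longrightarrow> w \<in> Cc \<Longrightarrow> inner_L2 w (\<lambda>x. u x - v x) = inner_L2 w u - inner_L2 w v"
  by (simp add: inner_L2_commute[of w] inner_L2_diff_left)

lemma inner_L2_scale_left:
  "u \<in> Cc \<Longrightarrow> w \<in> Cc \<Longrightarrow> inner_L2 (\<lambda>x. c * u x) w = c * inner_L2 u w"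
  using I_scale[OF Cc_mult[of u w], of c] by (simp add: inner_L2_def mult.assoc)

lemma inner_L2_scale_right:
  "u \<in> Cc \<Longrightarrow> w \<in> Cc \<Longrightarrow> inner_L2 w (\<lambda>x. c * u x) = c * inner_L2 w u"
  by (simp add: inner_L2_commute[of w] inner_L2_scale_left)

lemma inner_L2_cong:
  assumes "u \<in> Cc" "v \<in> Cc" "u' \<in> Cc" "v' \<in> Cc"
    and "\<And>x. x \<in> carrier L \<Longrightarrow> u x = u' x" "\<And>x. x \<in> carrier L \<Longrightarrow> v x = v' x"
  shows "inner_L2 u v = inner_L2 u' v'"
  unfolding inner_L2_def using assms by (intro I_cong Cc_mult) auto

lemma inner_L2_self_nonneg: "u \<in> Cc \<Longrightarrow> 0 \<le> inner_L2 u u"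
  unfolding inner_L2_def by (intro I_nonneg Cc_plusI Cc_mult) auto

lemma norm_L2_nonneg: "u \<in> Cc \<Longrightarrow> 0 \<le> norm_L2 u"
  by (simp add: norm_L2_def inner_L2_self_nonneg)

lemma norm_L2_squared: "u \<in> Cc \<Longrightarrow> (norm_L2 u)\<^sup>2 = inner_L2 u u"
  by (simp add: norm_L2_def inner_L2_self_nonneg)

lemma norm_L2_pos:
  assumes "u \<in> Cc" "x \<in> carrier L" "u x \<noteq> 0"
  shows "norm_L2 u > 0"
proof -
  have "inner_L2 u u > 0"
    unfolding inner_L2_def using assms
    by (intro I_pos[of _ x] Cc_plusI Cc_mult) (auto simp: zero_less_mult_iff)
  then show ?thesis by (simp add: norm_L2_def)
qed

lemma norm_L2_scale:
  assumes "u \<in> Cc"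
  shows "norm_L2 (\<lambda>x. c * u x) = \<bar>c\<bar> * norm_L2 u"
proof -
  have "inner_L2 (\<lambda>x. c * u x) (\<lambda>x. c * u x) = c\<^sup>2 * inner_L2 u u"
    using assms by (simp add: inner_L2_scale_left inner_L2_scale_right Cc_scale power2_eq_square)
  then show ?thesis by (simp add: norm_L2_def real_sqrt_mult)
qed

lemma norm_L2_minus: "u \<in> Cc \<Longrightarrow> norm_L2 (\<lambda>x. - u x) = norm_L2 u"
  using norm_L2_scale[of u "-1"] by simp

end

lemma quadratic_nonneg_imp_square_le:
  fixes p q c :: real
  assumes nonneg: "\<And>t. 0 \<le> p - 2 * t * c + t\<^sup>2 * q" and "0 \<le> q"
  shows "c\<^sup>2 \<le> p * q"
proof (cases "q = 0")
  case True
  have "c = 0"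
  proof (rule ccontr)
    assume "c \<noteq> 0"
    then show False using nonneg[of "(p + 1) / (2 * c)"] True by simp
  qed
  then show ?thesis using True by simp
next
  case False
  then have "q > 0" using \<open>0 \<le> q\<close> by simp
  moreover have "p - 2 * (c / q) * c + (c / q)\<^sup>2 * q = p - c\<^sup>2 / q"
    using False by (simp add: power2_eq_square)
  then have "0 \<le> p - c\<^sup>2 / q" using nonneg[of "c / q"] by simp
  ultimately show ?thesis by (simp add: field_simps)
qed

context haar_integral
begin

lemma inner_L2_le_norm_L2:
  assumes u: "u \<in> Cc" and v: "v \<in> Cc"
  shows "inner_L2 u v \<le> norm_L2 u * norm_L2 v"
proof (rule power2_le_imp_le)
  have "0 \<le> inner_L2 u u - 2 * t * inner_L2 u v + t\<^sup>2 * inner_L2 v v" for t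
  proof -
    have "0 \<le> inner_L2 (\<lambda>x. u x - t * v x) (\<lambda>x. u x - t * v x)"
      using u v by (intro inner_L2_self_nonneg Cc_diff Cc_scale)
    also have "\<dots> = inner_L2 u u - 2 * t * inner_L2 u v + t\<^sup>2 * inner_L2 v v"
      using u v inner_L2_commute[of v u]
      by (simp add: inner_L2_diff_left inner_L2_diff_right inner_L2_scale_left
          inner_L2_scale_right Cc_scale Cc_diff power2_eq_square algebra_simps)
    finally show ?thesis .
  qed
  then have "(inner_L2 u v)\<^sup>2 \<le> inner_L2 u u * inner_L2 v v"
    by (rule quadratic_nonneg_imp_square_le[OF _ inner_L2_self_nonneg[OF v]])
  then show "(inner_L2 u v)\<^sup>2 \<le> (norm_L2 u * norm_L2 v)\<^sup>2"
    using u v by (simp add: power_mult_distrib norm_L2_squared)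
qed (intro mult_nonneg_nonneg norm_L2_nonneg u v)

lemma norm_L2_diff_le:
  assumes u: "u \<in> Cc" and v: "v \<in> Cc"
  shows "norm_L2 (\<lambda>x. u x - v x) \<le> norm_L2 u + norm_L2 v"
proof (rule power2_le_imp_le)
  have "- inner_L2 u v \<le> norm_L2 u * norm_L2 v"
    using inner_L2_le_norm_L2[OF u Cc_minus[OF v]] inner_L2_scale_right[OF v u, of "-1"] v
    by (simp add: norm_L2_minus)
  moreover have "(norm_L2 (\<lambda>x. u x - v x))\<^sup>2 = inner_L2 u u - 2 * inner_L2 u v + inner_L2 v v"
    using u v inner_L2_commute[of v u]
    by (simp add: norm_L2_squared Cc_diff inner_L2_diff_left inner_L2_diff_right)
  ultimately show "(norm_L2 (\<lambda>x. u x - v x))\<^sup>2 \<le> (norm_L2 u + norm_L2 v)\<^sup>2"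
    using u v by (simp add: power2_sum norm_L2_squared)
qed (intro add_nonneg_nonneg norm_L2_nonneg u v)

lemma norm_L2_add_le:
  "u \<in> Cc \<Longrightarrow> v \<in> Cc \<Longrightarrow> norm_L2 (\<lambda>x. u x + v x) \<le> norm_L2 u + norm_L2 v"
  using norm_L2_diff_le[of u "\<lambda>x. - v x"] by (simp add: Cc_minus norm_L2_minus)

lemma norm_L2_sum_le:
  "finite S \<Longrightarrow> (\<And>s. s \<in> S \<Longrightarrow> f s \<in> Cc) \<Longrightarrow> norm_L2 (\<lambda>x. \<Sum>s\<in>S. f s x) \<le> (\<Sum>s\<in>S. norm_L2 (f s))"
proof (induction S rule: finite_induct)
  case empty
  then show ?case by (simp add: norm_L2_def inner_L2_def I_zero)
next
  case (insert s S)
  then show ?case using norm_L2_add_le[of "f s" "\<lambda>x. \<Sum>s\<in>S. f s x"] Cc_sum[of S f] by auto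
qed

end

section \<open>Small subgroups of compact groups\<close>

lemma (in group) subgroup_nat_pow_closed:
  "subgroup H G \<Longrightarrow> x \<in> H \<Longrightarrow> x [^] (n::nat) \<in> H"
  using subgroup_int_pow_closed[of H x "int n"] by (simp add: int_pow_int)

lemma log_convex_growth:
  fixes a :: "nat \<Rightarrow> real"
  assumes pos: "0 < a 0" and convex: "\<And>k. (a (Suc k))\<^sup>2 \<le> a k * a (Suc (Suc k))"
    and r: "0 < r" "r * a 0 \<le> a 1"
  shows "r ^ k * a 0 \<le> a k"
proof -
  have step: "0 < a k \<and> r * a k \<le> a (Suc k)" for k
  proof (induction k)
    case 0
    then show ?case using pos r(2) by simp
  next
    case (Suc k)
    have pos_Suc: "0 < a (Suc k)" using Suc r(1) by (smt (verit) mult_pos_pos)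
    have "r * a (Suc k) * a k \<le> a (Suc k) * a (Suc k)" using Suc pos_Suc by (simp add: mult_ac)
    also have "\<dots> \<le> a k * a (Suc (Suc k))" using convex[of k] by (simp add: power2_eq_square)
    finally show ?case using Suc pos_Suc by (simp add: mult_ac)
  qed
  show ?thesis
  proof (induction k)
    case (Suc k)
    have "r ^ Suc k * a 0 = r * (r ^ k * a 0)" by simp
    also have "\<dots> \<le> r * a k" using Suc r(1) by (intro mult_left_mono) auto
    also have "\<dots> \<le> a (Suc k)" using step by blast
    finally show ?case .
  qed simp
qed

lemma exponential_le_linear_imp_nonpos:
  fixes b c q :: real
  assumes q: "q > 1" and growth: "\<And>k::nat. q ^ k * b \<le> c * real (Suc k)"
  shows "b \<le> 0"
proof -
  have small: "norm (1 / q) < 1" using q by simp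
  have "(\<lambda>k. c * (real k * (1 / q) ^ k + (1 / q) ^ k)) \<longlonglongrightarrow> c * (0 + 0)"
    by (intro tendsto_intros powser_times_n_limit_0 LIMSEQ_power_zero small)
  moreover have "b \<le> c * (real k * (1 / q) ^ k + (1 / q) ^ k)" for k
    using growth[of k] q by (simp add: power_divide field_simps)
  ultimately show ?thesis by (intro LIMSEQ_le_const) auto
qed

lemma log_convex_decay_step:
  fixes a :: "nat \<Rightarrow> real"
  assumes nonneg: "\<And>k. 0 \<le> a k" and convex: "\<And>k. (a (Suc k))\<^sup>2 \<le> a k * a (Suc (Suc k))"
    and bound: "\<And>k. a k \<le> c * real (Suc k) * e ^ k" and e: "e > 0"
  shows "a 1 \<le> e * a 0"
proof (rule ccontr)
  assume greater: "\<not> ?thesis"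
  have "a 0 \<noteq> 0"
  proof
    assume "a 0 = 0"
    then show False using convex[of 0] greater by simp
  qed
  then have pos: "a 0 > 0" using nonneg[of 0] by simp
  define r where "r = a 1 / a 0"
  have r: "r > e" "r * a 0 = a 1" using greater pos by (auto simp: r_def field_simps)
  have "(r / e) ^ k * a 0 \<le> c * real (Suc k)" for k
  proof -
    have "r ^ k * a 0 \<le> c * real (Suc k) * e ^ k"
      using log_convex_growth[OF pos convex, of r k] bound[of k] r e by auto
    then show ?thesis using e by (simp add: power_divide field_simps)
  qed
  moreover have "r / e > 1" using r(1) e by simp
  ultimately have "a 0 \<le> 0" using exponential_le_linear_imp_nonpos by blast
  then show False using pos by simp
qed

lemma log_convex_decay:
  fixes a :: "nat \<Rightarrow> real"
  assumes nonneg: "\<And>k. 0 \<le> a k" and convex: "\<And>k. (a (Suc k))\<^sup>2 \<le> a k * a (Suc (Suc k))"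
    and bound: "\<And>k. a k \<le> c * real (Suc k) * e ^ k" and e: "e > 0" and c: "c \<ge> 0"
  shows "a k \<le> e ^ k * a 0"
proof -
  have step: "a (Suc j) \<le> e * a j" for j
  proof -
    have "a (1 + j) \<le> e * a (0 + j)"
    proof (rule log_convex_decay_step[of "\<lambda>k. a (k + j)" "c * real (Suc j) * e ^ j"])
      fix k
      have "a (k + j) \<le> c * real (Suc (k + j)) * e ^ (k + j)" by (rule bound)
      also have "\<dots> \<le> c * (real (Suc j) * real (Suc k)) * e ^ (k + j)"
        using c e by (intro mult_right_mono mult_left_mono) (auto simp: algebra_simps)
      also have "\<dots> = c * real (Suc j) * e ^ j * real (Suc k) * e ^ k"
        by (simp add: power_add mult_ac)
      finally show "a (k + j) \<le> c * real (Suc j) * e ^ j * real (Suc k) * e ^ k" .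
    qed (use nonneg convex e in auto)
    then show ?thesis by simp
  qed
  show ?thesis
  proof (induction k)
    case (Suc k)
    have "a (Suc k) \<le> e * a k" by (rule step)
    also have "\<dots> \<le> e * (e ^ k * a 0)" using Suc e by (intro mult_left_mono) auto
    finally show ?case by simp
  qed simp
qed

lemma halving_recursion_bound:
  fixes a :: "nat \<Rightarrow> real"
  assumes step: "\<And>k. a (Suc k) \<le> (1/2) * a k + b * (1/2) ^ Suc k"
  shows "a k \<le> (1/2) ^ k * (a 0 + b * real k)"
proof (induction k)
  case (Suc k)
  have "a (Suc k) \<le> (1/2) * a k + b * (1/2) ^ Suc k" by (rule step)
  also have "\<dots> \<le> (1/2) * ((1/2) ^ k * (a 0 + b * real k)) + b * (1/2) ^ Suc k" using Suc by simp
  also have "\<dots> = (1/2) ^ Suc k * (a 0 + b * real (Suc k))" by (simp add: algebra_simps)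
  finally show ?case .
qed simp

locale compact_group = haar_integral +
  assumes compact_T: "compact_space T"
begin

lemma compactin_whole: "compactin T (carrier L)"
  using compact_T by (simp add: compact_space_def)

lemma continuous_imp_Cc: "continuous_map T euclideanreal u \<Longrightarrow> u \<in> Cc"
  by (rule CcI[OF _ compactin_whole]) auto

text \<open>Functions are normalized to vanish outside the carrier, so that equality of functions means
  equality on the group.\<close>

definition cfun :: "('a \<Rightarrow> real) set" where
  "cfun = {u. continuous_map T euclideanreal u \<and> (\<forall>x. x \<notin> carrier L \<longrightarrow> u x = 0)}"

definition left_translate :: "'a \<Rightarrow> ('a \<Rightarrow> real) \<Rightarrow> 'a \<Rightarrow> real" where
  "left_translate g u = (\<lambda>x. if x \<in> carrier L then u (inv g \<otimes> x) else 0)"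

definition translate_diff :: "'a \<Rightarrow> ('a \<Rightarrow> real) \<Rightarrow> 'a \<Rightarrow> real" where
  "translate_diff g u = (\<lambda>x. u x - left_translate g u x)"

lemma cfun_Cc: "u \<in> cfun \<Longrightarrow> u \<in> Cc"
  by (auto simp: cfun_def intro: continuous_imp_Cc)

lemma cfun_outside: "u \<in> cfun \<Longrightarrow> x \<notin> carrier L \<Longrightarrow> u x = 0"
  by (simp add: cfun_def)

lemma cfun_restrict:
  assumes "continuous_map T euclideanreal u"
  shows "(\<lambda>x. if x \<in> carrier L then u x else 0) \<in> cfun"
  using continuous_map_eq[OF assms, of "\<lambda>x. if x \<in> carrier L then u x else 0"]
  by (auto simp: cfun_def)

lemma cfun_diff: "u \<in> cfun \<Longrightarrow> v \<in> cfun \<Longrightarrow> (\<lambda>x. u x - v x) \<in> cfun"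
  by (auto simp: cfun_def intro!: continuous_map_diff)

lemma left_translate_cfun: "u \<in> cfun \<Longrightarrow> g \<in> carrier L \<Longrightarrow> left_translate g u \<in> cfun"
  unfolding left_translate_def
  by (intro cfun_restrict Cc_continuous Cc_left_translate cfun_Cc) auto

lemma translate_diff_cfun: "u \<in> cfun \<Longrightarrow> g \<in> carrier L \<Longrightarrow> translate_diff g u \<in> cfun"
  unfolding translate_diff_def by (intro cfun_diff left_translate_cfun)

lemma left_translate_mult:
  "g \<in> carrier L \<Longrightarrow> h \<in> carrier L \<Longrightarrow> left_translate (g \<otimes> h) u = left_translate g (left_translate h u)"
  by (auto simp: left_translate_def fun_eq_iff inv_mult_group m_assoc)

lemma left_translate_one: "u \<in> cfun \<Longrightarrow> left_translate \<one> u = u"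
  by (auto simp: left_translate_def fun_eq_iff cfun_outside)

lemma left_translate_diff:
  "left_translate g (\<lambda>x. u x - v x) = (\<lambda>x. left_translate g u x - left_translate g v x)"
  by (auto simp: left_translate_def)

lemma translate_diff_one: "u \<in> cfun \<Longrightarrow> translate_diff \<one> u = (\<lambda>x. 0 * u x)"
  by (simp add: translate_diff_def left_translate_one)

lemma translate_diff_mult:
  "g \<in> carrier L \<Longrightarrow> h \<in> carrier L \<Longrightarrow>
    translate_diff (g \<otimes> h) u = (\<lambda>x. translate_diff g u x + left_translate g (translate_diff h u) x)"
  by (auto simp: translate_diff_def left_translate_mult left_translate_diff fun_eq_iff)

lemma translate_diff_inv:
  "u \<in> cfun \<Longrightarrow> g \<in> carrier L \<Longrightarrow>
    translate_diff (inv g) u = (\<lambda>x. (-1) * left_translate (inv g) (translate_diff g u) x)"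
  by (auto simp: translate_diff_def left_translate_diff left_translate_mult[symmetric]
      left_translate_one)

lemma norm_L2_left_translate:
  assumes u: "u \<in> cfun" and g: "g \<in> carrier L"
  shows "norm_L2 (left_translate g u) = norm_L2 u"
proof -
  have u': "(\<lambda>x. u (inv g \<otimes> x)) \<in> Cc" using u g by (intro Cc_left_translate cfun_Cc) auto
  have "inner_L2 (left_translate g u) (left_translate g u)
      = inner_L2 (\<lambda>x. u (inv g \<otimes> x)) (\<lambda>x. u (inv g \<otimes> x))"
    using cfun_Cc[OF left_translate_cfun[OF u g]] u'
    by (intro inner_L2_cong) (auto simp: left_translate_def)
  also have "\<dots> = inner_L2 u u"
    unfolding inner_L2_def using I_left_translate[OF Cc_mult[OF cfun_Cc[OF u] cfun_Cc[OF u]] g] .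
  finally show ?thesis by (simp add: norm_L2_def)
qed

lemma norm_L2_translate_diff_le:
  "u \<in> cfun \<Longrightarrow> g \<in> carrier L \<Longrightarrow> norm_L2 (translate_diff g u) \<le> 2 * norm_L2 u"
  using norm_L2_diff_le[OF cfun_Cc cfun_Cc[OF left_translate_cfun], of u u g]
  by (simp add: translate_diff_def norm_L2_left_translate)

lemma sum_left_translate_translate_diff:
  fixes n :: nat
  assumes u: "u \<in> cfun" and x: "x \<in> carrier L"
  shows "(\<Sum>j<n. left_translate (x [^] j) (translate_diff x u) t) = translate_diff (x [^] n) u t"
proof (induction n)
  case 0
  then show ?case using u by (simp add: translate_diff_one)
next
  case (Suc n)
  have "x [^] n \<in> carrier L" using x by simp
  from translate_diff_mult[OF this x, of u] show ?case using Suc by simp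
qed

text \<open>The translates of \<open>translate_diff x u\<close> along the powers of \<open>x\<close> telescope, so their average is
  small; if all of them are near \<open>translate_diff x u\<close>, then this function is small itself.\<close>

lemma norm_L2_translate_diff_le_of_powers:
  assumes u: "u \<in> cfun" and x: "x \<in> carrier L"
    and bound: "\<And>j::nat. norm_L2 (translate_diff (x [^] j) (translate_diff x u)) \<le> b"
  shows "norm_L2 (translate_diff x u) \<le> b"
proof (rule field_le_epsilon)
  fix e :: real assume e: "e > 0"
  let ?z = "translate_diff x u"
  have z: "?z \<in> cfun" by (rule translate_diff_cfun[OF u x])
  have xj: "x [^] j \<in> carrier L" for j :: nat using x by simp
  obtain n :: nat where n: "2 * norm_L2 u / e < real n" using reals_Archimedean2 by blast
  moreover have "0 \<le> 2 * norm_L2 u / e" using norm_L2_nonneg[OF cfun_Cc[OF u]] e by simp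
  ultimately have n_pos: "0 < real n" by linarith
  have zj: "translate_diff (x [^] j) ?z \<in> Cc" for j :: nat
    by (rule cfun_Cc[OF translate_diff_cfun[OF z xj]])
  have un: "translate_diff (x [^] n) u \<in> Cc" by (rule cfun_Cc[OF translate_diff_cfun[OF u xj]])
  have split: "(\<lambda>t. real n * ?z t) =
      (\<lambda>t. (\<Sum>j<n. translate_diff (x [^] j) ?z t) + translate_diff (x [^] n) u t)"
    unfolding sum_left_translate_translate_diff[OF u x, symmetric]
    by (simp add: translate_diff_def[of _ ?z] sum_subtractf fun_eq_iff)
  have "real n * norm_L2 ?z = norm_L2 (\<lambda>t. real n * ?z t)"
    using norm_L2_scale[OF cfun_Cc[OF z], of "real n"] by simp
  also have "\<dots> \<le> norm_L2 (\<lambda>t. \<Sum>j<n. translate_diff (x [^] j) ?z t)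
      + norm_L2 (translate_diff (x [^] n) u)"
    unfolding split by (intro norm_L2_add_le Cc_sum zj un) auto
  also have "\<dots> \<le> (\<Sum>j<n. norm_L2 (translate_diff (x [^] j) ?z)) + 2 * norm_L2 u"
    by (intro add_mono norm_L2_sum_le norm_L2_translate_diff_le u xj zj) auto
  also have "\<dots> \<le> real n * b + 2 * norm_L2 u"
    using sum_mono[of "{..<n}", OF bound] by simp
  also have "\<dots> \<le> real n * b + real n * e" using n e by (simp add: field_simps)
  finally have "real n * norm_L2 ?z \<le> real n * (b + e)" by (simp add: algebra_simps)
  then show "norm_L2 ?z \<le> b + e" using n_pos by simp
qed

lemma norm_L2_translate_diff_orthogonal:
  assumes u: "u \<in> cfun" and g: "g \<in> carrier L" and orthogonal: "inner_L2 u (left_translate g u) = 0"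
  shows "(norm_L2 (translate_diff g u))\<^sup>2 = 2 * (norm_L2 u)\<^sup>2"
proof -
  let ?v = "left_translate g u"
  have v: "?v \<in> Cc" by (rule cfun_Cc[OF left_translate_cfun[OF u g]])
  have "(norm_L2 (translate_diff g u))\<^sup>2 = inner_L2 u u + inner_L2 ?v ?v"
    using cfun_Cc[OF u] v orthogonal inner_L2_commute[of ?v u] unfolding translate_diff_def
    by (simp add: norm_L2_squared Cc_diff inner_L2_diff_left inner_L2_diff_right)
  then show ?thesis
    using norm_L2_left_translate[OF u g] cfun_Cc[OF u] v by (simp flip: norm_L2_squared)
qed

definition sqrt_mass :: real where
  "sqrt_mass = norm_L2 (\<lambda>x. 1)"

lemma one_Cc: "(\<lambda>x. 1) \<in> Cc"
  by (rule continuous_imp_Cc) auto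

lemma sqrt_mass_pos: "sqrt_mass > 0"
  unfolding sqrt_mass_def by (rule norm_L2_pos[OF one_Cc one_closed]) simp

lemma I_abs_le_norm_L2:
  assumes u: "u \<in> Cc"
  shows "I (\<lambda>x. \<bar>u x\<bar>) \<le> sqrt_mass * norm_L2 u"
proof -
  have "I (\<lambda>x. \<bar>u x\<bar>) = inner_L2 (\<lambda>x. 1) (\<lambda>x. \<bar>u x\<bar>)" by (simp add: inner_L2_def)
  also have "\<dots> \<le> sqrt_mass * norm_L2 (\<lambda>x. \<bar>u x\<bar>)"
    using inner_L2_le_norm_L2[OF one_Cc Cc_abs[OF u]] by (simp add: sqrt_mass_def)
  also have "norm_L2 (\<lambda>x. \<bar>u x\<bar>) = norm_L2 u" by (simp add: norm_L2_def inner_L2_def)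
  finally show ?thesis .
qed

lemma norm_L2_le_sup:
  assumes u: "u \<in> Cc" and c: "\<And>x. x \<in> carrier L \<Longrightarrow> \<bar>u x\<bar> \<le> c"
  shows "norm_L2 u \<le> c * sqrt_mass"
proof -
  have c0: "0 \<le> c" using c[OF one_closed] by linarith
  have "inner_L2 u u \<le> I (\<lambda>x. c\<^sup>2 * 1)"
    unfolding inner_L2_def
  proof (rule I_mono[OF Cc_mult[OF u u] Cc_scale[OF one_Cc]])
    fix x assume "x \<in> carrier L"
    then have "\<bar>u x\<bar>\<^sup>2 \<le> c\<^sup>2" using c by (intro power_mono) auto
    then show "u x * u x \<le> c\<^sup>2 * 1" by (simp add: power2_eq_square)
  qed
  also have "\<dots> = (c * sqrt_mass)\<^sup>2"
    using I_scale[OF one_Cc, of "c\<^sup>2"] norm_L2_squared[OF one_Cc]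
    by (simp add: sqrt_mass_def power_mult_distrib inner_L2_def)
  finally have "(norm_L2 u)\<^sup>2 \<le> (c * sqrt_mass)\<^sup>2" using norm_L2_squared[OF u] by simp
  then show ?thesis by (rule power2_le_imp_le) (use c0 sqrt_mass_pos in simp)
qed

lemma partition_of_unity:
  assumes V: "nhd_one V"
  obtains S \<rho> where "finite S" "S \<subseteq> carrier L" "\<And>s. s \<in> S \<Longrightarrow> \<rho> s \<in> Cc_plus"
    "\<And>x. x \<in> carrier L \<Longrightarrow> (\<Sum>s\<in>S. \<rho> s x) = 1"
    "\<And>s x. s \<in> S \<Longrightarrow> x \<in> carrier L \<Longrightarrow> \<rho> s x \<noteq> 0 \<Longrightarrow> inv s \<otimes> x \<in> V"
proof -
  obtain \<phi> where \<phi>: "\<phi> \<in> bumps_in V" "\<phi> \<one> = 1"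
    using normalized_bump_exists[OF V] by blast
  obtain S where S: "finite S" "S \<subseteq> carrier L"
      "\<And>x. x \<in> carrier L \<Longrightarrow> \<exists>s\<in>S. \<phi> \<one> / 2 < \<phi> (inv s \<otimes> x)"
    using compactin_covered_by_bump_translates[OF compactin_whole \<phi>(1)] by blast
  define \<sigma> where "\<sigma> = (\<lambda>x. \<Sum>s\<in>S. \<phi> (inv s \<otimes> x))"
  have translate: "(\<lambda>x. \<phi> (inv s \<otimes> x)) \<in> Cc_plus" if "s \<in> S" for s
    using that S(2) by (intro Cc_plus_left_translate bumps_inD(1)[OF \<phi>(1)]) auto
  have \<sigma>_pos: "\<sigma> x > 0" if x: "x \<in> carrier L" for x
  proof -
    obtain s where s: "s \<in> S" "1 / 2 < \<phi> (inv s \<otimes> x)" using S(3)[OF x] \<phi>(2) by auto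
    then have "0 < \<phi> (inv s \<otimes> x)" by linarith
    also have "\<dots> \<le> \<sigma> x"
      unfolding \<sigma>_def using s(1) S(1) Cc_plus_nonneg[OF translate _] x
      by (intro member_le_sum) auto
    finally show ?thesis .
  qed
  have "continuous_map T euclideanreal (\<lambda>x. 1 / \<sigma> x)"
    using \<sigma>_pos Cc_plus_continuous[OF Cc_plus_sum[OF S(1) translate]]
    by (intro continuous_map_real_divide) (auto simp: \<sigma>_def less_imp_neq[symmetric])
  then have \<rho>: "(\<lambda>x. \<phi> (inv s \<otimes> x) / \<sigma> x) \<in> Cc_plus" if "s \<in> S" for s
    using Cc_mult_left[OF Cc_plus_imp_Cc[OF translate[OF that]], of "\<lambda>x. 1 / \<sigma> x"] \<sigma>_pos
      Cc_plus_nonneg[OF translate[OF that]] by (auto intro!: Cc_plusI divide_nonneg_pos)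
  show ?thesis
  proof (rule that[of S "\<lambda>s x. \<phi> (inv s \<otimes> x) / \<sigma> x", OF S(1,2) \<rho>])
    show "(\<Sum>s\<in>S. \<phi> (inv s \<otimes> x) / \<sigma> x) = 1" if "x \<in> carrier L" for x
      using \<sigma>_pos[OF that] by (simp add: sum_divide_distrib[symmetric] \<sigma>_def)
    show "inv s \<otimes> x \<in> V" if "s \<in> S" "x \<in> carrier L" "\<phi> (inv s \<otimes> x) / \<sigma> x \<noteq> 0" for s x
      using that S(2) by (intro bumps_inD(3)[OF \<phi>(1)]) auto
  qed
qed

lemma convolution_kernel_separable_approx:
  assumes \<eta>: "\<eta> \<in> Cc" and e: "e > 0"
  obtains S \<rho> where "finite S" "S \<subseteq> carrier L" "\<And>s. s \<in> S \<Longrightarrow> \<rho> s \<in> Cc_plus"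
    "\<And>x y. x \<in> carrier L \<Longrightarrow> y \<in> carrier L \<Longrightarrow>
      \<bar>\<eta> (inv y \<otimes> x) - (\<Sum>s\<in>S. \<eta> (inv y \<otimes> s) * \<rho> s x)\<bar> \<le> e"
proof -
  obtain V where V: "nhd_one V" "\<And>x z. x \<in> carrier L \<Longrightarrow> z \<in> V \<Longrightarrow> \<bar>\<eta> (x \<otimes> z) - \<eta> x\<bar> < e"
    using Cc_right_modulus[OF \<eta> e] by blast
  obtain S \<rho> where S: "finite S" "S \<subseteq> carrier L" and \<rho>: "\<And>s. s \<in> S \<Longrightarrow> \<rho> s \<in> Cc_plus"
    and sum_1: "\<And>x. x \<in> carrier L \<Longrightarrow> (\<Sum>s\<in>S. \<rho> s x) = 1"
    and supp: "\<And>s x. s \<in> S \<Longrightarrow> x \<in> carrier L \<Longrightarrow> \<rho> s x \<noteq> 0 \<Longrightarrow> inv s \<otimes> x \<in> V"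
    using partition_of_unity[OF V(1)] by blast
  have "\<bar>\<eta> (inv y \<otimes> x) - (\<Sum>s\<in>S. \<eta> (inv y \<otimes> s) * \<rho> s x)\<bar> \<le> e"
    if x: "x \<in> carrier L" and y: "y \<in> carrier L" for x y
  proof -
    have "\<eta> (inv y \<otimes> x) - (\<Sum>s\<in>S. \<eta> (inv y \<otimes> s) * \<rho> s x)
        = (\<Sum>s\<in>S. (\<eta> (inv y \<otimes> x) - \<eta> (inv y \<otimes> s)) * \<rho> s x)"
      using sum_1[OF x] by (simp add: left_diff_distrib sum_subtractf sum_distrib_left[symmetric])
    also have "\<bar>\<dots>\<bar> \<le> (\<Sum>s\<in>S. e * \<rho> s x)"
    proof (rule order_trans[OF sum_abs sum_mono])
      fix s assume s: "s \<in> S"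
      then have sL: "s \<in> carrier L" using S(2) by auto
      show "\<bar>(\<eta> (inv y \<otimes> x) - \<eta> (inv y \<otimes> s)) * \<rho> s x\<bar> \<le> e * \<rho> s x"
      proof (cases "\<rho> s x = 0")
        case False
        then have "\<bar>\<eta> (inv y \<otimes> x) - \<eta> (inv y \<otimes> s)\<bar> \<le> e"
          using V(2)[of "inv y \<otimes> s" "inv s \<otimes> x"] supp[OF s x] x y sL by (simp add: m_assoc)
        then show ?thesis using Cc_plus_nonneg[OF \<rho>[OF s] x] by (simp add: abs_mult mult_right_mono)
      qed simp
    qed
    also have "\<dots> = e" using sum_1[OF x] by (simp add: sum_distrib_left[symmetric])
    finally show ?thesis .
  qed
  then show ?thesis using that S \<rho> by blast
qed

lemma convolution_selfadjoint_approx: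
  assumes u: "u \<in> Cc" and v: "v \<in> Cc" and \<eta>: "\<eta> \<in> Cc"
    and symmetric: "\<And>z. z \<in> carrier L \<Longrightarrow> \<eta> (inv z) = \<eta> z" and e: "e > 0"
  shows "\<bar>inner_L2 v (convolution u \<eta>) - inner_L2 u (convolution v \<eta>)\<bar>
    \<le> 2 * (I (\<lambda>x. \<bar>u x\<bar>) * I (\<lambda>x. \<bar>v x\<bar>)) * e"
proof -
  obtain S \<rho> where S: "finite S" "S \<subseteq> carrier L" and \<rho>: "\<And>s. s \<in> S \<Longrightarrow> \<rho> s \<in> Cc_plus"
    and close: "\<And>x y. x \<in> carrier L \<Longrightarrow> y \<in> carrier L \<Longrightarrow>
      \<bar>\<eta> (inv y \<otimes> x) - (\<Sum>s\<in>S. \<eta> (inv y \<otimes> s) * \<rho> s x)\<bar> \<le> e"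
    using convolution_kernel_separable_approx[OF \<eta> e] by blast
  have flip: "\<eta> (inv y \<otimes> x) = \<eta> (inv x \<otimes> y)" if "x \<in> carrier L" "y \<in> carrier L" for x y
    using symmetric[of "inv x \<otimes> y"] that by (simp add: inv_mult_group)
  have kernel: "continuous_map T euclideanreal (\<lambda>y. \<eta> (inv y \<otimes> x))" if "x \<in> carrier L" for x
    by (rule continuous_map_inv_translate[OF Cc_continuous[OF \<eta>] that])
  have \<eta>s: "continuous_map T euclideanreal (\<lambda>y. \<eta> (inv y \<otimes> s))" if "s \<in> S" for s
    using kernel that S(2) by blast
  have \<rho>s: "continuous_map T euclideanreal (\<rho> s)" if "s \<in> S" for s
    by (rule Cc_plus_continuous[OF \<rho>[OF that]])
  let ?k = "\<lambda>x y. \<Sum>s\<in>S. \<eta> (inv y \<otimes> s) * \<rho> s x"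
  have "\<bar>I (\<lambda>x. v x * I (\<lambda>y. u y * \<eta> (inv y \<otimes> x))) - I (\<lambda>x. v x * I (\<lambda>y. u y * ?k x y))\<bar>
      \<le> e * I (\<lambda>x. \<bar>u x\<bar>) * I (\<lambda>x. \<bar>v x\<bar>)"
  proof (rule iterated_integral_approx[OF u v less_imp_le[OF e] kernel _ _ _ close])
    show "continuous_map T euclideanreal (\<lambda>x. I (\<lambda>y. u y * \<eta> (inv y \<otimes> x)))"
      using continuous_map_convolution[OF u \<eta>] by (simp add: convolution_def[abs_def])
    show "continuous_map T euclideanreal (\<lambda>x. I (\<lambda>y. u y * ?k x y))"
      by (subst I_mult_sum[OF S(1) u \<eta>s])
        (auto intro!: continuous_map_sum continuous_map_real_mult S(1) \<rho>s)
  qed (auto intro!: continuous_map_sum continuous_map_real_mult S(1) \<eta>s)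
  moreover have "\<bar>I (\<lambda>y. u y * I (\<lambda>x. v x * \<eta> (inv x \<otimes> y))) - I (\<lambda>y. u y * I (\<lambda>x. v x * ?k x y))\<bar>
      \<le> e * I (\<lambda>x. \<bar>v x\<bar>) * I (\<lambda>x. \<bar>u x\<bar>)"
  proof (rule iterated_integral_approx[OF v u less_imp_le[OF e] kernel])
    show "continuous_map T euclideanreal (\<lambda>y. I (\<lambda>x. v x * \<eta> (inv x \<otimes> y)))"
      using continuous_map_convolution[OF v \<eta>] by (simp add: convolution_def[abs_def])
    have "(\<lambda>y. I (\<lambda>x. v x * ?k x y)) = (\<lambda>y. \<Sum>s\<in>S. I (\<lambda>x. v x * \<rho> s x) * \<eta> (inv y \<otimes> s))"
      using I_mult_sum[OF S(1) v \<rho>s, where c = "\<lambda>s. \<eta> (inv y \<otimes> s)" for y]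
      by (simp add: mult.commute)
    then show "continuous_map T euclideanreal (\<lambda>y. I (\<lambda>x. v x * ?k x y))"
      using S(1) \<eta>s by (auto intro!: continuous_map_sum continuous_map_real_mult)
    show "\<bar>\<eta> (inv x \<otimes> y) - ?k x y\<bar> \<le> e" if "y \<in> carrier L" "x \<in> carrier L" for x y
      using close[of x y] flip[of x y] that by simp
  qed (auto intro!: continuous_map_sum continuous_map_real_mult S(1) \<rho>s)
  moreover have "I (\<lambda>x. v x * I (\<lambda>y. u y * ?k x y)) = I (\<lambda>y. u y * I (\<lambda>x. v x * ?k x y))"
    by (rule I_swap_separable[OF S(1) u v \<eta>s \<rho>s])
  ultimately show ?thesis by (simp add: inner_L2_def convolution_def mult_ac)
qed

lemma convolution_selfadjoint:
  assumes u: "u \<in> Cc" and v: "v \<in> Cc" and \<eta>: "\<eta> \<in> Cc"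
    and symmetric: "\<And>z. z \<in> carrier L \<Longrightarrow> \<eta> (inv z) = \<eta> z"
  shows "inner_L2 (convolution u \<eta>) v = inner_L2 u (convolution v \<eta>)"
proof -
  let ?c = "I (\<lambda>x. \<bar>u x\<bar>) * I (\<lambda>x. \<bar>v x\<bar>)"
  let ?d = "\<bar>inner_L2 v (convolution u \<eta>) - inner_L2 u (convolution v \<eta>)\<bar>"
  have c: "0 \<le> ?c" by (intro mult_nonneg_nonneg I_abs_nonneg u v)
  have "?d \<le> 0 + e" if e: "e > 0" for e
  proof -
    have "?d \<le> 2 * ?c * (e / (2 * (?c + 1)))"
      using c e by (intro convolution_selfadjoint_approx[OF u v \<eta> symmetric]) auto
    also have "\<dots> \<le> e" using c e by (simp add: field_simps)
    finally show ?thesis by simp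
  qed
  then have "?d \<le> 0" by (rule field_le_epsilon)
  then show ?thesis by (simp add: inner_L2_commute[of "convolution u \<eta>"])
qed

lemma symmetric_bump_exists:
  assumes V: "nhd_one V"
  obtains \<eta> where "\<eta> \<in> bumps_in V" "\<And>z. z \<in> carrier L \<Longrightarrow> \<eta> (inv z) = \<eta> z" "I \<eta> = 1"
proof -
  obtain W where W: "nhd_one W" "symmetric_set W" "W \<subseteq> V" using symmetric_nhd_one[OF V] .
  obtain \<phi> where \<phi>: "\<phi> \<in> bumps_in W" using normalized_bump_exists[OF W(1)] by blast
  let ?h = "\<lambda>x. \<phi> x + \<phi> (inv x)"
  have h: "?h \<in> Cc_plus"
    using bumps_inD(1)[OF \<phi>] by (auto simp: Cc_plus_def intro!: Cc_add Cc_compose_inv)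
  have Ih: "I ?h > 0"
    by (rule I_pos[OF h one_closed]) (simp add: bumps_inD(2)[OF \<phi>])
  have supp: "x \<in> V" if x: "x \<in> carrier L" "?h x \<noteq> 0" for x
  proof -
    have "\<phi> x \<noteq> 0 \<or> \<phi> (inv x) \<noteq> 0" using x(2) by auto
    then have "x \<in> W \<or> inv x \<in> W" using bumps_inD(3)[OF \<phi>] x(1) by auto
    then have "x \<in> W" using symmetric_setD[OF W(2), of "inv x"] x(1) by auto
    then show ?thesis using W(3) by blast
  qed
  show ?thesis
  proof (rule that[of "\<lambda>x. (1 / I ?h) * ?h x"])
    show "(\<lambda>x. (1 / I ?h) * ?h x) \<in> bumps_in V"
      using Cc_plus_scale[OF h, of "1 / I ?h"] Ih supp bumps_inD(2)[OF \<phi>]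
      by (auto simp: bumps_in_def)
    show "I (\<lambda>x. (1 / I ?h) * ?h x) = 1"
      using I_scale[OF Cc_plus_imp_Cc[OF h], of "1 / I ?h"] Ih by simp
  qed (simp add: add.commute)
qed

end

locale symmetric_kernel = compact_group +
  fixes \<eta> :: "'a \<Rightarrow> real"
  assumes kernel: "\<eta> \<in> Cc" and kernel_inv: "\<And>z. z \<in> carrier L \<Longrightarrow> \<eta> (inv z) = \<eta> z"
begin

definition conv_op :: "('a \<Rightarrow> real) \<Rightarrow> 'a \<Rightarrow> real" where
  "conv_op u = (\<lambda>x. if x \<in> carrier L then convolution u \<eta> x else 0)"

lemma conv_op_cfun: "u \<in> cfun \<Longrightarrow> conv_op u \<in> cfun"
  unfolding conv_op_def by (intro cfun_restrict continuous_map_convolution cfun_Cc kernel)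

lemma conv_op_diff:
  "u \<in> cfun \<Longrightarrow> v \<in> cfun \<Longrightarrow> conv_op (\<lambda>x. u x - v x) = (\<lambda>x. conv_op u x - conv_op v x)"
  by (auto simp: conv_op_def convolution_diff_left cfun_Cc kernel)

lemma conv_op_scale: "u \<in> cfun \<Longrightarrow> conv_op (\<lambda>x. c * u x) = (\<lambda>x. c * conv_op u x)"
  using I_scale[OF convolution_integrand_Cc[OF cfun_Cc kernel]]
  by (auto simp: conv_op_def convolution_def mult.assoc)

lemma conv_op_left_translate:
  assumes u: "u \<in> cfun" and g: "g \<in> carrier L"
  shows "conv_op (left_translate g u) = left_translate g (conv_op u)"
proof
  fix x
  show "conv_op (left_translate g u) x = left_translate g (conv_op u) x"
  proof (cases "x \<in> carrier L")
    case True
    have "convolution (left_translate g u) \<eta> x = convolution (\<lambda>y. u (inv g \<otimes> y)) \<eta> x"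
      using g by (intro convolution_cong Cc_left_translate cfun_Cc left_translate_cfun u kernel True)
        (auto simp: left_translate_def)
    also have "\<dots> = convolution u \<eta> (inv g \<otimes> x)"
      using convolution_left_translate[OF cfun_Cc[OF u] kernel True g] by simp
    finally show ?thesis using True g by (simp add: conv_op_def left_translate_def)
  qed (simp add: conv_op_def left_translate_def)
qed

lemma conv_op_funpow_cfun: "u \<in> cfun \<Longrightarrow> (conv_op ^^ k) u \<in> cfun"
  by (induction k) (auto intro: conv_op_cfun)

lemma conv_op_funpow_diff:
  "u \<in> cfun \<Longrightarrow> v \<in> cfun \<Longrightarrow>
    (conv_op ^^ k) (\<lambda>x. u x - v x) = (\<lambda>x. (conv_op ^^ k) u x - (conv_op ^^ k) v x)"
  by (induction k) (auto simp: conv_op_diff conv_op_funpow_cfun)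

lemma conv_op_funpow_scale:
  "u \<in> cfun \<Longrightarrow> (conv_op ^^ k) (\<lambda>x. c * u x) = (\<lambda>x. c * (conv_op ^^ k) u x)"
  by (induction k) (auto simp: conv_op_scale conv_op_funpow_cfun)

lemma conv_op_funpow_left_translate:
  "u \<in> cfun \<Longrightarrow> g \<in> carrier L \<Longrightarrow>
    (conv_op ^^ k) (left_translate g u) = left_translate g ((conv_op ^^ k) u)"
  by (induction k) (auto simp: conv_op_left_translate conv_op_funpow_cfun)

lemma conv_op_funpow_translate_diff:
  "u \<in> cfun \<Longrightarrow> g \<in> carrier L \<Longrightarrow>
    (conv_op ^^ k) (translate_diff g u) = translate_diff g ((conv_op ^^ k) u)"
  by (simp add: translate_diff_def conv_op_funpow_diff left_translate_cfun
      conv_op_funpow_left_translate)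

lemma norm_L2_funpow_translate_diff_mult_le:
  assumes u: "u \<in> cfun" and gh: "g \<in> carrier L" "h \<in> carrier L"
  shows "norm_L2 ((conv_op ^^ k) (translate_diff (g \<otimes> h) u)) \<le>
    norm_L2 ((conv_op ^^ k) (translate_diff g u)) + norm_L2 ((conv_op ^^ k) (translate_diff h u))"
proof -
  let ?u = "(conv_op ^^ k) u"
  have u': "?u \<in> cfun" by (rule conv_op_funpow_cfun[OF u])
  note diff_cfun = translate_diff_cfun[OF u']
  have "norm_L2 (\<lambda>x. translate_diff g ?u x + left_translate g (translate_diff h ?u) x)
      \<le> norm_L2 (translate_diff g ?u) + norm_L2 (left_translate g (translate_diff h ?u))"
    using gh by (intro norm_L2_add_le cfun_Cc left_translate_cfun diff_cfun)
  then show ?thesis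
    using gh u diff_cfun
    by (simp add: conv_op_funpow_translate_diff norm_L2_left_translate
        translate_diff_mult[of g h ?u])
qed

lemma inner_L2_conv_op:
  assumes u: "u \<in> cfun" and v: "v \<in> cfun"
  shows "inner_L2 (conv_op u) v = inner_L2 u (conv_op v)"
proof -
  have "inner_L2 (conv_op u) v = inner_L2 (convolution u \<eta>) v"
    by (intro inner_L2_cong cfun_Cc conv_op_cfun convolution_Cc u v kernel)
      (simp_all add: conv_op_def)
  also have "\<dots> = inner_L2 u (convolution v \<eta>)"
    by (intro convolution_selfadjoint cfun_Cc u v kernel kernel_inv)
  also have "\<dots> = inner_L2 u (conv_op v)"
    by (intro inner_L2_cong cfun_Cc conv_op_cfun convolution_Cc u v kernel)
      (simp_all add: conv_op_def)
  finally show ?thesis .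
qed

lemma norm_L2_conv_op_funpow_log_convex:
  assumes u: "u \<in> cfun"
  shows "(norm_L2 ((conv_op ^^ Suc k) u))\<^sup>2
    \<le> norm_L2 ((conv_op ^^ k) u) * norm_L2 ((conv_op ^^ Suc (Suc k)) u)"
proof -
  note cfun = conv_op_funpow_cfun[OF u]
  have "(norm_L2 ((conv_op ^^ Suc k) u))\<^sup>2
      = inner_L2 (conv_op ((conv_op ^^ k) u)) ((conv_op ^^ Suc k) u)"
    using norm_L2_squared[OF cfun_Cc[OF cfun[of "Suc k"]]] by simp
  also have "\<dots> = inner_L2 ((conv_op ^^ k) u) ((conv_op ^^ Suc (Suc k)) u)"
    using inner_L2_conv_op[OF cfun[of k] cfun[of "Suc k"]] by simp
  also have "\<dots> \<le> norm_L2 ((conv_op ^^ k) u) * norm_L2 ((conv_op ^^ Suc (Suc k)) u)"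
    by (intro inner_L2_le_norm_L2 cfun_Cc cfun)
  finally show ?thesis .
qed

lemma norm_L2_conv_op_funpow_decay:
  assumes u: "u \<in> cfun" and "c \<ge> 0"
    and bound: "\<And>k. norm_L2 ((conv_op ^^ k) u) \<le> c * real (Suc k) * (1/2) ^ k"
  shows "norm_L2 ((conv_op ^^ k) u) \<le> (1/2) ^ k * norm_L2 u"
  using log_convex_decay[of "\<lambda>k. norm_L2 ((conv_op ^^ k) u)" c "1/2" k]
    norm_L2_nonneg[OF cfun_Cc[OF conv_op_funpow_cfun[OF u]]]
    norm_L2_conv_op_funpow_log_convex[OF u] bound \<open>c \<ge> 0\<close>
  by simp

lemma norm_L2_conv_op_le:
  assumes m: "\<And>x. x \<in> carrier L \<Longrightarrow> \<bar>\<eta> x\<bar> \<le> m" and u: "u \<in> cfun"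
  shows "norm_L2 (conv_op u) \<le> m * sqrt_mass\<^sup>2 * norm_L2 u"
proof -
  have m0: "0 \<le> m" using m[OF one_closed] by linarith
  have "\<bar>conv_op u x\<bar> \<le> m * (sqrt_mass * norm_L2 u)" if x: "x \<in> carrier L" for x
  proof -
    have "\<bar>convolution u \<eta> x\<bar> \<le> m * I (\<lambda>x. \<bar>u x\<bar>)"
      unfolding convolution_def using x m m0
      by (intro I_mult_abs_le cfun_Cc u continuous_map_inv_translate Cc_continuous kernel Cc_abs)
        auto
    also have "\<dots> \<le> m * (sqrt_mass * norm_L2 u)"
      using I_abs_le_norm_L2[OF cfun_Cc[OF u]] m0 by (rule mult_left_mono)
    finally show ?thesis using x by (simp add: conv_op_def)
  qed
  then have "norm_L2 (conv_op u) \<le> (m * (sqrt_mass * norm_L2 u)) * sqrt_mass"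
    by (intro norm_L2_le_sup cfun_Cc conv_op_cfun u)
  then show ?thesis by (simp add: power2_eq_square mult_ac)
qed

lemma norm_L2_conv_op_funpow_bounded:
  obtains M where "M > 0" "\<And>k u. u \<in> cfun \<Longrightarrow> norm_L2 ((conv_op ^^ k) u) \<le> M ^ k * norm_L2 u"
proof -
  obtain m where m: "m > 0" "\<And>x. x \<in> carrier L \<Longrightarrow> \<bar>\<eta> x\<bar> \<le> m" using Cc_bounded[OF kernel] by blast
  let ?M = "m * sqrt_mass\<^sup>2"
  have M: "?M > 0" using m(1) sqrt_mass_pos by simp
  have "norm_L2 ((conv_op ^^ k) u) \<le> ?M ^ k * norm_L2 u" if u: "u \<in> cfun" for k u
  proof (induction k)
    case (Suc k)
    have "norm_L2 ((conv_op ^^ Suc k) u) \<le> ?M * norm_L2 ((conv_op ^^ k) u)"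
      using norm_L2_conv_op_le[OF m(2) conv_op_funpow_cfun[OF u, of k]] by simp
    also have "\<dots> \<le> ?M * (?M ^ k * norm_L2 u)" using Suc M by (intro mult_left_mono) auto
    finally show ?case by simp
  qed simp
  then show ?thesis using that M by blast
qed

lemma translate_diff_conv_op_small:
  assumes e: "e > 0"
  obtains W where "nhd_one W"
    "\<And>h u. h \<in> W \<Longrightarrow> u \<in> cfun \<Longrightarrow> norm_L2 (translate_diff h (conv_op u)) \<le> e * norm_L2 u"
proof -
  define d where "d = e / sqrt_mass\<^sup>2"
  have d: "d > 0" using e sqrt_mass_pos by (simp add: d_def)
  obtain V where V: "nhd_one V" "symmetric_set V"
      "\<And>x z. x \<in> carrier L \<Longrightarrow> z \<in> V \<Longrightarrow> \<bar>\<eta> (z \<otimes> x) - \<eta> x\<bar> < d"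
    using Cc_left_modulus[OF kernel d] by blast
  obtain W0 where W0: "nhd_one W0" "\<And>y h. y \<in> carrier L \<Longrightarrow> h \<in> W0 \<Longrightarrow> inv y \<otimes> h \<otimes> y \<in> V"
    using nhd_one_conjugate[OF compactin_whole V(1)] by blast
  obtain W where W: "nhd_one W" "symmetric_set W" "W \<subseteq> W0" using symmetric_nhd_one[OF W0(1)] .
  have "norm_L2 (translate_diff h (conv_op u)) \<le> e * norm_L2 u"
    if h: "h \<in> W" and u: "u \<in> cfun" for h u
  proof -
    have hL: "h \<in> carrier L" by (rule nhd_one_mem_carrier[OF W(1) h])
    have osc: "\<bar>\<eta> (inv y \<otimes> inv h \<otimes> y \<otimes> z) - \<eta> z\<bar> \<le> d" if "y \<in> carrier L" "z \<in> carrier L" for y z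
      using V(3)[OF that(2) W0(2)[OF that(1)], of "inv h"] symmetric_setD[OF W(2) h] W(3)
      by (auto simp: less_imp_le)
    have "\<bar>translate_diff h (conv_op u) x\<bar> \<le> d * (sqrt_mass * norm_L2 u)"
      if x: "x \<in> carrier L" for x
    proof -
      have "\<bar>convolution u \<eta> (inv h \<otimes> x) - convolution u \<eta> x\<bar> \<le> d * I (\<lambda>x. \<bar>u x\<bar>)"
        using d osc
        by (intro convolution_left_translate_diff_abs_le[OF cfun_Cc[OF u] kernel hL x])
          (auto intro: Cc_abs cfun_Cc u)
      also have "\<dots> \<le> d * (sqrt_mass * norm_L2 u)"
        using I_abs_le_norm_L2[OF cfun_Cc[OF u]] d by simp
      finally show ?thesis
        using x hL
        by (simp add: conv_op_def translate_diff_def left_translate_def abs_minus_commute)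
    qed
    then have "norm_L2 (translate_diff h (conv_op u)) \<le> (d * (sqrt_mass * norm_L2 u)) * sqrt_mass"
      by (intro norm_L2_le_sup cfun_Cc translate_diff_cfun conv_op_cfun u hL)
    also have "\<dots> = e * norm_L2 u" using sqrt_mass_pos by (simp add: d_def power2_eq_square)
    finally show ?thesis .
  qed
  then show ?thesis using that W(1) by blast
qed

text \<open>These are the elements acting trivially on the spectral part of the self-adjoint operator
  \<open>conv_op\<close> outside \<open>[-1/2, 1/2]\<close>; the growth condition says this without spectral theory.\<close>

definition spectral_stabilizer :: "'a set" where
  "spectral_stabilizer = {x \<in> carrier L. \<forall>u\<in>cfun. \<forall>k.
     norm_L2 ((conv_op ^^ k) (translate_diff x u)) \<le> 2 * (1/2) ^ k * norm_L2 u}"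

lemma spectral_stabilizer_carrier: "x \<in> spectral_stabilizer \<Longrightarrow> x \<in> carrier L"
  by (simp add: spectral_stabilizer_def)

lemma spectral_stabilizerD:
  "x \<in> spectral_stabilizer \<Longrightarrow> u \<in> cfun \<Longrightarrow>
    norm_L2 ((conv_op ^^ k) (translate_diff x u)) \<le> 2 * (1/2) ^ k * norm_L2 u"
  unfolding spectral_stabilizer_def by blast

text \<open>By log-convexity the growth condition improves itself.\<close>

lemma spectral_stabilizerI:
  assumes x: "x \<in> carrier L"
    and bound: "\<And>u. u \<in> cfun \<Longrightarrow> \<exists>c\<ge>0. \<forall>k.
      norm_L2 ((conv_op ^^ k) (translate_diff x u)) \<le> c * real (Suc k) * (1/2) ^ k"
  shows "x \<in> spectral_stabilizer"
proof -
  have "norm_L2 ((conv_op ^^ k) (translate_diff x u)) \<le> 2 * (1/2) ^ k * norm_L2 u"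
    if u: "u \<in> cfun" for u k
  proof -
    obtain c where "c \<ge> 0"
        "\<And>k. norm_L2 ((conv_op ^^ k) (translate_diff x u)) \<le> c * real (Suc k) * (1/2) ^ k"
      using bound[OF u] by auto
    then have "norm_L2 ((conv_op ^^ k) (translate_diff x u))
        \<le> (1/2) ^ k * norm_L2 (translate_diff x u)"
      by (rule norm_L2_conv_op_funpow_decay[OF translate_diff_cfun[OF u x]])
    also have "\<dots> \<le> (1/2) ^ k * (2 * norm_L2 u)"
      by (intro mult_left_mono norm_L2_translate_diff_le u x) auto
    finally show ?thesis by (simp add: mult_ac)
  qed
  then show ?thesis using x by (simp add: spectral_stabilizer_def)
qed

lemma norm_L2_conv_op_translate_diff_le:
  assumes x: "x \<in> spectral_stabilizer" and u: "u \<in> cfun"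
  shows "norm_L2 (conv_op (translate_diff x u)) \<le> (1/2) * norm_L2 (translate_diff x u)"
proof -
  have xL: "x \<in> carrier L" by (rule spectral_stabilizer_carrier[OF x])
  have c: "0 \<le> 2 * norm_L2 u" using norm_L2_nonneg[OF cfun_Cc[OF u]] by simp
  have "norm_L2 ((conv_op ^^ k) (translate_diff x u))
      \<le> 2 * norm_L2 u * real (Suc k) * (1/2) ^ k" for k
  proof -
    have "norm_L2 ((conv_op ^^ k) (translate_diff x u)) \<le> 2 * norm_L2 u * 1 * (1/2) ^ k"
      using spectral_stabilizerD[OF x u, of k] by (simp add: mult_ac)
    also have "\<dots> \<le> 2 * norm_L2 u * real (Suc k) * (1/2) ^ k"
      using c by (intro mult_right_mono mult_left_mono) auto
    finally show ?thesis .
  qed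
  then show ?thesis
    using norm_L2_conv_op_funpow_decay[OF translate_diff_cfun[OF u xL] c, of 1] by simp
qed

lemma spectral_stabilizer_one: "\<one> \<in> spectral_stabilizer"
proof -
  have "norm_L2 ((conv_op ^^ k) (translate_diff \<one> u)) = 0" if "u \<in> cfun" for u k
    using that norm_L2_scale[OF cfun_Cc[OF conv_op_funpow_cfun[OF that]], of 0]
    by (simp add: translate_diff_one conv_op_funpow_scale[of _ _ 0, simplified])
  then show ?thesis using norm_L2_nonneg[OF cfun_Cc] by (simp add: spectral_stabilizer_def)
qed

lemma spectral_stabilizer_inv:
  assumes x: "x \<in> spectral_stabilizer"
  shows "inv x \<in> spectral_stabilizer"
proof -
  have xL: "x \<in> carrier L" by (rule spectral_stabilizer_carrier[OF x])
  have "norm_L2 ((conv_op ^^ k) (translate_diff (inv x) u))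
      = norm_L2 ((conv_op ^^ k) (translate_diff x u))"
    if u: "u \<in> cfun" for u k
  proof -
    have diff: "translate_diff x u \<in> cfun" by (rule translate_diff_cfun[OF u xL])
    have translate: "left_translate (inv x) (translate_diff x u) \<in> cfun"
      using diff xL by (intro left_translate_cfun) auto
    have "norm_L2 ((conv_op ^^ k) (translate_diff (inv x) u))
        = norm_L2 ((conv_op ^^ k) (left_translate (inv x) (translate_diff x u)))"
      unfolding translate_diff_inv[OF u xL] conv_op_funpow_scale[OF translate]
      using norm_L2_scale[OF cfun_Cc[OF conv_op_funpow_cfun[OF translate]], of "-1" k] by simp
    also have "\<dots> = norm_L2 ((conv_op ^^ k) (translate_diff x u))"
      using diff xL
      by (simp add: conv_op_funpow_left_translate norm_L2_left_translate conv_op_funpow_cfun)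
    finally show ?thesis .
  qed
  then show ?thesis using x by (simp add: spectral_stabilizer_def)
qed

lemma spectral_stabilizer_mult:
  assumes x: "x \<in> spectral_stabilizer" and y: "y \<in> spectral_stabilizer"
  shows "x \<otimes> y \<in> spectral_stabilizer"
proof (rule spectral_stabilizerI)
  have xy: "x \<in> carrier L" "y \<in> carrier L" using x y by (auto intro: spectral_stabilizer_carrier)
  then show "x \<otimes> y \<in> carrier L" by simp
  fix u assume u: "u \<in> cfun"
  have norm: "0 \<le> norm_L2 u" by (rule norm_L2_nonneg[OF cfun_Cc[OF u]])
  have "norm_L2 ((conv_op ^^ k) (translate_diff (x \<otimes> y) u))
      \<le> 4 * norm_L2 u * real (Suc k) * (1/2) ^ k" for k
  proof -
    have "norm_L2 ((conv_op ^^ k) (translate_diff (x \<otimes> y) u)) \<le> 4 * norm_L2 u * 1 * (1/2) ^ k"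
      using norm_L2_funpow_translate_diff_mult_le[OF u xy, of k]
        spectral_stabilizerD[OF x u, of k] spectral_stabilizerD[OF y u, of k] by (simp add: mult_ac)
    also have "\<dots> \<le> 4 * norm_L2 u * real (Suc k) * (1/2) ^ k"
      using norm by (intro mult_right_mono mult_left_mono) auto
    finally show ?thesis .
  qed
  then show "\<exists>c\<ge>0. \<forall>k. norm_L2 ((conv_op ^^ k) (translate_diff (x \<otimes> y) u))
      \<le> c * real (Suc k) * (1/2) ^ k"
    using norm by (intro exI[of _ "4 * norm_L2 u"]) auto
qed

lemma subgroup_spectral_stabilizer: "subgroup spectral_stabilizer L"
  using spectral_stabilizer_one spectral_stabilizer_inv spectral_stabilizer_mult
  by (auto intro!: subgroupI intro: spectral_stabilizer_carrier)

lemma closedin_spectral_stabilizer: "closedin T spectral_stabilizer"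
proof -
  have sub: "spectral_stabilizer \<subseteq> carrier L" using spectral_stabilizer_carrier by blast
  obtain M where M: "M > 0" "\<And>k u. u \<in> cfun \<Longrightarrow> norm_L2 ((conv_op ^^ k) u) \<le> M ^ k * norm_L2 u"
    using norm_L2_conv_op_funpow_bounded by blast
  have "x \<in> spectral_stabilizer" if x: "x \<in> T closure_of spectral_stabilizer" for x
  proof -
    have "norm_L2 ((conv_op ^^ k) (translate_diff x u)) \<le> 2 * (1/2) ^ k * norm_L2 u"
      if u: "u \<in> cfun" for u k
    proof (rule field_le_epsilon)
      fix e :: real assume e: "e > 0"
      let ?d = "e / (M ^ k * sqrt_mass)"
      have d: "?d > 0" using e M(1) sqrt_mass_pos by simp
      obtain V where V: "nhd_one V" "symmetric_set V"
          "\<And>x z. x \<in> carrier L \<Longrightarrow> z \<in> V \<Longrightarrow> \<bar>u (z \<otimes> x) - u x\<bar> < ?d"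
        using Cc_left_modulus[OF cfun_Cc[OF u] d] by blast
      obtain y z where yz: "y \<in> spectral_stabilizer" "z \<in> V" "x = y \<otimes> z"
        using closure_of_subset_set_mult[OF sub V(1)] x by (auto simp: set_mult_def)
      have carrier: "y \<in> carrier L" "z \<in> carrier L"
        using yz spectral_stabilizer_carrier nhd_one_mem_carrier[OF V(1)] by auto
      have "norm_L2 ((conv_op ^^ k) (translate_diff z u)) \<le> M ^ k * norm_L2 (translate_diff z u)"
        by (rule M(2)[OF translate_diff_cfun[OF u carrier(2)]])
      also have "\<dots> \<le> M ^ k * (?d * sqrt_mass)"
      proof (intro mult_left_mono norm_L2_le_sup cfun_Cc translate_diff_cfun u carrier)
        show "\<bar>translate_diff z u w\<bar> \<le> ?d" if "w \<in> carrier L" for w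
          using V(3)[OF that symmetric_setD[OF V(2) yz(2)]] that
          by (simp add: translate_diff_def left_translate_def abs_minus_commute less_imp_le)
      qed (use M(1) in auto)
      also have "\<dots> = e" using M(1) sqrt_mass_pos by simp
      finally show "norm_L2 ((conv_op ^^ k) (translate_diff x u)) \<le> 2 * (1/2) ^ k * norm_L2 u + e"
        using norm_L2_funpow_translate_diff_mult_le[OF u carrier, of k]
          spectral_stabilizerD[OF yz(1) u, of k] by (simp add: yz(3))
    qed
    then show ?thesis using x by (simp add: spectral_stabilizer_def in_closure_of)
  qed
  then show ?thesis using closure_of_subset_eq[of spectral_stabilizer T] sub by auto
qed

lemma translate_diff_funpow_step:
  assumes W: "nhd_one W"
      "\<And>h u. h \<in> W \<Longrightarrow> u \<in> cfun \<Longrightarrow> norm_L2 (translate_diff h (conv_op u)) \<le> (1/2) * norm_L2 u"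
    and g: "g \<in> W <#> spectral_stabilizer" and u: "u \<in> cfun"
  shows "norm_L2 (translate_diff g ((conv_op ^^ Suc k) u))
    \<le> (1/2) * norm_L2 ((conv_op ^^ k) u) + 2 * norm_L2 u * (1/2) ^ Suc k"
proof -
  obtain w h where wh: "w \<in> W" "h \<in> spectral_stabilizer" "g = w \<otimes> h"
    using g by (auto simp: set_mult_def)
  have carrier: "w \<in> carrier L" "h \<in> carrier L"
    using wh spectral_stabilizer_carrier nhd_one_mem_carrier[OF W(1)] by auto
  let ?u = "(conv_op ^^ Suc k) u"
  have "norm_L2 (translate_diff (w \<otimes> h) ?u) \<le> norm_L2 (translate_diff w ?u) + norm_L2 (translate_diff h ?u)"
    using norm_L2_funpow_translate_diff_mult_le[OF conv_op_funpow_cfun[OF u, of "Suc k"] carrier, of 0]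
    by simp
  moreover have "norm_L2 (translate_diff w ?u) \<le> (1/2) * norm_L2 ((conv_op ^^ k) u)"
    using W(2)[OF wh(1) conv_op_funpow_cfun[OF u, of k]] by simp
  moreover have "norm_L2 (translate_diff h ?u) \<le> 2 * (1/2) ^ Suc k * norm_L2 u"
    using spectral_stabilizerD[OF wh(2) u, of "Suc k"]
    by (simp only: conv_op_funpow_translate_diff[OF u carrier(2)])
  ultimately show ?thesis unfolding wh(3) by (simp only: mult.assoc mult.commute[of "norm_L2 u"])
qed

lemma traps_subgroups_spectral_stabilizer:
  assumes W: "nhd_one W"
      "\<And>h u. h \<in> W \<Longrightarrow> u \<in> cfun \<Longrightarrow> norm_L2 (translate_diff h (conv_op u)) \<le> (1/2) * norm_L2 u"
  shows "traps_subgroups (W <#> spectral_stabilizer) spectral_stabilizer"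
  unfolding traps_subgroups_def
proof (intro allI impI subsetI)
  fix P x assume P: "subgroup P L" "P \<subseteq> W <#> spectral_stabilizer" and xP: "x \<in> P"
  have xL: "x \<in> carrier L" using subgroup.subset[OF P(1)] xP by auto
  have powers: "x [^] (j::nat) \<in> W <#> spectral_stabilizer" for j
    using P(2) subgroup_nat_pow_closed[OF P(1) xP] by blast
  show "x \<in> spectral_stabilizer"
  proof (rule spectral_stabilizerI[OF xL])
    fix u assume u: "u \<in> cfun"
    define a where "a k = norm_L2 ((conv_op ^^ k) (translate_diff x u))" for k
    have a_0: "a 0 = norm_L2 (translate_diff x u)" by (simp add: a_def)
    then have a_0_nonneg: "0 \<le> a 0"
      using norm_L2_nonneg[OF cfun_Cc[OF translate_diff_cfun[OF u xL]]] by simp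
    have "a (Suc k) \<le> (1/2) * a k + 2 * a 0 * (1/2) ^ Suc k" for k
    proof -
      have diff: "(conv_op ^^ Suc k) (translate_diff x u) = translate_diff x ((conv_op ^^ Suc k) u)"
        by (rule conv_op_funpow_translate_diff[OF u xL])
      show ?thesis
        unfolding a_def[of k] a_def[of "Suc k"] a_0 diff
      proof (rule norm_L2_translate_diff_le_of_powers[OF conv_op_funpow_cfun[OF u] xL])
        show "norm_L2 (translate_diff (x [^] j) (translate_diff x ((conv_op ^^ Suc k) u)))
            \<le> (1/2) * norm_L2 ((conv_op ^^ k) (translate_diff x u))
              + 2 * norm_L2 (translate_diff x u) * (1/2) ^ Suc k" for j :: nat
          unfolding diff[symmetric]
          by (rule translate_diff_funpow_step[OF W powers translate_diff_cfun[OF u xL]])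
      qed
    qed
    then have "a k \<le> (1/2) ^ k * (a 0 + 2 * a 0 * real k)" for k by (rule halving_recursion_bound)
    moreover have "(1/2) ^ k * (a 0 + 2 * a 0 * real k) \<le> 2 * a 0 * real (Suc k) * (1/2) ^ k" for k
    proof -
      have "(1/2) ^ k * (a 0 + 2 * a 0 * real k) \<le> (1/2) ^ k * (2 * a 0 * real (Suc k))"
        using a_0_nonneg by (intro mult_left_mono) (auto simp: distrib_left)
      then show ?thesis by (simp only: mult_ac)
    qed
    ultimately have "a k \<le> 2 * a 0 * real (Suc k) * (1/2) ^ k" for k by (rule order_trans)
    then show "\<exists>c\<ge>0. \<forall>k. norm_L2 ((conv_op ^^ k) (translate_diff x u))
        \<le> c * real (Suc k) * (1/2) ^ k"
      using a_0_nonneg by (intro exI[of _ "2 * a 0"]) (auto simp: a_def)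
  qed
qed

lemma conv_op_approximate_identity:
  assumes \<eta>: "\<eta> \<in> bumps_in V" "I \<eta> = 1" and u: "u \<in> cfun" and x: "x \<in> carrier L" and d: "0 \<le> d"
    and modulus: "\<And>z. z \<in> V \<Longrightarrow> \<bar>u (x \<otimes> z) - u x\<bar> \<le> d"
  shows "\<bar>conv_op u x - u x\<bar> \<le> d"
proof -
  let ?\<eta> = "\<lambda>y. \<eta> (inv x \<otimes> y)"
  have \<eta>': "?\<eta> \<in> Cc" using x by (intro Cc_left_translate kernel) auto
  have I_\<eta>': "I ?\<eta> = 1" using I_left_translate[OF kernel x] \<eta>(2) by simp
  have "convolution u \<eta> x = I (\<lambda>y. ?\<eta> y * u y)"
    unfolding convolution_def
  proof (rule I_cong[OF convolution_integrand_Cc[OF cfun_Cc[OF u] kernel x] Cc_mult[OF \<eta>' cfun_Cc[OF u]]])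
    show "u y * \<eta> (inv y \<otimes> x) = ?\<eta> y * u y" if "y \<in> carrier L" for y
      using kernel_inv[of "inv x \<otimes> y"] x that by (simp add: inv_mult_group)
  qed
  moreover have "I (\<lambda>y. ?\<eta> y * u x) = u x"
    using I_scale[OF \<eta>', of "u x"] I_\<eta>' by (simp add: mult.commute)
  moreover have "\<bar>I (\<lambda>y. ?\<eta> y * u y) - I (\<lambda>y. ?\<eta> y * u x)\<bar> \<le> d * I ?\<eta>"
  proof (rule I_mult_diff_abs_le[OF \<eta>' Cc_continuous[OF cfun_Cc[OF u]] _ \<eta>' d])
    fix y assume y: "y \<in> carrier L"
    show "\<bar>?\<eta> y\<bar> \<le> ?\<eta> y" using Cc_plus_nonneg[OF bumps_inD(1)[OF \<eta>(1)], of "inv x \<otimes> y"] x y by simp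
    assume "?\<eta> y \<noteq> 0"
    then have "inv x \<otimes> y \<in> V" using bumps_inD(3)[OF \<eta>(1)] x y by auto
    then show "\<bar>u y - u x\<bar> \<le> d" using modulus[of "inv x \<otimes> y"] x y by simp
  qed simp
  ultimately show ?thesis using x I_\<eta>' by (simp add: conv_op_def)
qed

text \<open>If \<open>x\<close> moves the support of \<open>u\<close> off itself, then \<open>translate_diff x u\<close> is too large and too
  close to its image under \<open>conv_op\<close> to be contracted by \<open>conv_op\<close>.\<close>

lemma spectral_stabilizer_subset:
  assumes u: "u \<in> cfun" "norm_L2 u > 0" "norm_L2 (\<lambda>x. conv_op u x - u x) \<le> (1/4) * norm_L2 u"
    and support: "\<And>y. y \<in> carrier L \<Longrightarrow> u y \<noteq> 0 \<Longrightarrow> y \<in> W"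
    and W: "symmetric_set W" "\<And>y z. y \<in> W \<Longrightarrow> z \<in> W \<Longrightarrow> y \<otimes> z \<in> V"
  shows "spectral_stabilizer \<subseteq> V"
proof
  fix x assume x: "x \<in> spectral_stabilizer"
  have xL: "x \<in> carrier L" by (rule spectral_stabilizer_carrier[OF x])
  show "x \<in> V"
  proof (rule ccontr)
    assume "x \<notin> V"
    have disjoint: "u y * left_translate x u y = 0" if y: "y \<in> carrier L" for y
    proof (rule ccontr)
      assume "u y * left_translate x u y \<noteq> 0"
      then have "u y \<noteq> 0" "u (inv x \<otimes> y) \<noteq> 0" using y by (auto simp: left_translate_def)
      then have "y \<in> W" "inv (inv x \<otimes> y) \<in> W"
        using support[of y] support[of "inv x \<otimes> y"] symmetric_setD[OF W(1)] xL y by auto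
      then have "y \<otimes> inv (inv x \<otimes> y) \<in> V" by (rule W(2))
      then show False using \<open>x \<notin> V\<close> xL y by (simp add: inv_mult_group)
    qed
    let ?v = "translate_diff x u" and ?r = "\<lambda>t. conv_op u t - u t"
    have v: "?v \<in> cfun" by (rule translate_diff_cfun[OF u(1) xL])
    have r: "?r \<in> cfun" by (intro cfun_diff conv_op_cfun u(1))
    have "inner_L2 u (left_translate x u) = I (\<lambda>y. 0)"
      unfolding inner_L2_def
      by (intro I_cong Cc_mult cfun_Cc left_translate_cfun u(1) xL Cc_zero disjoint)
    then have large: "(norm_L2 ?v)\<^sup>2 = 2 * (norm_L2 u)\<^sup>2"
      by (intro norm_L2_translate_diff_orthogonal u(1) xL) (simp add: I_zero)
    have "(\<lambda>t. conv_op ?v t - ?v t) = translate_diff x ?r"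
      using conv_op_funpow_translate_diff[OF u(1) xL, of 1]
      by (auto simp: translate_diff_def left_translate_def fun_eq_iff)
    then have "norm_L2 (\<lambda>t. conv_op ?v t - ?v t) \<le> (1/2) * norm_L2 u"
      using norm_L2_translate_diff_le[OF r xL] u(3) by simp
    moreover have "norm_L2 (conv_op ?v) \<le> (1/2) * norm_L2 ?v"
      by (rule norm_L2_conv_op_translate_diff_le[OF x u(1)])
    moreover have "norm_L2 ?v \<le> norm_L2 (conv_op ?v) + norm_L2 (\<lambda>t. conv_op ?v t - ?v t)"
      using norm_L2_diff_le[OF cfun_Cc[OF conv_op_cfun[OF v]] cfun_Cc[OF cfun_diff[OF conv_op_cfun[OF v] v]]]
      by simp
    ultimately have "norm_L2 ?v \<le> norm_L2 u" by linarith
    then have "(norm_L2 ?v)\<^sup>2 \<le> (norm_L2 u)\<^sup>2"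
      using norm_L2_nonneg[OF cfun_Cc[OF v]] by (rule power_mono)
    then show False using large u(2) by (simp add: power2_eq_square)
  qed
qed

end

lemma (in compact_group) closed_subgroup_trapping_small_subgroups:
  assumes V: "nhd_one V"
  obtains K W where "subgroup K L" "closedin T K" "K \<subseteq> V" "nhd_one W" "traps_subgroups (W <#> K) K"
proof -
  obtain V1 where V1: "nhd_one V1" "symmetric_set V1" "V1 \<subseteq> V"
      "\<And>x y. x \<in> V1 \<Longrightarrow> y \<in> V1 \<Longrightarrow> x \<otimes> y \<in> V"
    using mult_nhd_one[OF V] by blast
  obtain \<phi> where \<phi>: "\<phi> \<in> bumps_in V1" using normalized_bump_exists[OF V1(1)] by blast
  define u where "u = (\<lambda>x. if x \<in> carrier L then \<phi> x else 0)"
  have u: "u \<in> cfun" unfolding u_def by (intro cfun_restrict Cc_plus_continuous bumps_inD(1)[OF \<phi>])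
  have norm_u: "norm_L2 u > 0"
    using bumps_inD(2)[OF \<phi>] by (intro norm_L2_pos[OF cfun_Cc[OF u] one_closed]) (simp add: u_def)
  define d where "d = norm_L2 u / (4 * sqrt_mass)"
  have d: "d > 0" using norm_u sqrt_mass_pos by (simp add: d_def)
  obtain V2 where V2: "nhd_one V2" "\<And>x z. x \<in> carrier L \<Longrightarrow> z \<in> V2 \<Longrightarrow> \<bar>u (x \<otimes> z) - u x\<bar> < d"
    using Cc_right_modulus[OF cfun_Cc[OF u] d] by blast
  obtain \<eta> where \<eta>: "\<eta> \<in> bumps_in V2" "\<And>z. z \<in> carrier L \<Longrightarrow> \<eta> (inv z) = \<eta> z" "I \<eta> = 1"
    using symmetric_bump_exists[OF V2(1)] by blast
  interpret symmetric_kernel L T I \<eta>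
    by unfold_locales (use Cc_plus_imp_Cc[OF bumps_inD(1)[OF \<eta>(1)]] \<eta>(2) in auto)
  have "\<bar>conv_op u x - u x\<bar> \<le> d" if "x \<in> carrier L" for x
    using V2(2)[OF that] d
    by (intro conv_op_approximate_identity[OF \<eta>(1,3) u that]) (auto simp: less_imp_le)
  then have "norm_L2 (\<lambda>x. conv_op u x - u x) \<le> d * sqrt_mass"
    by (intro norm_L2_le_sup cfun_Cc cfun_diff conv_op_cfun u)
  then have near: "norm_L2 (\<lambda>x. conv_op u x - u x) \<le> (1/4) * norm_L2 u"
    using sqrt_mass_pos by (simp add: d_def)
  have "spectral_stabilizer \<subseteq> V"
  proof (rule spectral_stabilizer_subset[OF u norm_u near _ V1(2,4)])
    show "y \<in> V1" if "y \<in> carrier L" "u y \<noteq> 0" for y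
      using bumps_inD(3)[OF \<phi> that(1)] that by (simp add: u_def)
  qed
  moreover obtain W where "nhd_one W"
      "\<And>h u. h \<in> W \<Longrightarrow> u \<in> cfun \<Longrightarrow> norm_L2 (translate_diff h (conv_op u)) \<le> (1/2) * norm_L2 u"
    using translate_diff_conv_op_small[of "1/2"] by (metis half_gt_zero zero_less_one)
  ultimately show ?thesis
    by (intro that[OF subgroup_spectral_stabilizer closedin_spectral_stabilizer])
      (assumption | rule traps_subgroups_spectral_stabilizer)+
qed

lemma (in lc_group) compact_subgroup_trapping_small_subgroups:
  assumes H: "subgroup H L" "compactin T H" and V: "nhd_one V"
  obtains K W where "subgroup K L" "compactin T K" "K \<subseteq> V" "K \<subseteq> H" "nhd_one W"
    "traps_subgroups (H \<inter> (W <#> K)) K"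
proof -
  let ?LH = "L\<lparr>carrier := H\<rparr>" and ?TH = "subtopology T H"
  have HL: "H \<subseteq> carrier L" using H(1) by (rule subgroup.subset)
  interpret H: lc_group ?LH ?TH
    by (rule lc_group_closed_subgroup[OF H(1) compactin_closedin[OF H(2)]])
  have compact_H: "compact_space ?TH" using H(2) by (simp add: compactin_subspace)
  obtain I where "haar_integral ?LH ?TH I" by (rule H.haar_integral_exists)
  then interpret H: compact_group ?LH ?TH I
    using compact_H by (simp add: compact_group_def compact_group_axioms_def)
  have "H.nhd_one (V \<inter> H)"
    using V subgroup.one_closed[OF H(1)]
    by (auto simp: H.nhd_one_def nhd_one_def openin_subtopology)
  then obtain K W where K: "subgroup K ?LH" "closedin ?TH K" "K \<subseteq> V \<inter> H" and W: "H.nhd_one W"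
    and trap: "H.traps_subgroups (W <#>\<^bsub>?LH\<^esub> K) K"
    using H.closed_subgroup_trapping_small_subgroups by blast
  obtain W' where W': "openin T W'" "W = W' \<inter> H"
    using W by (auto simp: H.nhd_one_def openin_subtopology)
  have "traps_subgroups (H \<inter> (W' <#> K)) K"
    unfolding traps_subgroups_def
  proof (intro allI impI)
    fix P assume P: "subgroup P L" "P \<subseteq> H \<inter> (W' <#> K)"
    have "P \<subseteq> W <#>\<^bsub>?LH\<^esub> K"
    proof
      fix p assume p: "p \<in> P"
      then obtain w k where wk: "w \<in> W'" "k \<in> K" "p = w \<otimes> k" using P(2) by (auto simp: set_mult_def)
      have "w \<in> carrier L" "k \<in> carrier L" "k \<in> H"
        using wk openin_subset[OF W'(1)] K(3) HL by auto
      then have "w = p \<otimes> inv k" using wk(3) by (simp add: m_assoc)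
      also have "\<dots> \<in> H"
        using P(2) p \<open>k \<in> H\<close> H(1) by (auto intro: subgroup.m_closed subgroup.m_inv_closed)
      finally show "p \<in> W <#>\<^bsub>?LH\<^esub> K" using wk W'(2) by (auto simp: set_mult_def)
    qed
    then show "P \<subseteq> K"
      using H.traps_subgroupsD[OF trap subgroup_incl[OF P(1) H(1)]] P(2) by blast
  qed
  moreover have "nhd_one W'" using W' W by (auto simp: nhd_one_def H.nhd_one_def)
  moreover have "compactin T K"
    using closedin_compact_space[OF compact_H K(2)] by (simp add: compactin_subtopology)
  moreover have "subgroup K L" using incl_subgroup[OF H(1) K(1)] .
  ultimately show ?thesis using that[of K W'] K(3) by blast
qed

section \<open>Products of elements with small powers\<close>

context group
begin

inductive weighted_word :: "('a \<Rightarrow> real \<Rightarrow> bool) \<Rightarrow> 'a \<Rightarrow> real \<Rightarrow> bool" for wt where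
  weighted_word_one: "weighted_word wt \<one> 0"
| weighted_word_step:
    "wt g w \<Longrightarrow> weighted_word wt q r \<Longrightarrow> weighted_word wt (g \<otimes> q) (r + w)"

definition symmetric_weights :: "('a \<Rightarrow> real \<Rightarrow> bool) \<Rightarrow> bool" where
  "symmetric_weights wt \<longleftrightarrow> (\<forall>g w. wt g w \<longrightarrow> g \<in> carrier G \<and> 0 < w \<and> wt (inv g) w)"

lemma symmetric_weightsD:
  assumes "symmetric_weights wt" "wt g w"
  shows "g \<in> carrier G" "0 < w" "wt (inv g) w"
  using assms by (auto simp: symmetric_weights_def)

lemma weighted_word_carrier: "weighted_word wt q r \<Longrightarrow> symmetric_weights wt \<Longrightarrow> q \<in> carrier G"
  by (induction rule: weighted_word.induct) (auto dest: symmetric_weightsD)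

lemma weighted_word_nonneg: "weighted_word wt q r \<Longrightarrow> symmetric_weights wt \<Longrightarrow> 0 \<le> r"
  by (induction rule: weighted_word.induct) (auto dest: symmetric_weightsD(2))

lemma weighted_word_letter:
  assumes "symmetric_weights wt" "wt g w"
  shows "weighted_word wt g w"
  using weighted_word_step[of wt g w, OF assms(2) weighted_word_one] symmetric_weightsD(1)[OF assms]
  by simp

lemma weighted_word_mult:
  assumes wt: "symmetric_weights wt" and q: "weighted_word wt q r" and p: "weighted_word wt p s"
  shows "weighted_word wt (q \<otimes> p) (r + s)"
  using q
proof (induction rule: weighted_word.induct)
  case weighted_word_one
  then show ?case using p weighted_word_carrier[OF p wt] by simp
next
  case (weighted_word_step g w q r)
  have "weighted_word wt (g \<otimes> (q \<otimes> p)) ((r + s) + w)"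
    by (rule weighted_word.weighted_word_step[OF weighted_word_step(1,3)])
  then show ?case
    using weighted_word_carrier[OF p wt] weighted_word_carrier[OF weighted_word_step(2) wt]
      symmetric_weightsD(1)[OF wt weighted_word_step(1)]
    by (simp add: m_assoc add.commute add.left_commute)
qed

lemma weighted_word_inv:
  assumes wt: "symmetric_weights wt" and q: "weighted_word wt q r"
  shows "weighted_word wt (inv q) r"
  using q
proof (induction rule: weighted_word.induct)
  case weighted_word_one
  then show ?case using weighted_word.weighted_word_one by simp
next
  case (weighted_word_step g w q r)
  have "weighted_word wt (inv g) w"
    by (rule weighted_word_letter[OF wt symmetric_weightsD(3)[OF wt weighted_word_step(1)]])
  then have "weighted_word wt (inv q \<otimes> inv g) (r + w)"
    by (rule weighted_word_mult[OF wt weighted_word_step(3)])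
  then show ?case
    using symmetric_weightsD(1)[OF wt weighted_word_step(1)]
      weighted_word_carrier[OF weighted_word_step(2) wt] by (simp add: inv_mult_group)
qed

lemma weighted_word_mono: "weighted_word wt q r \<Longrightarrow> wt \<le> wt' \<Longrightarrow> weighted_word wt' q r"
  by (induction rule: weighted_word.induct) (auto intro: weighted_word.intros)

definition weight_ball :: "('a \<Rightarrow> real \<Rightarrow> bool) \<Rightarrow> real \<Rightarrow> 'a set" where
  "weight_ball wt r = {q. \<exists>s\<le>r. weighted_word wt q s}"

lemma weight_ballI: "weighted_word wt q s \<Longrightarrow> s \<le> r \<Longrightarrow> q \<in> weight_ball wt r"
  by (auto simp: weight_ball_def)

lemma weight_ball_carrier: "symmetric_weights wt \<Longrightarrow> weight_ball wt r \<subseteq> carrier G"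
  by (auto simp: weight_ball_def dest: weighted_word_carrier)

lemma weight_ball_mono: "r \<le> s \<Longrightarrow> weight_ball wt r \<subseteq> weight_ball wt s"
  by (auto simp: weight_ball_def intro: order_trans)

lemma weight_ball_mult:
  "symmetric_weights wt \<Longrightarrow> q \<in> weight_ball wt r \<Longrightarrow> p \<in> weight_ball wt s \<Longrightarrow>
    q \<otimes> p \<in> weight_ball wt (r + s)"
  unfolding weight_ball_def using weighted_word_mult add_mono by fastforce

lemma weight_ball_inv:
  "symmetric_weights wt \<Longrightarrow> q \<in> weight_ball wt r \<Longrightarrow> inv q \<in> weight_ball wt r"
  unfolding weight_ball_def using weighted_word_inv by blast

lemma weight_ball_one: "0 \<le> r \<Longrightarrow> \<one> \<in> weight_ball wt r"
  unfolding weight_ball_def using weighted_word_one by blast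

definition powers_upto_in :: "'a set \<Rightarrow> nat \<Rightarrow> 'a set" where
  "powers_upto_in V n = {x \<in> carrier G. \<forall>j\<le>n. x [^] (j::nat) \<in> V}"

definition power_weights :: "'a set \<Rightarrow> 'a \<Rightarrow> real \<Rightarrow> bool" where
  "power_weights V g w \<longleftrightarrow> (\<exists>n\<ge>1. w = 1 / real n \<and> g \<in> powers_upto_in V n)"

lemma powers_upto_in_carrier: "x \<in> powers_upto_in V n \<Longrightarrow> x \<in> carrier G"
  by (simp add: powers_upto_in_def)

lemma powers_upto_inD: "x \<in> powers_upto_in V n \<Longrightarrow> j \<le> n \<Longrightarrow> x [^] j \<in> V"
  by (simp add: powers_upto_in_def)

lemma powers_upto_in_mem: "x \<in> powers_upto_in V n \<Longrightarrow> 1 \<le> n \<Longrightarrow> x \<in> V"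
  using powers_upto_inD[of x V n 1] powers_upto_in_carrier[of x V n] by simp

lemma power_weights_mono: "V \<subseteq> W \<Longrightarrow> power_weights V \<le> power_weights W"
  by (fastforce simp: power_weights_def powers_upto_in_def)

lemma sum_power_increments:
  fixes f :: "'a \<Rightarrow> real" and n :: nat
  assumes "g \<in> carrier G" "x \<in> carrier G"
  shows "(\<Sum>j<n. f (inv g \<otimes> (inv (g [^] j) \<otimes> x)) - f (inv (g [^] j) \<otimes> x)) =
    f (inv (g [^] n) \<otimes> x) - f x"
proof (induction n)
  case 0
  then show ?case using assms by simp
next
  case (Suc n)
  have "g [^] n \<in> carrier G" using assms by simp
  then have "inv g \<otimes> (inv (g [^] n) \<otimes> x) = inv (g [^] Suc n) \<otimes> x"
    using assms by (simp add: inv_mult_group m_assoc)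
  then show ?case using Suc by simp
qed

lemma power_increment_linear:
  fixes f :: "'a \<Rightarrow> real" and n :: nat
  assumes g: "g \<in> carrier G" and x: "x \<in> carrier G"
    and second: "\<And>j. j < n \<Longrightarrow> \<bar>f (inv g \<otimes> (inv (g [^] j) \<otimes> x)) - f (inv (g [^] j) \<otimes> x)
      - (f (inv g \<otimes> x) - f x)\<bar> \<le> b"
  shows "\<bar>f (inv (g [^] n) \<otimes> x) - f x - real n * (f (inv g \<otimes> x) - f x)\<bar> \<le> real n * b"
proof -
  have "f (inv (g [^] n) \<otimes> x) - f x - real n * (f (inv g \<otimes> x) - f x)
      = (\<Sum>j<n. f (inv g \<otimes> (inv (g [^] j) \<otimes> x)) - f (inv (g [^] j) \<otimes> x) - (f (inv g \<otimes> x) - f x))"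
    by (simp add: sum_subtractf[of _ "\<lambda>_. f (inv g \<otimes> x) - f x"] sum_power_increments[OF g x])
  also have "\<bar>\<dots>\<bar> \<le> (\<Sum>j<n. b)"
    using second by (intro order_trans[OF sum_abs sum_mono]) auto
  finally show ?thesis by simp
qed

end

text \<open>By construction the envelope moves by at most \<open>w / \<kappa>\<close> under translation by an element of
  weight \<open>w\<close>.\<close>

locale weight_envelope = lc_group +
  fixes wt :: "'a \<Rightarrow> real \<Rightarrow> bool" and \<kappa> :: real and \<theta> :: "'a \<Rightarrow> real"
  assumes wt: "symmetric_weights wt" and \<kappa>_pos: "0 < \<kappa>"
    and \<theta>: "\<theta> \<in> Cc" and \<theta>_range: "\<And>x. x \<in> carrier L \<Longrightarrow> \<theta> x \<in> {0..1}"
begin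

definition envelope_term :: "'a \<Rightarrow> 'a \<Rightarrow> real \<Rightarrow> real" where
  "envelope_term x q r = max 0 (1 - r / \<kappa>) * \<theta> (inv q \<otimes> x)"

definition envelope :: "'a \<Rightarrow> real" where
  "envelope x = (SUP (q,r)\<in>{(q,r). weighted_word wt q r}. envelope_term x q r)"

lemma cutoff_range: "weighted_word wt q r \<Longrightarrow> max 0 (1 - r / \<kappa>) \<in> {0..1}"
  using weighted_word_nonneg[OF _ wt] \<kappa>_pos by auto

lemma envelope_term_range:
  assumes q: "weighted_word wt q r" and x: "x \<in> carrier L"
  shows "envelope_term x q r \<in> {0..1}"
proof -
  have "inv q \<otimes> x \<in> carrier L" using weighted_word_carrier[OF q wt] x by simp
  then have "\<theta> (inv q \<otimes> x) \<in> {0..1}" by (rule \<theta>_range)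
  then show ?thesis using cutoff_range[OF q] by (auto simp: envelope_term_def mult_le_one)
qed

lemma envelope_term_le_envelope:
  assumes q: "weighted_word wt q r" and x: "x \<in> carrier L"
  shows "envelope_term x q r \<le> envelope x"
proof -
  have "(case (q, r) of (q, r) \<Rightarrow> envelope_term x q r) \<le> envelope x"
    unfolding envelope_def
  proof (rule cSUP_upper)
    show "bdd_above ((\<lambda>(q, r). envelope_term x q r) ` {(q, r). weighted_word wt q r})"
      using envelope_term_range[OF _ x] by (intro bdd_aboveI[of _ 1]) auto
  qed (use q in auto)
  then show ?thesis by simp
qed

lemma envelope_le:
  assumes "\<And>q r. weighted_word wt q r \<Longrightarrow> envelope_term x q r \<le> b"
  shows "envelope x \<le> b"
  unfolding envelope_def
proof (rule cSUP_least)
  show "{(q, r). weighted_word wt q r} \<noteq> {}" using weighted_word_one by auto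
qed (use assms in auto)

lemma \<theta>_le_envelope: "x \<in> carrier L \<Longrightarrow> \<theta> x \<le> envelope x"
  using envelope_term_le_envelope[OF weighted_word_one, of x] by (simp add: envelope_term_def)

lemma envelope_range: "x \<in> carrier L \<Longrightarrow> envelope x \<in> {0..1}"
  using \<theta>_le_envelope[of x] \<theta>_range[of x] envelope_le[of x 1] envelope_term_range[of _ _ x] by auto

lemma envelope_support:
  assumes x: "x \<in> carrier L" "envelope x \<noteq> 0"
  obtains q r where "weighted_word wt q r" "r < \<kappa>" "\<theta> (inv q \<otimes> x) \<noteq> 0"
proof -
  have "\<exists>q r. weighted_word wt q r \<and> r < \<kappa> \<and> \<theta> (inv q \<otimes> x) \<noteq> 0"
  proof (rule ccontr)
    assume none: "\<not> ?thesis"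
    have "envelope_term x q r = 0" if "weighted_word wt q r" for q r
    proof (cases "r < \<kappa>")
      case True
      then show ?thesis using none that by (auto simp: envelope_term_def)
    next
      case False
      then show ?thesis using \<kappa>_pos by (simp add: envelope_term_def)
    qed
    then have "envelope x \<le> 0" by (intro envelope_le) auto
    then show False using envelope_range[OF x(1)] x(2) by auto
  qed
  then show ?thesis using that by blast
qed

lemma envelope_left_translate_le:
  assumes g: "wt g w" and x: "x \<in> carrier L"
  shows "envelope (inv g \<otimes> x) \<le> envelope x + w / \<kappa>"
proof (rule envelope_le)
  fix q r assume q: "weighted_word wt q r"
  have carrier: "g \<in> carrier L" "q \<in> carrier L" and w: "0 \<le> w / \<kappa>"
    using weighted_word_carrier[OF q wt] symmetric_weightsD[OF wt g] \<kappa>_pos by auto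
  let ?t = "\<theta> (inv q \<otimes> (inv g \<otimes> x))"
  have translate: "inv (g \<otimes> q) \<otimes> x = inv q \<otimes> (inv g \<otimes> x)"
    using carrier x by (simp add: inv_mult_group m_assoc)
  have t: "?t \<in> {0..1}" using carrier x by (intro \<theta>_range) auto
  have "max 0 (1 - r / \<kappa>) \<le> max 0 (1 - (r + w) / \<kappa>) + w / \<kappa>"
    using w by (simp add: add_divide_distrib max_def)
  then have "envelope_term (inv g \<otimes> x) q r \<le> (max 0 (1 - (r + w) / \<kappa>) + w / \<kappa>) * ?t"
    unfolding envelope_term_def using t by (intro mult_right_mono) auto
  also have "\<dots> = envelope_term x (g \<otimes> q) (r + w) + w / \<kappa> * ?t"
    by (simp add: envelope_term_def translate distrib_right)
  also have "\<dots> \<le> envelope x + w / \<kappa> * 1"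
    using t w by (intro add_mono envelope_term_le_envelope weighted_word_step[of wt, OF g q] x
        mult_left_mono) auto
  finally show "envelope_term (inv g \<otimes> x) q r \<le> envelope x + w / \<kappa>" by simp
qed

lemma envelope_left_translate_diff_abs_le:
  assumes g: "wt g w" and x: "x \<in> carrier L"
  shows "\<bar>envelope (inv g \<otimes> x) - envelope x\<bar> \<le> w / \<kappa>"
proof -
  have gL: "g \<in> carrier L" by (rule symmetric_weightsD(1)[OF wt g])
  have "envelope (inv (inv g) \<otimes> (inv g \<otimes> x)) \<le> envelope (inv g \<otimes> x) + w / \<kappa>"
    using gL x by (intro envelope_left_translate_le symmetric_weightsD(3)[OF wt g]) auto
  then have "envelope x \<le> envelope (inv g \<otimes> x) + w / \<kappa>" using gL x by simp
  then show ?thesis using envelope_left_translate_le[OF g x] by linarith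
qed

lemma envelope_right_modulus:
  assumes V: "\<And>x z. x \<in> carrier L \<Longrightarrow> z \<in> V \<Longrightarrow> \<bar>\<theta> (x \<otimes> z) - \<theta> x\<bar> \<le> e" and e: "0 \<le> e"
    and x: "x \<in> carrier L" and z: "z \<in> V" "z \<in> carrier L"
  shows "\<bar>envelope (x \<otimes> z) - envelope x\<bar> \<le> e"
proof -
  have close: "\<bar>envelope_term (x \<otimes> z) q r - envelope_term x q r\<bar> \<le> e"
    if q: "weighted_word wt q r" for q r
  proof -
    have qL: "q \<in> carrier L" by (rule weighted_word_carrier[OF q wt])
    have "\<bar>\<theta> (inv q \<otimes> (x \<otimes> z)) - \<theta> (inv q \<otimes> x)\<bar> \<le> e"
      using V[of "inv q \<otimes> x" z] qL x z by (simp add: m_assoc)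
    then have "max 0 (1 - r / \<kappa>) * \<bar>\<theta> (inv q \<otimes> (x \<otimes> z)) - \<theta> (inv q \<otimes> x)\<bar> \<le> 1 * e"
      using cutoff_range[OF q] e by (intro mult_mono) auto
    then show ?thesis
      by (simp add: envelope_term_def abs_mult right_diff_distrib[symmetric])
  qed
  have "envelope (x \<otimes> z) \<le> envelope x + e"
  proof (rule envelope_le)
    fix q r assume q: "weighted_word wt q r"
    show "envelope_term (x \<otimes> z) q r \<le> envelope x + e"
      using close[OF q] envelope_term_le_envelope[OF q x] by linarith
  qed
  moreover have "envelope x \<le> envelope (x \<otimes> z) + e"
  proof (rule envelope_le)
    fix q r assume q: "weighted_word wt q r"
    show "envelope_term x q r \<le> envelope (x \<otimes> z) + e"
      using close[OF q] envelope_term_le_envelope[OF q m_closed[OF x z(2)]] by linarith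
  qed
  ultimately show ?thesis by linarith
qed

lemma continuous_map_envelope: "continuous_map T euclideanreal envelope"
proof (rule continuous_map_of_right_modulus)
  fix e :: real assume e: "e > 0"
  obtain V where V: "nhd_one V" "\<And>x z. x \<in> carrier L \<Longrightarrow> z \<in> V \<Longrightarrow> \<bar>\<theta> (x \<otimes> z) - \<theta> x\<bar> < e / 2"
    using Cc_right_modulus[OF \<theta>, of "e / 2"] e by auto
  have "\<bar>envelope (x \<otimes> z) - envelope x\<bar> < e" if "x \<in> carrier L" "z \<in> V" for x z
  proof -
    have "\<bar>envelope (x \<otimes> z) - envelope x\<bar> \<le> e / 2"
      using V e that nhd_one_mem_carrier[OF V(1)]
      by (intro envelope_right_modulus[where V = V]) (auto simp: less_imp_le)
    then show ?thesis using e by linarith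
  qed
  then show "\<exists>V. nhd_one V \<and> (\<forall>x\<in>carrier L. \<forall>z\<in>V. \<bar>envelope (x \<otimes> z) - envelope x\<bar> < e)"
    using V(1) by blast
qed

end

definition (in lc_group) gleason_region :: "'a set \<Rightarrow> 'a set \<Rightarrow> 'a set \<Rightarrow> 'a set" where
  "gleason_region U C D = (U <#> D) \<union> (C <#> (U <#> D))"

locale gleason_bump = haar_integral + weight_envelope +
  fixes \<Theta> :: "'a \<Rightarrow> real" and U C D :: "'a set"
  assumes \<kappa>_le_1: "\<kappa> \<le> 1"
    and compact_U: "compactin T U"
    and words_in_U: "\<And>q r. weighted_word wt q r \<Longrightarrow> r < \<kappa> \<Longrightarrow> q \<in> U"
    and letters_in_C: "\<And>g w. wt g w \<Longrightarrow> g \<in> C"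
    and compact_D: "compactin T D" and \<theta>_outside: "\<And>x. x \<in> carrier L \<Longrightarrow> x \<notin> D \<Longrightarrow> \<theta> x = 0"
    and \<Theta>: "\<Theta> \<in> Cc_plus" and \<Theta>_ge_1: "\<And>y. y \<in> gleason_region U C D \<Longrightarrow> 1 \<le> \<Theta> y"
begin

lemma \<theta>_nonzero_in_D: "x \<in> carrier L \<Longrightarrow> \<theta> x \<noteq> 0 \<Longrightarrow> x \<in> D"
  using \<theta>_outside by blast

lemma envelope_nonzero_in:
  assumes x: "x \<in> carrier L" "envelope x \<noteq> 0"
  shows "x \<in> U <#> D"
proof -
  obtain q r where q: "weighted_word wt q r" "r < \<kappa>" "\<theta> (inv q \<otimes> x) \<noteq> 0"
    using envelope_support[OF x] .
  have qL: "q \<in> carrier L" by (rule weighted_word_carrier[OF q(1) wt])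
  then have "inv q \<otimes> x \<in> D" using x(1) q(3) by (intro \<theta>_nonzero_in_D) auto
  moreover have "x = q \<otimes> (inv q \<otimes> x)" using qL x(1) by simp
  ultimately show ?thesis using words_in_U[OF q(1,2)] unfolding set_mult_def by blast
qed

lemma envelope_Cc_plus: "envelope \<in> Cc_plus"
  using envelope_nonzero_in envelope_range
  by (intro Cc_plusI CcI[OF continuous_map_envelope compactin_set_mult[OF compact_U compact_D]])
    auto

lemma envelope_Cc: "envelope \<in> Cc"
  by (rule Cc_plus_imp_Cc[OF envelope_Cc_plus])

lemma I_\<Theta>_nonneg: "0 \<le> I \<Theta>"
  by (rule I_nonneg[OF \<Theta>])

lemma abs_le_mult_\<Theta>:
  assumes "\<bar>a\<bar> \<le> c" "a \<noteq> 0 \<Longrightarrow> y \<in> gleason_region U C D" "y \<in> carrier L"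
  shows "\<bar>a\<bar> \<le> c * \<Theta> y"
proof (cases "a = 0")
  case True
  then show ?thesis using assms(1) Cc_plus_nonneg[OF \<Theta> assms(3)] by simp
next
  case False
  then have "c * 1 \<le> c * \<Theta> y" using assms(1) \<Theta>_ge_1[OF assms(2)] by (intro mult_left_mono) auto
  then show ?thesis using assms(1) by simp
qed

definition envelope_diff :: "'a \<Rightarrow> 'a \<Rightarrow> real" where
  "envelope_diff g y = envelope (inv g \<otimes> y) - envelope y"

lemma envelope_diff_Cc: "g \<in> carrier L \<Longrightarrow> envelope_diff g \<in> Cc"
  unfolding envelope_diff_def[abs_def] by (intro Cc_diff Cc_left_translate envelope_Cc) auto

lemma envelope_diff_nonzero_in:
  assumes g: "wt g w" and y: "y \<in> carrier L" "envelope_diff g y \<noteq> 0"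
  shows "y \<in> gleason_region U C D"
proof -
  have gL: "g \<in> carrier L" by (rule symmetric_weightsD(1)[OF wt g])
  consider "envelope (inv g \<otimes> y) \<noteq> 0" | "envelope y \<noteq> 0"
    using y(2) by (cases "envelope y = 0") (simp_all add: envelope_diff_def)
  then show ?thesis
  proof cases
    case 1
    then have "inv g \<otimes> y \<in> U <#> D" using gL y(1) by (intro envelope_nonzero_in) auto
    then have "g \<otimes> (inv g \<otimes> y) \<in> C <#> (U <#> D)"
      using letters_in_C[OF g] unfolding set_mult_def by blast
    then show ?thesis using gL y(1) by (simp add: gleason_region_def)
  next
    case 2
    then show ?thesis using envelope_nonzero_in[OF y(1)] by (simp add: gleason_region_def)
  qed
qed

lemma convolution_envelope_diff:
  assumes "\<eta> \<in> Cc" "g \<in> carrier L" "x \<in> carrier L"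
  shows "convolution (envelope_diff g) \<eta> x =
    convolution envelope \<eta> (inv g \<otimes> x) - convolution envelope \<eta> x"
  using assms unfolding envelope_diff_def[abs_def]
  by (simp add: convolution_left_translate convolution_diff_left Cc_left_translate envelope_Cc)

lemma convolution_envelope_translate_le:
  assumes \<eta>: "\<eta> \<in> Cc" and h: "h \<in> carrier L" and x: "x \<in> carrier L" and \<beta>: "0 \<le> \<beta>"
    and osc: "\<And>y z. y \<in> gleason_region U C D \<Longrightarrow> y \<in> carrier L \<Longrightarrow> z \<in> carrier L \<Longrightarrow>
      \<bar>\<eta> (inv y \<otimes> inv h \<otimes> y \<otimes> z) - \<eta> z\<bar> \<le> \<beta>"
  shows "\<bar>convolution envelope \<eta> (inv h \<otimes> x) - convolution envelope \<eta> x\<bar> \<le> \<beta> * I \<Theta>"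
proof (rule convolution_left_translate_diff_abs_le[OF envelope_Cc \<eta> h x Cc_plus_imp_Cc[OF \<Theta>] \<beta>])
  have region: "y \<in> gleason_region U C D" if "y \<in> carrier L" "envelope y \<noteq> 0" for y
    using envelope_nonzero_in[OF that] by (simp add: gleason_region_def)
  show "\<bar>envelope y\<bar> \<le> \<Theta> y" if "y \<in> carrier L" for y
    using abs_le_mult_\<Theta>[of "envelope y" 1 y] envelope_range[OF that] region[OF that] that by auto
  show "\<bar>\<eta> (inv y \<otimes> inv h \<otimes> y \<otimes> z) - \<eta> z\<bar> \<le> \<beta>"
    if "y \<in> carrier L" "envelope y \<noteq> 0" "z \<in> carrier L" for y z
    using osc region that by blast
qed

lemma convolution_envelope_diff_translate_le:
  assumes g: "wt g w" and \<eta>: "\<eta> \<in> Cc" and h: "h \<in> carrier L" and x: "x \<in> carrier L" and \<beta>: "0 \<le> \<beta>"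
    and osc: "\<And>y z. y \<in> gleason_region U C D \<Longrightarrow> y \<in> carrier L \<Longrightarrow> z \<in> carrier L \<Longrightarrow>
      \<bar>\<eta> (inv y \<otimes> inv h \<otimes> y \<otimes> z) - \<eta> z\<bar> \<le> \<beta>"
  shows "\<bar>convolution (envelope_diff g) \<eta> (inv h \<otimes> x) - convolution (envelope_diff g) \<eta> x\<bar>
    \<le> \<beta> * (w / \<kappa> * I \<Theta>)"
proof -
  have "\<bar>convolution (envelope_diff g) \<eta> (inv h \<otimes> x) - convolution (envelope_diff g) \<eta> x\<bar>
      \<le> \<beta> * I (\<lambda>y. w / \<kappa> * \<Theta> y)"
  proof (rule convolution_left_translate_diff_abs_le[OF _ \<eta> h x _ \<beta>])
    show "envelope_diff g \<in> Cc" by (rule envelope_diff_Cc[OF symmetric_weightsD(1)[OF wt g]])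
    show "(\<lambda>y. w / \<kappa> * \<Theta> y) \<in> Cc" by (rule Cc_scale[OF Cc_plus_imp_Cc[OF \<Theta>]])
    show "\<bar>envelope_diff g y\<bar> \<le> w / \<kappa> * \<Theta> y" if y: "y \<in> carrier L" for y
      using envelope_left_translate_diff_abs_le[OF g y] envelope_diff_nonzero_in[OF g y] y
      by (intro abs_le_mult_\<Theta>) (auto simp: envelope_diff_def)
    show "\<bar>\<eta> (inv y \<otimes> inv h \<otimes> y \<otimes> z) - \<eta> z\<bar> \<le> \<beta>"
      if "y \<in> carrier L" "envelope_diff g y \<noteq> 0" "z \<in> carrier L" for y z
      using osc envelope_diff_nonzero_in[OF g that(1,2)] that by blast
  qed
  then show ?thesis using I_scale[OF Cc_plus_imp_Cc[OF \<Theta>], of "w / \<kappa>"] by simp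
qed

context
  fixes V :: "'a set" and \<epsilon> :: real
  assumes \<epsilon>: "0 \<le> \<epsilon>"
    and osc: "\<And>h y z. h \<in> V \<Longrightarrow> h \<in> carrier L \<Longrightarrow> y \<in> gleason_region U C D \<Longrightarrow> y \<in> carrier L \<Longrightarrow>
      z \<in> carrier L \<Longrightarrow> \<bar>\<theta> (inv (inv y \<otimes> inv h \<otimes> y \<otimes> z)) - \<theta> (inv z)\<bar> \<le> \<epsilon>"
    and power_wt: "wt \<le> power_weights V"
begin

text \<open>Since \<open>g\<close> has weight \<open>1/n\<close> and its first \<open>n\<close> powers lie in \<open>V\<close>, the increment at \<open>g\<close> is
  about \<open>1/n\<close> times the increment at \<open>g^n\<close>.\<close>

lemma convolution_envelope_letter_le:
  assumes g: "wt g w" and x: "x \<in> carrier L"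
  defines "f \<equiv> convolution envelope (\<lambda>x. \<theta> (inv x))"
  shows "\<bar>f (inv g \<otimes> x) - f x\<bar> \<le> w * (2 * I \<Theta> * \<epsilon> / \<kappa>)"
proof -
  have \<eta>: "(\<lambda>x. \<theta> (inv x)) \<in> Cc" by (rule Cc_compose_inv[OF \<theta>])
  have gL: "g \<in> carrier L" and w: "0 < w" using symmetric_weightsD[OF wt g] by auto
  have "power_weights V g w" using power_wt g by auto
  then obtain n where n: "1 \<le> n" "w = 1 / real n" "g \<in> powers_upto_in V n"
    by (auto simp: power_weights_def)
  have gj: "g [^] j \<in> V" "g [^] j \<in> carrier L" if "j \<le> n" for j
    using powers_upto_inD[OF n(3) that] gL by auto
  have "\<bar>f (inv g \<otimes> (inv (g [^] j) \<otimes> x)) - f (inv (g [^] j) \<otimes> x) - (f (inv g \<otimes> x) - f x)\<bar>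
      \<le> \<epsilon> * (w / \<kappa> * I \<Theta>)" if "j < n" for j
    using convolution_envelope_diff_translate_le[OF g \<eta> gj(2) x \<epsilon> osc[OF gj]] that gj(2)[of j] x gL
    by (simp add: convolution_envelope_diff[OF \<eta>] f_def)
  then have "\<bar>f (inv (g [^] n) \<otimes> x) - f x - real n * (f (inv g \<otimes> x) - f x)\<bar>
      \<le> real n * (\<epsilon> * (w / \<kappa> * I \<Theta>))"
    by (rule power_increment_linear[OF gL x])
  also have "\<dots> = \<epsilon> * I \<Theta> / \<kappa>" using n(1,2) by simp
  finally have "\<bar>f (inv (g [^] n) \<otimes> x) - f x - real n * (f (inv g \<otimes> x) - f x)\<bar> \<le> \<epsilon> * I \<Theta> / \<kappa>" .
  moreover have "\<bar>f (inv (g [^] n) \<otimes> x) - f x\<bar> \<le> \<epsilon> * I \<Theta>"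
    unfolding f_def by (rule convolution_envelope_translate_le[OF \<eta> gj(2) x \<epsilon> osc[OF gj]]) auto
  moreover have "\<epsilon> * I \<Theta> \<le> \<epsilon> * I \<Theta> / \<kappa>"
    using mult_left_mono[OF \<kappa>_le_1, of "\<epsilon> * I \<Theta>"] \<epsilon> I_\<Theta>_nonneg \<kappa>_pos by (simp add: le_divide_eq)
  ultimately have "\<bar>real n * (f (inv g \<otimes> x) - f x)\<bar> \<le> 2 * (\<epsilon> * I \<Theta> / \<kappa>)" by linarith
  also have "\<dots> = 2 * I \<Theta> * \<epsilon> / \<kappa>" by simp
  finally have "w * \<bar>real n * (f (inv g \<otimes> x) - f x)\<bar> \<le> w * (2 * I \<Theta> * \<epsilon> / \<kappa>)"
    using w by (intro mult_left_mono) auto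
  then show ?thesis using n(1,2) by (simp add: abs_mult)
qed

lemma convolution_envelope_word_le:
  assumes "weighted_word wt q r" "x \<in> carrier L"
  defines "f \<equiv> convolution envelope (\<lambda>x. \<theta> (inv x))"
  shows "\<bar>f (inv q \<otimes> x) - f x\<bar> \<le> r * (2 * I \<Theta> * \<epsilon> / \<kappa>)"
  using assms(1,2)
proof (induction arbitrary: x rule: weighted_word.induct)
  case weighted_word_one
  then show ?case by simp
next
  case (weighted_word_step g w q r)
  have carrier: "g \<in> carrier L" "q \<in> carrier L"
    using symmetric_weightsD(1)[OF wt weighted_word_step(1)]
      weighted_word_carrier[OF weighted_word_step(2) wt] by auto
  have "inv (g \<otimes> q) \<otimes> x = inv q \<otimes> (inv g \<otimes> x)"
    using carrier weighted_word_step(4) by (simp add: inv_mult_group m_assoc)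
  moreover have "\<bar>f (inv q \<otimes> (inv g \<otimes> x)) - f (inv g \<otimes> x)\<bar> \<le> r * (2 * I \<Theta> * \<epsilon> / \<kappa>)"
    using weighted_word_step(3)[of "inv g \<otimes> x"] carrier weighted_word_step(4) by simp
  moreover have "\<bar>f (inv g \<otimes> x) - f x\<bar> \<le> w * (2 * I \<Theta> * \<epsilon> / \<kappa>)"
    unfolding f_def by (rule convolution_envelope_letter_le[OF weighted_word_step(1,4)])
  ultimately show ?case by (simp only: distrib_right)
qed

lemma weighted_word_factorization:
  assumes q: "weighted_word wt q r" and small: "r * (2 * I \<Theta> * \<epsilon> / \<kappa>) < I (\<lambda>x. \<theta> x * \<theta> x)"
  obtains p s a b where "weighted_word wt p s" "s < \<kappa>" "a \<in> D" "b \<in> D" "q = p \<otimes> a \<otimes> inv b"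
proof -
  let ?\<eta> = "\<lambda>x. \<theta> (inv x)"
  let ?f = "convolution envelope ?\<eta>"
  have \<eta>: "?\<eta> \<in> Cc" by (rule Cc_compose_inv[OF \<theta>])
  have qL: "q \<in> carrier L" by (rule weighted_word_carrier[OF q wt])
  have "\<theta> x * \<theta> x \<le> envelope x * \<theta> (inv (inv x \<otimes> \<one>))" if "x \<in> carrier L" for x
    using \<theta>_le_envelope[OF that] \<theta>_range[OF that] that by (simp add: mult_right_mono)
  then have "I (\<lambda>x. \<theta> x * \<theta> x) \<le> ?f \<one>"
    unfolding convolution_def
    by (intro I_mono convolution_integrand_Cc[OF envelope_Cc \<eta>] Cc_mult \<theta>) auto
  moreover have "\<bar>?f (inv (inv q) \<otimes> \<one>) - ?f \<one>\<bar> \<le> r * (2 * I \<Theta> * \<epsilon> / \<kappa>)"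
    by (rule convolution_envelope_word_le[OF weighted_word_inv[OF wt q] one_closed])
  ultimately have "?f q \<noteq> 0" using qL small by auto
  then obtain y where y: "y \<in> carrier L" "envelope y * \<theta> (inv (inv y \<otimes> q)) \<noteq> 0"
    using convolution_eq_0[OF _ envelope_Cc \<eta> qL] by blast
  obtain p s where p: "weighted_word wt p s" "s < \<kappa>" "\<theta> (inv p \<otimes> y) \<noteq> 0"
    using envelope_support[OF y(1)] y(2) by auto
  have pL: "p \<in> carrier L" by (rule weighted_word_carrier[OF p(1) wt])
  have "inv p \<otimes> y \<in> D" using p(3) pL y(1) by (intro \<theta>_nonzero_in_D) auto
  moreover have "inv q \<otimes> y \<in> D"
    using y qL by (intro \<theta>_nonzero_in_D) (auto simp: inv_mult_group)
  moreover have "q = p \<otimes> (inv p \<otimes> y) \<otimes> inv (inv q \<otimes> y)"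
    using pL qL y(1) by (simp add: inv_mult_group)
  ultimately show ?thesis using that p(1,2) by blast
qed

lemma weight_ball_subset_set_mult:
  assumes D: "D \<subseteq> W'" and W': "nhd_one W'" "symmetric_set W'" "\<And>x y. x \<in> W' \<Longrightarrow> y \<in> W' \<Longrightarrow> x \<otimes> y \<in> W"
    and small: "s * (2 * I \<Theta> * \<epsilon> / \<kappa>) < I (\<lambda>x. \<theta> x * \<theta> x)"
  shows "weight_ball wt s \<subseteq> weight_ball wt \<kappa> <#> W"
proof
  fix q assume "q \<in> weight_ball wt s"
  then obtain r where q: "weighted_word wt q r" "r \<le> s" by (auto simp: weight_ball_def)
  have "r * (2 * I \<Theta> * \<epsilon> / \<kappa>) \<le> s * (2 * I \<Theta> * \<epsilon> / \<kappa>)"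
    using q(2) I_\<Theta>_nonneg \<epsilon> \<kappa>_pos by (intro mult_right_mono) auto
  then have "r * (2 * I \<Theta> * \<epsilon> / \<kappa>) < I (\<lambda>x. \<theta> x * \<theta> x)" using small by linarith
  then obtain p t a b where p: "weighted_word wt p t" "t < \<kappa>" and ab: "a \<in> D" "b \<in> D"
    and q_eq: "q = p \<otimes> a \<otimes> inv b"
    using weighted_word_factorization[OF q(1)] by blast
  have "a \<in> W'" "inv b \<in> W'" using ab D symmetric_setD[OF W'(2)] by auto
  then have "a \<otimes> inv b \<in> W" "a \<in> carrier L" "inv b \<in> carrier L"
    using W'(3) nhd_one_mem_carrier[OF W'(1)] by auto
  moreover have "p \<in> weight_ball wt \<kappa>" using weight_ballI[OF p(1)] p(2) by simp
  moreover have "q = p \<otimes> (a \<otimes> inv b)"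
    using q_eq calculation weighted_word_carrier[OF p(1) wt] by (simp add: m_assoc)
  ultimately show "q \<in> weight_ball wt \<kappa> <#> W" unfolding set_mult_def by blast
qed

end

end

context haar_integral
begin

lemma gleason_oscillation_nhd:
  assumes Y: "compactin T Y" and \<theta>: "\<theta> \<in> Cc" and \<epsilon>: "0 < \<epsilon>"
  obtains V where "nhd_one V" "\<And>h y z. h \<in> V \<Longrightarrow> y \<in> Y \<Longrightarrow> z \<in> carrier L \<Longrightarrow>
    \<bar>\<theta> (inv (inv y \<otimes> inv h \<otimes> y \<otimes> z)) - \<theta> (inv z)\<bar> \<le> \<epsilon>"
proof -
  obtain V1 where V1: "nhd_one V1" "symmetric_set V1"
      "\<And>x z. x \<in> carrier L \<Longrightarrow> z \<in> V1 \<Longrightarrow> \<bar>\<theta> (inv (z \<otimes> x)) - \<theta> (inv x)\<bar> < \<epsilon>"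
    using Cc_left_modulus[OF Cc_compose_inv[OF \<theta>] \<epsilon>] by blast
  obtain V2 where V2: "nhd_one V2" "\<And>y h. y \<in> Y \<Longrightarrow> h \<in> V2 \<Longrightarrow> inv y \<otimes> h \<otimes> y \<in> V1"
    using nhd_one_conjugate[OF Y V1(1)] by blast
  obtain V where V: "nhd_one V" "symmetric_set V" "V \<subseteq> V2" using symmetric_nhd_one[OF V2(1)] .
  have "\<bar>\<theta> (inv (inv y \<otimes> inv h \<otimes> y \<otimes> z)) - \<theta> (inv z)\<bar> \<le> \<epsilon>"
    if "h \<in> V" "y \<in> Y" "z \<in> carrier L" for h y z
    using V1(3)[OF that(3) V2(2)[OF that(2)], of "inv h"] symmetric_setD[OF V(2) that(1)] V(3)
    by (auto simp: less_imp_le)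
  then show ?thesis using that V(1) by blast
qed

lemma gleason_data_exist:
  assumes U: "compactin T U" and C: "compactin T C" and W: "nhd_one W"
  obtains \<theta> D \<Theta> where "\<theta> \<in> Cc" "\<And>x. x \<in> carrier L \<Longrightarrow> \<theta> x \<in> {0..1}" "\<theta> \<one> = 1"
    "compactin T D" "D \<subseteq> W" "\<And>x. x \<in> carrier L \<Longrightarrow> x \<notin> D \<Longrightarrow> \<theta> x = 0"
    "\<Theta> \<in> Cc_plus" "\<And>y. y \<in> gleason_region U C D \<Longrightarrow> 1 \<le> \<Theta> y" "compactin T (gleason_region U C D)"
proof -
  obtain \<theta> :: "'a \<Rightarrow> real" and D where \<theta>: "continuous_map T euclideanreal \<theta>" "compactin T D" "D \<subseteq> W"
      "\<theta> \<in> carrier L \<rightarrow> {0..1}" "\<theta> \<one> = 1" "\<And>x. x \<in> carrier L \<Longrightarrow> x \<notin> D \<Longrightarrow> \<theta> x = 0"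
    using bump_function_exists[OF W] by blast
  have region: "compactin T (gleason_region U C D)"
    unfolding gleason_region_def by (intro compactin_Un compactin_set_mult U C \<theta>(2))
  obtain \<Theta> where "\<Theta> \<in> Cc_plus" "\<And>y. y \<in> gleason_region U C D \<Longrightarrow> 1 \<le> \<Theta> y"
    using Cc_plus_ge_one_on_compact[OF region] by blast
  then show ?thesis using that[of \<theta> D \<Theta>] \<theta> CcI[OF \<theta>(1,2,6)] region by blast
qed

lemma gleason_bump_of_power_weights:
  assumes wt: "symmetric_weights wt" "wt \<le> power_weights W" "W \<subseteq> C"
    and \<kappa>: "0 < \<kappa>" "\<kappa> \<le> 1" and U: "compactin T U" "weight_ball wt \<kappa> \<subseteq> U"
    and \<theta>: "\<theta> \<in> Cc" "\<And>x. x \<in> carrier L \<Longrightarrow> \<theta> x \<in> {0..1}"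
    and D: "compactin T D" "\<And>x. x \<in> carrier L \<Longrightarrow> x \<notin> D \<Longrightarrow> \<theta> x = 0"
    and \<Theta>: "\<Theta> \<in> Cc_plus" "\<And>y. y \<in> gleason_region U C D \<Longrightarrow> 1 \<le> \<Theta> y"
  shows "gleason_bump L T I wt \<kappa> \<theta> \<Theta> U C D"
proof unfold_locales
  show "q \<in> U" if "weighted_word wt q r" "r < \<kappa>" for q r
    using weight_ballI[OF that(1), of \<kappa>] that(2) U(2) by auto
  show "g \<in> C" if "wt g w" for g w
  proof -
    have "power_weights W g w" using wt(2) that by auto
    then show ?thesis using powers_upto_in_mem wt(3) by (fastforce simp: power_weights_def)
  qed
qed (fact wt(1) \<kappa> \<theta> U(1) D \<Theta>)+

end

lemma (in lc_group) weight_ball_doubling: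
  assumes U: "compactin T U" and W: "nhd_one W" and \<tau>: "0 < \<tau>" "\<tau> \<le> 1"
  obtains V where "nhd_one V" "\<And>wt \<rho>. symmetric_weights wt \<Longrightarrow> wt \<le> power_weights V \<Longrightarrow>
    0 < \<rho> \<Longrightarrow> \<rho> \<le> 1 \<Longrightarrow> weight_ball wt \<rho> \<subseteq> U \<Longrightarrow> weight_ball wt (2 * \<rho>) \<subseteq> weight_ball wt (\<tau> * \<rho>) <#> W"
proof -
  obtain I where "haar_integral L T I" by (rule haar_integral_exists)
  then interpret haar_integral L T I .
  obtain W1 where W1: "nhd_one W1" "symmetric_set W1" "W1 \<subseteq> W"
      "\<And>x y. x \<in> W1 \<Longrightarrow> y \<in> W1 \<Longrightarrow> x \<otimes> y \<in> W"
    using mult_nhd_one[OF W] by blast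
  obtain W0 C where C: "nhd_one W0" "compactin T C" "W0 \<subseteq> C" "C \<subseteq> carrier L"
    using compact_nhd_one[OF nhd_one_univ] .
  obtain \<theta> D \<Theta> where \<theta>: "\<theta> \<in> Cc" "\<And>x. x \<in> carrier L \<Longrightarrow> \<theta> x \<in> {0..1}" "\<theta> \<one> = 1"
    and D: "compactin T D" "D \<subseteq> W1" "\<And>x. x \<in> carrier L \<Longrightarrow> x \<notin> D \<Longrightarrow> \<theta> x = 0"
    and \<Theta>: "\<Theta> \<in> Cc_plus" "\<And>y. y \<in> gleason_region U C D \<Longrightarrow> 1 \<le> \<Theta> y"
    and region: "compactin T (gleason_region U C D)"
    using gleason_data_exist[OF U C(2) W1(1)] by blast
  have I\<Theta>: "0 \<le> I \<Theta>" by (rule I_nonneg[OF \<Theta>(1)])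
  have mass: "0 < I (\<lambda>x. \<theta> x * \<theta> x)"
    using \<theta> by (intro I_pos[of _ \<one>] Cc_plusI Cc_mult) auto
  define M where "M = I \<Theta> + 1"
  define \<epsilon> where "\<epsilon> = I (\<lambda>x. \<theta> x * \<theta> x) * \<tau> / (4 * M)"
  have M: "I \<Theta> < M" "0 < M" using I\<Theta> by (auto simp: M_def)
  then have \<epsilon>: "0 < \<epsilon>" unfolding \<epsilon>_def using mass \<tau> by simp
  obtain V1 where V1: "nhd_one V1" "\<And>h y z. h \<in> V1 \<Longrightarrow> y \<in> gleason_region U C D \<Longrightarrow> z \<in> carrier L \<Longrightarrow>
      \<bar>\<theta> (inv (inv y \<otimes> inv h \<otimes> y \<otimes> z)) - \<theta> (inv z)\<bar> \<le> \<epsilon>"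
    using gleason_oscillation_nhd[OF region \<theta>(1) \<epsilon>] by blast
  have "4 * I \<Theta> * \<epsilon> / \<tau> = I (\<lambda>x. \<theta> x * \<theta> x) * (I \<Theta> / M)" using \<tau> M by (simp add: \<epsilon>_def)
  also have "\<dots> < I (\<lambda>x. \<theta> x * \<theta> x) * 1" using mass M by (intro mult_strict_left_mono) auto
  finally have small: "4 * I \<Theta> * \<epsilon> / \<tau> < I (\<lambda>x. \<theta> x * \<theta> x)" by simp
  have "weight_ball wt (2 * \<rho>) \<subseteq> weight_ball wt (\<tau> * \<rho>) <#> W"
    if weights: "symmetric_weights wt" "wt \<le> power_weights (V1 \<inter> W0)"
      and \<rho>: "0 < \<rho>" "\<rho> \<le> 1" and ball: "weight_ball wt \<rho> \<subseteq> U" for wt \<rho>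
  proof -
    have scale: "0 < \<tau> * \<rho>" "\<tau> * \<rho> \<le> \<rho>" "\<tau> * \<rho> \<le> 1"
      using \<tau> \<rho> by (auto simp: mult_left_le_one_le mult_le_one)
    have "wt \<le> power_weights W0" using weights(2) power_weights_mono[of "V1 \<inter> W0" W0] by auto
    moreover have "weight_ball wt (\<tau> * \<rho>) \<subseteq> U" using weight_ball_mono[OF scale(2)] ball by blast
    ultimately interpret gleason_bump L T I wt "\<tau> * \<rho>" \<theta> \<Theta> U C D
      by (rule gleason_bump_of_power_weights[OF weights(1) _ C(3) scale(1,3) U _ \<theta>(1,2) D(1,3) \<Theta>])
    have "wt \<le> power_weights V1" using weights(2) power_weights_mono[of "V1 \<inter> W0" V1] by auto
    moreover have "2 * \<rho> * (2 * I \<Theta> * \<epsilon> / (\<tau> * \<rho>)) < I (\<lambda>x. \<theta> x * \<theta> x)" using small \<rho>(1) by simp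
    ultimately show ?thesis
      using weight_ball_subset_set_mult[OF less_imp_le[OF \<epsilon>] V1(2) _ D(2) W1(1,2,4)] by blast
  qed
  then show ?thesis using that nhd_one_Int[OF V1(1) C(1)] by blast
qed

section \<open>Trapping products of elements with small powers\<close>

locale shrinking_weights = lc_group +
  fixes F :: "'i filter" and wt :: "'i \<Rightarrow> 'a \<Rightarrow> real \<Rightarrow> bool"
  assumes F: "ultrafilter F" and symmetric_wt: "\<And>i. symmetric_weights (wt i)"
    and shrinking: "\<And>V. nhd_one V \<Longrightarrow> eventually (\<lambda>i. wt i \<le> power_weights V) F"
begin

text \<open>The elements that are limits of words of weight \<open>o(\<rho>)\<close>.\<close>

definition limit_subgroup :: "('i \<Rightarrow> real) \<Rightarrow> 'a set" where
  "limit_subgroup \<rho> = {p \<in> carrier L. \<forall>t>0. \<forall>S. openin T S \<longrightarrow> p \<in> S \<longrightarrow>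
     eventually (\<lambda>i. weight_ball (wt i) (t * \<rho> i) \<inter> S \<noteq> {}) F}"

lemma limit_subgroup_carrier: "p \<in> limit_subgroup \<rho> \<Longrightarrow> p \<in> carrier L"
  by (simp add: limit_subgroup_def)

lemma limit_subgroupI:
  assumes "p \<in> carrier L"
    and "\<And>t S. 0 < t \<Longrightarrow> openin T S \<Longrightarrow> p \<in> S \<Longrightarrow>
      eventually (\<lambda>i. weight_ball (wt i) (t * \<rho> i) \<inter> S \<noteq> {}) F"
  shows "p \<in> limit_subgroup \<rho>"
  using assms by (simp add: limit_subgroup_def)

lemma limit_subgroupD:
  assumes "p \<in> limit_subgroup \<rho>" "0 < t" "openin T S" "p \<in> S"
  shows "eventually (\<lambda>i. weight_ball (wt i) (t * \<rho> i) \<inter> S \<noteq> {}) F"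
  using assms by (simp add: limit_subgroup_def)

lemma limit_subgroup_mono:
  assumes le: "\<And>i. \<rho> i \<le> \<rho>' i"
  shows "limit_subgroup \<rho> \<subseteq> limit_subgroup \<rho>'"
proof
  fix p assume p: "p \<in> limit_subgroup \<rho>"
  show "p \<in> limit_subgroup \<rho>'"
  proof (rule limit_subgroupI[OF limit_subgroup_carrier[OF p]])
    fix t :: real and S assume S: "0 < t" "openin T S" "p \<in> S"
    have "weight_ball (wt i) (t * \<rho> i) \<subseteq> weight_ball (wt i) (t * \<rho>' i)" for i
      using le S(1) by (intro weight_ball_mono) simp
    then show "eventually (\<lambda>i. weight_ball (wt i) (t * \<rho>' i) \<inter> S \<noteq> {}) F"
      by (intro eventually_mono[OF limit_subgroupD[OF p S]]) blast
  qed
qed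

lemma limit_subgroup_subset_closure_of:
  assumes ball: "eventually (\<lambda>i. weight_ball (wt i) (\<rho> i) \<subseteq> A) F"
  shows "limit_subgroup \<rho> \<subseteq> T closure_of A"
proof
  fix p assume p: "p \<in> limit_subgroup \<rho>"
  have "\<exists>y. y \<in> A \<and> y \<in> S" if S: "p \<in> S" "openin T S" for S
  proof -
    have "eventually (\<lambda>i. weight_ball (wt i) (1 * \<rho> i) \<inter> S \<noteq> {}) F"
      by (rule limit_subgroupD[OF p zero_less_one S(2,1)])
    with ball have "eventually (\<lambda>i. A \<inter> S \<noteq> {}) F" by eventually_elim auto
    then show ?thesis using ultrafilter_not_bot[OF F] by (auto simp: eventually_const_iff)
  qed
  then show "p \<in> T closure_of A" using limit_subgroup_carrier[OF p] by (simp add: in_closure_of)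
qed

lemma closedin_limit_subgroup: "closedin T (limit_subgroup \<rho>)"
proof -
  have "T closure_of limit_subgroup \<rho> \<subseteq> limit_subgroup \<rho>"
  proof
    fix p assume p: "p \<in> T closure_of limit_subgroup \<rho>"
    show "p \<in> limit_subgroup \<rho>"
    proof (rule limit_subgroupI)
      show "p \<in> carrier L" using p by (simp add: in_closure_of)
      fix t :: real and S assume S: "0 < t" "openin T S" "p \<in> S"
      then obtain y where "y \<in> limit_subgroup \<rho>" "y \<in> S" using p by (meson in_closure_of)
      then show "eventually (\<lambda>i. weight_ball (wt i) (t * \<rho> i) \<inter> S \<noteq> {}) F"
        using S by (intro limit_subgroupD)
    qed
  qed
  moreover have "limit_subgroup \<rho> \<subseteq> topspace T" using limit_subgroup_carrier by auto
  ultimately show ?thesis using closure_of_subset_eq[of "limit_subgroup \<rho>" T] by auto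
qed

lemma limit_subgroup_one:
  assumes \<rho>: "\<And>i. 0 < \<rho> i"
  shows "\<one> \<in> limit_subgroup \<rho>"
proof (rule limit_subgroupI)
  fix t :: real and S assume "0 < t" "openin T S" "\<one> \<in> S"
  then have "\<one> \<in> weight_ball (wt i) (t * \<rho> i) \<inter> S" for i
    using \<rho>[of i] by (auto intro!: weight_ball_one)
  then show "eventually (\<lambda>i. weight_ball (wt i) (t * \<rho> i) \<inter> S \<noteq> {}) F"
    by (intro always_eventually) blast
qed simp

lemma limit_subgroup_inv:
  assumes a: "a \<in> limit_subgroup \<rho>"
  shows "inv a \<in> limit_subgroup \<rho>"
proof (rule limit_subgroupI)
  have aL: "a \<in> carrier L" by (rule limit_subgroup_carrier[OF a])
  then show "inv a \<in> carrier L" by simp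
  fix t :: real and S assume t: "0 < t" and S: "openin T S" "inv a \<in> S"
  have "eventually (\<lambda>i. weight_ball (wt i) (t * \<rho> i) \<inter> {x \<in> carrier L. inv x \<in> S} \<noteq> {}) F"
    using aL S by (intro limit_subgroupD[OF a t] openin_preimage[OF cont_inv]) auto
  then show "eventually (\<lambda>i. weight_ball (wt i) (t * \<rho> i) \<inter> S \<noteq> {}) F"
    by eventually_elim (use weight_ball_inv[OF symmetric_wt] in blast)
qed

lemma limit_subgroup_mult:
  assumes a: "a \<in> limit_subgroup \<rho>" and b: "b \<in> limit_subgroup \<rho>"
  shows "a \<otimes> b \<in> limit_subgroup \<rho>"
proof (rule limit_subgroupI)
  have carrier: "a \<in> carrier L" "b \<in> carrier L" using a b limit_subgroup_carrier by auto
  then show "a \<otimes> b \<in> carrier L" by simp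
  fix t :: real and S assume t: "0 < t" and S: "openin T S" "a \<otimes> b \<in> S"
  obtain A B where AB: "openin T A" "openin T B" "a \<in> A" "b \<in> B"
      "\<And>x y. x \<in> A \<Longrightarrow> y \<in> B \<Longrightarrow> x \<otimes> y \<in> S"
    using mult_open_nhds[OF S(1) carrier S(2)] by blast
  have "0 < t / 2" using t by simp
  note half = limit_subgroupD[OF a this AB(1,3)] limit_subgroupD[OF b this AB(2,4)]
  from half show "eventually (\<lambda>i. weight_ball (wt i) (t * \<rho> i) \<inter> S \<noteq> {}) F"
  proof eventually_elim
    case (elim i)
    then obtain x y where "x \<in> weight_ball (wt i) (t / 2 * \<rho> i)" "x \<in> A"
        "y \<in> weight_ball (wt i) (t / 2 * \<rho> i)" "y \<in> B"
      by blast
    then have "x \<otimes> y \<in> weight_ball (wt i) (t / 2 * \<rho> i + t / 2 * \<rho> i) \<inter> S"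
      using AB(5) weight_ball_mult[OF symmetric_wt] by blast
    then show ?case by auto
  qed
qed

lemma subgroup_limit_subgroup: "(\<And>i. 0 < \<rho> i) \<Longrightarrow> subgroup (limit_subgroup \<rho>) L"
  using limit_subgroup_one[of \<rho>] limit_subgroup_inv limit_subgroup_mult limit_subgroup_carrier
  by (intro subgroupI) auto

lemma not_in_limit_subgroup_imp_avoids:
  assumes "p \<notin> limit_subgroup \<rho>" "p \<in> carrier L"
  shows "\<exists>t S. 0 < t \<and> openin T S \<and> p \<in> S \<and>
    eventually (\<lambda>i. weight_ball (wt i) (t * \<rho> i) \<inter> S = {}) F"
proof -
  obtain t S where "0 < t" "openin T S" "p \<in> S"
      "\<not> eventually (\<lambda>i. weight_ball (wt i) (t * \<rho> i) \<inter> S \<noteq> {}) F"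
    using limit_subgroupI assms by blast
  then show ?thesis using ultrafilter_not_eventually[OF F] by auto
qed

lemma weight_ball_avoids_compact:
  assumes Y: "compactin T Y" "Y \<inter> limit_subgroup \<rho> = {}" and \<rho>: "\<And>i. 0 < \<rho> i"
  obtains \<tau> where "0 < \<tau>" "\<tau> \<le> 1" "eventually (\<lambda>i. weight_ball (wt i) (\<tau> * \<rho> i) \<inter> Y = {}) F"
proof -
  have "\<forall>p\<in>Y. \<exists>t S. 0 < t \<and> openin T S \<and> p \<in> S \<and>
      eventually (\<lambda>i. weight_ball (wt i) (t * \<rho> i) \<inter> S = {}) F"
    using Y(2) compactin_carrier[OF Y(1)] by (intro ballI not_in_limit_subgroup_imp_avoids) auto
  then obtain t where "\<forall>p\<in>Y. \<exists>S. 0 < t p \<and> openin T S \<and> p \<in> S \<and>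
      eventually (\<lambda>i. weight_ball (wt i) (t p * \<rho> i) \<inter> S = {}) F"
    by (rule exE[OF bchoice])
  then obtain S where tS: "\<forall>p\<in>Y. 0 < t p \<and> openin T (S p) \<and> p \<in> S p \<and>
      eventually (\<lambda>i. weight_ball (wt i) (t p * \<rho> i) \<inter> S p = {}) F"
    by (rule exE[OF bchoice])
  obtain P where P: "finite P" "P \<subseteq> Y" "Y \<subseteq> \<Union>(S ` P)"
    using compactin_finite_subcover[OF Y(1), of S] tS by blast
  define \<tau> where "\<tau> = Min (insert 1 (t ` P))"
  have \<tau>: "0 < \<tau>" "\<tau> \<le> 1" "\<And>p. p \<in> P \<Longrightarrow> \<tau> \<le> t p"
    unfolding \<tau>_def using P tS by (auto simp: Min_gr_iff)
  have "eventually (\<lambda>i. \<forall>p\<in>P. weight_ball (wt i) (t p * \<rho> i) \<inter> S p = {}) F"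
    using P tS by (intro eventually_ball_finite) auto
  then have "eventually (\<lambda>i. weight_ball (wt i) (\<tau> * \<rho> i) \<inter> Y = {}) F"
  proof eventually_elim
    case (elim i)
    have "weight_ball (wt i) (\<tau> * \<rho> i) \<subseteq> weight_ball (wt i) (t p * \<rho> i)" if "p \<in> P" for p
      using \<tau>(3)[OF that] \<rho>[of i] by (intro weight_ball_mono mult_right_mono) auto
    then show ?case using elim P(3) by blast
  qed
  then show ?thesis by (rule that[OF \<tau>(1,2)])
qed

lemma small_weight_ball_near_limit_subgroup:
  assumes U: "compactin T U" and ball: "\<And>i. weight_ball (wt i) (\<rho> i) \<subseteq> U" and \<rho>: "\<And>i. 0 < \<rho> i"
    and W: "nhd_one W"
  obtains \<tau> where "0 < \<tau>" "\<tau> \<le> 1"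
    "eventually (\<lambda>i. weight_ball (wt i) (\<tau> * \<rho> i) \<subseteq> limit_subgroup \<rho> <#> W) F"
proof -
  let ?HW = "limit_subgroup \<rho> <#> W"
  have HL: "limit_subgroup \<rho> \<subseteq> carrier L" using limit_subgroup_carrier by auto
  have "openin T ?HW" by (rule openin_set_mult_right[OF HL nhd_one_openin[OF W]])
  then have "compactin T (U - ?HW)"
    using closed_compactin[OF U, of "U - ?HW"] closedin_diff[OF compactin_closedin[OF U]] by auto
  moreover have "(U - ?HW) \<inter> limit_subgroup \<rho> = {}"
    using subset_set_mult_right_nhd_one[OF HL W] by blast
  ultimately obtain \<tau> where \<tau>: "0 < \<tau>" "\<tau> \<le> 1"
      and avoids: "eventually (\<lambda>i. weight_ball (wt i) (\<tau> * \<rho> i) \<inter> (U - ?HW) = {}) F"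
    by (rule weight_ball_avoids_compact[OF _ _ \<rho>])
  have "weight_ball (wt i) (\<tau> * \<rho> i) \<subseteq> U" for i
    using weight_ball_mono[of "\<tau> * \<rho> i" "\<rho> i" "wt i"] ball[of i] \<tau>(2) \<rho>[of i] by auto
  then have "eventually (\<lambda>i. weight_ball (wt i) (\<tau> * \<rho> i) \<subseteq> ?HW) F"
    by (intro eventually_mono[OF avoids]) blast
  then show ?thesis by (rule that[OF \<tau>])
qed

lemma double_weight_ball_near_limit_subgroup:
  assumes U: "compactin T U" and ball: "\<And>i. weight_ball (wt i) (\<rho> i) \<subseteq> U"
    and \<rho>: "\<And>i. 0 < \<rho> i" "\<And>i. \<rho> i \<le> 1" and W: "nhd_one W"
  shows "eventually (\<lambda>i. weight_ball (wt i) (2 * \<rho> i) \<subseteq> limit_subgroup \<rho> <#> W) F"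
proof -
  obtain W1 where W1: "nhd_one W1" "symmetric_set W1" "W1 \<subseteq> W" "\<And>x y. x \<in> W1 \<Longrightarrow> y \<in> W1 \<Longrightarrow> x \<otimes> y \<in> W"
    using mult_nhd_one[OF W] by blast
  obtain \<tau> where \<tau>: "0 < \<tau>" "\<tau> \<le> 1"
    and small: "eventually (\<lambda>i. weight_ball (wt i) (\<tau> * \<rho> i) \<subseteq> limit_subgroup \<rho> <#> W1) F"
    using small_weight_ball_near_limit_subgroup[OF U ball \<rho>(1) W1(1)] .
  obtain V where V: "nhd_one V"
    and doubling: "\<And>wt \<rho>. symmetric_weights wt \<Longrightarrow> wt \<le> power_weights V \<Longrightarrow> 0 < \<rho> \<Longrightarrow> \<rho> \<le> 1 \<Longrightarrow>
      weight_ball wt \<rho> \<subseteq> U \<Longrightarrow> weight_ball wt (2 * \<rho>) \<subseteq> weight_ball wt (\<tau> * \<rho>) <#> W1"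
    using weight_ball_doubling[OF U W1(1) \<tau>] by blast
  have HL: "limit_subgroup \<rho> \<subseteq> carrier L" using limit_subgroup_carrier by auto
  have W1_W: "W1 <#> W1 \<subseteq> W" using W1(4) by (auto simp: set_mult_def)
  from small shrinking[OF V] show ?thesis
  proof eventually_elim
    case (elim i)
    have "weight_ball (wt i) (2 * \<rho> i) \<subseteq> weight_ball (wt i) (\<tau> * \<rho> i) <#> W1"
      by (rule doubling[OF symmetric_wt elim(2) \<rho> ball])
    also have "\<dots> \<subseteq> (limit_subgroup \<rho> <#> W1) <#> W1" by (rule mono_set_mult[OF elim(1) order_refl])
    also have "\<dots> = limit_subgroup \<rho> <#> (W1 <#> W1)"
      using HL nhd_one_carrier[OF W1(1)] by (intro set_mult_assoc) auto
    also have "\<dots> \<subseteq> limit_subgroup \<rho> <#> W" by (rule mono_set_mult[OF order_refl W1_W])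
    finally show ?case .
  qed
qed

end

lemma halving_scale:
  fixes a b :: real
  assumes "\<not> P a" "0 < a" "0 < b" and small: "\<And>r. 0 < r \<Longrightarrow> r < b \<Longrightarrow> P r"
  obtains R where "0 < R" "R \<le> a" "P R" "\<not> P (2 * R)"
proof -
  obtain n where "a / b < 2 ^ n" using real_arch_pow[of 2 "a / b"] by auto
  then have "a / 2 ^ n < b" using assms(3) by (simp add: field_simps)
  then have ex: "\<exists>k. P (a / 2 ^ k)" using assms by (intro exI[of _ n]) auto
  define k where "k = (LEAST k. P (a / 2 ^ k))"
  have P_k: "P (a / 2 ^ k)" unfolding k_def by (rule LeastI_ex[OF ex])
  then obtain m where m: "k = Suc m" using assms(1) by (cases k) auto
  have "\<not> P (a / 2 ^ m)" using not_less_Least[of m "\<lambda>k. P (a / 2 ^ k)"] m by (simp add: k_def)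
  then have "\<not> P (2 * (a / 2 ^ k))" by (simp add: m)
  moreover have "a / 2 ^ k \<le> a" using assms(2) by (simp add: divide_le_eq)
  ultimately show ?thesis using that[of "a / 2 ^ k"] P_k assms(2) by simp
qed

context top_group
begin

lemma powers_upto_in_inv: "symmetric_set V \<Longrightarrow> x \<in> powers_upto_in V n \<Longrightarrow> inv x \<in> powers_upto_in V n"
  by (auto simp: powers_upto_in_def symmetric_set_def nat_pow_inv)

lemma symmetric_power_weights: "symmetric_set V \<Longrightarrow> symmetric_weights (power_weights V)"
  using powers_upto_in_inv powers_upto_in_carrier
  by (fastforce simp: symmetric_weights_def power_weights_def)

end

context group
begin

definition weights_above :: "real \<Rightarrow> ('a \<Rightarrow> real \<Rightarrow> bool) \<Rightarrow> 'a \<Rightarrow> real \<Rightarrow> bool" where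
  "weights_above \<delta> wt g w \<longleftrightarrow> wt g w \<and> \<delta> \<le> w"

lemma symmetric_weights_above: "symmetric_weights wt \<Longrightarrow> symmetric_weights (weights_above \<delta> wt)"
  by (fastforce simp: symmetric_weights_def weights_above_def)

lemma weights_above_le: "weights_above \<delta> wt \<le> wt"
  by (auto simp: weights_above_def)

lemma weights_above_antimono: "\<delta> \<le> \<epsilon> \<Longrightarrow> weights_above \<epsilon> wt \<le> weights_above \<delta> wt"
  by (auto simp: weights_above_def)

lemma weighted_word_above:
  assumes q: "weighted_word wt q r" and wt: "symmetric_weights wt"
  obtains \<delta> where "0 < \<delta>" "weighted_word (weights_above \<delta> wt) q r"
proof -
  have "\<exists>\<delta>>0. weighted_word (weights_above \<delta> wt) q r"
    using q
  proof (induction rule: weighted_word.induct)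
    case weighted_word_one
    then show ?case using weighted_word.weighted_word_one zero_less_one by blast
  next
    case (weighted_word_step g w q r)
    then obtain \<delta> where \<delta>: "0 < \<delta>" "weighted_word (weights_above \<delta> wt) q r" by blast
    have "weighted_word (weights_above (min \<delta> w) wt) q r"
      by (rule weighted_word_mono[OF \<delta>(2) weights_above_antimono]) simp
    moreover have "weights_above (min \<delta> w) wt g w"
      using weighted_word_step(1) by (simp add: weights_above_def)
    moreover have "0 < min \<delta> w"
      using \<delta>(1) symmetric_weightsD(2)[OF wt weighted_word_step(1)] by simp
    ultimately show ?case using weighted_word.weighted_word_step by blast
  qed
  then show ?thesis using that by blast
qed

lemma weight_ball_weights_above:
  assumes wt: "symmetric_weights wt" and r: "r < \<delta>"
  shows "weight_ball (weights_above \<delta> wt) r \<subseteq> {\<one>}"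
proof -
  have "q = \<one> \<or> \<delta> \<le> s" if "weighted_word (weights_above \<delta> wt) q s" for q s
    using that
  proof (cases rule: weighted_word.cases)
    case (weighted_word_step g w p t)
    then show ?thesis
      using weighted_word_nonneg[OF _ symmetric_weights_above[OF wt]]
      by (force simp: weights_above_def)
  qed simp
  then show ?thesis using r by (fastforce simp: weight_ball_def)
qed

lemma escaping_weights_exist:
  assumes wt: "symmetric_weights wt" and U: "\<one> \<in> U" "\<not> weight_ball wt 1 \<subseteq> U"
  obtains wt' \<delta> R where "symmetric_weights wt'" "wt' \<le> wt"
    "0 < \<delta>" "\<And>r. r < \<delta> \<Longrightarrow> weight_ball wt' r \<subseteq> {\<one>}"
    "0 < R" "R \<le> 1" "weight_ball wt' R \<subseteq> U" "\<not> weight_ball wt' (2 * R) \<subseteq> U"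
proof -
  obtain q r where q: "weighted_word wt q r" "r \<le> 1" "q \<notin> U"
    using U(2) by (auto simp: weight_ball_def)
  obtain \<delta> where \<delta>: "0 < \<delta>" "weighted_word (weights_above \<delta> wt) q r"
    by (rule weighted_word_above[OF q(1) wt])
  let ?wt = "weights_above \<delta> wt"
  note trivial = weight_ball_weights_above[OF wt]
  have "\<not> weight_ball ?wt 1 \<subseteq> U" using weight_ballI[OF \<delta>(2) q(2)] q(3) by blast
  moreover have "weight_ball ?wt r \<subseteq> U" if "r < \<delta>" for r using trivial[OF that] U(1) by blast
  ultimately obtain R where "0 < R" "R \<le> 1" "weight_ball ?wt R \<subseteq> U" "\<not> weight_ball ?wt (2 * R) \<subseteq> U"
    using halving_scale[of "\<lambda>r. weight_ball ?wt r \<subseteq> U" 1 \<delta>] \<delta>(1) by auto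
  then show ?thesis
    using that[OF symmetric_weights_above[OF wt, of \<delta>] weights_above_le \<delta>(1) trivial] by blast
qed

end

lemma (in lc_group) set_mult_closure_subset:
  assumes K: "subgroup K L" "compactin T K" and W: "nhd_one W"
  obtains S where "nhd_one S" "T closure_of (S <#> K) \<subseteq> W <#> K"
proof -
  have KL: "K \<subseteq> carrier L" by (rule subgroup.subset[OF K(1)])
  obtain S where S: "nhd_one S" "symmetric_set S" "S \<subseteq> W" "\<And>x y. x \<in> S \<Longrightarrow> y \<in> S \<Longrightarrow> x \<otimes> y \<in> W"
    using mult_nhd_one[OF W] by blast
  have SL: "S \<subseteq> carrier L" by (rule nhd_one_carrier[OF S(1)])
  have "openin T (S <#> K)" by (rule openin_set_mult_left[OF KL nhd_one_openin[OF S(1)]])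
  then obtain W' where W': "nhd_one W'" "K <#> W' \<subseteq> S <#> K"
    using compactin_set_mult_nhd_one[OF K(2) _ subset_set_mult_left_nhd_one[OF KL S(1)]] by blast
  have SS: "S <#> S \<subseteq> W" using S(4) by (auto simp: set_mult_def)
  have "T closure_of (S <#> K) \<subseteq> (S <#> K) <#> W'"
    by (rule closure_of_subset_set_mult[OF set_mult_closed[OF SL KL] W'(1)])
  also have "\<dots> = S <#> (K <#> W')" by (rule set_mult_assoc[OF SL KL nhd_one_carrier[OF W'(1)]])
  also have "\<dots> \<subseteq> S <#> (S <#> K)" by (rule mono_set_mult[OF order_refl W'(2)])
  also have "\<dots> = (S <#> S) <#> K" by (rule set_mult_assoc[symmetric, OF SL SL KL])
  also have "\<dots> \<subseteq> W <#> K" by (rule mono_set_mult[OF SS order_refl])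
  finally show ?thesis by (rule that[OF S(1)])
qed

locale escaping_weights = shrinking_weights L T F wt
  for L (structure) and T and F :: "'i filter" and wt :: "'i \<Rightarrow> 'a \<Rightarrow> real \<Rightarrow> bool" +
  fixes U :: "'a set" and \<delta> R :: "'i \<Rightarrow> real"
  assumes compact_U: "compactin T U"
    and \<delta>_pos: "\<And>i. 0 < \<delta> i" and small_ball: "\<And>i r. r < \<delta> i \<Longrightarrow> weight_ball (wt i) r \<subseteq> {\<one>}"
    and R_pos: "\<And>i. 0 < R i" and R_le_1: "\<And>i. R i \<le> 1"
    and ball_R: "\<And>i. weight_ball (wt i) (R i) \<subseteq> U"
    and escape: "\<And>i. \<not> weight_ball (wt i) (2 * R i) \<subseteq> U"
begin

lemma double_ball_near:
  assumes "\<And>i. 0 < \<rho> i" "\<And>i. \<rho> i \<le> R i" "nhd_one W"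
  shows "eventually (\<lambda>i. weight_ball (wt i) (2 * \<rho> i) \<subseteq> limit_subgroup \<rho> <#> W) F"
proof (rule double_weight_ball_near_limit_subgroup[OF compact_U _ assms(1) _ assms(3)])
  show "weight_ball (wt i) (\<rho> i) \<subseteq> U" for i
    using weight_ball_mono[OF assms(2), of "wt i" i] ball_R[of i] by blast
  show "\<rho> i \<le> 1" for i using assms(2)[of i] R_le_1[of i] by linarith
qed

lemma compactin_limit_subgroup_R: "compactin T (limit_subgroup R)"
proof -
  have "limit_subgroup R \<subseteq> T closure_of U"
    using ball_R by (intro limit_subgroup_subset_closure_of) simp
  then have "limit_subgroup R \<subseteq> U"
    using closure_of_closedin[OF compactin_closedin[OF compact_U]] by simp
  then show ?thesis by (rule closed_compactin[OF compact_U _ closedin_limit_subgroup])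
qed

lemma not_limit_subgroup_R_subset:
  assumes N: "nhd_one N" "N \<subseteq> U"
  shows "\<not> limit_subgroup R \<subseteq> N"
proof
  assume "limit_subgroup R \<subseteq> N"
  then obtain W where W: "nhd_one W" "limit_subgroup R <#> W \<subseteq> N"
    using compactin_set_mult_nhd_one[OF compactin_limit_subgroup_R nhd_one_openin[OF N(1)]] by blast
  have "eventually (\<lambda>i. False) F"
    using double_ball_near[OF R_pos order_refl W(1)]
    by eventually_elim (use W(2) N(2) escape in blast)
  then show False using ultrafilter_not_bot[OF F] by simp
qed

lemma escape_scale:
  assumes S: "\<one> \<in> S" and escapes: "eventually (\<lambda>i. \<not> weight_ball (wt i) (R i) \<subseteq> S) F"
  obtains \<rho> where "\<And>i. 0 < \<rho> i" "\<And>i. \<rho> i \<le> R i" "eventually (\<lambda>i. weight_ball (wt i) (\<rho> i) \<subseteq> S) F"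
    "eventually (\<lambda>i. \<not> weight_ball (wt i) (2 * \<rho> i) \<subseteq> S) F"
proof -
  have "\<exists>\<rho>>0. \<rho> \<le> R i \<and> (\<not> weight_ball (wt i) (R i) \<subseteq> S \<longrightarrow>
      weight_ball (wt i) \<rho> \<subseteq> S \<and> \<not> weight_ball (wt i) (2 * \<rho>) \<subseteq> S)" for i
  proof (cases "weight_ball (wt i) (R i) \<subseteq> S")
    case True
    then show ?thesis using R_pos by blast
  next
    case False
    have "weight_ball (wt i) r \<subseteq> S" if "r < \<delta> i" for r using small_ball[OF that] S by blast
    then show ?thesis
      using halving_scale[of "\<lambda>r. weight_ball (wt i) r \<subseteq> S", OF False R_pos \<delta>_pos] by metis
  qed
  then obtain \<rho> where \<rho>: "\<And>i. 0 < \<rho> i" "\<And>i. \<rho> i \<le> R i"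
    "\<And>i. \<not> weight_ball (wt i) (R i) \<subseteq> S \<Longrightarrow>
      weight_ball (wt i) (\<rho> i) \<subseteq> S \<and> \<not> weight_ball (wt i) (2 * \<rho> i) \<subseteq> S"
    by metis
  have "eventually (\<lambda>i. weight_ball (wt i) (\<rho> i) \<subseteq> S \<and> \<not> weight_ball (wt i) (2 * \<rho> i) \<subseteq> S) F"
    using escapes by eventually_elim (rule \<rho>(3))
  then show ?thesis using that[OF \<rho>(1,2)] by (simp add: eventually_conj_iff)
qed

text \<open>The limit subgroup at scale \<open>R\<close> contains a compact subgroup \<open>K \<subseteq> N\<close> with a gap around it.
  At the scale at which the balls leave a neighbourhood of \<open>K\<close>, the limit subgroup is already
  contained in \<open>K\<close>, so the balls of twice that radius cannot leave it.\<close>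

lemma no_escape:
  assumes N: "nhd_one N" "N \<subseteq> U"
  shows False
proof -
  obtain K W where K: "subgroup K L" "compactin T K" "K \<subseteq> N" "K \<subseteq> limit_subgroup R"
    and W: "nhd_one W" and gap: "traps_subgroups (limit_subgroup R \<inter> (W <#> K)) K"
    using compact_subgroup_trapping_small_subgroups[OF subgroup_limit_subgroup[OF R_pos]
        compactin_limit_subgroup_R N(1)] .
  have KL: "K \<subseteq> carrier L" by (rule subgroup.subset[OF K(1)])
  obtain S where S: "nhd_one S" "T closure_of (S <#> K) \<subseteq> W <#> K"
    using set_mult_closure_subset[OF K(1,2) W] .
  have K_SK: "K \<subseteq> S <#> K" by (rule subset_set_mult_left_nhd_one[OF KL S(1)])
  have limit_subset: "limit_subgroup \<rho> \<subseteq> K"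
    if "\<And>i. 0 < \<rho> i" "\<And>i. \<rho> i \<le> R i" "eventually (\<lambda>i. weight_ball (wt i) (\<rho> i) \<subseteq> S <#> K) F" for \<rho>
  proof (rule traps_subgroupsD[OF gap subgroup_limit_subgroup[OF that(1)]])
    show "limit_subgroup \<rho> \<subseteq> limit_subgroup R \<inter> (W <#> K)"
      by (rule Int_greatest[OF limit_subgroup_mono[OF that(2)]
            order_trans[OF limit_subgroup_subset_closure_of[OF that(3)] S(2)]])
  qed
  have "\<not> eventually (\<lambda>i. weight_ball (wt i) (R i) \<subseteq> S <#> K) F"
  proof
    assume "eventually (\<lambda>i. weight_ball (wt i) (R i) \<subseteq> S <#> K) F"
    then have "limit_subgroup R \<subseteq> K" by (rule limit_subset[OF R_pos order_refl])
    then show False using not_limit_subgroup_R_subset[OF N] K(3) by blast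
  qed
  then have "eventually (\<lambda>i. \<not> weight_ball (wt i) (R i) \<subseteq> S <#> K) F"
    by (simp add: ultrafilter_not_eventually[OF F])
  moreover have "\<one> \<in> S <#> K" using K_SK subgroup.one_closed[OF K(1)] by blast
  ultimately obtain \<rho> where \<rho>: "\<And>i. 0 < \<rho> i" "\<And>i. \<rho> i \<le> R i"
      "eventually (\<lambda>i. weight_ball (wt i) (\<rho> i) \<subseteq> S <#> K) F"
      and leaves: "eventually (\<lambda>i. \<not> weight_ball (wt i) (2 * \<rho> i) \<subseteq> S <#> K) F"
    using escape_scale by blast
  obtain W' where W': "nhd_one W'" "K <#> W' \<subseteq> S <#> K"
    using compactin_set_mult_nhd_one[OF K(2) openin_set_mult_left[OF KL nhd_one_openin[OF S(1)]] K_SK] .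
  have "limit_subgroup \<rho> <#> W' \<subseteq> S <#> K"
    using mono_set_mult[OF limit_subset[OF \<rho>] order_refl[of W']] W'(2) by blast
  then have "eventually (\<lambda>i. weight_ball (wt i) (2 * \<rho> i) \<subseteq> S <#> K) F"
    by (intro eventually_mono[OF double_ball_near[OF \<rho>(1,2) W'(1)]]) blast
  with leaves have "eventually (\<lambda>i. False) F" by eventually_elim blast
  then show False using ultrafilter_not_bot[OF F] by simp
qed

end

theorem (in lc_group) weight_ball_trapping:
  assumes U: "compactin T U" and N: "nhd_one N" "N \<subseteq> U"
  obtains V where "nhd_one V" "symmetric_set V" "weight_ball (power_weights V) 1 \<subseteq> U"
proof (rule ccontr)
  assume none: "\<not> thesis"
  have escapes: "\<exists>wt \<delta> R. symmetric_weights wt \<and> (nhd_one V \<longrightarrow> wt \<le> power_weights V) \<and>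
      0 < \<delta> \<and> (\<forall>r<\<delta>. weight_ball wt r \<subseteq> {\<one>}) \<and>
      0 < R \<and> R \<le> 1 \<and> weight_ball wt R \<subseteq> U \<and> \<not> weight_ball wt (2 * R) \<subseteq> U" for V
  proof -
    obtain W where W: "nhd_one W" "symmetric_set W" "nhd_one V \<longrightarrow> W \<subseteq> V"
      using symmetric_nhd_one nhd_one_univ by metis
    have "\<one> \<in> U" "\<not> weight_ball (power_weights W) 1 \<subseteq> U"
      using N nhd_one_mem that none W(1,2) by auto
    then obtain wt \<delta> R where "symmetric_weights wt" "wt \<le> power_weights W"
        "0 < \<delta>" "\<And>r. r < \<delta> \<Longrightarrow> weight_ball wt r \<subseteq> {\<one>}"
        "0 < R" "R \<le> 1" "weight_ball wt R \<subseteq> U" "\<not> weight_ball wt (2 * R) \<subseteq> U"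
      using escaping_weights_exist[OF symmetric_power_weights[OF W(2)]] by metis
    moreover have "nhd_one V \<longrightarrow> wt \<le> power_weights V"
      using W(3) power_weights_mono[of W V] \<open>wt \<le> power_weights W\<close> by auto
    ultimately show ?thesis by blast
  qed
  obtain wt :: "'a set \<Rightarrow> 'a \<Rightarrow> real \<Rightarrow> bool" and \<delta> R where wt: "\<And>V. symmetric_weights (wt V)"
      "\<And>V. nhd_one V \<Longrightarrow> wt V \<le> power_weights V"
      "\<And>V. 0 < \<delta> V" "\<And>V r. r < \<delta> V \<Longrightarrow> weight_ball (wt V) r \<subseteq> {\<one>}"
      "\<And>V. 0 < R V" "\<And>V. R V \<le> 1" "\<And>V. weight_ball (wt V) (R V) \<subseteq> U"
      "\<And>V. \<not> weight_ball (wt V) (2 * R V) \<subseteq> U"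
    using escapes by metis
  obtain F where F: "ultrafilter F" "\<And>V. nhd_one V \<Longrightarrow> eventually (\<lambda>W. W \<in> {W. nhd_one W \<and> W \<subseteq> V}) F"
    by (rule ultrafilter_of_nhd_one_family[of "\<lambda>V. {W. nhd_one W \<and> W \<subseteq> V}"]) auto
  have "eventually (\<lambda>W. wt W \<le> power_weights V) F" if "nhd_one V" for V
    using F(2)[OF that] by eventually_elim (use wt(2) power_weights_mono order_trans in blast)
  then interpret escaping_weights L T F wt U \<delta> R
    by unfold_locales (use F(1) wt U in auto)
  show False by (rule no_escape[OF N])
qed

section \<open>One-parameter subgroups\<close>

definition real_group :: "real monoid" where
  "real_group = \<lparr>carrier = UNIV, monoid.mult = (+), one = 0\<rparr>"

lemma carrier_real_group [simp]: "carrier real_group = UNIV"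
  by (simp add: real_group_def)

lemma mult_real_group [simp]: "s \<otimes>\<^bsub>real_group\<^esub> t = s + t"
  by (simp add: real_group_def)

context group
begin

lemma real_hom_closed: "\<xi> \<in> hom real_group G \<Longrightarrow> \<xi> t \<in> carrier G"
  by (rule hom_in_carrier) auto

lemma real_hom_add: "\<xi> \<in> hom real_group G \<Longrightarrow> \<xi> (s + t) = \<xi> s \<otimes> \<xi> t"
  using hom_mult[of \<xi> real_group G s t] by simp

lemma real_hom_zero: "\<xi> \<in> hom real_group G \<Longrightarrow> \<xi> 0 = \<one>"
  using real_hom_add[of \<xi> 0 0] real_hom_closed[of \<xi> 0] by simp

lemma real_hom_nat_mult: "\<xi> \<in> hom real_group G \<Longrightarrow> \<xi> (real n * t) = \<xi> t [^] n"
proof (induction n)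
  case (Suc n)
  have "\<xi> (real (Suc n) * t) = \<xi> (real n * t + t)" by (simp add: algebra_simps)
  then show ?case using Suc by (simp add: real_hom_add)
qed (simp add: real_hom_zero)

end

lemma floor_divide_mult_le:
  fixes q t :: real
  assumes "0 < q"
  shows "\<bar>real_of_int \<lfloor>t / q\<rfloor>\<bar> * q \<le> \<bar>t\<bar> + q"
proof -
  have "\<bar>real_of_int \<lfloor>t / q\<rfloor>\<bar> \<le> \<bar>t / q\<bar> + 1" by linarith
  then have "\<bar>real_of_int \<lfloor>t / q\<rfloor>\<bar> * q \<le> (\<bar>t / q\<bar> + 1) * q"
    using assms by (intro mult_right_mono) auto
  then show ?thesis using assms by (simp add: distrib_right abs_divide)
qed

lemma half_le_nat_floor:
  fixes u :: real
  assumes "2 < u"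
  shows "u / 2 \<le> real (nat \<lfloor>u\<rfloor>)"
  using assms by linarith

locale translation_length = lc_group +
  fixes f :: "'a \<Rightarrow> real"
  assumes f: "f \<in> Cc"
begin

definition len :: "'a \<Rightarrow> real" where
  "len x = (SUP z\<in>carrier L. \<bar>f (inv x \<otimes> z) - f z\<bar>)"

lemma len_ge:
  assumes x: "x \<in> carrier L" and z: "z \<in> carrier L"
  shows "\<bar>f (inv x \<otimes> z) - f z\<bar> \<le> len x"
proof -
  obtain B where B: "\<And>x. x \<in> carrier L \<Longrightarrow> \<bar>f x\<bar> \<le> B" using Cc_bounded[OF f] by blast
  have "\<bar>f (inv x \<otimes> z) - f z\<bar> \<le> B + B" if "z \<in> carrier L" for z
    using B[of "inv x \<otimes> z"] B[OF that] x that by (auto simp: abs_le_iff)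
  then show ?thesis unfolding len_def using z by (intro cSUP_upper bdd_aboveI2[of _ _ "B + B"]) auto
qed

lemma len_le: "(\<And>z. z \<in> carrier L \<Longrightarrow> \<bar>f (inv x \<otimes> z) - f z\<bar> \<le> b) \<Longrightarrow> len x \<le> b"
  unfolding len_def by (rule cSUP_least) auto

lemma len_nonneg: "x \<in> carrier L \<Longrightarrow> 0 \<le> len x"
  using len_ge[of x \<one>] by (auto intro: order_trans[OF abs_ge_zero])

lemma len_one: "len \<one> = 0"
  using len_le[of \<one> 0] len_nonneg[of \<one>] by force

lemma len_mult:
  assumes "x \<in> carrier L" "y \<in> carrier L"
  shows "len (x \<otimes> y) \<le> len x + len y"
proof (rule len_le)
  fix z assume z: "z \<in> carrier L"
  have "inv (x \<otimes> y) \<otimes> z = inv y \<otimes> (inv x \<otimes> z)" using assms z by (simp add: inv_mult_group m_assoc)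
  then show "\<bar>f (inv (x \<otimes> y) \<otimes> z) - f z\<bar> \<le> len x + len y"
    using len_ge[OF assms(1) z] len_ge[OF assms(2), of "inv x \<otimes> z"] assms z by fastforce
qed

lemma translates_diff_le_len:
  assumes "x \<in> carrier L" "y \<in> carrier L" "z \<in> carrier L"
  shows "\<bar>f (inv x \<otimes> z) - f (inv y \<otimes> z)\<bar> \<le> len (inv y \<otimes> x)"
  using len_ge[of "inv y \<otimes> x" "inv y \<otimes> z"] assms by (simp add: inv_mult_group m_assoc)

lemma len_le_translates_diff:
  assumes "x \<in> carrier L" "y \<in> carrier L"
    and "\<And>z. z \<in> carrier L \<Longrightarrow> \<bar>f (inv x \<otimes> z) - f (inv y \<otimes> z)\<bar> \<le> b"
  shows "len (inv y \<otimes> x) \<le> b"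
proof (rule len_le)
  fix z assume z: "z \<in> carrier L"
  have "inv (inv y \<otimes> x) \<otimes> z = inv x \<otimes> (y \<otimes> z)" using assms z by (simp add: inv_mult_group m_assoc)
  then show "\<bar>f (inv (inv y \<otimes> x) \<otimes> z) - f z\<bar> \<le> b" using assms(3)[of "y \<otimes> z"] assms z by simp
qed

lemma len_inv:
  assumes "x \<in> carrier L"
  shows "len (inv x) = len x"
proof -
  have len_inv_le: "len (inv y) \<le> len y" if y: "y \<in> carrier L" for y
  proof (rule len_le)
    fix z assume "z \<in> carrier L"
    then show "\<bar>f (inv (inv y) \<otimes> z) - f z\<bar> \<le> len y"
      using len_ge[OF y, of "y \<otimes> z"] y by (simp add: abs_minus_commute)
  qed
  show ?thesis using len_inv_le[OF assms] len_inv_le[of "inv x"] assms by simp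
qed

lemma len_nat_pow: "x \<in> carrier L \<Longrightarrow> len (x [^] (n::nat)) \<le> real n * len x"
proof (induction n)
  case (Suc n)
  have "len (x [^] Suc n) \<le> len (x [^] n) + len x" using len_mult[of "x [^] n" x] Suc by simp
  then show ?case using Suc by (simp add: algebra_simps)
qed (simp add: len_one)

lemma len_int_pow:
  assumes x: "x \<in> carrier L"
  shows "len (x [^] (k::int)) \<le> \<bar>real_of_int k\<bar> * len x"
proof (cases "k < 0")
  case True
  then have "len (x [^] k) = len (x [^] nat (- k))"
    using x by (simp add: int_pow_def2 len_inv del: pow_nat)
  also have "\<dots> \<le> real (nat (- k)) * len x" by (rule len_nat_pow[OF x])
  finally show ?thesis using True by simp
next
  case False
  then have "len (x [^] k) = len (x [^] nat k)" by (simp add: int_pow_def2 del: pow_nat)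
  also have "\<dots> \<le> real (nat k) * len x" by (rule len_nat_pow[OF x])
  finally show ?thesis using False by simp
qed

lemma len_small_near_one:
  assumes e: "0 < e"
  obtains V where "nhd_one V" "\<And>z. z \<in> V \<Longrightarrow> len z < e"
proof -
  obtain V where V: "nhd_one V" "symmetric_set V"
      "\<And>x z. x \<in> carrier L \<Longrightarrow> z \<in> V \<Longrightarrow> \<bar>f (z \<otimes> x) - f x\<bar> < e / 2"
    using Cc_left_modulus[OF f, of "e / 2"] e by auto
  have "len z < e" if "z \<in> V" for z
  proof -
    have "len z \<le> e / 2"
      using V(3) symmetric_setD[OF V(2) that] by (intro len_le) (simp add: less_imp_le)
    then show ?thesis using e by simp
  qed
  then show ?thesis using that V(1) by blast
qed

lemma continuous_map_len: "continuous_map T euclideanreal len"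
proof (rule continuous_map_of_right_modulus)
  fix e :: real assume "0 < e"
  then obtain V where V: "nhd_one V" "\<And>z. z \<in> V \<Longrightarrow> len z < e" using len_small_near_one by blast
  have "\<bar>len (x \<otimes> z) - len x\<bar> < e" if x: "x \<in> carrier L" and z: "z \<in> V" for x z
  proof -
    have zL: "z \<in> carrier L" by (rule nhd_one_mem_carrier[OF V(1) z])
    have "len x \<le> len (x \<otimes> z) + len z"
      using len_mult[of "x \<otimes> z" "inv z"] x zL by (simp add: m_assoc len_inv)
    then show ?thesis using len_mult[OF x zL] V(2)[OF z] by linarith
  qed
  then show "\<exists>V. nhd_one V \<and> (\<forall>x\<in>carrier L. \<forall>z\<in>V. \<bar>len (x \<otimes> z) - len x\<bar> < e)" using V(1) by blast
qed

end

text \<open>The second difference bound makes the group nearly commutative near the identity, and powers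
  of short elements nearly linear.\<close>

locale gleason_length = translation_length +
  fixes U :: "'a set" and c M :: real
  assumes compact_U: "compactin T U" and c_pos: "0 < c" and M_pos: "0 < M"
    and f_one: "c \<le> f \<one>" and f_outside: "\<And>x. x \<in> carrier L \<Longrightarrow> x \<notin> U \<Longrightarrow> f x = 0"
    and second_difference: "\<And>x y z. x \<in> U \<Longrightarrow> y \<in> U \<Longrightarrow> z \<in> carrier L \<Longrightarrow>
      \<bar>f (inv y \<otimes> (inv x \<otimes> z)) - f (inv x \<otimes> z) - (f (inv y \<otimes> z) - f z)\<bar> \<le> M * len x * len y"
    and len_zero_in: "\<And>x. x \<in> U \<Longrightarrow> len x = 0 \<Longrightarrow> x = \<one>"
begin

lemma U_carrier: "x \<in> U \<Longrightarrow> x \<in> carrier L"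
  using compactin_carrier[OF compact_U] by blast

lemma len_less_imp_in_U:
  assumes x: "x \<in> carrier L" "len x < c"
  shows "x \<in> U"
proof (rule ccontr)
  assume "x \<notin> U"
  then show False using len_ge[OF x(1) x(1)] f_outside[OF x(1)] f_one x by simp
qed

lemma len_zero: "x \<in> carrier L \<Longrightarrow> len x = 0 \<Longrightarrow> x = \<one>"
  using len_zero_in len_less_imp_in_U c_pos by simp

lemma nhd_one_contains_len_ball:
  assumes V: "nhd_one V"
  obtains d where "0 < d" "\<And>x. x \<in> carrier L \<Longrightarrow> len x < d \<Longrightarrow> x \<in> V"
proof (cases "U \<subseteq> V")
  case True
  then show ?thesis using len_less_imp_in_U c_pos by (intro that[of c]) auto
next
  case False
  have "compactin T (U - V)"
    using closed_compactin[OF compact_U, of "U - V"]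
      closedin_diff[OF compactin_closedin[OF compact_U] nhd_one_openin[OF V]] by auto
  then have "compact (len ` (U - V))" using image_compactin[OF _ continuous_map_len] by simp
  moreover have "len ` (U - V) \<noteq> {}" using False by blast
  ultimately obtain m where "m \<in> len ` (U - V)" and m_le: "\<forall>y\<in>len ` (U - V). m \<le> y"
    using compact_attains_inf by blast
  then obtain x where x: "x \<in> U" "x \<notin> V" "m = len x" by blast
  have "0 < m"
    using x nhd_one_mem[OF V] len_zero[of x] len_nonneg[of x] U_carrier[of x] by fastforce
  moreover have "y \<in> V" if y: "y \<in> carrier L" "len y < min m c" for y
  proof (rule ccontr)
    assume "y \<notin> V"
    then have "m \<le> len y" using y len_less_imp_in_U m_le by simp
    then show False using y(2) by simp
  qed
  ultimately show ?thesis using that[of "min m c"] c_pos by simp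
qed

lemma len_commutator:
  assumes xy: "x \<in> U" "y \<in> U"
  shows "len (inv (y \<otimes> x) \<otimes> (x \<otimes> y)) \<le> 2 * M * len x * len y"
proof (rule len_le_translates_diff)
  have carrier: "x \<in> carrier L" "y \<in> carrier L" using xy U_carrier by auto
  then show "x \<otimes> y \<in> carrier L" "y \<otimes> x \<in> carrier L" by auto
  fix z assume z: "z \<in> carrier L"
  have inv_mult: "inv (x \<otimes> y) \<otimes> z = inv y \<otimes> (inv x \<otimes> z)" "inv (y \<otimes> x) \<otimes> z = inv x \<otimes> (inv y \<otimes> z)"
    using carrier z by (auto simp: inv_mult_group m_assoc)
  have "M * len y * len x = M * len x * len y" by simp
  then have "\<bar>f (inv y \<otimes> (inv x \<otimes> z)) - f (inv x \<otimes> (inv y \<otimes> z))\<bar> \<le> 2 * (M * len x * len y)"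
    using second_difference[OF xy z] second_difference[OF xy(2,1) z] by linarith
  then show "\<bar>f (inv (x \<otimes> y) \<otimes> z) - f (inv (y \<otimes> x) \<otimes> z)\<bar> \<le> 2 * M * len x * len y"
    unfolding inv_mult by simp
qed

lemma len_power_linear:
  assumes x: "x \<in> carrier L" and n: "real n * len x < c" and z: "z \<in> carrier L"
  shows "\<bar>f (inv (x [^] n) \<otimes> z) - f z - real n * (f (inv x \<otimes> z) - f z)\<bar> \<le> M * (real n * len x)\<^sup>2"
proof -
  have len_x: "0 \<le> len x" by (rule len_nonneg[OF x])
  have increment: "\<bar>f (inv x \<otimes> (inv (x [^] j) \<otimes> z)) - f (inv (x [^] j) \<otimes> z) - (f (inv x \<otimes> z) - f z)\<bar>
      \<le> M * (real n * len x) * len x" if j: "j < n" for j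
  proof -
    have len_power: "len (x [^] j) \<le> real n * len x"
      using len_nat_pow[OF x, of j] j len_x mult_right_mono[of "real j" "real n" "len x"]
      by linarith
    have "1 * len x \<le> real n * len x" using j len_x by (intro mult_right_mono) auto
    then have "x [^] j \<in> U" "x \<in> U" using len_power n x by (auto intro!: len_less_imp_in_U)
    then have "\<bar>f (inv x \<otimes> (inv (x [^] j) \<otimes> z)) - f (inv (x [^] j) \<otimes> z) - (f (inv x \<otimes> z) - f z)\<bar>
        \<le> M * len (x [^] j) * len x"
      by (rule second_difference[OF _ _ z])
    also have "\<dots> \<le> M * (real n * len x) * len x"
      using len_power M_pos len_x by (intro mult_right_mono mult_left_mono) auto
    finally show ?thesis .
  qed
  have "\<bar>f (inv (x [^] n) \<otimes> z) - f z - real n * (f (inv x \<otimes> z) - f z)\<bar>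
      \<le> real n * (M * (real n * len x) * len x)"
    by (rule power_increment_linear[OF x z increment])
  then show ?thesis by (simp add: power2_eq_square mult_ac)
qed

lemma len_quotient_le_of_powers:
  assumes x: "x \<in> carrier L" and y: "y \<in> carrier L"
    and \<tau>: "real k * len x \<le> \<tau>" "real k * len y \<le> \<tau>" "\<tau> < c"
    and close: "len (inv (y [^] k) \<otimes> x [^] k) \<le> e"
  shows "real k * len (inv y \<otimes> x) \<le> 2 * M * \<tau>\<^sup>2 + e"
proof (cases "k = 0")
  case True
  then show ?thesis using close M_pos by (simp add: len_one)
next
  case False
  have "len (inv y \<otimes> x) \<le> (2 * M * \<tau>\<^sup>2 + e) / real k"
  proof (rule len_le_translates_diff[OF x y])
    fix z assume z: "z \<in> carrier L"
    have square: "M * (real k * len w)\<^sup>2 \<le> M * \<tau>\<^sup>2" if "w \<in> carrier L" "real k * len w \<le> \<tau>" for w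
      using that len_nonneg M_pos by (intro mult_left_mono power_mono) auto
    have "\<bar>f (inv (x [^] k) \<otimes> z) - f z - real k * (f (inv x \<otimes> z) - f z)\<bar> \<le> M * \<tau>\<^sup>2"
      using len_power_linear[OF x _ z, of k] square[OF x \<tau>(1)] \<tau> by linarith
    moreover have "\<bar>f (inv (y [^] k) \<otimes> z) - f z - real k * (f (inv y \<otimes> z) - f z)\<bar> \<le> M * \<tau>\<^sup>2"
      using len_power_linear[OF y _ z, of k] square[OF y \<tau>(2)] \<tau> by linarith
    moreover have "\<bar>f (inv (x [^] k) \<otimes> z) - f (inv (y [^] k) \<otimes> z)\<bar> \<le> e"
      using translates_diff_le_len[of "x [^] k" "y [^] k" z] x y z close by simp
    moreover have "\<bar>real k * (f (inv x \<otimes> z) - f (inv y \<otimes> z))\<bar> \<le> 2 * m + e"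
      if "\<bar>P - F - real k * (f (inv x \<otimes> z) - F)\<bar> \<le> m" "\<bar>Q - F - real k * (f (inv y \<otimes> z) - F)\<bar> \<le> m"
        "\<bar>P - Q\<bar> \<le> e" for P Q F m
      using that by (simp add: right_diff_distrib)
    ultimately have "\<bar>real k * (f (inv x \<otimes> z) - f (inv y \<otimes> z))\<bar> \<le> 2 * (M * \<tau>\<^sup>2) + e" by blast
    then have "\<bar>f (inv x \<otimes> z) - f (inv y \<otimes> z)\<bar> * real k \<le> 2 * M * \<tau>\<^sup>2 + e"
      by (simp only: abs_mult abs_of_nat mult.commute mult.assoc)
    then show "\<bar>f (inv x \<otimes> z) - f (inv y \<otimes> z)\<bar> \<le> (2 * M * \<tau>\<^sup>2 + e) / real k"
      using False by (simp only: pos_le_divide_eq of_nat_0_less_iff neq0_conv)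
  qed
  then show ?thesis using False by (simp add: field_simps)
qed

definition lipschitz_homs :: "(real \<Rightarrow> 'a) set" where
  "lipschitz_homs = {\<xi> \<in> hom real_group L. \<forall>t. len (\<xi> t) \<le> \<bar>t\<bar>}"

lemma lipschitz_homs_real_hom: "\<xi> \<in> lipschitz_homs \<Longrightarrow> \<xi> \<in> hom real_group L"
  by (simp add: lipschitz_homs_def)

lemma lipschitz_homs_closed: "\<xi> \<in> lipschitz_homs \<Longrightarrow> \<xi> t \<in> carrier L"
  using lipschitz_homs_real_hom real_hom_closed by blast

lemma lipschitz_homs_len: "\<xi> \<in> lipschitz_homs \<Longrightarrow> len (\<xi> t) \<le> \<bar>t\<bar>"
  by (simp add: lipschitz_homs_def)

lemma continuous_map_lipschitz_homs:
  assumes \<xi>: "\<xi> \<in> lipschitz_homs"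
  shows "continuous_map euclideanreal T \<xi>"
proof -
  note closed = lipschitz_homs_closed[OF \<xi>]
  have "open {t. \<xi> t \<in> W}" if W: "openin T W" for W
  proof (subst open_dist, intro ballI)
    fix t assume "t \<in> {t. \<xi> t \<in> W}"
    then have nhd: "nhd_one {z \<in> carrier L. \<xi> t \<otimes> z \<in> W}"
      using closed by (intro nhd_one_preimage[OF continuous_map_left_translate W]) auto
    then obtain d where d: "0 < d" "\<And>x. x \<in> carrier L \<Longrightarrow> len x < d \<Longrightarrow>
        x \<in> {z \<in> carrier L. \<xi> t \<otimes> z \<in> W}"
      using nhd_one_contains_len_ball[OF nhd] by blast
    have "\<xi> s \<in> W" if "dist s t < d" for s
    proof -
      have "len (\<xi> (s - t)) < d"
        using lipschitz_homs_len[OF \<xi>, of "s - t"] that by (simp add: dist_real_def)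
      then have "\<xi> t \<otimes> \<xi> (s - t) \<in> W" using d(2) closed by blast
      then show ?thesis using real_hom_add[OF lipschitz_homs_real_hom[OF \<xi>], of t "s - t"] by simp
    qed
    then show "\<exists>e>0. \<forall>s. dist s t < e \<longrightarrow> s \<in> {t. \<xi> t \<in> W}" using d(1) by blast
  qed
  then show ?thesis using closed by (auto simp: continuous_map_def)
qed

lemma split_short_power:
  assumes x: "x \<in> carrier L" "0 < len x" "len x < c / 2"
    and k: "real k * len x \<le> real (Suc K) * (c / 2)"
  obtains j where "j \<le> k" "x [^] j \<in> U" "real (k - j) * len x \<le> real K * (c / 2)"
proof
  define u where "u = (c / 2) / len x"
  define j where "j = min k (nat \<lceil>u\<rceil>)"
  have u: "0 < u" "u * len x = c / 2" using x(2) c_pos by (auto simp: u_def)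
  show j_le: "j \<le> k" by (simp add: j_def)
  have "real j \<le> real (nat \<lceil>u\<rceil>)" by (simp add: j_def)
  then have "real j < u + 1" using u(1) by linarith
  then have "real j * len x < (u + 1) * len x" using x(2) by (rule mult_strict_right_mono)
  then have "real j * len x < c / 2 + len x" by (simp add: distrib_right u(2))
  then show "x [^] j \<in> U" using len_nat_pow[OF x(1), of j] x(1,3) by (intro len_less_imp_in_U) auto
  show "real (k - j) * len x \<le> real K * (c / 2)"
  proof (cases "j = k")
    case True
    then show ?thesis using c_pos by simp
  next
    case False
    then have "j = nat \<lceil>u\<rceil>" by (simp add: j_def min_def split: if_splits)
    then have "u \<le> real j" using real_nat_ceiling_ge[of u] by metis
    then have "u * len x \<le> real j * len x" using x(2) by (intro mult_right_mono) auto
    then have "c / 2 \<le> real j * len x" by (simp add: u(2))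
    then show ?thesis using k j_le by (simp add: of_nat_diff algebra_simps)
  qed
qed

lemma short_powers_in_compact:
  obtains D where "compactin T D" "\<And>x k. x \<in> carrier L \<Longrightarrow> 0 < len x \<Longrightarrow> len x < c / 2 \<Longrightarrow>
    real k * len x \<le> real K * (c / 2) \<Longrightarrow> x [^] k \<in> D"
proof -
  have "\<exists>D. compactin T D \<and> (\<forall>x\<in>carrier L. \<forall>k::nat. 0 < len x \<longrightarrow> len x < c / 2 \<longrightarrow>
      real k * len x \<le> real K * (c / 2) \<longrightarrow> x [^] k \<in> D)"
  proof (induction K)
    case 0
    have "x [^] k = \<one>" if "0 < len x" "real k * len x \<le> real 0 * (c / 2)" for x and k :: nat
      using that by (simp add: mult_le_0_iff)
    then show ?case by (intro exI[of _ "{\<one>}"]) auto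
  next
    case (Suc K)
    then obtain D where D: "compactin T D" "\<And>x k::nat. x \<in> carrier L \<Longrightarrow> 0 < len x \<Longrightarrow> len x < c / 2 \<Longrightarrow>
        real k * len x \<le> real K * (c / 2) \<Longrightarrow> x [^] k \<in> D"
      by blast
    have "x [^] k \<in> D <#> U" if x: "x \<in> carrier L" "0 < len x" "len x < c / 2"
      and k: "real k * len x \<le> real (Suc K) * (c / 2)" for x and k :: nat
    proof -
      obtain j where j: "j \<le> k" "x [^] j \<in> U" "real (k - j) * len x \<le> real K * (c / 2)"
        using split_short_power[OF x k] .
      then have "x [^] (k - j) \<in> D" by (intro D(2)[OF x])
      moreover have "x [^] k = x [^] (k - j) \<otimes> x [^] j" using x(1) j(1) by (simp add: nat_pow_mult)
      ultimately show ?thesis using j(2) unfolding set_mult_def by blast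
    qed
    then show ?case by (intro exI[of _ "D <#> U"] conjI compactin_set_mult D(1) compact_U) auto
  qed
  then show ?thesis using that by blast
qed

context
  fixes F :: "'a filter"
  assumes F: "ultrafilter F"
    and short: "\<And>d. 0 < d \<Longrightarrow> eventually (\<lambda>x. x \<in> carrier L \<and> 0 < len x \<and> len x < d) F"
begin

lemma floor_power_limit_exists: "\<exists>l. limitin T (\<lambda>x. x [^] \<lfloor>t / len x\<rfloor>) l F"
proof -
  obtain K :: nat where "(\<bar>t\<bar> + c / 2) / (c / 2) \<le> real K" using real_arch_simple by blast
  then have K: "\<bar>t\<bar> + c / 2 \<le> real K * (c / 2)" using c_pos by (simp add: field_simps)
  obtain D where D: "compactin T D" "\<And>x k. x \<in> carrier L \<Longrightarrow> 0 < len x \<Longrightarrow> len x < c / 2 \<Longrightarrow>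
      real k * len x \<le> real K * (c / 2) \<Longrightarrow> x [^] k \<in> D"
    using short_powers_in_compact by blast
  have "compactin T (D \<union> (\<lambda>x. inv x) ` D)" using D(1) by (intro compactin_Un compactin_image_inv)
  moreover have "eventually (\<lambda>x. x [^] \<lfloor>t / len x\<rfloor> \<in> D \<union> (\<lambda>x. inv x) ` D) F"
    using short[OF half_gt_zero[OF c_pos]]
  proof eventually_elim
    case (elim x)
    define k where "k = \<lfloor>t / len x\<rfloor>"
    have bound: "\<bar>real_of_int k\<bar> * len x \<le> real K * (c / 2)"
      using floor_divide_mult_le[of "len x" t] K elim unfolding k_def by linarith
    show ?case
    proof (cases "k < 0")
      case True
      then have "x [^] nat (- k) \<in> D" using bound elim by (intro D(2)) auto
      then show ?thesis using True by (simp add: k_def[symmetric] int_pow_def2 del: pow_nat)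
    next
      case False
      then have "x [^] nat k \<in> D" using bound elim by (intro D(2)) auto
      then show ?thesis using False by (simp add: k_def[symmetric] int_pow_def2 del: pow_nat)
    qed
  qed
  ultimately show ?thesis using ultrafilter_compactin_limit[OF F] by metis
qed

lemma floor_power_limit_add:
  assumes a: "limitin T (\<lambda>x. x [^] \<lfloor>s / len x\<rfloor>) a F" and b: "limitin T (\<lambda>x. x [^] \<lfloor>t / len x\<rfloor>) b F"
  shows "limitin T (\<lambda>x. x [^] \<lfloor>(s + t) / len x\<rfloor>) (a \<otimes> b) F"
proof -
  define e where "e x = \<lfloor>(s + t) / len x\<rfloor> - \<lfloor>s / len x\<rfloor> - \<lfloor>t / len x\<rfloor>" for x
  have e: "e x = 0 \<or> e x = 1" for x
    unfolding e_def add_divide_distrib by linarith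
  have "limitin T (\<lambda>x. x [^] e x) \<one> F"
    unfolding limitin_def
  proof (intro conjI allI impI)
    fix V assume "openin T V \<and> \<one> \<in> V"
    then have V: "nhd_one V" by (simp add: nhd_one_def)
    obtain d where d: "0 < d" "\<And>x. x \<in> carrier L \<Longrightarrow> len x < d \<Longrightarrow> x \<in> V"
      using nhd_one_contains_len_ball[OF V] by blast
    from short[OF d(1)] show "eventually (\<lambda>x. x [^] e x \<in> V) F"
    proof eventually_elim
      case (elim x)
      have "x [^] (0::int) \<in> V" "x [^] (1::int) \<in> V" using d(2) elim nhd_one_mem[OF V] by auto
      then show ?case using e[of x] by auto
    qed
  qed simp
  then have "limitin T (\<lambda>x. x [^] \<lfloor>s / len x\<rfloor> \<otimes> x [^] \<lfloor>t / len x\<rfloor> \<otimes> x [^] e x) (a \<otimes> b \<otimes> \<one>) F"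
    by (intro limitin_mult a b)
  moreover have "a \<otimes> b \<otimes> \<one> = a \<otimes> b" using limitin_topspace[OF a] limitin_topspace[OF b] by simp
  moreover have "eventually (\<lambda>x. x [^] \<lfloor>s / len x\<rfloor> \<otimes> x [^] \<lfloor>t / len x\<rfloor> \<otimes> x [^] e x =
      x [^] \<lfloor>(s + t) / len x\<rfloor>) F"
    using short[OF zero_less_one]
  proof eventually_elim
    case (elim x)
    then have "x [^] \<lfloor>s / len x\<rfloor> \<otimes> x [^] \<lfloor>t / len x\<rfloor> \<otimes> x [^] e x =
        x [^] (\<lfloor>s / len x\<rfloor> + \<lfloor>t / len x\<rfloor> + e x)"
      by (simp add: int_pow_mult)
    then show ?case by (simp add: e_def)
  qed
  ultimately show ?thesis using limitin_transform_eventually by fastforce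
qed

lemma floor_power_limit_len:
  assumes a: "limitin T (\<lambda>x. x [^] \<lfloor>t / len x\<rfloor>) a F"
  shows "len a \<le> \<bar>t\<bar>"
proof (rule field_le_epsilon)
  fix d :: real assume d: "0 < d"
  have "((\<lambda>x. len (x [^] \<lfloor>t / len x\<rfloor>)) \<longlongrightarrow> len a) F"
    using continuous_map_limit[OF continuous_map_len a] by (simp add: o_def)
  moreover have "eventually (\<lambda>x. len (x [^] \<lfloor>t / len x\<rfloor>) \<le> \<bar>t\<bar> + d) F"
    using short[OF d]
  proof eventually_elim
    case (elim x)
    then show ?case
      using len_int_pow[of x "\<lfloor>t / len x\<rfloor>"] floor_divide_mult_le[of "len x" t] by linarith
  qed
  ultimately show "len a \<le> \<bar>t\<bar> + d" using tendsto_upperbound ultrafilter_not_bot[OF F] by blast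
qed

lemma lipschitz_hom_of_short_elements:
  obtains \<xi> where "\<xi> \<in> lipschitz_homs" "\<And>t. limitin T (\<lambda>x. x [^] \<lfloor>t / len x\<rfloor>) (\<xi> t) F"
proof -
  obtain \<xi> where \<xi>: "\<And>t. limitin T (\<lambda>x. x [^] \<lfloor>t / len x\<rfloor>) (\<xi> t) F"
    using floor_power_limit_exists by metis
  have "\<xi> (s + t) = \<xi> s \<otimes> \<xi> t" for s t
    using limitin_unique[OF \<xi> floor_power_limit_add[OF \<xi> \<xi>] ultrafilter_not_bot[OF F]] .
  moreover have "\<xi> t \<in> carrier L" for t using limitin_topspace[OF \<xi>] by simp
  ultimately have "\<xi> \<in> lipschitz_homs"
    using floor_power_limit_len[OF \<xi>] by (simp add: lipschitz_homs_def hom_def)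
  then show ?thesis using that \<xi> by blast
qed

end

text \<open>With \<open>k = \<lfloor>\<tau> / len x\<rfloor>\<close> and \<open>a = \<tau> / k\<close>, the elements \<open>x\<close> and \<open>\<xi> a\<close> have the \<open>k\<close>-th powers
  \<open>x^k\<close> and \<open>\<xi> \<tau>\<close>, which are close, so \<open>x\<close> and \<open>\<xi> a\<close> are \<open>k\<close> times closer.\<close>

lemma lipschitz_hom_approximates:
  assumes \<xi>: "\<xi> \<in> lipschitz_homs" and x: "x \<in> carrier L" "0 < len x" "len x < \<tau> / 2"
    and \<tau>: "\<tau> < c" "32 * M * \<tau> \<le> 1"
    and close: "len (inv (\<xi> \<tau>) \<otimes> x [^] \<lfloor>\<tau> / len x\<rfloor>) < \<tau> / 16"
  obtains a where "\<bar>a\<bar> \<le> 2 * len x" "len (inv (\<xi> a) \<otimes> x) \<le> len x / 4"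
proof -
  have \<tau>_pos: "0 < \<tau>" using x by linarith
  define k where "k = nat \<lfloor>\<tau> / len x\<rfloor>"
  have k: "\<tau> / len x / 2 \<le> real k" "real k * len x \<le> \<tau>" "0 < real k"
  proof -
    have large: "2 < \<tau> / len x" using x(2,3) by (simp add: field_simps)
    then show "\<tau> / len x / 2 \<le> real k" unfolding k_def by (rule half_le_nat_floor)
    then show "0 < real k" by (rule less_le_trans[rotated]) (use \<tau>_pos x(2) in simp)
    have "real k \<le> \<tau> / len x" using large by (simp add: k_def)
    then show "real k * len x \<le> \<tau>" using x(2) by (simp add: field_simps)
  qed
  define a where "a = \<tau> / real k"
  have "\<tau> \<le> 2 * len x * real k" using k(1) x by (simp add: field_simps)
  then have a: "0 < a" "a \<le> 2 * len x" "real k * a = \<tau>"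
    using k(3) \<tau>_pos by (auto simp: a_def field_simps)
  have power: "\<xi> a [^] k = \<xi> \<tau>"
    using real_hom_nat_mult[OF lipschitz_homs_real_hom[OF \<xi>], of k a] a(3) by simp
  have "real k * len (\<xi> a) \<le> \<tau>"
    using mult_left_mono[OF lipschitz_homs_len[OF \<xi>, of a], of "real k"] a by simp
  moreover have "len (inv (\<xi> a [^] k) \<otimes> x [^] k) \<le> \<tau> / 16"
    using close k(3) unfolding power by (simp add: k_def less_imp_le)
  ultimately have "real k * len (inv (\<xi> a) \<otimes> x) \<le> 2 * M * \<tau>\<^sup>2 + \<tau> / 16"
    using len_quotient_le_of_powers[OF x(1) lipschitz_homs_closed[OF \<xi>] k(2) _ \<tau>(1)] by blast
  also have "\<dots> = \<tau> * (32 * M * \<tau>) / 16 + \<tau> / 16" by (simp add: power2_eq_square)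
  also have "\<dots> \<le> \<tau> * 1 / 16 + \<tau> / 16"
    using \<tau>(2) \<tau>_pos by (intro add_right_mono divide_right_mono mult_left_mono) auto
  also have "\<dots> = \<tau> / len x / 2 * (len x / 4)" using x by simp
  also have "\<dots> \<le> real k * (len x / 4)" using k(1) x(2) by (intro mult_right_mono) auto
  finally have "len (inv (\<xi> a) \<otimes> x) \<le> len x / 4" using k(3) by simp
  moreover have "\<bar>a\<bar> \<le> 2 * len x" using a by simp
  ultimately show ?thesis using that by blast
qed

definition approximates :: "(real \<Rightarrow> 'a) set \<Rightarrow> 'a \<Rightarrow> bool" where
  "approximates \<Xi> x \<longleftrightarrow> (\<exists>\<xi>\<in>\<Xi>. \<exists>a. \<bar>a\<bar> \<le> 2 * len x \<and> len (inv (\<xi> a) \<otimes> x) \<le> len x / 4)"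

lemma lipschitz_hom_eventually_approximates:
  assumes F: "ultrafilter F"
    and short: "\<And>d. 0 < d \<Longrightarrow> eventually (\<lambda>x. x \<in> carrier L \<and> 0 < len x \<and> len x < d) F"
  obtains \<xi> where "\<xi> \<in> lipschitz_homs" "eventually (approximates {\<xi>}) F"
proof -
  obtain \<xi> where \<xi>: "\<xi> \<in> lipschitz_homs" and limit: "\<And>t. limitin T (\<lambda>x. x [^] \<lfloor>t / len x\<rfloor>) (\<xi> t) F"
    using lipschitz_hom_of_short_elements[OF F short] by blast
  note closed = lipschitz_homs_closed[OF \<xi>]
  define \<tau> where "\<tau> = min (c / 2) (1 / (32 * M))"
  have "32 * M * \<tau> \<le> 32 * M * (1 / (32 * M))"
    unfolding \<tau>_def using M_pos by (intro mult_left_mono) auto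
  then have \<tau>: "0 < \<tau>" "\<tau> < c" "32 * M * \<tau> \<le> 1" using c_pos M_pos by (auto simp: \<tau>_def)
  have "limitin T (\<lambda>x. inv (\<xi> \<tau>) \<otimes> x [^] \<lfloor>\<tau> / len x\<rfloor>) (inv (\<xi> \<tau>) \<otimes> \<xi> \<tau>) F"
    using closed by (intro limitin_mult limit) (auto simp: limitin_const_iff)
  then have "((\<lambda>x. len (inv (\<xi> \<tau>) \<otimes> x [^] \<lfloor>\<tau> / len x\<rfloor>)) \<longlongrightarrow> 0) F"
    using continuous_map_limit[OF continuous_map_len, of _ \<one> F] closed by (simp add: o_def len_one)
  then have "eventually (\<lambda>x. len (inv (\<xi> \<tau>) \<otimes> x [^] \<lfloor>\<tau> / len x\<rfloor>) < \<tau> / 16) F"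
    using \<tau> by (intro order_tendstoD(2)) auto
  moreover have "0 < \<tau> / 2" using \<tau>(1) by simp
  from short[OF this] calculation have "eventually (approximates {\<xi>}) F"
  proof eventually_elim
    case (elim x)
    then show ?case
      using lipschitz_hom_approximates[OF \<xi> _ _ _ \<tau>(2,3)] unfolding approximates_def by blast
  qed
  then show ?thesis by (rule that[OF \<xi>])
qed

lemma finite_approximating_homs:
  obtains \<Xi> d where "finite \<Xi>" "\<Xi> \<subseteq> lipschitz_homs" "0 < d"
    "\<And>x. x \<in> carrier L \<Longrightarrow> 0 < len x \<Longrightarrow> len x < d \<Longrightarrow> approximates \<Xi> x"
proof -
  define bad where "bad \<Xi> d = {x \<in> carrier L. 0 < len x \<and> len x < d \<and> \<not> approximates \<Xi> x}" for \<Xi> d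
  let ?I = "{(\<Xi>, d). finite \<Xi> \<and> \<Xi> \<subseteq> lipschitz_homs \<and> (0::real) < d}"
  have "\<exists>(\<Xi>, d)\<in>?I. bad \<Xi> d = {}"
  proof (rule ccontr)
    assume nonempty: "\<not> ?thesis"
    obtain F where F: "ultrafilter F" and in_F: "\<And>A. A \<in> case_prod bad ` ?I \<Longrightarrow>
        eventually (\<lambda>x. x \<in> A) F"
    proof (rule ultrafilter_exists_base[of "case_prod bad ` ?I"])
      have "({}, 1) \<in> ?I" by simp
      then show "case_prod bad ` ?I \<noteq> {}" by blast
      show "A \<noteq> {}" if "A \<in> case_prod bad ` ?I" for A using that nonempty by auto
      fix A B assume "A \<in> case_prod bad ` ?I" "B \<in> case_prod bad ` ?I"
      then obtain \<Xi> d \<Xi>' d' where A: "(\<Xi>, d) \<in> ?I" "A = bad \<Xi> d"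
          and B: "(\<Xi>', d') \<in> ?I" "B = bad \<Xi>' d'"
        by auto
      have "(\<Xi> \<union> \<Xi>', min d d') \<in> ?I" using A B by auto
      moreover have "bad (\<Xi> \<union> \<Xi>') (min d d') \<subseteq> A \<inter> B"
        using A B by (auto simp: bad_def approximates_def)
      moreover have "bad (\<Xi> \<union> \<Xi>') (min d d') = case_prod bad (\<Xi> \<union> \<Xi>', min d d')" by simp
      ultimately show "\<exists>D\<in>case_prod bad ` ?I. D \<subseteq> A \<inter> B" by blast
    qed blast
    have bad: "eventually (\<lambda>x. x \<in> bad \<Xi> d) F" if "finite \<Xi>" "\<Xi> \<subseteq> lipschitz_homs" "0 < d" for \<Xi> d
      using that by (intro in_F image_eqI[of _ _ "(\<Xi>, d)"]) simp_all
    have "eventually (\<lambda>x. x \<in> carrier L \<and> 0 < len x \<and> len x < d) F" if "0 < d" for d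
      using bad[of "{}" d] that by (auto simp: bad_def elim: eventually_mono)
    then obtain \<xi> where \<xi>: "\<xi> \<in> lipschitz_homs" "eventually (approximates {\<xi>}) F"
      using lipschitz_hom_eventually_approximates[OF F] by blast
    have "eventually (\<lambda>x. x \<in> bad {\<xi>} 1) F" using bad[of "{\<xi>}" 1] \<xi>(1) by simp
    with \<xi>(2) have "eventually (\<lambda>x. False) F" by eventually_elim (simp add: bad_def)
    then show False using ultrafilter_not_bot[OF F] by simp
  qed
  then obtain \<Xi> d where "finite \<Xi>" "\<Xi> \<subseteq> lipschitz_homs" "0 < d" "bad \<Xi> d = {}" by auto
  then show ?thesis using that[of \<Xi> d] by (auto simp: bad_def)
qed

end

lemma (in group) mult_swap_quotient:
  assumes "e \<in> carrier G" "b \<in> carrier G" "u \<in> carrier G" "x \<in> carrier G"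
  shows "inv (e \<otimes> (u \<otimes> b)) \<otimes> x = (inv (u \<otimes> b) \<otimes> (b \<otimes> u)) \<otimes> (inv u \<otimes> (inv (e \<otimes> b) \<otimes> x))"
  using assms by (simp add: inv_mult_group m_assoc)

context gleason_length
begin

primrec path_product :: "(nat \<Rightarrow> real \<Rightarrow> 'a) \<Rightarrow> nat \<Rightarrow> (nat \<Rightarrow> real) \<Rightarrow> 'a" where
  "path_product \<zeta> 0 t = \<one>"
| "path_product \<zeta> (Suc m) t = path_product \<zeta> m t \<otimes> \<zeta> m (t m)"

lemma path_product_cong: "(\<And>j. j < m \<Longrightarrow> t j = t' j) \<Longrightarrow> path_product \<zeta> m t = path_product \<zeta> m t'"
  by (induction m) auto

lemma path_product_mem:
  assumes "subgroup N L" "\<And>j t. j < m \<Longrightarrow> \<zeta> j t \<in> N"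
  shows "path_product \<zeta> m t \<in> N"
  using assms by (induction m) (auto intro: subgroup.one_closed subgroup.m_closed)

lemma path_product_carrier:
  "(\<And>j. j < m \<Longrightarrow> \<zeta> j \<in> lipschitz_homs) \<Longrightarrow> path_product \<zeta> m t \<in> carrier L"
  by (rule path_product_mem[OF subgroup_self]) (use lipschitz_homs_closed in blast)

lemma path_product_zero:
  "(\<And>j. j < m \<Longrightarrow> \<zeta> j \<in> lipschitz_homs) \<Longrightarrow> (\<And>j. j < m \<Longrightarrow> t j = 0) \<Longrightarrow> path_product \<zeta> m t = \<one>"
  by (induction m) (auto simp: real_hom_zero lipschitz_homs_real_hom)

lemma path_product_upd:
  assumes "\<And>j. j < m \<Longrightarrow> \<zeta> j \<in> lipschitz_homs" "j < m"
  obtains a b where "a \<in> carrier L" "b \<in> carrier L" "len b \<le> (\<Sum>i<m. \<bar>t i\<bar>)"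
    "\<forall>s. path_product \<zeta> m (t(j := s)) = a \<otimes> \<zeta> j s \<otimes> b"
proof -
  have "\<exists>a b. a \<in> carrier L \<and> b \<in> carrier L \<and> len b \<le> (\<Sum>i<m. \<bar>t i\<bar>) \<and>
      (\<forall>s. path_product \<zeta> m (t(j := s)) = a \<otimes> \<zeta> j s \<otimes> b)"
    using assms
  proof (induction m)
    case (Suc m)
    have \<zeta>: "\<zeta> i s \<in> carrier L" if "i < Suc m" for i s
      using Suc.prems(1)[OF that] lipschitz_homs_closed by blast
    show ?case
    proof (cases "j = m")
      case True
      have prefix: "path_product \<zeta> m t \<in> carrier L"
        using Suc.prems(1) by (intro path_product_carrier) auto
      have "path_product \<zeta> (Suc m) (t(j := s)) = path_product \<zeta> m t \<otimes> \<zeta> j s \<otimes> \<one>" for s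
        using path_product_cong[of m "t(j := s)" t \<zeta>] prefix \<zeta>[of j s] True by simp
      moreover have "len \<one> \<le> (\<Sum>i<Suc m. \<bar>t i\<bar>)" by (simp only: len_one) (rule sum_nonneg, simp)
      ultimately show ?thesis using prefix one_closed by blast
    next
      case False
      then obtain a b where ab: "a \<in> carrier L" "b \<in> carrier L" "len b \<le> (\<Sum>i<m. \<bar>t i\<bar>)"
          "\<And>s. path_product \<zeta> m (t(j := s)) = a \<otimes> \<zeta> j s \<otimes> b"
        using Suc by (metis less_Suc_eq)
      have "len (\<zeta> m (t m)) \<le> \<bar>t m\<bar>" using Suc.prems(1) lipschitz_homs_len by blast
      then have "len (b \<otimes> \<zeta> m (t m)) \<le> (\<Sum>i<Suc m. \<bar>t i\<bar>)"
        using len_mult[OF ab(2) \<zeta>[of m "t m"]] ab(3) by simp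
      moreover have "path_product \<zeta> (Suc m) (t(j := s)) = a \<otimes> \<zeta> j s \<otimes> (b \<otimes> \<zeta> m (t m))" for s
        using ab \<zeta>[of m "t m"] \<zeta>[of j s] Suc.prems(2) False by (simp add: m_assoc)
      ultimately show ?thesis using ab(1) m_closed[OF ab(2) \<zeta>[of m "t m"]] by blast
    qed
  qed simp
  then show ?thesis using that by blast
qed

lemma continuous_map_path_product:
  assumes "\<And>j. j < m \<Longrightarrow> \<zeta> j \<in> lipschitz_homs" "m \<le> n"
  shows "continuous_map (product_topology (\<lambda>_. euclideanreal) {..<n}) T (path_product \<zeta> m)"
  using assms
proof (induction m)
  case 0
  have "path_product \<zeta> 0 = (\<lambda>t. \<one>)" by (rule ext) simp
  then show ?case by simp
next
  case (Suc m)
  let ?P = "product_topology (\<lambda>_. euclideanreal) {..<n}"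
  have "continuous_map ?P euclideanreal (\<lambda>t. t m)"
    using Suc.prems by (intro continuous_map_product_projection) auto
  then have "continuous_map ?P T (\<lambda>t. \<zeta> m (t m))"
    using continuous_map_compose[OF _ continuous_map_lipschitz_homs, of ?P "\<lambda>t. t m" "\<zeta> m"]
      Suc.prems
    by (simp add: o_def)
  then have "continuous_map ?P T (\<lambda>t. path_product \<zeta> m t \<otimes> \<zeta> m (t m))"
    using Suc by (intro continuous_map_mult) auto
  moreover have "path_product \<zeta> (Suc m) = (\<lambda>t. path_product \<zeta> m t \<otimes> \<zeta> m (t m))" by (rule ext) simp
  ultimately show ?case by simp
qed

definition path_cost :: "(nat \<Rightarrow> real \<Rightarrow> 'a) \<Rightarrow> nat \<Rightarrow> 'a \<Rightarrow> (nat \<Rightarrow> real) \<Rightarrow> real" where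
  "path_cost \<zeta> m x t = len (inv (path_product \<zeta> m t) \<otimes> x) + (\<Sum>j<m. \<bar>t j\<bar>) / 4"

context
  fixes \<zeta> :: "nat \<Rightarrow> real \<Rightarrow> 'a" and m :: nat
  assumes \<zeta>: "\<And>j. j < m \<Longrightarrow> \<zeta> j \<in> lipschitz_homs"
begin

lemma path_cost_attains_min:
  assumes x: "x \<in> carrier L" and b: "0 \<le> b"
  obtains t where "t \<in> {..<m} \<rightarrow>\<^sub>E {-b..b}" "path_cost \<zeta> m x t \<le> len x"
    "\<And>t'. t' \<in> {..<m} \<rightarrow>\<^sub>E {-b..b} \<Longrightarrow> path_cost \<zeta> m x t \<le> path_cost \<zeta> m x t'"
proof -
  let ?P = "product_topology (\<lambda>_. euclideanreal) {..<m}"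
  let ?B = "{..<m} \<rightarrow>\<^sub>E {-b..b}"
  have "continuous_map ?P euclideanreal (\<lambda>t. len (inv (path_product \<zeta> m t) \<otimes> x))"
    using continuous_map_path_product[of m \<zeta> m] \<zeta> x
    by (intro continuous_map_real_compose[OF continuous_map_len] continuous_map_mult
        continuous_map_inverse) auto
  moreover have "continuous_map ?P euclideanreal (\<lambda>t. (\<Sum>j<m. \<bar>t j\<bar>) / 4)"
    by (intro continuous_map_real_divide continuous_map_sum continuous_map_real_abs
        continuous_map_product_projection) auto
  ultimately have "continuous_map ?P euclideanreal (path_cost \<zeta> m x)"
    unfolding path_cost_def[abs_def] by (rule continuous_map_add)
  then have compact: "compact (path_cost \<zeta> m x ` ?B)"
    using image_compactin[of ?P ?B euclideanreal "path_cost \<zeta> m x"] by (simp add: compactin_PiE)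
  let ?z = "\<lambda>j\<in>{..<m}. 0 :: real"
  have z: "?z \<in> ?B" using b by auto
  then obtain v where v: "v \<in> path_cost \<zeta> m x ` ?B" "\<forall>y\<in>path_cost \<zeta> m x ` ?B. v \<le> y"
    using compact_attains_inf[OF compact] by blast
  then obtain t where t: "t \<in> ?B" "v = path_cost \<zeta> m x t" by blast
  have min: "path_cost \<zeta> m x t \<le> path_cost \<zeta> m x t'" if "t' \<in> ?B" for t'
    using v(2) t(2) that by simp
  have "path_product \<zeta> m ?z = \<one>" using \<zeta> by (intro path_product_zero) auto
  then have "path_cost \<zeta> m x ?z = len x" using x by (simp add: path_cost_def)
  then show ?thesis using that[OF t(1) _ min] min[OF z] by simp
qed

text \<open>Appending \<open>\<zeta> j a\<close> to the path would decrease the distance to \<open>x\<close>. Moving it back to position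
  \<open>j\<close> costs a commutator, which is of second order.\<close>

lemma path_cost_decreases:
  assumes x: "x \<in> carrier L" and sum: "(\<Sum>i<m. \<bar>t i\<bar>) < 4 * r"
    and r: "8 * r \<le> c" "128 * M * r \<le> 1"
  defines "y \<equiv> inv (path_product \<zeta> m t) \<otimes> x"
  assumes y: "0 < len y" "len y < r"
    and a: "j < m" "\<bar>a\<bar> \<le> 2 * len y" "len (inv (\<zeta> j a) \<otimes> y) \<le> len y / 4"
  shows "path_cost \<zeta> m x (t(j := t j + a)) < path_cost \<zeta> m x t"
proof -
  let ?S = "\<Sum>i<m. \<bar>t i\<bar>" and ?t' = "t(j := t j + a)"
  have \<zeta>j: "\<zeta> j \<in> hom real_group L" "\<zeta> j s \<in> carrier L" for s
    using \<zeta>[OF a(1)] lipschitz_homs_real_hom lipschitz_homs_closed by auto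
  obtain d b where db: "d \<in> carrier L" "b \<in> carrier L" "len b \<le> ?S"
      "\<forall>s. path_product \<zeta> m (t(j := s)) = d \<otimes> \<zeta> j s \<otimes> b"
    using path_product_upd[OF \<zeta> a(1)] .
  define e where "e = d \<otimes> \<zeta> j (t j)"
  have e: "e \<in> carrier L" using db(1) \<zeta>j by (simp add: e_def)
  have t: "path_product \<zeta> m t = e \<otimes> b" using db(4)[THEN spec, of "t j"] by (simp add: e_def)
  have t': "path_product \<zeta> m ?t' = e \<otimes> (\<zeta> j a \<otimes> b)"
    using db \<zeta>j by (simp add: e_def real_hom_add m_assoc)
  have len_a: "len (\<zeta> j a) \<le> 2 * len y"
    using lipschitz_homs_len[OF \<zeta>[OF a(1)], of a] a(2) by linarith
  have yL: "y \<in> carrier L" using e db x by (simp add: y_def t)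
  have "len (inv (\<zeta> j a \<otimes> b) \<otimes> (b \<otimes> \<zeta> j a)) \<le> 2 * M * len b * len (\<zeta> j a)"
  proof (rule len_commutator)
    show "b \<in> U" "\<zeta> j a \<in> U" using db(2,3) \<zeta>j sum r(1) y len_a by (auto intro!: len_less_imp_in_U)
  qed
  also have "\<dots> \<le> 2 * M * (4 * r) * (2 * len y)"
    using M_pos db(3) sum len_a y len_nonneg[OF db(2)] len_nonneg[OF \<zeta>j(2)]
    by (intro mult_mono) auto
  also have "\<dots> = (128 * M * r) * (len y / 8)" by simp
  also have "\<dots> \<le> 1 * (len y / 8)" using r(2) y by (intro mult_right_mono) auto
  finally have commutator: "len (inv (\<zeta> j a \<otimes> b) \<otimes> (b \<otimes> \<zeta> j a)) \<le> len y / 8" by simp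
  have "inv (path_product \<zeta> m ?t') \<otimes> x = (inv (\<zeta> j a \<otimes> b) \<otimes> (b \<otimes> \<zeta> j a)) \<otimes> (inv (\<zeta> j a) \<otimes> y)"
    unfolding t' y_def t by (rule mult_swap_quotient[OF e db(2) \<zeta>j(2) x])
  then have "len (inv (path_product \<zeta> m ?t') \<otimes> x)
      \<le> len (inv (\<zeta> j a \<otimes> b) \<otimes> (b \<otimes> \<zeta> j a)) + len (inv (\<zeta> j a) \<otimes> y)"
    using db(2) \<zeta>j yL by (simp add: len_mult)
  moreover have "(\<Sum>i<m. \<bar>?t' i\<bar>) \<le> ?S + \<bar>a\<bar>"
  proof -
    have "(\<Sum>i<m. \<bar>?t' i\<bar>) \<le> (\<Sum>i<m. \<bar>t i\<bar> + (if i = j then \<bar>a\<bar> else 0))" by (intro sum_mono) auto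
    then show ?thesis using a(1) by (simp add: sum.distrib)
  qed
  ultimately have "path_cost \<zeta> m x ?t' \<le> len y / 8 + len y / 4 + (?S + \<bar>a\<bar>) / 4"
    using commutator a(3) unfolding path_cost_def by (simp add: field_simps)
  also have "\<dots> < len y + ?S / 4" using a(2) y by (simp add: field_simps)
  finally show ?thesis by (simp add: path_cost_def y_def)
qed

lemma short_element_is_path_product:
  assumes x: "x \<in> carrier L" "len x < r" and r: "0 < r" "8 * r \<le> c" "128 * M * r \<le> 1"
    and approx: "\<And>y. y \<in> carrier L \<Longrightarrow> 0 < len y \<Longrightarrow> len y < r \<Longrightarrow> approximates (\<zeta> ` {..<m}) y"
  obtains t where "x = path_product \<zeta> m t"
proof -
  obtain t where t: "t \<in> {..<m} \<rightarrow>\<^sub>E {-(8 * r)..8 * r}" and cost: "path_cost \<zeta> m x t \<le> len x"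
    and min: "\<And>t'. t' \<in> {..<m} \<rightarrow>\<^sub>E {-(8 * r)..8 * r} \<Longrightarrow> path_cost \<zeta> m x t \<le> path_cost \<zeta> m x t'"
    using path_cost_attains_min[OF x(1), of "8 * r"] r(1) by auto
  have pL: "path_product \<zeta> m t \<in> carrier L" by (rule path_product_carrier[OF \<zeta>])
  define y where "y = inv (path_product \<zeta> m t) \<otimes> x"
  have yL: "y \<in> carrier L" using pL x by (simp add: y_def)
  have "0 \<le> (\<Sum>j<m. \<bar>t j\<bar>)" by (rule sum_nonneg) simp
  then have small: "len y < r" "(\<Sum>j<m. \<bar>t j\<bar>) < 4 * r"
    using cost x(2) len_nonneg[OF yL] unfolding path_cost_def y_def by linarith+
  have "len y = 0"
  proof (rule ccontr)
    assume "len y \<noteq> 0"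
    then have y: "0 < len y" using len_nonneg[OF yL] by linarith
    then obtain j a where a: "j < m" "\<bar>a\<bar> \<le> 2 * len y" "len (inv (\<zeta> j a) \<otimes> y) \<le> len y / 4"
      using approx[OF yL _ small(1)] by (auto simp: approximates_def)
    have "\<bar>t j\<bar> \<le> (\<Sum>j<m. \<bar>t j\<bar>)" using a(1) by (intro member_le_sum) auto
    then have "\<bar>t j + a\<bar> \<le> 8 * r" using small a(2) by linarith
    then have "t(j := t j + a) \<in> {..<m} \<rightarrow>\<^sub>E {-(8 * r)..8 * r}"
      using t a(1) by (auto simp: PiE_iff extensional_def abs_le_iff)
    then have "path_cost \<zeta> m x t \<le> path_cost \<zeta> m x (t(j := t j + a))" by (rule min)
    moreover have "path_cost \<zeta> m x (t(j := t j + a)) < path_cost \<zeta> m x t"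
      using path_cost_decreases[OF x(1) small(2) r(2,3), folded y_def, OF y small(1) a] .
    ultimately show False by simp
  qed
  then have "y = \<one>" by (rule len_zero[OF yL])
  then have "x = path_product \<zeta> m t" using mult_inv_cancel_left[OF pL x(1)] pL by (simp add: y_def)
  then show ?thesis by (rule that)
qed

end

theorem lipschitz_homs_generate_nhd_one:
  assumes N: "subgroup N L" "\<And>\<xi> t. \<xi> \<in> lipschitz_homs \<Longrightarrow> \<xi> t \<in> N"
  obtains V where "nhd_one V" "V \<subseteq> N"
proof -
  obtain \<Xi> d where \<Xi>: "finite \<Xi>" "\<Xi> \<subseteq> lipschitz_homs" and d: "0 < d"
    and approx: "\<And>x. x \<in> carrier L \<Longrightarrow> 0 < len x \<Longrightarrow> len x < d \<Longrightarrow> approximates \<Xi> x"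
    using finite_approximating_homs by blast
  obtain \<zeta> and m :: nat where \<Xi>_eq: "\<Xi> = \<zeta> ` {..<m}" using finite_imp_nat_seg_image_inj_on[OF \<Xi>(1)]
    by (auto simp: lessThan_def)
  have \<zeta>: "\<zeta> j \<in> lipschitz_homs" if "j < m" for j using that \<Xi>(2) \<Xi>_eq by auto
  define r where "r = min d (min (c / 8) (1 / (128 * M)))"
  have "128 * M * r \<le> 128 * M * (1 / (128 * M))"
    unfolding r_def using M_pos by (intro mult_left_mono) auto
  then have r: "0 < r" "r \<le> d" "8 * r \<le> c" "128 * M * r \<le> 1"
    using d c_pos M_pos by (auto simp: r_def)
  have "x \<in> N" if x: "x \<in> carrier L" "len x < r" for x
  proof -
    have "approximates (\<zeta> ` {..<m}) y" if "y \<in> carrier L" "0 < len y" "len y < r" for y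
      using approx[OF that(1,2)] that(3) r(2) \<Xi>_eq by simp
    then obtain t where "x = path_product \<zeta> m t"
      using short_element_is_path_product[where \<zeta> = \<zeta> and m = m, OF \<zeta> x r(1,3,4)] by blast
    then show ?thesis using path_product_mem[OF N(1)] N(2)[OF \<zeta>] by simp
  qed
  moreover obtain V where "nhd_one V" "\<And>z. z \<in> V \<Longrightarrow> len z < r"
    using len_small_near_one[OF r(1)] by blast
  ultimately show ?thesis using that[of V] nhd_one_mem_carrier by blast
qed

end

section \<open>Groups without small subgroups\<close>

lemma (in group) nat_pow_conjugate:
  assumes "y \<in> carrier G" "h \<in> carrier G"
  shows "(inv y \<otimes> h \<otimes> y) [^] (n::nat) = inv y \<otimes> h [^] n \<otimes> y"
  using assms by (induction n) (simp_all add: m_assoc)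

lemma (in group) weighted_word_rescale:
  assumes wt: "symmetric_weights wt"
    and letter: "\<And>g w. wt g w \<Longrightarrow> w \<le> b \<Longrightarrow> \<exists>w'\<le>K * w. wt' g w'"
    and q: "weighted_word wt q r" "r \<le> b"
  shows "\<exists>r'\<le>K * r. weighted_word wt' q r'"
  using q
proof (induction rule: weighted_word.induct)
  case weighted_word_one
  then show ?case using weighted_word.weighted_word_one by auto
next
  case (weighted_word_step g w q r)
  have "0 < w" "0 \<le> r"
    using symmetric_weightsD(2)[OF wt weighted_word_step(1)]
      weighted_word_nonneg[OF weighted_word_step(2) wt]
    by auto
  then have "r \<le> b" "w \<le> b" using weighted_word_step.prems by linarith+
  then obtain r' w' where "r' \<le> K * r" "weighted_word wt' q r'" "w' \<le> K * w" "wt' g w'"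
    using weighted_word_step letter by blast
  then show ?case
    by (intro exI[of _ "r' + w'"]) (auto simp: distrib_left intro: weighted_word.weighted_word_step)
qed

lemma inverse_nat_div_le:
  assumes "1 \<le> d" "d \<le> (n::nat)"
  shows "1 \<le> n div d" "1 / real (n div d) \<le> 2 * real d * (1 / real n)"
proof -
  show div_ge_1: "1 \<le> n div d" using assms by (simp add: div_greater_zero_iff Suc_le_eq)
  have "n < d * (n div d + 1)"
    using assms dividend_less_times_div[of d n] by (simp add: mult.commute)
  also have "\<dots> \<le> d * (n div d + n div d)" using div_ge_1 by (intro mult_le_mono) auto
  finally have "n \<le> 2 * d * (n div d)" by (simp only: mult_2 distrib_left distrib_right less_imp_le)
  then have "real n \<le> real (2 * d * (n div d))" by (simp only: of_nat_le_iff)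
  then show "1 / real (n div d) \<le> 2 * real d * (1 / real n)"
    using div_ge_1 assms by (simp add: field_simps)
qed

context group
begin

lemma power_weights_rescale:
  assumes d: "1 \<le> d" "\<And>n. powers_upto_in U n \<subseteq> powers_upto_in V (n div d)"
    and g: "power_weights U g w" "w \<le> 1 / real d"
  shows "\<exists>w'\<le>2 * real d * w. power_weights V g w'"
proof -
  obtain n where n: "1 \<le> n" "w = 1 / real n" "g \<in> powers_upto_in U n"
    using g(1) by (auto simp: power_weights_def)
  have "d \<le> n" using g(2) n(1,2) d(1) by (simp add: field_simps)
  then show ?thesis
    using inverse_nat_div_le[OF d(1)] n d(2) unfolding power_weights_def by blast
qed

lemma powers_upto_in_conjugate:
  assumes "h \<in> powers_upto_in V n" "y \<in> carrier G" "\<And>g. g \<in> V \<Longrightarrow> inv y \<otimes> g \<otimes> y \<in> W"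
  shows "inv y \<otimes> h \<otimes> y \<in> powers_upto_in W n"
  using assms by (auto simp: powers_upto_in_def nat_pow_conjugate)

end

lemma (in top_group) powers_in_imp_one:
  assumes U: "symmetric_set U" "traps_subgroups U {\<one>}"
    and x: "x \<in> carrier L" "\<And>j::nat. x [^] j \<in> U"
  shows "x = \<one>"
proof -
  have "x [^] k \<in> U" for k :: int
    using x(2) U(1) by (simp add: int_pow_def2 symmetric_setD del: pow_nat)
  then have "generate L {x} \<subseteq> U" using generate_pow[OF x(1)] by auto
  moreover have "subgroup (generate L {x}) L" using x(1) by (intro generate_is_subgroup) auto
  ultimately have "generate L {x} \<subseteq> {\<one>}" using traps_subgroupsD[OF U(2)] by blast
  then show ?thesis using generate.incl[of x "{x}" L] by auto
qed

context lc_group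
begin

text \<open>All powers of a limit of the elements \<open>x d\<close> to the \<open>j d\<close> lie in \<open>U\<close>.\<close>

lemma nss_powers_eventually_in:
  assumes U: "compactin T U" "symmetric_set U" "traps_subgroups U {\<one>}" and V: "nhd_one V"
    and F: "ultrafilter F" "F \<le> sequentially"
    and x: "\<And>d. 1 \<le> d \<Longrightarrow> x d \<in> powers_upto_in U (n d)"
    and j: "\<And>d. 1 \<le> d \<Longrightarrow> d * j d \<le> n d"
  shows "eventually (\<lambda>d. x d [^] (j d :: nat) \<in> V) F"
proof -
  have large: "eventually (\<lambda>d. d \<ge> m) F" for m
    using F(2) eventually_ge_at_top[of m] filter_leD by blast
  have powers: "eventually (\<lambda>d. (x d [^] j d) [^] s \<in> U) F" for s :: nat
    using large[of "max 1 s"]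
  proof eventually_elim
    case (elim d)
    have xd: "x d \<in> powers_upto_in U (n d)" "d * j d \<le> n d" using x[of d] j[of d] elim by auto
    have "j d * s \<le> d * j d" using elim by (simp add: mult.commute)
    then have "x d [^] (j d * s) \<in> U" using xd(2) by (intro powers_upto_inD[OF xd(1)]) linarith
    moreover have "x d \<in> carrier L" by (rule powers_upto_in_carrier[OF xd(1)])
    ultimately show ?case by (simp add: nat_pow_pow)
  qed
  have "eventually (\<lambda>d. x d [^] j d \<in> U) F"
    using powers[of 1] large[of 1]
  proof eventually_elim
    case (elim d)
    then have "x d \<in> carrier L" using x[of d] by (intro powers_upto_in_carrier) auto
    then show ?case using elim by simp
  qed
  then obtain l where l: "l \<in> U" "limitin T (\<lambda>d. x d [^] j d) l F"
    by (rule ultrafilter_compactin_limit[OF F(1) U(1)])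
  have "l [^] s \<in> U" for s :: nat
    by (rule limitin_closedin[OF limitin_nat_pow[OF l(2)] compactin_closedin[OF U(1)] powers])
      (rule ultrafilter_not_bot[OF F(1)])
  then have "l = \<one>" using powers_in_imp_one[OF U(2,3)] limitin_topspace[OF l(2)] by simp
  then show ?thesis
    using l(2) nhd_one_openin[OF V] nhd_one_mem[OF V] by (auto simp: limitin_def)
qed

lemma nss_power_control:
  assumes U: "compactin T U" "symmetric_set U" "traps_subgroups U {\<one>}" and V: "nhd_one V"
  obtains d :: nat where "1 \<le> d" "\<And>n. powers_upto_in U n \<subseteq> powers_upto_in V (n div d)"
proof -
  have "\<exists>d\<ge>1. \<forall>n x j. x \<in> powers_upto_in U n \<longrightarrow> d * j \<le> n \<longrightarrow> x [^] j \<in> V"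
  proof (rule ccontr)
    assume "\<not> ?thesis"
    then have "\<forall>d. \<exists>n x j. 1 \<le> d \<longrightarrow> x \<in> powers_upto_in U n \<and> d * j \<le> n \<and> x [^] j \<notin> V" by blast
    then obtain n x and j :: "nat \<Rightarrow> nat" where x: "\<And>d. 1 \<le> d \<Longrightarrow>
        x d \<in> powers_upto_in U (n d) \<and> d * j d \<le> n d \<and> x d [^] j d \<notin> V"
      by metis
    obtain F where F: "ultrafilter F" "F \<le> sequentially"
      using ultrafilter_exists[OF sequentially_bot] .
    have "eventually (\<lambda>d. x d [^] j d \<in> V) F"
      using nss_powers_eventually_in[OF U V F, of x n j] x by blast
    moreover have "eventually (\<lambda>d. 1 \<le> d) F"
      using F(2) eventually_ge_at_top[of 1] filter_leD by blast
    ultimately have "eventually (\<lambda>d. False) F" by eventually_elim (use x in auto)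
    then show False using ultrafilter_not_bot[OF F(1)] by simp
  qed
  then obtain d :: nat where d: "1 \<le> d" "\<And>n x j. x \<in> powers_upto_in U n \<Longrightarrow> d * j \<le> n \<Longrightarrow> x [^] j \<in> V"
    by blast
  have "x \<in> powers_upto_in V (n div d)" if x: "x \<in> powers_upto_in U n" for x n
  proof -
    have "d * j \<le> n" if "j \<le> n div d" for j
      using mult_le_mono2[OF that, of d] times_div_less_eq_dividend[of d n] by linarith
    then show ?thesis
      using d(2)[OF x] powers_upto_in_carrier[OF x] by (auto simp: powers_upto_in_def)
  qed
  then show ?thesis using that[OF d(1)] by blast
qed

lemma nss_conjugate_power_control:
  assumes U: "compactin T U" "symmetric_set U" "traps_subgroups U {\<one>}"
    and Y: "compactin T Y" and N: "nhd_one N" "N \<subseteq> U"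
  obtains d :: nat where "1 \<le> d"
    "\<And>y h n. y \<in> Y \<Longrightarrow> h \<in> powers_upto_in U n \<Longrightarrow> inv y \<otimes> h \<otimes> y \<in> powers_upto_in U (n div d)"
proof -
  obtain V where V: "nhd_one V" "\<And>y h. y \<in> Y \<Longrightarrow> h \<in> V \<Longrightarrow> inv y \<otimes> h \<otimes> y \<in> N"
    using nhd_one_conjugate[OF Y N(1)] by blast
  obtain d :: nat where d: "1 \<le> d" "\<And>n. powers_upto_in U n \<subseteq> powers_upto_in V (n div d)"
    using nss_power_control[OF U V(1)] by blast
  have "inv y \<otimes> h \<otimes> y \<in> powers_upto_in U (n div d)"
    if y: "y \<in> Y" and h: "h \<in> powers_upto_in U n" for y h n
    using powers_upto_in_conjugate[of h V "n div d" y U] d(2) h y V(2)[OF y] N(2)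
      compactin_carrier[OF Y] by blast
  then show ?thesis using that[OF d(1)] by blast
qed

lemma nss_words_in_compact:
  assumes U: "compactin T U" "symmetric_set U" "traps_subgroups U {\<one>}"
    and C: "compactin T C" and N: "nhd_one N" "N \<subseteq> C"
  obtains \<kappa> where "0 < \<kappa>" "\<kappa> \<le> 1" "\<And>q r. weighted_word (power_weights U) q r \<Longrightarrow> r < \<kappa> \<Longrightarrow> q \<in> C"
proof -
  obtain V where V: "nhd_one V" "symmetric_set V" "weight_ball (power_weights V) 1 \<subseteq> C"
    using weight_ball_trapping[OF C N] .
  obtain k :: nat where k: "1 \<le> k" "\<And>n. powers_upto_in U n \<subseteq> powers_upto_in V (n div k)"
    using nss_power_control[OF U V(1)] by blast
  define \<kappa> where "\<kappa> = 1 / (2 * real k)"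
  have \<kappa>: "0 < \<kappa>" "\<kappa> \<le> 1" "\<kappa> \<le> 1 / real k" "2 * real k * \<kappa> = 1"
    using k(1) by (auto simp: \<kappa>_def field_simps)
  have "q \<in> C" if q: "weighted_word (power_weights U) q r" "r < \<kappa>" for q r
  proof -
    have "\<exists>r'\<le>2 * real k * r. weighted_word (power_weights V) q r'"
    proof (rule weighted_word_rescale[OF symmetric_power_weights[OF U(2)] _ q(1)])
      show "\<exists>w'\<le>2 * real k * w. power_weights V g w'"
        if "power_weights U g w" "w \<le> 1 / real k" for g w
        by (rule power_weights_rescale[OF k that])
      show "r \<le> 1 / real k" using q(2) \<kappa>(3) by linarith
    qed
    then obtain r' where r': "r' \<le> 2 * real k * r" "weighted_word (power_weights V) q r'" by blast
    have "2 * real k * r \<le> 2 * real k * \<kappa>" using q(2) by (intro mult_left_mono) auto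
    then have "q \<in> weight_ball (power_weights V) 1"
      using r' \<kappa>(4) by (intro weight_ballI[of _ q r']) auto
    then show ?thesis using V(3) by blast
  qed
  then show ?thesis using that \<kappa>(1,2) by blast
qed

lemma compact_symmetric_nhd_one:
  assumes V: "nhd_one V"
  obtains W C where "nhd_one W" "compactin T C" "symmetric_set C" "W \<subseteq> C" "C \<subseteq> V"
proof -
  obtain V' where V': "nhd_one V'" "symmetric_set V'" "V' \<subseteq> V" using symmetric_nhd_one[OF V] .
  obtain W C where C: "nhd_one W" "compactin T C" "W \<subseteq> C" "C \<subseteq> V'" using compact_nhd_one[OF V'(1)] .
  let ?C = "C \<union> (\<lambda>x. inv x) ` C"
  have "symmetric_set ?C" using compactin_carrier[OF C(2)] by (auto simp: symmetric_set_def)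
  moreover have "compactin T ?C" by (intro compactin_Un compactin_image_inv C(2))
  moreover have "?C \<subseteq> V" using C(4) V'(3) symmetric_setD[OF V'(2)] by blast
  ultimately show ?thesis using that[of W ?C] C(1,3) by blast
qed

end

locale nss_bump = gleason_bump L T I "group.power_weights L U" \<kappa> \<theta> \<Theta> U\<^sub>1 U D
  for L (structure) and T and I :: "('a \<Rightarrow> real) \<Rightarrow> real" and U :: "'a set" and \<kappa> \<theta> \<Theta> U\<^sub>1 D +
  fixes d :: nat
  assumes symmetric_U: "symmetric_set U" and nss: "traps_subgroups U {\<one>}"
    and compactin_U: "compactin T U" and one_in_U: "\<one> \<in> U"
    and support_square: "\<And>x y. x \<in> U\<^sub>1 <#> D \<Longrightarrow> y \<in> U\<^sub>1 <#> D \<Longrightarrow> x \<otimes> y \<in> U"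
    and d_pos: "1 \<le> d"
    and conjugate_powers: "\<And>y h n. y \<in> gleason_region U\<^sub>1 U D \<Longrightarrow> h \<in> powers_upto_in U n \<Longrightarrow>
      inv y \<otimes> h \<otimes> y \<in> powers_upto_in U (n div d)"
    and \<theta>_one: "\<theta> \<one> = 1"
begin

definition envelope_square :: "'a \<Rightarrow> real" where
  "envelope_square = convolution envelope envelope"

sublocale translation_length L T envelope_square
  by unfold_locales (simp add: envelope_square_def convolution_Cc envelope_Cc)

lemma power_weights_U: "g \<in> powers_upto_in U n \<Longrightarrow> 1 \<le> n \<Longrightarrow> power_weights U g (1 / real n)"
  by (auto simp: power_weights_def)

lemma envelope_conjugate_diff_le:
  assumes y: "y \<in> gleason_region U\<^sub>1 U D" "y \<in> carrier L" and z: "z \<in> carrier L"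
    and h: "h \<in> powers_upto_in U m" "1 \<le> m"
  shows "\<bar>envelope (inv y \<otimes> inv h \<otimes> y \<otimes> z) - envelope z\<bar> \<le> 2 * real d / \<kappa> * (1 / real m)"
proof -
  define k where "k = inv y \<otimes> h \<otimes> y"
  have hL: "h \<in> carrier L" by (rule powers_upto_in_carrier[OF h(1)])
  then have kL: "k \<in> carrier L" and inv_k: "inv y \<otimes> inv h \<otimes> y = inv k"
    using y(2) by (auto simp: k_def inv_mult_group m_assoc)
  have "\<bar>envelope (inv k \<otimes> z) - envelope z\<bar> \<le> 2 * real d / \<kappa> * (1 / real m)"
  proof (cases "d \<le> m")
    case True
    note div = inverse_nat_div_le[OF d_pos True]
    have "power_weights U k (1 / real (m div d))"
      unfolding k_def by (rule power_weights_U[OF conjugate_powers[OF y(1) h(1)] div(1)])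
    then have "\<bar>envelope (inv k \<otimes> z) - envelope z\<bar> \<le> (1 / real (m div d)) / \<kappa>"
      by (rule envelope_left_translate_diff_abs_le[OF _ z])
    also have "\<dots> \<le> (2 * real d * (1 / real m)) / \<kappa>"
      using div(2) \<kappa>_pos by (intro divide_right_mono) auto
    also have "\<dots> = 2 * real d / \<kappa> * (1 / real m)" by simp
    finally show ?thesis .
  next
    case False
    have "\<bar>envelope (inv k \<otimes> z) - envelope z\<bar> \<le> 1"
      using envelope_range[of "inv k \<otimes> z"] envelope_range[OF z] kL z by auto
    also have "\<kappa> * real m \<le> 1 * (2 * real d)" using \<kappa>_le_1 \<kappa>_pos False by (intro mult_mono) auto
    then have "1 \<le> 2 * real d / \<kappa> * (1 / real m)" using \<kappa>_pos h(2) by (simp add: field_simps)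
    finally show ?thesis .
  qed
  then show ?thesis by (simp add: inv_k)
qed

lemma envelope_square_second_difference_le:
  assumes g: "g \<in> powers_upto_in U n" "1 \<le> n" and h: "h \<in> powers_upto_in U m" "1 \<le> m"
    and x: "x \<in> carrier L"
  defines "f \<equiv> envelope_square"
  shows "\<bar>f (inv g \<otimes> (inv h \<otimes> x)) - f (inv h \<otimes> x) - (f (inv g \<otimes> x) - f x)\<bar>
    \<le> 2 * real d * I \<Theta> / \<kappa>\<^sup>2 * (1 / real m) * (1 / real n)"
proof -
  have carrier: "g \<in> carrier L" "h \<in> carrier L" using g h powers_upto_in_carrier by auto
  let ?c = "convolution (envelope_diff g) envelope"
  have "\<bar>?c (inv h \<otimes> x) - ?c x\<bar> \<le> 2 * real d / \<kappa> * (1 / real m) * (1 / real n / \<kappa> * I \<Theta>)"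
    using \<kappa>_pos envelope_conjugate_diff_le[OF _ _ _ h]
    by (intro convolution_envelope_diff_translate_le[OF power_weights_U[OF g] envelope_Cc carrier(2) x]) auto
  also have "\<dots> = 2 * real d * I \<Theta> / \<kappa>\<^sup>2 * (1 / real m) * (1 / real n)"
    by (simp add: power2_eq_square)
  finally show ?thesis
    using carrier x by (simp add: convolution_envelope_diff envelope_Cc f_def envelope_square_def)
qed

lemma envelope_square_one_pos: "0 < envelope_square \<one>"
proof -
  have "(\<lambda>y. \<theta> y * \<theta> (inv y)) \<in> Cc"
    using Cc_mult[OF \<theta> Cc_compose_inv[OF \<theta>]] .
  then have Cc: "(\<lambda>y. \<theta> y * \<theta> (inv y)) \<in> Cc" .
  then have "0 < I (\<lambda>y. \<theta> y * \<theta> (inv y))"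
    using \<theta>_range \<theta>_one by (intro I_pos[of _ \<one>] Cc_plusI) auto
  also have "\<dots> \<le> I (\<lambda>y. envelope y * envelope (inv y \<otimes> \<one>))"
  proof (rule I_mono[OF Cc convolution_integrand_Cc[OF envelope_Cc envelope_Cc one_closed]])
    fix y assume y: "y \<in> carrier L"
    have "\<theta> y * \<theta> (inv y) \<le> envelope y * envelope (inv y)"
      using \<theta>_le_envelope[of y] \<theta>_le_envelope[of "inv y"] \<theta>_range[of "inv y"] envelope_range[of y] y
      by (intro mult_mono) auto
    then show "\<theta> y * \<theta> (inv y) \<le> envelope y * envelope (inv y \<otimes> \<one>)" using y by simp
  qed
  finally show ?thesis by (simp add: envelope_square_def convolution_def)
qed

lemma envelope_square_outside:
  assumes x: "x \<in> carrier L" "x \<notin> U"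
  shows "envelope_square x = 0"
  unfolding envelope_square_def
proof (rule convolution_eq_0[OF _ envelope_Cc envelope_Cc x(1)])
  fix y assume y: "y \<in> carrier L"
  show "envelope y * envelope (inv y \<otimes> x) = 0"
  proof (rule ccontr)
    assume "\<not> ?thesis"
    then have "y \<in> U\<^sub>1 <#> D" "inv y \<otimes> x \<in> U\<^sub>1 <#> D"
      using envelope_nonzero_in[OF y] envelope_nonzero_in[of "inv y \<otimes> x"] x y by auto
    then have "y \<otimes> (inv y \<otimes> x) \<in> U" by (rule support_square)
    then show False using x y by simp
  qed
qed

text \<open>The powers of \<open>x\<close> reach the complement of \<open>U\<close>, where the function vanishes, so the length
  of \<open>x\<close> is at least proportional to the inverse of the escape time.\<close>

lemma escape_time_le_len:
  assumes x: "x \<in> U" "x \<noteq> \<one>"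
  obtains n where "1 \<le> n" "x \<in> powers_upto_in U n" "1 / real n \<le> 2 * len x / envelope_square \<one>"
proof -
  have xL: "x \<in> carrier L" using compactin_carrier[OF compactin_U] x(1) by blast
  have ex: "\<exists>j::nat. x [^] j \<notin> U" using powers_in_imp_one[OF symmetric_U nss xL] x(2) by blast
  define j where "j = (LEAST j::nat. x [^] j \<notin> U)"
  have escaped: "x [^] j \<notin> U" unfolding j_def by (rule LeastI_ex[OF ex])
  have before: "x [^] i \<in> U" if "i < j" for i
    using not_less_Least[of i] that unfolding j_def by blast
  have "j \<noteq> 0" using escaped one_in_U by (intro notI) simp
  moreover have "j \<noteq> 1" using escaped x(1) xL by (intro notI) simp
  ultimately have j: "2 \<le> j" by simp
  have xj: "x [^] j \<in> carrier L" using xL by simp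
  have "envelope_square \<one> \<le> len (x [^] j)"
    using len_ge[OF xj xj] envelope_square_outside[OF xj escaped] xj by simp
  also have "\<dots> \<le> real j * len x" by (rule len_nat_pow[OF xL])
  also have "\<dots> \<le> (2 * real (j - 1)) * len x"
    using j len_nonneg[OF xL] by (intro mult_right_mono) (auto simp: of_nat_diff)
  finally have "1 / real (j - 1) \<le> 2 * len x / envelope_square \<one>"
    using j envelope_square_one_pos by (simp add: field_simps)
  moreover have "x \<in> powers_upto_in U (j - 1)" using before xL j by (auto simp: powers_upto_in_def)
  ultimately show ?thesis using that[of "j - 1"] j by simp
qed

lemma envelope_square_second_difference_le_len:
  assumes x: "x \<in> U" and y: "y \<in> U" and z: "z \<in> carrier L"
  defines "f \<equiv> envelope_square"
  shows "\<bar>f (inv y \<otimes> (inv x \<otimes> z)) - f (inv x \<otimes> z) - (f (inv y \<otimes> z) - f z)\<bar>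
    \<le> ((2 * real d * I \<Theta> / \<kappa>\<^sup>2 + 1) * (2 / f \<one>)\<^sup>2) * len x * len y"
proof (cases "x = \<one> \<or> y = \<one>")
  case True
  then show ?thesis
    using z compactin_carrier[OF compactin_U] x y len_nonneg I_\<Theta>_nonneg by (auto simp: len_one)
next
  case False
  have carrier: "x \<in> carrier L" "y \<in> carrier L" using compactin_carrier[OF compactin_U] x y by auto
  have f1: "0 < f \<one>" using envelope_square_one_pos by (simp add: f_def)
  obtain m where m: "1 \<le> m" "x \<in> powers_upto_in U m" "1 / real m \<le> 2 * len x / f \<one>"
    using escape_time_le_len[OF x] False unfolding f_def by blast
  obtain n where n: "1 \<le> n" "y \<in> powers_upto_in U n" "1 / real n \<le> 2 * len y / f \<one>"
    using escape_time_le_len[OF y] False unfolding f_def by blast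
  have K: "0 \<le> 2 * real d * I \<Theta> / \<kappa>\<^sup>2" using I_\<Theta>_nonneg by simp
  have "\<bar>f (inv y \<otimes> (inv x \<otimes> z)) - f (inv x \<otimes> z) - (f (inv y \<otimes> z) - f z)\<bar>
      \<le> 2 * real d * I \<Theta> / \<kappa>\<^sup>2 * (1 / real m) * (1 / real n)"
    unfolding f_def by (rule envelope_square_second_difference_le[OF n(2,1) m(2,1) z])
  also have "\<dots> \<le> (2 * real d * I \<Theta> / \<kappa>\<^sup>2 + 1) * (2 * len x / f \<one>) * (2 * len y / f \<one>)"
    using m n K f1 len_nonneg carrier by (intro mult_mono) auto
  also have "\<dots> = ((2 * real d * I \<Theta> / \<kappa>\<^sup>2 + 1) * (2 / f \<one>)\<^sup>2) * len x * len y"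
    by (simp add: power2_eq_square)
  finally show ?thesis .
qed

sublocale gleason_length L T envelope_square U "envelope_square \<one>"
  "(2 * real d * I \<Theta> / \<kappa>\<^sup>2 + 1) * (2 / envelope_square \<one>)\<^sup>2"
proof unfold_locales
  show "0 < (2 * real d * I \<Theta> / \<kappa>\<^sup>2 + 1) * (2 / envelope_square \<one>)\<^sup>2"
    using I_\<Theta>_nonneg envelope_square_one_pos by (intro mult_pos_pos add_nonneg_pos) auto
  show "x = \<one>" if x: "x \<in> U" "len x = 0" for x
  proof (rule ccontr)
    assume "x \<noteq> \<one>"
    then obtain n where "1 \<le> n" "1 / real n \<le> 2 * len x / envelope_square \<one>"
      using escape_time_le_len[OF x(1)] by blast
    then show False using x(2) by simp
  qed
qed (use compactin_U envelope_square_one_pos envelope_square_outside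
    envelope_square_second_difference_le_len in auto)

end

lemma (in lc_group) nss_bump_exists:
  assumes U: "compactin T U" "symmetric_set U" "traps_subgroups U {\<one>}" and N: "nhd_one N" "N \<subseteq> U"
  obtains I \<kappa> \<theta> \<Theta> U\<^sub>1 D d where "nss_bump L T I U \<kappa> \<theta> \<Theta> U\<^sub>1 D d"
proof -
  obtain W2 where W2: "nhd_one W2" "symmetric_set W2" "W2 \<subseteq> N" "\<And>x y. x \<in> W2 \<Longrightarrow> y \<in> W2 \<Longrightarrow> x \<otimes> y \<in> N"
    using mult_nhd_one[OF N(1)] by blast
  obtain W1 where W1: "nhd_one W1" "symmetric_set W1" "W1 \<subseteq> W2" "\<And>x y. x \<in> W1 \<Longrightarrow> y \<in> W1 \<Longrightarrow> x \<otimes> y \<in> W2"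
    using mult_nhd_one[OF W2(1)] by blast
  obtain N1 U\<^sub>1 where U\<^sub>1: "nhd_one N1" "compactin T U\<^sub>1" "N1 \<subseteq> U\<^sub>1" "U\<^sub>1 \<subseteq> W1"
    using compact_nhd_one[OF W1(1)] .
  obtain \<kappa> where \<kappa>: "0 < \<kappa>" "\<kappa> \<le> 1"
      "\<And>q r. weighted_word (power_weights U) q r \<Longrightarrow> r < \<kappa> \<Longrightarrow> q \<in> U\<^sub>1"
    using nss_words_in_compact[OF U U\<^sub>1(2,1,3)] by blast
  obtain I where "haar_integral L T I" by (rule haar_integral_exists)
  then interpret haar_integral L T I .
  obtain \<theta> D \<Theta> where \<theta>: "\<theta> \<in> Cc" "\<And>x. x \<in> carrier L \<Longrightarrow> \<theta> x \<in> {0..1}" "\<theta> \<one> = 1"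
    and D: "compactin T D" "D \<subseteq> W1" "\<And>x. x \<in> carrier L \<Longrightarrow> x \<notin> D \<Longrightarrow> \<theta> x = 0"
    and \<Theta>: "\<Theta> \<in> Cc_plus" "\<And>y. y \<in> gleason_region U\<^sub>1 U D \<Longrightarrow> 1 \<le> \<Theta> y"
    and region: "compactin T (gleason_region U\<^sub>1 U D)"
    using gleason_data_exist[OF U\<^sub>1(2) U(1) W1(1)] by blast
  obtain d :: nat where d: "1 \<le> d" "\<And>y h n. y \<in> gleason_region U\<^sub>1 U D \<Longrightarrow>
      h \<in> powers_upto_in U n \<Longrightarrow> inv y \<otimes> h \<otimes> y \<in> powers_upto_in U (n div d)"
    using nss_conjugate_power_control[OF U region N] by blast
  have square: "x \<otimes> y \<in> U" if "x \<in> U\<^sub>1 <#> D" "y \<in> U\<^sub>1 <#> D" for x y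
  proof -
    have "U\<^sub>1 <#> D \<subseteq> W2" using U\<^sub>1(4) D(2) W1(4) unfolding set_mult_def by blast
    then show ?thesis using W2(4) that N(2) by blast
  qed
  have one: "\<one> \<in> U" using nhd_one_mem[OF N(1)] N(2) by blast
  have letters: "g \<in> U" if "power_weights U g w" for g w
    using that powers_upto_in_mem by (auto simp: power_weights_def)
  have "nss_bump L T I U \<kappa> \<theta> \<Theta> U\<^sub>1 D d"
    by unfold_locales
      (fact symmetric_power_weights[OF U(2)] \<kappa> \<theta> D(1,3) \<Theta> U\<^sub>1(2) U letters one square d)+
  then show ?thesis by (rule that)
qed

theorem (in lc_group) real_homs_generate_nhd_one:
  assumes N\<^sub>0: "nhd_one N\<^sub>0" "traps_subgroups N\<^sub>0 {\<one>}"
    and N: "subgroup N L" "\<And>\<xi> t. \<xi> \<in> hom real_group L \<Longrightarrow> \<xi> t \<in> N"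
  obtains V where "nhd_one V" "V \<subseteq> N"
proof -
  obtain W U where U: "nhd_one W" "compactin T U" "symmetric_set U" "W \<subseteq> U" "U \<subseteq> N\<^sub>0"
    using compact_symmetric_nhd_one[OF N\<^sub>0(1)] .
  obtain I \<kappa> \<theta> \<Theta> U\<^sub>1 D d where "nss_bump L T I U \<kappa> \<theta> \<Theta> U\<^sub>1 D d"
    using nss_bump_exists[OF U(2,3) traps_subgroups_mono[OF N\<^sub>0(2) U(5)] U(1,4)] .
  then interpret nss_bump L T I U \<kappa> \<theta> \<Theta> U\<^sub>1 D d .
  show ?thesis
    using lipschitz_homs_generate_nhd_one[OF N(1)] N(2) lipschitz_homs_real_hom that by blast
qed

section \<open>Homomorphisms into groups of class G\<close>

lemma infinite_cyclic_iso_integer_group: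
  assumes "group C" "cyclic_group C" and y: "y \<in> carrier C" "group.ord C y = 0"
  obtains \<psi> where "\<psi> \<in> iso C integer_group"
proof -
  interpret C: group C by fact
  obtain g where g: "g \<in> carrier C" and range: "carrier C = range (\<lambda>n::int. g [^]\<^bsub>C\<^esub> n)"
    using assms(2) C.cyclic_group by blast
  obtain k :: int where k: "y = g [^]\<^bsub>C\<^esub> k" using y(1) range by auto
  have "C.ord g = 0"
  proof (rule ccontr)
    assume "C.ord g \<noteq> 0"
    have "y [^]\<^bsub>C\<^esub> C.ord g = g [^]\<^bsub>C\<^esub> (k * int (C.ord g))"
      using g by (simp add: k C.int_pow_pow flip: int_pow_int)
    also have "\<dots> = \<one>\<^bsub>C\<^esub>" using g by (simp add: C.int_pow_eq_id)
    finally show False using \<open>C.ord g \<noteq> 0\<close> y C.ord_eq_0 by auto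
  qed
  then have "inj (\<lambda>n::int. g [^]\<^bsub>C\<^esub> n)" using C.int_pow_eq[OF g] by (auto intro: injI)
  then have "(\<lambda>n::int. g [^]\<^bsub>C\<^esub> n) \<in> iso integer_group C"
    using C.hom_integer_group_pow[OF g] range by (simp add: iso_def bij_betw_def)
  then show ?thesis using that group.iso_set_sym[OF group_integer_group] by blast
qed

lemma sum_group_component_hom:
  assumes "\<And>i. i \<in> I \<Longrightarrow> group (C i)" "i \<in> I"
  shows "(\<lambda>x. x i) \<in> hom (sum_group I C) (C i)"
  using assms by (auto simp: hom_def carrier_sum_group PiE_iff)

text \<open>Only finitely many components of \<open>x\<close> are nontrivial.\<close>

lemma sum_group_component_ord_eq_0:
  assumes C: "\<And>i. i \<in> I \<Longrightarrow> group (C i)"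
    and x: "x \<in> carrier (sum_group I C)" "group.ord (sum_group I C) x = 0"
  obtains i where "i \<in> I" "group.ord (C i) (x i) = 0"
proof (rule ccontr)
  assume none: "\<not> thesis"
  interpret S: group "sum_group I C" using C by simp
  define J where "J = {i \<in> I. x i \<noteq> \<one>\<^bsub>C i\<^esub>}"
  define n where "n = (\<Prod>i\<in>J. group.ord (C i) (x i))"
  have J: "finite J" using x(1) C by (simp add: carrier_sum_group J_def)
  have n: "0 < n" unfolding n_def using none that by (intro prod_pos) (auto simp: J_def)
  have "(x [^]\<^bsub>sum_group I C\<^esub> n) i = \<one>\<^bsub>C i\<^esub>" if i: "i \<in> I" for i
  proof -
    interpret group_hom "sum_group I C" "C i" "\<lambda>x. x i"
      using sum_group_component_hom[OF C i] C[OF i] S.is_group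
      by (simp add: group_hom_def group_hom_axioms_def)
    have "x i [^]\<^bsub>C i\<^esub> n = \<one>\<^bsub>C i\<^esub>"
    proof (cases "i \<in> J")
      case True
      then have "H.ord (x i) dvd n" unfolding n_def using J by (intro dvd_prodI) auto
      then show ?thesis using H.pow_eq_id hom_closed[OF x(1)] by blast
    next
      case False
      then show ?thesis using i by (simp add: J_def)
    qed
    then show ?thesis using hom_nat_pow[OF x(1)] by simp
  qed
  moreover have "x [^]\<^bsub>sum_group I C\<^esub> n \<in> carrier (sum_group I C)" using x(1) by simp
  ultimately have "x [^]\<^bsub>sum_group I C\<^esub> n = \<one>\<^bsub>sum_group I C\<^esub>"
    using C by (intro extensionalityI[of _ I]) (auto simp: carrier_sum_group PiE_iff)
  then show False using S.ord_eq_0[OF x(1)] x(2) n by simp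
qed

lemma direct_sum_of_cyclic_nonzero_int_hom:
  fixes G (structure)
  assumes "group G" and A: "subgroup A G" "direct_sum_of_cyclic G A"
    and x: "x \<in> A" "group.ord G x = 0"
  obtains \<psi> where "\<psi> \<in> hom (G\<lparr>carrier := A\<rparr>) integer_group" "\<psi> x \<noteq> 0"
proof -
  interpret group G by fact
  let ?A = "subgroup_generated G A"
  have carrier: "carrier ?A = A" by (rule subgroup.carrier_subgroup_generated_subgroup[OF A(1)])
  obtain I and C :: "'a \<Rightarrow> 'a monoid" where
    C: "\<And>i. i \<in> I \<Longrightarrow> group (C i)" "\<And>i. i \<in> I \<Longrightarrow> cyclic_group (C i)"
    and "?A \<cong> sum_group I C"
    using A(2) unfolding direct_sum_of_cyclic_def by blast
  then obtain h where h: "h \<in> iso ?A (sum_group I C)" by (auto simp: is_iso_def)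
  then have hom_h: "h \<in> hom ?A (sum_group I C)" and inj_h: "inj_on h A"
    by (auto simp: iso_def bij_betw_def carrier)
  interpret h: group_hom ?A "sum_group I C" h
    using hom_h C(1) by (simp add: group_hom_def group_hom_axioms_def)
  have hx: "h x \<in> carrier (sum_group I C)" using x(1) carrier by simp
  have "x [^] n = \<one>" if "h x [^]\<^bsub>sum_group I C\<^esub> n = \<one>\<^bsub>sum_group I C\<^esub>" for n :: nat
  proof -
    have "h (x [^]\<^bsub>?A\<^esub> n) = h \<one>\<^bsub>?A\<^esub>" using that x(1) by (simp only: h.hom_nat_pow h.hom_one carrier)
    moreover have "x [^]\<^bsub>?A\<^esub> n \<in> A" "\<one>\<^bsub>?A\<^esub> \<in> A"
      using h.G.nat_pow_closed[of x n] h.G.one_closed x(1) carrier by auto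
    ultimately show ?thesis using inj_h by (simp add: inj_on_eq_iff nat_pow_def)
  qed
  then have "h.H.ord (h x) = 0"
    using x(2) ord_eq_0[of x] h.H.ord_eq_0[OF hx] subgroup.mem_carrier[OF A(1) x(1)] by metis
  then obtain i where i: "i \<in> I" "group.ord (C i) (h x i) = 0"
    using sum_group_component_ord_eq_0[OF C(1) hx] by blast
  interpret Ci: group "C i" by (rule C(1)[OF i(1)])
  have proj: "(\<lambda>x. h x i) \<in> hom ?A (C i)"
    using Group.hom_compose[OF hom_h sum_group_component_hom[where C = C, OF C(1) i(1)]]
    by (simp add: o_def)
  then have hxi: "h x i \<in> carrier (C i)" using x(1) carrier hom_in_carrier by fastforce
  obtain \<psi> where \<psi>: "\<psi> \<in> iso (C i) integer_group"
    using infinite_cyclic_iso_integer_group[OF C[OF i(1)] hxi i(2)] .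
  have "h x i \<noteq> \<one>\<^bsub>C i\<^esub>" using i(2) by (metis Ci.ord_id zero_neq_one)
  then have "\<psi> (h x i) \<noteq> 0"
    using \<psi> hxi hom_one[of \<psi> "C i" integer_group] by (auto simp: iso_def bij_betw_def inj_on_def)
  moreover have "(\<lambda>x. \<psi> (h x i)) \<in> hom (G\<lparr>carrier := A\<rparr>) integer_group"
    using Group.hom_compose[OF proj, of \<psi> integer_group] \<psi> carrier
    by (simp add: o_def iso_def hom_def)
  ultimately show ?thesis using that by blast
qed

lemma class_G_hom_ord_neq_0:
  assumes G: "class_G G" and H: "comm_group H" and \<phi>: "\<phi> \<in> hom H G"
    and trivial: "\<And>\<psi>. \<psi> \<in> hom H integer_group \<Longrightarrow> \<psi> x = 0" and x: "x \<in> carrier H"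
  shows "group.ord G (\<phi> x) \<noteq> 0"
proof
  assume infinite: "group.ord G (\<phi> x) = 0"
  interpret H: comm_group H by fact
  interpret \<phi>: group_hom H G \<phi>
    using \<phi> G by (simp add: class_G_def group_hom_def group_hom_axioms_def)
  let ?A = "\<phi> ` carrier H"
  have A: "subgroup ?A G" by (rule \<phi>.img_is_subgroup)
  have "a \<otimes>\<^bsub>G\<^esub> b = b \<otimes>\<^bsub>G\<^esub> a" if "a \<in> ?A" "b \<in> ?A" for a b
    using that H.m_comm by (auto simp flip: \<phi>.hom_mult)
  then have "direct_sum_of_cyclic G ?A" using G A by (simp add: class_G_def abelian_subgroup_def)
  then obtain \<psi> where \<psi>: "\<psi> \<in> hom (G\<lparr>carrier := ?A\<rparr>) integer_group" "\<psi> (\<phi> x) \<noteq> 0"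
    using direct_sum_of_cyclic_nonzero_int_hom[OF \<phi>.H.is_group A _ imageI[OF x] infinite] by blast
  have "(\<lambda>x. \<psi> (\<phi> x)) \<in> hom H integer_group" using \<psi>(1) by (auto simp: hom_def)
  then show False using trivial \<psi>(2) by blast
qed

lemma comm_group_real_group: "comm_group real_group"
proof (rule comm_groupI)
  show "\<exists>y\<in>carrier real_group. y \<otimes>\<^bsub>real_group\<^esub> x = \<one>\<^bsub>real_group\<^esub>" for x
    by (rule bexI[of _ "- x"]) (simp_all add: real_group_def)
qed (simp_all add: real_group_def)

lemma real_int_hom_trivial:
  assumes \<psi>: "\<psi> \<in> hom real_group integer_group"
  shows "\<psi> t = 0"
proof (rule ccontr)
  assume nonzero: "\<psi> t \<noteq> 0"
  define n where "n = nat \<bar>\<psi> t\<bar> + 1"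
  have "\<psi> t = \<psi> (real n * (t / real n))" by (simp add: n_def)
  also have "\<dots> = int n * \<psi> (t / real n)"
    using group.real_hom_nat_mult[OF group_integer_group \<psi>, of n "t / real n"] by simp
  finally have "int n dvd \<psi> t" by simp
  then have "int n \<le> \<bar>\<psi> t\<bar>" using dvd_imp_le_int[OF nonzero, of "int n"] by simp
  then show False by (simp add: n_def)
qed

lemma class_G_real_hom_trivial:
  fixes G (structure)
  assumes G: "class_G G" and \<xi>: "\<xi> \<in> hom real_group G"
  shows "\<xi> t = \<one>"
proof -
  interpret group G using G by (simp add: class_G_def)
  interpret \<xi>: group_hom real_group G \<xi>
    using \<xi> comm_group_real_group
    by (simp add: group_hom_def group_hom_axioms_def comm_group_def)
  have ord: "ord (\<xi> t) \<noteq> 0" for t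
    by (rule class_G_hom_ord_neq_0[OF G comm_group_real_group \<xi> real_int_hom_trivial]) auto
  moreover have "subgroup (range \<xi>) G" using \<xi>.img_is_subgroup by simp
  ultimately have finite: "finite (range \<xi>)"
    using G unfolding class_G_def torsion_subgroup_def by blast
  define n where "n = (\<Prod>a\<in>range \<xi>. ord a)"
  have n: "0 < n" unfolding n_def using ord by (intro prod_pos) auto
  have "ord (\<xi> (t / real n)) dvd n" unfolding n_def using finite by (intro dvd_prodI) auto
  then have "\<xi> (t / real n) [^] n = \<one>" using pow_eq_id real_hom_closed[OF \<xi>] by blast
  then show ?thesis using real_hom_nat_mult[OF \<xi>, of n "t / real n"] n by simp
qed

lemma int_recurrence_eq_0:
  fixes z :: "nat \<Rightarrow> int"
  assumes rec: "\<And>n. z n = m + int k * z (Suc n)" and k: "k = nat \<bar>m\<bar> + 2"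
  shows "m = 0"
proof (rule ccontr)
  assume m: "m \<noteq> 0"
  define w where "w = (int k - 1) * z 0 + m"
  have w: "w = int k ^ n * ((int k - 1) * z n + m)" for n
  proof (induction n)
    case (Suc n)
    have "(int k - 1) * z n + m = int k * ((int k - 1) * z (Suc n) + m)"
      by (subst rec) (simp add: algebra_simps)
    with Suc show ?case by (simp only: power_Suc mult.assoc mult.left_commute[of "int k"])
  qed (simp add: w_def)
  have "w = 0"
  proof (rule ccontr)
    assume "w \<noteq> 0"
    moreover have "int k ^ nat \<bar>w\<bar> dvd w" using w[of "nat \<bar>w\<bar>"] by (metis dvd_triv_left)
    ultimately have "int k ^ nat \<bar>w\<bar> \<le> \<bar>w\<bar>" using dvd_imp_le_int[of w "int k ^ nat \<bar>w\<bar>"] by simp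
    moreover have "2 ^ nat \<bar>w\<bar> \<le> int k ^ nat \<bar>w\<bar>" by (intro power_mono) (simp_all add: k)
    moreover have "int (nat \<bar>w\<bar>) < int (2 ^ nat \<bar>w\<bar>)" by (simp only: of_nat_less_iff less_exp)
    ultimately show False by simp
  qed
  then have "int k - 1 dvd m"
    unfolding w_def by (metis add.commute add_eq_0_iff dvd_minus_iff dvd_triv_left)
  then have "\<bar>int k - 1\<bar> \<le> \<bar>m\<bar>" using dvd_imp_le_int[OF m] by blast
  then show False by (simp add: k)
qed

context lc_group
begin

text \<open>The \<open>y n\<close> are limits of the powers of \<open>x\<close> with exponents \<open>1 + k + \<dots> + k^{N-n-1}\<close>.\<close>

lemma compact_iterated_roots:
  assumes compact: "compact_space T" and x: "x \<in> carrier L"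
  obtains y where "\<And>n. y n \<in> carrier L" "\<And>n. y n = x \<otimes> y (Suc n) [^] (k::nat)"
proof -
  define e where "e j = (\<Sum>i<j. k ^ i)" for j :: nat
  have e_Suc: "e (Suc j) = Suc (e j * k)" for j
    unfolding e_def by (subst sum.lessThan_Suc_shift) (simp add: sum_distrib_left mult.commute)
  obtain U :: "nat filter" where U: "ultrafilter U" "U \<le> sequentially"
    using ultrafilter_exists[OF sequentially_bot] .
  have compact: "compactin T (carrier L)" using compact by (simp add: compact_space_def)
  have "\<exists>y. limitin T (\<lambda>N. x [^] e (N - n)) y U" for n
    using ultrafilter_compactin_limit[OF U(1) compact] x
    by (metis (no_types, lifting) always_eventually nat_pow_closed)
  then obtain y where y: "\<And>n. limitin T (\<lambda>N. x [^] e (N - n)) (y n) U" by metis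
  have "y n = x \<otimes> y (Suc n) [^] k" for n
  proof (rule limitin_unique[OF y _ ultrafilter_not_bot[OF U(1)]])
    have "limitin T (\<lambda>N. x \<otimes> (x [^] e (N - Suc n)) [^] k) (x \<otimes> y (Suc n) [^] k) U"
      using x by (intro limitin_mult limitin_nat_pow y) (simp add: limitin_const_iff)
    moreover have "eventually (\<lambda>N. n < N) U"
      using U(2) eventually_gt_at_top filter_leD by blast
    then have "eventually (\<lambda>N. x \<otimes> (x [^] e (N - Suc n)) [^] k = x [^] e (N - n)) U"
    proof eventually_elim
      case (elim N)
      then have "e (N - n) = Suc (e (N - Suc n) * k)"
        using e_Suc[of "N - Suc n"] by (simp add: Suc_diff_Suc)
      then show ?case using x by (simp only: nat_pow_pow nat_pow_Suc2)
    qed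
    ultimately show "limitin T (\<lambda>N. x [^] e (N - n)) (x \<otimes> y (Suc n) [^] k) U"
      by (rule limitin_transform_eventually[rotated])
  qed
  moreover have "y n \<in> carrier L" for n using limitin_topspace[OF y] by simp
  ultimately show ?thesis using that by blast
qed

lemma compact_group_int_hom_trivial:
  assumes compact: "compact_space T" and \<psi>: "\<psi> \<in> hom L integer_group" and x: "x \<in> carrier L"
  shows "\<psi> x = 0"
proof -
  interpret \<psi>: group_hom L integer_group \<psi>
    using \<psi> by (simp add: group_hom_def group_hom_axioms_def)
  define k where "k = nat \<bar>\<psi> x\<bar> + 2"
  obtain y where y: "\<And>n. y n \<in> carrier L" "\<And>n. y n = x \<otimes> y (Suc n) [^] k"
    using compact_iterated_roots[OF compact x] by blast
  have "\<psi> (y n) = \<psi> x + int k * \<psi> (y (Suc n))" for n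
    by (subst y(2)) (simp add: x y(1) \<psi>.hom_nat_pow)
  then show ?thesis by (rule int_recurrence_eq_0) (rule k_def)
qed

lemma compact_monothetic_subgroup:
  assumes K: "subgroup K L" "compactin T K" and x: "x \<in> K"
  obtains P where "x \<in> P" "P \<subseteq> K" "subgroup P L" "compactin T P" "comm_group (L\<lparr>carrier := P\<rparr>)"
proof
  let ?Z = "generate L {x}"
  have xL: "x \<in> carrier L" by (rule subgroup.mem_carrier[OF K(1) x])
  have Z: "subgroup ?Z L" using xL by (intro generate_is_subgroup) auto
  then have ZL: "?Z \<subseteq> carrier L" by (rule subgroup.subset)
  show "x \<in> T closure_of ?Z" using closure_of_subset[of ?Z T] ZL generate.incl[of x "{x}" L] by auto
  have "?Z \<subseteq> K" using generate_subgroup_incl[OF _ K(1), of "{x}"] x by simp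
  then show sub: "T closure_of ?Z \<subseteq> K"
    by (rule closure_of_minimal[OF _ compactin_closedin[OF K(2)]])
  show closure: "subgroup (T closure_of ?Z) L" by (rule subgroup_closure_of[OF Z])
  show "compactin T (T closure_of ?Z)" by (rule closed_compactin[OF K(2) sub]) simp
  have "a \<otimes> b = b \<otimes> a" if ab: "a \<in> ?Z" "b \<in> ?Z" for a b
  proof -
    obtain i j :: int where "a = x [^] i" "b = x [^] j" using ab generate_pow[OF xL] by auto
    then show ?thesis using xL by (simp add: add.commute flip: int_pow_mult)
  qed
  then have "a \<otimes> b = b \<otimes> a" if "a \<in> T closure_of ?Z" "b \<in> T closure_of ?Z" for a b
    using closure_of_commute[OF Hausdorff_T ZL] that by blast
  then show "comm_group (L\<lparr>carrier := T closure_of ?Z\<rparr>)"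
    using group.group_comm_groupI[OF subgroup.subgroup_is_group[OF closure is_group]] by simp
qed

lemma class_G_finite_compact_image:
  assumes K: "subgroup K L" "compactin T K" and \<phi>: "\<phi> \<in> hom L G" and G: "class_G G"
  shows "finite (\<phi> ` K)"
proof -
  interpret \<phi>: group_hom L G \<phi>
    using \<phi> G by (simp add: class_G_def group_hom_def group_hom_axioms_def)
  have "\<phi>.H.ord (\<phi> x) \<noteq> 0" if x: "x \<in> K" for x
  proof -
    obtain P where P: "x \<in> P" "P \<subseteq> K" "subgroup P L" "compactin T P" "comm_group (L\<lparr>carrier := P\<rparr>)"
      using compact_monothetic_subgroup[OF K x] .
    interpret P: lc_group "L\<lparr>carrier := P\<rparr>" "subtopology T P"
      by (rule lc_group_closed_subgroup[OF P(3) compactin_closedin[OF P(4)]])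
    have "compact_space (subtopology T P)" using P(4) by (simp add: compactin_subspace)
    note trivial = P.compact_group_int_hom_trivial[OF this]
    have "\<phi> \<in> hom (L\<lparr>carrier := P\<rparr>) G"
      using \<phi> subgroup.subset[OF P(3)] by (auto simp: hom_def subset_iff)
    then show ?thesis
      by (rule class_G_hom_ord_neq_0[OF G P(5)]) (use trivial P(1) in auto)
  qed
  then have "torsion_subgroup G (\<phi> ` K)"
    unfolding torsion_subgroup_def using \<phi>.subgroup_img_is_subgroup[OF K(1)] by blast
  then show ?thesis using G by (simp add: class_G_def)
qed

end

section \<open>Quotients by closed normal subgroups\<close>

lemma open_map_prod_topology:
  assumes f: "open_map A A' f" and g: "open_map B B' g"
  shows "open_map (prod_topology A B) (prod_topology A' B') (\<lambda>p. (f (fst p), g (snd p)))"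
  unfolding open_map_def
proof (intro allI impI)
  let ?h = "\<lambda>p. (f (fst p), g (snd p))"
  fix W assume W: "openin (prod_topology A B) W"
  show "openin (prod_topology A' B') (?h ` W)"
    unfolding openin_prod_topology_alt
  proof (intro allI impI)
    fix u v assume "(u, v) \<in> ?h ` W"
    then obtain x y where xy: "(x, y) \<in> W" "u = f x" "v = g y" by auto
    then obtain R S where RS: "openin A R" "openin B S" "x \<in> R" "y \<in> S" "R \<times> S \<subseteq> W"
      using W unfolding openin_prod_topology_alt by meson
    have "openin A' (f ` R)" "openin B' (g ` S)" using f g RS by (auto simp: open_map_def)
    moreover have "u \<in> f ` R" "v \<in> g ` S" using xy RS by auto
    moreover have "f ` R \<times> g ` S \<subseteq> ?h ` W" using RS(5) by force
    ultimately show "\<exists>R S. openin A' R \<and> openin B' S \<and> u \<in> R \<and> v \<in> S \<and> R \<times> S \<subseteq> ?h ` W" by blast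
  qed
qed

context top_group
begin

definition quotient_topology :: "'a set \<Rightarrow> 'a set topology" where
  "quotient_topology K =
    topology (\<lambda>S. S \<subseteq> carrier (L Mod K) \<and> openin T {x \<in> carrier L. K #> x \<in> S})"

lemma openin_quotient_topology:
  "openin (quotient_topology K) S \<longleftrightarrow>
    S \<subseteq> carrier (L Mod K) \<and> openin T {x \<in> carrier L. K #> x \<in> S}"
proof -
  let ?open = "\<lambda>S. S \<subseteq> carrier (L Mod K) \<and> openin T {x \<in> carrier L. K #> x \<in> S}"
  have "{x \<in> carrier L. K #> x \<in> A \<inter> B} =
      {x \<in> carrier L. K #> x \<in> A} \<inter> {x \<in> carrier L. K #> x \<in> B}" for A B
    by auto
  moreover have "{x \<in> carrier L. K #> x \<in> \<Union>\<A>} = (\<Union>A\<in>\<A>. {x \<in> carrier L. K #> x \<in> A})" for \<A>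
    by auto
  ultimately have "istopology ?open"
    unfolding istopology_def by (auto intro!: openin_Union)
  then show ?thesis unfolding quotient_topology_def by (simp add: topology_inverse')
qed

lemma rcos_in_carrier_FactGroup: "x \<in> carrier L \<Longrightarrow> K #> x \<in> carrier (L Mod K)"
  by (simp add: carrier_FactGroup)

lemma topspace_quotient_topology: "topspace (quotient_topology K) = carrier (L Mod K)"
proof -
  have "openin (quotient_topology K) (carrier (L Mod K))"
    using rcos_in_carrier_FactGroup openin_topspace[of T]
    by (simp add: openin_quotient_topology cong: conj_cong)
  then have "carrier (L Mod K) \<subseteq> topspace (quotient_topology K)" by (rule openin_subset)
  moreover have "topspace (quotient_topology K) \<subseteq> carrier (L Mod K)"
    using openin_topspace[of "quotient_topology K"] unfolding openin_quotient_topology by blast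
  ultimately show ?thesis by (rule antisym[rotated])
qed

lemma continuous_map_rcos: "continuous_map T (quotient_topology K) (\<lambda>x. K #> x)"
  by (auto simp: continuous_map_def Pi_iff topspace_quotient_topology openin_quotient_topology
      rcos_in_carrier_FactGroup)

lemma rcos_preimage_image:
  assumes K: "subgroup K L" and U: "U \<subseteq> carrier L"
  shows "{x \<in> carrier L. K #> x \<in> (\<lambda>x. K #> x) ` U} = K <#> U"
proof (intro equalityI subsetI)
  fix x assume "x \<in> {x \<in> carrier L. K #> x \<in> (\<lambda>x. K #> x) ` U}"
  then obtain u where u: "x \<in> carrier L" "u \<in> U" "K #> x = K #> u" by auto
  then have "x \<in> K #> u" using rcos_self[OF u(1) K] by simp
  then show "x \<in> K <#> U" using u(2) by (auto simp: r_coset_def set_mult_def)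
next
  fix x assume "x \<in> K <#> U"
  then obtain k u where u: "k \<in> K" "u \<in> U" "x = k \<otimes> u" by (auto simp: set_mult_def)
  then have "x \<in> K #> u" by (auto simp: r_coset_def)
  then have "K #> x = K #> u" using repr_independence[OF _ _ K, of x u] u U by auto
  then show "x \<in> {x \<in> carrier L. K #> x \<in> (\<lambda>x. K #> x) ` U}"
    using u U subgroup.mem_carrier[OF K] by auto
qed

lemma open_map_rcos:
  assumes "subgroup K L"
  shows "open_map T (quotient_topology K) (\<lambda>x. K #> x)"
  unfolding open_map_def
proof (intro allI impI)
  fix U assume U: "openin T U"
  have UL: "U \<subseteq> carrier L" using openin_subset[OF U] by simp
  show "openin (quotient_topology K) ((\<lambda>x. K #> x) ` U)"
    using openin_set_mult_right[OF subgroup.subset[OF assms] U] UL rcos_in_carrier_FactGroup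
    by (auto simp: openin_quotient_topology rcos_preimage_image[OF assms UL])
qed

lemma rcos_eq_iff:
  assumes K: "subgroup K L" and "x \<in> carrier L" "y \<in> carrier L"
  shows "K #> x = K #> y \<longleftrightarrow> x \<otimes> inv y \<in> K"
  using subgroup.rcos_module[OF K is_group assms(3,2)] rcos_self[OF assms(2) K]
    repr_independence[OF _ assms(3) K, of x] by auto

lemma top_group_quotient:
  assumes "K \<lhd> L"
  shows "top_group (L Mod K) (quotient_topology K)"
proof -
  interpret K: normal K L by fact
  interpret Q: group "L Mod K" by (rule K.factorgroup_is_group)
  let ?Q = "quotient_topology K" and ?\<pi> = "\<lambda>x. K #> x" and ?\<pi>2 = "\<lambda>p. (K #> fst p, K #> snd p)"
  note continuous = continuous_map_rcos[of K] and open_map = open_map_rcos[OF K.subgroup_axioms]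
  have image: "?\<pi> ` carrier L = carrier (L Mod K)" by (simp add: carrier_FactGroup)
  have "quotient_map (prod_topology T T) (prod_topology ?Q ?Q) ?\<pi>2"
  proof (rule continuous_open_imp_quotient_map)
    show "continuous_map (prod_topology T T) (prod_topology ?Q ?Q) ?\<pi>2"
      using continuous_map_compose[OF continuous_map_fst continuous, of T]
        continuous_map_compose[OF continuous_map_snd continuous, of T]
      by (simp add: continuous_map_pairwise o_def)
    show "open_map (prod_topology T T) (prod_topology ?Q ?Q) ?\<pi>2"
      by (rule open_map_prod_topology[OF open_map open_map])
    show "?\<pi>2 ` topspace (prod_topology T T) = topspace (prod_topology ?Q ?Q)"
      by (force simp: topspace_quotient_topology image[symmetric])
  qed
  moreover have "continuous_map (prod_topology T T) ?Q (\<lambda>p. ?\<pi> (fst p \<otimes> snd p))"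
    using continuous_map_compose[OF cont_mult continuous] by (simp add: o_def)
  then have "continuous_map (prod_topology T T) ?Q ((\<lambda>p. fst p \<otimes>\<^bsub>L Mod K\<^esub> snd p) \<circ> ?\<pi>2)"
    by (rule continuous_map_eq) (auto simp: K.rcos_sum)
  ultimately have mult: "continuous_map (prod_topology ?Q ?Q) ?Q (\<lambda>p. fst p \<otimes>\<^bsub>L Mod K\<^esub> snd p)"
    by (rule continuous_compose_quotient_map)
  have "quotient_map T ?Q ?\<pi>"
    by (rule continuous_open_imp_quotient_map[OF continuous open_map])
      (simp add: topspace_quotient_topology image)
  moreover have "continuous_map T ?Q (\<lambda>x. ?\<pi> (inv x))"
    using continuous_map_compose[OF cont_inv continuous] by (simp add: o_def)
  then have "continuous_map T ?Q ((\<lambda>x. inv\<^bsub>L Mod K\<^esub> x) \<circ> ?\<pi>)"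
    by (rule continuous_map_eq) (simp add: K.inv_FactGroup rcos_in_carrier_FactGroup K.rcos_inv)
  ultimately have inv: "continuous_map ?Q ?Q (\<lambda>x. inv\<^bsub>L Mod K\<^esub> x)"
    by (rule continuous_compose_quotient_map)
  show ?thesis by unfold_locales (rule topspace_quotient_topology mult inv)+
qed

lemma Hausdorff_quotient:
  assumes K: "subgroup K L" "closedin T K"
  shows "Hausdorff_space (quotient_topology K)"
  unfolding Hausdorff_space_def
proof (intro allI impI)
  fix u v
  assume uv: "u \<in> topspace (quotient_topology K) \<and> v \<in> topspace (quotient_topology K) \<and> u \<noteq> v"
  then obtain a b where ab: "a \<in> carrier L" "b \<in> carrier L" "u = K #> a" "v = K #> b"
    unfolding topspace_quotient_topology carrier_FactGroup by blast
  have "a \<otimes> inv b \<in> carrier L - K" using rcos_eq_iff[OF K(1) ab(1,2)] uv ab by auto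
  moreover have "openin T (carrier L - K)" using openin_diff[OF openin_topspace K(2)] by simp
  ultimately obtain A B where AB: "openin T A" "openin T B" "a \<in> A" "inv b \<in> B"
      "\<And>x y. x \<in> A \<Longrightarrow> y \<in> B \<Longrightarrow> x \<otimes> y \<in> carrier L - K"
    using mult_open_nhds[of "carrier L - K" a "inv b"] ab by auto
  define C where "C = {y \<in> carrier L. inv y \<in> B}"
  have C: "openin T C" "b \<in> C"
    using openin_preimage[OF cont_inv AB(2)] ab AB(4) by (auto simp: C_def)
  have AL: "A \<subseteq> carrier L" using openin_subset[OF AB(1)] by simp
  have "K #> x \<noteq> K #> y" if "x \<in> A" "y \<in> C" for x y
    using rcos_eq_iff[OF K(1), of x y] AB(5)[of x "inv y"] AL that by (auto simp: C_def)
  then have "disjnt ((\<lambda>x. K #> x) ` A) ((\<lambda>x. K #> x) ` C)" by (auto simp: disjnt_def)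
  moreover have "openin (quotient_topology K) ((\<lambda>x. K #> x) ` A)"
      "openin (quotient_topology K) ((\<lambda>x. K #> x) ` C)"
    using open_map_rcos[OF K(1)] AB(1) C(1) by (auto simp: open_map_def)
  ultimately show "\<exists>U V. openin (quotient_topology K) U \<and> openin (quotient_topology K) V \<and>
      u \<in> U \<and> v \<in> V \<and> disjnt U V"
    using ab AB(3) C(2) by blast
qed

lemma traps_subgroups_quotient:
  assumes K: "K \<lhd> L" and \<Omega>: "traps_subgroups \<Omega> K" "K <#> V \<subseteq> \<Omega>" "V \<subseteq> carrier L"
  shows "top_group.traps_subgroups (L Mod K) ((\<lambda>x. K #> x) ` V) {\<one>\<^bsub>L Mod K\<^esub>}"
proof -
  interpret K: normal K L by (rule K)
  interpret Q: top_group "L Mod K" "quotient_topology K" by (rule top_group_quotient[OF K])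
  show ?thesis
    unfolding Q.traps_subgroups_def
  proof (intro allI impI subsetI)
    fix P u assume P: "subgroup P (L Mod K)" "P \<subseteq> (\<lambda>x. K #> x) ` V" and u: "u \<in> P"
    have "\<Union>P \<subseteq> K <#> V"
    proof
      fix x assume "x \<in> \<Union>P"
      then obtain v where "v \<in> V" "x \<in> K #> v" using P(2) by blast
      then show "x \<in> K <#> V" by (auto simp: r_coset_def set_mult_def)
    qed
    then have "\<Union>P \<subseteq> K"
      using traps_subgroupsD[OF \<Omega>(1) K.factgroup_subgroup_union_subgroup[OF P(1)]] \<Omega>(2) by blast
    moreover obtain v where v: "v \<in> V" "u = K #> v" using P(2) u by blast
    ultimately have "v \<in> K" using rcos_self[of v K] K.subgroup_axioms \<Omega>(3) u by blast
    then show "u \<in> {\<one>\<^bsub>L Mod K\<^esub>}" using v(2) K.rcos_const[OF is_group] by simp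
  qed
qed

end

context lc_group
begin

lemma lc_group_quotient:
  assumes K: "K \<lhd> L" "closedin T K"
  shows "lc_group (L Mod K) (quotient_topology K)"
proof -
  have subgroup: "subgroup K L" by (rule normal_imp_subgroup[OF K(1)])
  have "locally_compact_space (quotient_topology K)"
    by (rule locally_compact_space_continuous_open_map_image[OF continuous_map_rcos
          open_map_rcos[OF subgroup] _ locally_compact_T])
      (simp add: topspace_quotient_topology carrier_FactGroup)
  then show ?thesis
    using top_group_quotient[OF K(1)] Hausdorff_quotient[OF subgroup K(2)]
    by (simp add: lc_group_def lc_group_axioms_def)
qed

theorem real_homs_mod_generate_nhd_one:
  assumes K: "K \<lhd> L" "compactin T K" and \<Omega>: "openin T \<Omega>" "K \<subseteq> \<Omega>" "traps_subgroups \<Omega> K"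
    and N: "subgroup N L" "K \<subseteq> N" "\<And>\<xi> t. \<xi> \<in> hom real_group (L Mod K) \<Longrightarrow> \<xi> t \<subseteq> N"
  obtains V where "nhd_one V" "V \<subseteq> N"
proof -
  interpret K: normal K L by (rule K(1))
  interpret Q: lc_group "L Mod K" "quotient_topology K"
    by (rule lc_group_quotient[OF K(1) compactin_closedin[OF K(2)]])
  interpret \<pi>: group_hom L "L Mod K" "\<lambda>x. K #> x" using K.r_coset_hom_Mod by unfold_locales
  obtain V where V: "nhd_one V" "K <#> V \<subseteq> \<Omega>" using compactin_set_mult_nhd_one[OF K(2) \<Omega>(1,2)] .
  have one: "K #> \<one> = \<one>\<^bsub>L Mod K\<^esub>" using coset_mult_one[OF K.subset] by simp
  have "\<one>\<^bsub>L Mod K\<^esub> \<in> (\<lambda>x. K #> x) ` V" using one[symmetric] nhd_one_mem[OF V(1)] by (rule image_eqI)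
  then have "Q.nhd_one ((\<lambda>x. K #> x) ` V)"
    using open_map_rcos[OF K.subgroup_axioms] nhd_one_openin[OF V(1)]
    unfolding Q.nhd_one_def open_map_def by blast
  moreover have "Q.traps_subgroups ((\<lambda>x. K #> x) ` V) {\<one>\<^bsub>L Mod K\<^esub>}"
    by (rule traps_subgroups_quotient[OF K(1) \<Omega>(3) V(2) nhd_one_carrier[OF V(1)]])
  moreover have "subgroup ((\<lambda>x. K #> x) ` N) (L Mod K)"
    by (rule \<pi>.subgroup_img_is_subgroup[OF N(1)])
  moreover have "\<xi> t \<in> (\<lambda>x. K #> x) ` N" if \<xi>: "\<xi> \<in> hom real_group (L Mod K)" for \<xi> t
  proof -
    obtain x where "x \<in> carrier L" "\<xi> t = K #> x"
      using Q.real_hom_closed[OF \<xi>, of t] by (auto simp: carrier_FactGroup)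
    moreover have "x \<in> N"
      using N(3)[OF \<xi>, of t] rcos_self[OF _ K.subgroup_axioms] calculation by blast
    ultimately show ?thesis by blast
  qed
  ultimately obtain W where W: "Q.nhd_one W" "W \<subseteq> (\<lambda>x. K #> x) ` N"
    using Q.real_homs_generate_nhd_one by blast
  have "nhd_one {x \<in> carrier L. K #> x \<in> W}"
    using nhd_one_preimage[OF continuous_map_rcos Q.nhd_one_openin[OF W(1)]] Q.nhd_one_mem[OF W(1)]
      one
    by simp
  moreover have "x \<in> N" if x: "x \<in> carrier L" "K #> x \<in> W" for x
  proof -
    obtain n where n: "n \<in> N" "K #> x = K #> n" using x(2) W(2) by blast
    then have "x \<in> K #> n" using rcos_self[OF x(1) K.subgroup_axioms] by simp
    then show ?thesis using n(1) N(1,2) by (auto simp: r_coset_def intro: subgroup.m_closed)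
  qed
  ultimately show ?thesis using that by blast
qed

end

section \<open>Kernels of homomorphisms into groups of class G\<close>

lemma (in group) normalizerI:
  assumes g: "g \<in> carrier G" and H: "H \<subseteq> carrier G"
    and "\<And>h. h \<in> H \<Longrightarrow> g \<otimes> h \<otimes> inv g \<in> H" "\<And>h. h \<in> H \<Longrightarrow> inv g \<otimes> h \<otimes> g \<in> H"
  shows "g \<in> normalizer G H"
proof -
  have "g <# H #> inv g = H"
  proof (intro equalityI subsetI)
    fix y assume "y \<in> g <# H #> inv g"
    then show "y \<in> H" using assms(3) by (auto simp: l_coset_def r_coset_def)
  next
    fix y assume y: "y \<in> H"
    then have "y = g \<otimes> (inv g \<otimes> y \<otimes> g) \<otimes> inv g" using g H by (auto simp: m_assoc)
    then show "y \<in> g <# H #> inv g"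
      using assms(4)[OF y] unfolding l_coset_def r_coset_def by blast
  qed
  then show ?thesis using g H by (simp add: normalizer_def stabilizer_def)
qed

context lc_group
begin

text \<open>Elements close to \<open>1\<close> conjugate \<open>K\<close> into \<open>\<Omega>\<close>, hence into \<open>K\<close>.\<close>

lemma openin_normalizer:
  assumes K: "subgroup K L" "compactin T K" and \<Omega>: "openin T \<Omega>" "K \<subseteq> \<Omega>" "traps_subgroups \<Omega> K"
  shows "openin T (normalizer L K)"
proof -
  have KL: "K \<subseteq> carrier L" by (rule subgroup.subset[OF K(1)])
  have "continuous_map (prod_topology T T) T (\<lambda>p. snd p \<otimes> fst p \<otimes> inv (snd p))"
    by (intro continuous_intros continuous_map_fst continuous_map_snd)
  then obtain V' where V': "nhd_one V'" "\<And>k h. k \<in> K \<Longrightarrow> h \<in> V' \<Longrightarrow> h \<otimes> k \<otimes> inv h \<in> \<Omega>"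
    using nhd_one_tube[of T "\<lambda>k h. h \<otimes> k \<otimes> inv h" K \<Omega>] K(2) \<Omega> KL by (auto simp: subset_iff)
  obtain V where V: "nhd_one V" "symmetric_set V" "V \<subseteq> V'" using symmetric_nhd_one[OF V'(1)] .
  have conj: "h \<otimes> k \<otimes> inv h \<in> K" if h: "h \<in> V" and k: "k \<in> K" for h k
  proof -
    have hL: "h \<in> carrier L" by (rule nhd_one_mem_carrier[OF V(1) h])
    have "h <# K #> inv h \<subseteq> \<Omega>" using V'(2) V(3) h by (auto simp: l_coset_def r_coset_def)
    then have "h <# K #> inv h \<subseteq> K"
      by (rule traps_subgroupsD[OF \<Omega>(3) subgroup_conjugation_is_surj2[OF hL K(1)]])
    then show ?thesis using k unfolding l_coset_def r_coset_def by blast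
  qed
  have "V \<subseteq> normalizer L K"
  proof
    fix h assume h: "h \<in> V"
    have hL: "h \<in> carrier L" by (rule nhd_one_mem_carrier[OF V(1) h])
    show "h \<in> normalizer L K"
      using conj[OF h] conj[OF symmetric_setD[OF V(2) h]] hL by (intro normalizerI KL) auto
  qed
  then show ?thesis by (rule openin_subgroup[OF normalizer_imp_subgroup[OF KL] V(1)])
qed

lemma class_G_kernel_mod_contains_nhd_one:
  assumes K: "K \<lhd> L" "compactin T K" and \<Omega>: "openin T \<Omega>" "K \<subseteq> \<Omega>" "traps_subgroups \<Omega> K"
    and G: "class_G G" and \<phi>: "\<phi> \<in> hom L G" "K \<subseteq> kernel L G \<phi>"
  obtains V where "nhd_one V" "V \<subseteq> kernel L G \<phi>"
proof -
  interpret \<phi>: group_hom L G \<phi>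
    using \<phi> G by (simp add: class_G_def group_hom_def group_hom_axioms_def)
  obtain g where g: "g \<in> hom (L Mod K) G" "\<And>x. x \<in> carrier L \<Longrightarrow> g (K #> x) = \<phi> x"
    using \<phi>.FactGroup_universal_kernel[OF K(1) \<phi>(2)] by blast
  have "\<xi> t \<subseteq> kernel L G \<phi>" if \<xi>: "\<xi> \<in> hom real_group (L Mod K)" for \<xi> t
  proof
    fix x assume x: "x \<in> \<xi> t"
    obtain y where y: "y \<in> carrier L" "\<xi> t = K #> y"
      using hom_in_carrier[OF \<xi>, of t] by (auto simp: carrier_FactGroup)
    have subgroup: "subgroup K L" by (rule normal_imp_subgroup[OF K(1)])
    have xL: "x \<in> carrier L" using x y subgroup.subset[OF subgroup] r_coset_subset_G by blast
    have "K #> x = \<xi> t" using repr_independence[OF _ y(1) subgroup, of x] x y(2) by simp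
    then have "\<phi> x = (g \<circ> \<xi>) t" using g(2)[OF xL] by simp
    also have "\<dots> = \<one>\<^bsub>G\<^esub>"
      using class_G_real_hom_trivial[OF G Group.hom_compose[OF \<xi> g(1)]] .
    finally show "x \<in> kernel L G \<phi>" using xL by (simp add: kernel_def)
  qed
  then show ?thesis
    using real_homs_mod_generate_nhd_one[OF K \<Omega> \<phi>.subgroup_kernel \<phi>(2)] that by blast
qed

lemma compact_subgroup_trapping_open_set:
  assumes H: "subgroup H L" "compactin T H" and V: "nhd_one V" "traps_subgroups V H"
  obtains K \<Omega> where "subgroup K L" "compactin T K" "K \<subseteq> H"
    "openin T \<Omega>" "K \<subseteq> \<Omega>" "traps_subgroups \<Omega> K"
proof -
  obtain K W where K: "subgroup K L" "compactin T K" "K \<subseteq> V" "K \<subseteq> H" and W: "nhd_one W"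
    and trap: "traps_subgroups (H \<inter> (W <#> K)) K"
    using compact_subgroup_trapping_small_subgroups[OF H V(1)] .
  have KL: "K \<subseteq> carrier L" by (rule subgroup.subset[OF K(1)])
  let ?\<Omega> = "V \<inter> (W <#> K)"
  have "openin T ?\<Omega>" using openin_set_mult_left[OF KL] nhd_one_openin V(1) W by blast
  moreover have "K \<subseteq> ?\<Omega>" using K(3) subset_set_mult_left_nhd_one[OF KL W] by blast
  moreover have "traps_subgroups ?\<Omega> K"
    unfolding traps_subgroups_def
  proof (intro allI impI)
    fix P assume P: "subgroup P L" "P \<subseteq> ?\<Omega>"
    then have "P \<subseteq> H" by (intro traps_subgroupsD[OF V(2)]) auto
    then show "P \<subseteq> K" using P by (intro traps_subgroupsD[OF trap]) auto
  qed
  ultimately show ?thesis by (rule that[OF K(1,2,4)])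
qed

theorem class_G_kernel_contains_nhd_one:
  assumes H: "subgroup H L" "compactin T H" and V\<^sub>0: "nhd_one V\<^sub>0" "traps_subgroups V\<^sub>0 H"
    and G: "class_G G" and \<phi>: "\<phi> \<in> hom L G" "H \<subseteq> kernel L G \<phi>"
  obtains V where "nhd_one V" "V \<subseteq> kernel L G \<phi>"
proof -
  obtain K \<Omega> where K: "subgroup K L" "compactin T K" "K \<subseteq> H"
    and \<Omega>: "openin T \<Omega>" "K \<subseteq> \<Omega>" "traps_subgroups \<Omega> K"
    using compact_subgroup_trapping_open_set[OF H V\<^sub>0] .
  have KL: "K \<subseteq> carrier L" by (rule subgroup.subset[OF K(1)])
  define N where "N = normalizer L K"
  have N: "subgroup N L" "openin T N"
    unfolding N_def by (rule normalizer_imp_subgroup[OF KL], rule openin_normalizer[OF K(1,2) \<Omega>])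
  let ?L = "L\<lparr>carrier := N\<rparr>" and ?T = "subtopology T N"
  interpret N: lc_group ?L ?T by (rule lc_group_open_subgroup[OF N])
  have normal: "K \<lhd> ?L" unfolding N_def by (rule subgroup_in_normalizer[OF K(1)])
  have KN: "K \<subseteq> N" using subgroup.subset[OF normal_imp_subgroup[OF normal]] by simp
  have NL: "N \<subseteq> carrier L" by (rule subgroup.subset[OF N(1)])
  obtain V where V: "N.nhd_one V" "V \<subseteq> kernel ?L G \<phi>"
  proof (rule N.class_G_kernel_mod_contains_nhd_one[OF normal _ _ _ _ G])
    show "compactin ?T K" using K(2) KN by (simp add: compactin_subtopology)
    show "openin ?T (\<Omega> \<inter> N)" using \<Omega>(1) by (auto simp: openin_subtopology)
    show "K \<subseteq> \<Omega> \<inter> N" using \<Omega>(2) KN by blast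
    show "N.traps_subgroups (\<Omega> \<inter> N) K"
      using traps_subgroupsD[OF \<Omega>(3)] incl_subgroup[OF N(1)] by (auto simp: N.traps_subgroups_def)
    show "\<phi> \<in> hom ?L G" using \<phi>(1) NL by (auto simp: hom_def subset_iff)
    show "K \<subseteq> kernel ?L G \<phi>" using \<phi>(2) K(3) KN by (auto simp: kernel_def)
  qed
  have "nhd_one V"
    using V(1) openin_trans_full[OF _ N(2), of V] by (auto simp: nhd_one_def N.nhd_one_def)
  moreover have "V \<subseteq> kernel L G \<phi>" using V(2) NL by (auto simp: kernel_def)
  ultimately show ?thesis by (rule that)
qed

end

lemma (in top_group) continuous_map_discrete_of_kernel_nhd:
  assumes \<phi>: "group_hom L G \<phi>" and V: "nhd_one V" "V \<subseteq> kernel L G \<phi>"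
  shows "continuous_map T (discrete_topology (carrier G)) \<phi>"
  unfolding continuous_map_def
proof (intro conjI allI impI)
  interpret \<phi>: group_hom L G \<phi> by (rule \<phi>)
  show "\<phi> \<in> topspace T \<rightarrow> topspace (discrete_topology (carrier G))" by auto
  fix S
  let ?P = "{x \<in> carrier L. \<phi> x \<in> S}"
  have "?P <#> V \<subseteq> ?P" using V(2) by (auto simp: set_mult_def kernel_def)
  then have "?P = ?P <#> V" using subset_set_mult_right_nhd_one[of ?P, OF _ V(1)] by blast
  moreover have "openin T (?P <#> V)"
    by (rule openin_set_mult_right[OF _ nhd_one_openin[OF V(1)]]) auto
  ultimately show "openin T {x \<in> topspace T. \<phi> x \<in> S}" by simp
qed

section \<open>Elements with all powers in a neighbourhood\<close>

context group
begin

definition powers_in :: "'a set \<Rightarrow> 'a set" where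
  "powers_in V = {x \<in> carrier G. \<forall>j::nat. x [^] j \<in> V}"

lemma powers_in_carrier: "powers_in V \<subseteq> carrier G"
  by (auto simp: powers_in_def)

lemma conjugation_hom: "g \<in> carrier G \<Longrightarrow> (\<lambda>x. inv g \<otimes> x \<otimes> g) \<in> hom G G"
  by (auto simp: hom_def m_assoc)

end

context top_group
begin

definition powers_subgroup :: "'a set \<Rightarrow> 'a set" where
  "powers_subgroup V = T closure_of (generate L (powers_in V))"

lemma powers_subgroup_mono: "V \<subseteq> W \<Longrightarrow> powers_subgroup V \<subseteq> powers_subgroup W"
  unfolding powers_subgroup_def
  by (intro closure_of_mono mono_generate) (auto simp: powers_in_def)

lemma subgroup_powers_subgroup: "subgroup (powers_subgroup V) L"
  unfolding powers_subgroup_def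
  by (intro subgroup_closure_of generate_is_subgroup powers_in_carrier)

lemma traps_subgroups_powers_subgroup: "traps_subgroups V (powers_subgroup V)"
  unfolding traps_subgroups_def
proof (intro allI impI)
  fix P assume P: "subgroup P L" "P \<subseteq> V"
  have "P \<subseteq> powers_in V"
    using P subgroup_nat_pow_closed[OF P(1)] subgroup.mem_carrier[OF P(1)]
    by (auto simp: powers_in_def)
  also have "\<dots> \<subseteq> generate L (powers_in V)" by (auto intro: generate.incl)
  also have "\<dots> \<subseteq> powers_subgroup V"
    unfolding powers_subgroup_def
    using subgroup.subset[OF generate_is_subgroup[OF powers_in_carrier]]
    by (intro closure_of_subset) simp
  finally show "P \<subseteq> powers_subgroup V" .
qed

text \<open>An element of \<open>powers_in V\<close> has arbitrarily small weights.\<close>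

lemma generate_powers_in_subset_weight_ball:
  assumes V: "symmetric_set V" and r: "0 < r"
  shows "generate L (powers_in V) \<subseteq> weight_ball (power_weights V) r"
proof -
  note wt = symmetric_power_weights[OF V]
  let ?Z = "{x. \<forall>r>0. x \<in> weight_ball (power_weights V) r}"
  have carrier: "?Z \<subseteq> carrier L"
    using weight_ball_carrier[OF wt, of 1] zero_less_one by blast
  have "subgroup ?Z L"
  proof (rule subgroupI[OF carrier])
    show "?Z \<noteq> {}" using weight_ball_one less_imp_le by blast
    show "inv a \<in> ?Z" if "a \<in> ?Z" for a using that weight_ball_inv[OF wt] by blast
    show "a \<otimes> b \<in> ?Z" if "a \<in> ?Z" "b \<in> ?Z" for a b
    proof (intro CollectI allI impI)
      fix r :: real assume "0 < r"
      then have "a \<in> weight_ball (power_weights V) (r / 2)"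
          "b \<in> weight_ball (power_weights V) (r / 2)"
        using that by auto
      from weight_ball_mult[OF wt this] show "a \<otimes> b \<in> weight_ball (power_weights V) r" by simp
    qed
  qed
  moreover have "powers_in V \<subseteq> ?Z"
  proof (intro subsetI CollectI allI impI)
    fix x and r :: real assume x: "x \<in> powers_in V" and r: "0 < r"
    obtain n :: nat where n: "0 < n" "1 / real n < r" using real_arch_inverse[of r] r
      by (auto simp: inverse_eq_divide)
    have "power_weights V x (1 / real n)"
      using x n(1) by (auto simp: power_weights_def powers_upto_in_def powers_in_def)
    from weighted_word_letter[OF wt this] show "x \<in> weight_ball (power_weights V) r"
      by (rule weight_ballI) (use n(2) in simp)
  qed
  ultimately have "generate L (powers_in V) \<subseteq> ?Z" using generate_subgroup_incl by blast
  then show ?thesis using r by blast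
qed

lemma powers_subgroup_image_subset:
  assumes c: "c \<in> hom L L" "continuous_map T T c" and V: "\<And>x. x \<in> V \<Longrightarrow> c x \<in> W"
  shows "c ` powers_subgroup V \<subseteq> powers_subgroup W"
proof -
  interpret c: group_hom L L c using c(1) by unfold_locales
  have "c ` powers_in V \<subseteq> powers_in W"
    using V by (auto simp: powers_in_def simp flip: c.hom_nat_pow)
  then have "c ` generate L (powers_in V) \<subseteq> generate L (powers_in W)"
    using mono_generate c.generate_img[OF powers_in_carrier] by metis
  then have "T closure_of (c ` generate L (powers_in V)) \<subseteq> powers_subgroup W"
    unfolding powers_subgroup_def by (rule closure_of_mono)
  then show ?thesis
    using continuous_map_image_closure_subset[OF c(2)] unfolding powers_subgroup_def by blast
qed

end

context lc_group
begin

lemma compact_powers_subgroup_exists: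
  obtains V where "nhd_one V" "compactin T (powers_subgroup V)"
proof -
  obtain N U where U: "nhd_one N" "compactin T U" "N \<subseteq> U" "U \<subseteq> carrier L"
    using compact_nhd_one[OF nhd_one_univ] .
  obtain V where V: "nhd_one V" "symmetric_set V" "weight_ball (power_weights V) 1 \<subseteq> U"
    using weight_ball_trapping[OF U(2,1,3)] .
  have "generate L (powers_in V) \<subseteq> U"
    using generate_powers_in_subset_weight_ball[OF V(2) zero_less_one] V(3) by blast
  then have "powers_subgroup V \<subseteq> U"
    unfolding powers_subgroup_def by (rule closure_of_minimal[OF _ compactin_closedin[OF U(2)]])
  then have "compactin T (powers_subgroup V)"
    by (rule closed_compactin[OF U(2)]) (simp add: powers_subgroup_def)
  then show ?thesis by (rule that[OF V(1)])
qed

context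
  fixes G :: "('c, 'd) monoid_scheme" and \<phi> :: "'a \<Rightarrow> 'c"
  assumes G: "class_G G" and \<phi>: "\<phi> \<in> hom L G"
begin

interpretation \<phi>: group_hom L G \<phi>
  using \<phi> G by (simp add: class_G_def group_hom_def group_hom_axioms_def)

lemma stable_powers_subgroup_exists:
  obtains V where "nhd_one V" "compactin T (powers_subgroup V)"
    "\<And>W. nhd_one W \<Longrightarrow> W \<subseteq> V \<Longrightarrow> \<phi> ` powers_subgroup W = \<phi> ` powers_subgroup V"
proof -
  obtain V\<^sub>1 where V\<^sub>1: "nhd_one V\<^sub>1" "compactin T (powers_subgroup V\<^sub>1)"
    using compact_powers_subgroup_exists .
  have compact: "compactin T (powers_subgroup W)" if "W \<subseteq> V\<^sub>1" for W
    using closed_compactin[OF V\<^sub>1(2) powers_subgroup_mono[OF that]]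
    by (simp add: powers_subgroup_def)
  obtain V where V: "nhd_one V" "V \<subseteq> V\<^sub>1" and least: "\<And>W. nhd_one W \<Longrightarrow> W \<subseteq> V\<^sub>1 \<Longrightarrow>
      card (\<phi> ` powers_subgroup V) \<le> card (\<phi> ` powers_subgroup W)"
    using ex_has_least_nat[of "\<lambda>W. nhd_one W \<and> W \<subseteq> V\<^sub>1" V\<^sub>1 "\<lambda>W. card (\<phi> ` powers_subgroup W)"]
      V\<^sub>1(1)
    by blast
  have "\<phi> ` powers_subgroup W = \<phi> ` powers_subgroup V" if W: "nhd_one W" "W \<subseteq> V" for W
  proof (rule card_seteq)
    show "finite (\<phi> ` powers_subgroup V)"
      by (rule class_G_finite_compact_image[OF subgroup_powers_subgroup compact[OF V(2)] \<phi> G])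
    show "\<phi> ` powers_subgroup W \<subseteq> \<phi> ` powers_subgroup V"
      by (rule image_mono[OF powers_subgroup_mono[OF W(2)]])
    show "card (\<phi> ` powers_subgroup V) \<le> card (\<phi> ` powers_subgroup W)" using least W V(2) by auto
  qed
  then show ?thesis using that V(1) compact[OF V(2)] by blast
qed

lemma normalizes_stable_image:
  assumes V: "nhd_one V"
    and stable: "\<And>W. nhd_one W \<Longrightarrow> W \<subseteq> V \<Longrightarrow> \<phi> ` powers_subgroup W = \<phi> ` powers_subgroup V"
  shows "\<phi> ` carrier L \<subseteq> normalizer G (\<phi> ` powers_subgroup V)"
proof clarify
  have conj: "inv\<^bsub>G\<^esub> (\<phi> g) \<otimes>\<^bsub>G\<^esub> f \<otimes>\<^bsub>G\<^esub> \<phi> g \<in> \<phi> ` powers_subgroup V"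
    if g: "g \<in> carrier L" and f: "f \<in> \<phi> ` powers_subgroup V" for g f
  proof -
    let ?c = "\<lambda>x. inv g \<otimes> x \<otimes> g"
    let ?W = "V \<inter> {x \<in> carrier L. ?c x \<in> V}"
    have continuous: "continuous_map T T ?c" using g by (intro continuous_intros) auto
    have "nhd_one ?W"
      using g nhd_one_mem[OF V]
      by (intro nhd_one_Int V nhd_one_preimage[OF continuous nhd_one_openin[OF V]]) simp
    then obtain x where x: "x \<in> powers_subgroup ?W" "f = \<phi> x" using stable[of ?W] f by blast
    have "?c x \<in> powers_subgroup V"
      using powers_subgroup_image_subset[OF conjugation_hom[OF g] continuous, of ?W V] x(1) by blast
    moreover have "\<phi> (?c x) = inv\<^bsub>G\<^esub> (\<phi> g) \<otimes>\<^bsub>G\<^esub> f \<otimes>\<^bsub>G\<^esub> \<phi> g"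
      using g x subgroup.mem_carrier[OF subgroup_powers_subgroup] by simp
    ultimately show ?thesis by (metis imageI)
  qed
  fix g assume g: "g \<in> carrier L"
  show "\<phi> g \<in> normalizer G (\<phi> ` powers_subgroup V)"
  proof (rule \<phi>.H.normalizerI)
    show "\<phi> ` powers_subgroup V \<subseteq> carrier G"
      using subgroup.mem_carrier[OF subgroup_powers_subgroup] by auto
    show "\<phi> g \<otimes>\<^bsub>G\<^esub> f \<otimes>\<^bsub>G\<^esub> inv\<^bsub>G\<^esub> (\<phi> g) \<in> \<phi> ` powers_subgroup V" if "f \<in> \<phi> ` powers_subgroup V" for f
      using conj[of "inv g" f] g that by simp
  qed (use g conj in auto)
qed

theorem continuous_or_normalizes_finite:
  "continuous_map T (discrete_topology (carrier G)) \<phi> \<or>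
    (\<exists>F. subgroup F G \<and> finite F \<and> F \<noteq> {\<one>\<^bsub>G\<^esub>} \<and> \<phi> ` carrier L \<subseteq> normalizer G F)"
proof -
  obtain V where V: "nhd_one V" "compactin T (powers_subgroup V)"
    and stable: "\<And>W. nhd_one W \<Longrightarrow> W \<subseteq> V \<Longrightarrow> \<phi> ` powers_subgroup W = \<phi> ` powers_subgroup V"
    using stable_powers_subgroup_exists by blast
  note subgroup = subgroup_powers_subgroup[of V]
  let ?F = "\<phi> ` powers_subgroup V"
  show ?thesis
  proof (cases "?F = {\<one>\<^bsub>G\<^esub>}")
    case True
    then have "powers_subgroup V \<subseteq> kernel L G \<phi>"
      using subgroup.subset[OF subgroup] by (auto simp: kernel_def)
    from class_G_kernel_contains_nhd_one[OF subgroup V(2,1) traps_subgroups_powers_subgroup G \<phi> this]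
    obtain W where "nhd_one W" "W \<subseteq> kernel L G \<phi>" .
    then show ?thesis
      using continuous_map_discrete_of_kernel_nhd[OF \<phi>.group_hom_axioms] by blast
  next
    case False
    moreover have "subgroup ?F G" by (rule \<phi>.subgroup_img_is_subgroup[OF subgroup])
    moreover have "finite ?F" by (rule class_G_finite_compact_image[OF subgroup V(2) \<phi> G])
    moreover have "\<phi> ` carrier L \<subseteq> normalizer G ?F"
      by (rule normalizes_stable_image[OF V(1) stable])
    ultimately show ?thesis by blast
  qed
qed

end

end

theorem theoremD:
  fixes L :: "('a, 'b) monoid_scheme" and T :: "'a topology"
    and G :: "('c, 'd) monoid_scheme" and \<phi> :: "'a \<Rightarrow> 'c"
  assumes "locally_compact_group L T"
    and "class_G G"
    and "\<phi> \<in> hom L G"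
  shows "continuous_map T (discrete_topology (carrier G)) \<phi> \<or>
         (\<exists>F. subgroup F G \<and> finite F \<and> F \<noteq> {\<one>\<^bsub>G\<^esub>} \<and>
              \<phi> ` carrier L \<subseteq> normalizer G F)"
proof -
  interpret lc_group L T by (rule locally_compact_group_imp_lc_group[OF assms(1)])
  show ?thesis by (rule continuous_or_normalizes_finite[OF assms(2,3)])
qed

end
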